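(* Let $\mathcal C$ be a symmetric monoidal category, $\mathcal A$ a symmetric abelian monoidal category, $\Gamma$ an acyclic class in $\mathbf C_*(\mathbf{Fun}(\mathcal C,\mathcal A))$, $\Sigma$ the associated class of weak equivalences, and $\mathbf G$ a cotriple in $\mathbf{SyMon}(\mathcal C,\mathbf C_*(\mathcal A))$ compatible with $\Sigma$, i.e. $G(\Sigma)\subseteq\Sigma$. Let $K_*,L_*$ be objects of $\mathbf{SyMon}(\mathcal C,\mathbf C_*(\mathcal A))$ in non-negative degrees. Suppose that $K_*,L_*$ are $\mathbf G$-acyclic and $\mathbf G$-presentable. Then any symmetric monoidal natural isomorphism $H_0(K_* )\to H_0(L_* )$ lifts to a unique isomorphism $f_*:K_*\to L_*$ in $\mathbf{SyMon}(\mathcal C,\mathbf C_*(\mathcal A))[\Sigma^{-1}]$.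
   Context: Monoidal functors are lax: $(F,\kappa,\eta)$ with natural $\kappa_{X,Y}:FX\otimes FY\to F(X\otimes Y)$ and $\eta:\mathbf 1\to F\mathbf 1$ satisfying associativity and unit constraints; such a functor between symmetric monoidal categories is symmetric if $\kappa$ is compatible with the commutativity isomorphisms. Monoidal natural transformations are compatible with $\kappa,\eta$. An abelian monoidal category is an abelian category with biadditive monoidal product. $\mathbf C_*(\mathcal A)$ is the symmetric monoidal category of uniformly bounded below chain complexes in $\mathcal A$ (vanishing in degrees below some $n$; for functors to $\mathbf C_*(\mathcal A)$, $n$ is independent of the object, so $\mathbf{Fun}(\mathcal C,\mathbf C_*(\mathcal A))=\mathbf C_*(\mathbf{Fun}(\mathcal C,\mathcal A))$), with the usual tensor product of complexes and commutativity isomorphism $(-1)^{pq}\tau_{C_p,D_q}$ on $C_p\otimes D_q$. $\mathbf{SyMon}(\mathcal C,\mathbf C_*(\mathcal A))$ is the category of symmetric monoidal functors and monoidal natural transformations. Acyclic class: a class $\Gamma$ of complexes in $\mathbf C_*(\mathcal B)$ ($\mathcal B$ abelian) such that (AC1) $0\in\Gamma$; (AC2) $C_*\in\Gamma$ iff $C_*[-1]\in\Gamma$, where $C_*[-1]_n=C_{n-1}$ with differential $-d$; (AC3) if $C_*,D_*$ are chain homotopy equivalent then $C_*\in\Gamma$ iff $D_*\in\Gamma$; (AC4) every complex in $\Gamma$ is acyclic; (AC5) if all rows of a bounded below double complex are in $\Gamma$, so is its total complex. The associated weak equivalences are the morphisms whose mapping cone is in $\Gamma$; a morphism of $\mathbf{SyMon}(\mathcal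 C,\mathbf C_*(\mathcal A))$ is in $\Sigma$ if it is a weak equivalence in $\mathbf{Fun}(\mathcal C,\mathbf C_*(\mathcal A))$. $[\Sigma^{-1}]$ denotes localization. Symmetric Eilenberg–MacLane simple functor $s_{EM}:\Delta^o\mathbf{SyMon}(\mathcal C,\mathbf C_*(\mathcal A))\to\mathbf{SyMon}(\mathcal C,\mathbf C_*(\mathcal A))$: it sends $K_\bullet$ to the functor taking $X$ to the total complex of the double complex $K_p(X)_q$ with simplicial differential $\sum_i(-1)^i\partial_i$ and internal differential (total differential $d'+(-1)^pd''$), with Künneth morphism obtained by composing (with usual Koszul signs) the shuffle map $sh_{pq}=\sum_{(\mu,\nu)}\varepsilon(\mu,\nu)(s_{\nu_q}\cdots s_{\nu_1})\otimes(s_{\mu_p}\cdots s_{\mu_1})$ (sum over $(p,q)$-shuffles) with the Künneth morphisms of the $K_n$. A cotriple is a comonad $\mathbf G=(G,\varepsilon:G\Rightarrow\mathrm{id},\delta:G\Rightarrow G^2)$; its standard construction is the augmented simplicial object $B_n(K)=G^{n+1}(K)$, $\partial_i=G^i\varepsilon G^{n-i}$, $s_i=G^i\delta G^{n-i}$, augmentation $\varepsilon:G(K)\to K$. Put $B_*=s_{EM}B_\bullet$ with induced $\varepsilon:B_*\Rightarrow\mathrm{id}$. $K_*$ is $\mathbf G$-presentable if $\varepsilon:B_*(K_* )\to K_*$ is in $\Sigma$. $H_0(K_* )$ is viewed as a symmetric monoidal functor concentrated in degree $0$, with the structure induced by the Künneth morphism of homology. An object $K_*$ in non-negative degrees ($K_p=0$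 for $p<0$) is $\mathbf G$-acyclic if $G$ applied to the augmentation $K_*\to H_0(K_* )$ is in $\Sigma$. A morphism $f_*:K_*\to L_*$ in the localized category lifts $\alpha:H_0(K_* )\to H_0(L_* )$ if its composite with the augmentation $L_*\to H_0(L_* )$ equals the composite of the augmentation $K_*\to H_0(K_* )$ with $\alpha$.
   Formalization: Added so that B_* and H_0 are defined: for each object F the complexes G^{n+1}(F) have a common lower bound independent of n and of the object of C; and G-acyclicity includes that the augmentation K_*→H_0(K_* ) is a morphism of symmetric monoidal functors (tensor need not be right exact). *)

theory Defs
  imports "HOL-Algebra.FiniteProduct"
begin

section \<open>Categories, functors, natural transformations\<close>

record ('o,'a) cat =
  Obj :: "'o set"
  Arr :: "'a set"
  Dom :: "'a \<Rightarrow> 'o"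
  Cod :: "'a \<Rightarrow> 'o"
  Idt :: "'o \<Rightarrow> 'a"
  Comp :: "'a \<Rightarrow> 'a \<Rightarrow> 'a" (infixr "\<cdot>\<index>" 70)

definition Hom :: "('o,'a,'z) cat_scheme \<Rightarrow> 'o \<Rightarrow> 'o \<Rightarrow> 'a set" where
  "Hom C X Y = {f \<in> Arr C. Dom C f = X \<and> Cod C f = Y}"

locale category =
  fixes C :: "('o,'a,'z) cat_scheme" (structure)
  assumes Dom_Obj: "f \<in> Arr C \<Longrightarrow> Dom C f \<in> Obj C"
    and Cod_Obj: "f \<in> Arr C \<Longrightarrow> Cod C f \<in> Obj C"
    and Idt_Hom: "X \<in> Obj C \<Longrightarrow> Idt C X \<in> Hom C X X"
    and Comp_Hom: "\<lbrakk>f \<in> Hom C X Y; g \<in> Hom C Y Z\<rbrakk> \<Longrightarrow> g \<cdot> f \<in> Hom C X Z"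
    and Comp_Idt: "f \<in> Hom C X Y \<Longrightarrow> f \<cdot> Idt C X = f"
    and Idt_Comp: "f \<in> Hom C X Y \<Longrightarrow> Idt C Y \<cdot> f = f"
    and Comp_assoc: "\<lbrakk>f \<in> Hom C W X; g \<in> Hom C X Y; h \<in> Hom C Y Z\<rbrakk> \<Longrightarrow> (h \<cdot> g) \<cdot> f = h \<cdot> (g \<cdot> f)"

definition iso_arr :: "('o,'a,'z) cat_scheme \<Rightarrow> 'a \<Rightarrow> bool" where
  "iso_arr C f \<longleftrightarrow> f \<in> Arr C \<and> (\<exists>g \<in> Hom C (Cod C f) (Dom C f).
     g \<cdot>\<^bsub>C\<^esub> f = Idt C (Dom C f) \<and> f \<cdot>\<^bsub>C\<^esub> g = Idt C (Cod C f))"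

definition full_subcat :: "('o,'a) cat \<Rightarrow> ('o \<Rightarrow> bool) \<Rightarrow> ('o,'a) cat" where
  "full_subcat C P = \<lparr>Obj = {X \<in> Obj C. P X}, Arr = {f \<in> Arr C. P (Dom C f) \<and> P (Cod C f)},
     Dom = Dom C, Cod = Cod C, Idt = Idt C, Comp = Comp C\<rparr>"

text \<open>Functors and transformations are extensional (\<open>undefined\<close> outside the source category),
  so that equality in HOL is equality of functors and of transformations.\<close>

record ('o,'a,'p,'b) fctr =
  fo :: "'o \<Rightarrow> 'p"
  fa :: "'a \<Rightarrow> 'b"

definition is_functor ::
  "('o,'a,'y) cat_scheme \<Rightarrow> ('p,'b,'z) cat_scheme \<Rightarrow> ('o,'a,'p,'b) fctr \<Rightarrow> bool" where
  "is_functor C D F \<longleftrightarrow>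
     fo F \<in> Obj C \<rightarrow>\<^sub>E Obj D \<and> fa F \<in> Arr C \<rightarrow>\<^sub>E Arr D \<and>
     (\<forall>f \<in> Arr C. Dom D (fa F f) = fo F (Dom C f) \<and> Cod D (fa F f) = fo F (Cod C f)) \<and>
     (\<forall>X \<in> Obj C. fa F (Idt C X) = Idt D (fo F X)) \<and>
     (\<forall>f \<in> Arr C. \<forall>g \<in> Arr C. Cod C f = Dom C g \<longrightarrow> fa F (g \<cdot>\<^bsub>C\<^esub> f) = fa F g \<cdot>\<^bsub>D\<^esub> fa F f)"

record ('o,'a,'p,'b) ntr =
  ndom :: "('o,'a,'p,'b) fctr"
  ncod :: "('o,'a,'p,'b) fctr"
  ncomp :: "'o \<Rightarrow> 'b"

definition is_ntr ::
  "('o,'a,'y) cat_scheme \<Rightarrow> ('p,'b,'z) cat_scheme \<Rightarrow> ('o,'a,'p,'b) ntr \<Rightarrow> bool" where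
  "is_ntr C D t \<longleftrightarrow> is_functor C D (ndom t) \<and> is_functor C D (ncod t) \<and>
     ncomp t \<in> extensional (Obj C) \<and>
     (\<forall>X \<in> Obj C. ncomp t X \<in> Hom D (fo (ndom t) X) (fo (ncod t) X)) \<and>
     (\<forall>f \<in> Arr C. ncomp t (Cod C f) \<cdot>\<^bsub>D\<^esub> fa (ndom t) f = fa (ncod t) f \<cdot>\<^bsub>D\<^esub> ncomp t (Dom C f))"


section \<open>Abelian categories\<close>

record ('o,'a) acat = "('o,'a) cat" +
  Add :: "'a \<Rightarrow> 'a \<Rightarrow> 'a"
  Zer :: "'o \<Rightarrow> 'o \<Rightarrow> 'a"

definition hom_grp :: "('o,'a,'z) acat_scheme \<Rightarrow> 'o \<Rightarrow> 'o \<Rightarrow> 'a monoid" where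
  "hom_grp A X Y = \<lparr>carrier = Hom A X Y, mult = Add A, one = Zer A X Y\<rparr>"

definition hsum :: "('o,'a,'z) acat_scheme \<Rightarrow> 'o \<Rightarrow> 'o \<Rightarrow> ('i \<Rightarrow> 'a) \<Rightarrow> 'i set \<Rightarrow> 'a" where
  "hsum A X Y f I = finprod (hom_grp A X Y) f I"

definition neg :: "('o,'a,'z) acat_scheme \<Rightarrow> 'a \<Rightarrow> 'a" where
  "neg A f = m_inv (hom_grp A (Dom A f) (Cod A f)) f"

text \<open>\<open>(-1)^n f\<close>\<close>
definition sgnm :: "('o,'a,'z) acat_scheme \<Rightarrow> int \<Rightarrow> 'a \<Rightarrow> 'a" where
  "sgnm A n f = (if even n then f else neg A f)"

definition is_zero :: "('o,'a,'z) cat_scheme \<Rightarrow> 'o \<Rightarrow> bool" where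
  "is_zero A Z \<longleftrightarrow> Z \<in> Obj A \<and> (\<forall>X \<in> Obj A. (\<exists>!f. f \<in> Hom A X Z) \<and> (\<exists>!f. f \<in> Hom A Z X))"

definition zero_obj :: "('o,'a,'z) cat_scheme \<Rightarrow> 'o" where
  "zero_obj A = (SOME Z. is_zero A Z)"

definition is_ker :: "('o,'a,'z) acat_scheme \<Rightarrow> 'a \<Rightarrow> 'a \<Rightarrow> bool" where
  "is_ker A f k \<longleftrightarrow> k \<in> Arr A \<and> Cod A k = Dom A f \<and> f \<cdot>\<^bsub>A\<^esub> k = Zer A (Dom A k) (Cod A f) \<and>
     (\<forall>T \<in> Obj A. \<forall>t \<in> Hom A T (Dom A f). f \<cdot>\<^bsub>A\<^esub> t = Zer A T (Cod A f) \<longrightarrow>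
        (\<exists>!u. u \<in> Hom A T (Dom A k) \<and> k \<cdot>\<^bsub>A\<^esub> u = t))"

definition is_coker :: "('o,'a,'z) acat_scheme \<Rightarrow> 'a \<Rightarrow> 'a \<Rightarrow> bool" where
  "is_coker A f e \<longleftrightarrow> e \<in> Arr A \<and> Dom A e = Cod A f \<and> e \<cdot>\<^bsub>A\<^esub> f = Zer A (Dom A f) (Cod A e) \<and>
     (\<forall>T \<in> Obj A. \<forall>t \<in> Hom A (Cod A f) T. t \<cdot>\<^bsub>A\<^esub> f = Zer A (Dom A f) T \<longrightarrow>
        (\<exists>!u. u \<in> Hom A (Cod A e) T \<and> u \<cdot>\<^bsub>A\<^esub> e = t))"

definition ker :: "('o,'a,'z) acat_scheme \<Rightarrow> 'a \<Rightarrow> 'a" where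
  "ker A f = (SOME k. is_ker A f k)"

definition coker :: "('o,'a,'z) acat_scheme \<Rightarrow> 'a \<Rightarrow> 'a" where
  "coker A f = (SOME e. is_coker A f e)"

definition lift :: "('o,'a,'z) acat_scheme \<Rightarrow> 'a \<Rightarrow> 'a \<Rightarrow> 'a" where
  "lift A k t = (THE u. u \<in> Hom A (Dom A t) (Dom A k) \<and> k \<cdot>\<^bsub>A\<^esub> u = t)"

definition desc :: "('o,'a,'z) acat_scheme \<Rightarrow> 'a \<Rightarrow> 'a \<Rightarrow> 'a" where
  "desc A e t = (THE u. u \<in> Hom A (Cod A e) (Cod A t) \<and> u \<cdot>\<^bsub>A\<^esub> e = t)"

definition is_mono :: "('o,'a,'z) cat_scheme \<Rightarrow> 'a \<Rightarrow> bool" where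
  "is_mono A f \<longleftrightarrow> f \<in> Arr A \<and> (\<forall>g \<in> Arr A. \<forall>h \<in> Arr A.
     Dom A g = Dom A h \<and> Cod A g = Dom A f \<and> Cod A h = Dom A f \<and> f \<cdot>\<^bsub>A\<^esub> g = f \<cdot>\<^bsub>A\<^esub> h \<longrightarrow> g = h)"

definition is_epi :: "('o,'a,'z) cat_scheme \<Rightarrow> 'a \<Rightarrow> bool" where
  "is_epi A f \<longleftrightarrow> f \<in> Arr A \<and> (\<forall>g \<in> Arr A. \<forall>h \<in> Arr A.
     Cod A g = Cod A h \<and> Dom A g = Cod A f \<and> Dom A h = Cod A f \<and> g \<cdot>\<^bsub>A\<^esub> f = h \<cdot>\<^bsub>A\<^esub> f \<longrightarrow> g = h)"

text \<open>Direct sum (biproduct) of a family of objects of which only finitely many are non-zero,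
  as a triple of the object, the injections and the projections.\<close>

definition supp :: "('o,'a,'z) cat_scheme \<Rightarrow> ('i \<Rightarrow> 'o) \<Rightarrow> 'i set" where
  "supp A X = {i. \<not> is_zero A (X i)}"

definition is_dsum ::
  "('o,'a,'z) acat_scheme \<Rightarrow> ('i \<Rightarrow> 'o) \<Rightarrow> 'o \<times> ('i \<Rightarrow> 'a) \<times> ('i \<Rightarrow> 'a) \<Rightarrow> bool" where
  "is_dsum A X = (\<lambda>(S, inj, prj). finite (supp A X) \<and> S \<in> Obj A \<and>
     (\<forall>i. inj i \<in> Hom A (X i) S \<and> prj i \<in> Hom A S (X i)) \<and>
     (\<forall>i j. prj j \<cdot>\<^bsub>A\<^esub> inj i = (if i = j then Idt A (X i) else Zer A (X i) (X j))) \<and>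
     Idt A S = hsum A S S (\<lambda>i. inj i \<cdot>\<^bsub>A\<^esub> prj i) (supp A X))"

definition dsum :: "('o,'a,'z) acat_scheme \<Rightarrow> ('i \<Rightarrow> 'o) \<Rightarrow> 'o \<times> ('i \<Rightarrow> 'a) \<times> ('i \<Rightarrow> 'a)" where
  "dsum A X = (SOME t. is_dsum A X t)"

definition dS :: "('o,'a,'z) acat_scheme \<Rightarrow> ('i \<Rightarrow> 'o) \<Rightarrow> 'o" where
  "dS A X = fst (dsum A X)"

definition dI :: "('o,'a,'z) acat_scheme \<Rightarrow> ('i \<Rightarrow> 'o) \<Rightarrow> 'i \<Rightarrow> 'a" where
  "dI A X = fst (snd (dsum A X))"

definition dP :: "('o,'a,'z) acat_scheme \<Rightarrow> ('i \<Rightarrow> 'o) \<Rightarrow> 'i \<Rightarrow> 'a" where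
  "dP A X = snd (snd (dsum A X))"

text \<open>The morphism of direct sums with matrix entries \<open>m i j : X i \<rightarrow> Y j\<close>.\<close>
definition dmat :: "('o,'a,'z) acat_scheme \<Rightarrow> ('i \<Rightarrow> 'o) \<Rightarrow> ('j \<Rightarrow> 'o) \<Rightarrow> ('i \<Rightarrow> 'j \<Rightarrow> 'a) \<Rightarrow> 'a" where
  "dmat A X Y m = hsum A (dS A X) (dS A Y)
     (\<lambda>(i, j). dI A Y j \<cdot>\<^bsub>A\<^esub> m i j \<cdot>\<^bsub>A\<^esub> dP A X i) (supp A X \<times> supp A Y)"

locale abelian_category = category A for A :: "('o,'a,'z) acat_scheme" (structure) +
  assumes hom_grp: "\<lbrakk>X \<in> Obj A; Y \<in> Obj A\<rbrakk> \<Longrightarrow> comm_group (hom_grp A X Y)"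
    and Comp_Add: "\<lbrakk>f \<in> Hom A X Y; g \<in> Hom A X Y; h \<in> Hom A Y Z\<rbrakk> \<Longrightarrow>
      h \<cdot> Add A f g = Add A (h \<cdot> f) (h \<cdot> g)"
    and Add_Comp: "\<lbrakk>f \<in> Hom A Y Z; g \<in> Hom A Y Z; h \<in> Hom A X Y\<rbrakk> \<Longrightarrow>
      Add A f g \<cdot> h = Add A (f \<cdot> h) (g \<cdot> h)"
    and ex_zero: "\<exists>Z. is_zero A Z"
    and ex_dsum: "\<lbrakk>X \<in> Obj A; Y \<in> Obj A\<rbrakk> \<Longrightarrow> \<exists>t. is_dsum A (\<lambda>b::bool. if b then Y else X) t"
    and ex_ker: "f \<in> Arr A \<Longrightarrow> \<exists>k. is_ker A f k"
    and ex_coker: "f \<in> Arr A \<Longrightarrow> \<exists>e. is_coker A f e"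
    and mono_ker: "is_mono A k \<Longrightarrow> \<exists>f \<in> Arr A. is_ker A f k"
    and epi_coker: "is_epi A e \<Longrightarrow> \<exists>f \<in> Arr A. is_coker A f e"

definition FunA ::
  "('o,'a,'y) cat_scheme \<Rightarrow> ('p,'b,'z) acat_scheme \<Rightarrow>
   (('o,'a,'p,'b) fctr, ('o,'a,'p,'b) ntr) acat" where
  "FunA C A = \<lparr>Obj = {F. is_functor C A F}, Arr = {t. is_ntr C A t}, Dom = ndom, Cod = ncod,
     Idt = (\<lambda>F. \<lparr>ndom = F, ncod = F, ncomp = (\<lambda>X \<in> Obj C. Idt A (fo F X))\<rparr>),
     Comp = (\<lambda>t s. \<lparr>ndom = ndom s, ncod = ncod t,
       ncomp = (\<lambda>X \<in> Obj C. ncomp t X \<cdot>\<^bsub>A\<^esub> ncomp s X)\<rparr>),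
     Add = (\<lambda>s t. \<lparr>ndom = ndom s, ncod = ncod s,
       ncomp = (\<lambda>X \<in> Obj C. Add A (ncomp s X) (ncomp t X))\<rparr>),
     Zer = (\<lambda>F H. \<lparr>ndom = F, ncod = H, ncomp = (\<lambda>X \<in> Obj C. Zer A (fo F X) (fo H X))\<rparr>)\<rparr>"


section \<open>Symmetric monoidal categories and functors\<close>

record ('o,'a) mon =
  tenO :: "'o \<Rightarrow> 'o \<Rightarrow> 'o"
  tenA :: "'a \<Rightarrow> 'a \<Rightarrow> 'a"
  unt :: 'o
  asc :: "'o \<Rightarrow> 'o \<Rightarrow> 'o \<Rightarrow> 'a"
  lun :: "'o \<Rightarrow> 'a"
  run :: "'o \<Rightarrow> 'a"
  swp :: "'o \<Rightarrow> 'o \<Rightarrow> 'a"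

locale symmetric_monoidal = category C for C :: "('o,'a,'z) cat_scheme" (structure) +
  fixes M :: "('o,'a) mon"
  assumes tenO: "\<lbrakk>X \<in> Obj C; Y \<in> Obj C\<rbrakk> \<Longrightarrow> tenO M X Y \<in> Obj C"
    and tenA: "\<lbrakk>f \<in> Hom C X X'; g \<in> Hom C Y Y'\<rbrakk> \<Longrightarrow> tenA M f g \<in> Hom C (tenO M X Y) (tenO M X' Y')"
    and tenA_Idt: "\<lbrakk>X \<in> Obj C; Y \<in> Obj C\<rbrakk> \<Longrightarrow> tenA M (Idt C X) (Idt C Y) = Idt C (tenO M X Y)"
    and tenA_Comp: "\<lbrakk>f \<in> Hom C X X'; f' \<in> Hom C X' X''; g \<in> Hom C Y Y'; g' \<in> Hom C Y' Y''\<rbrakk> \<Longrightarrow>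
      tenA M (f' \<cdot> f) (g' \<cdot> g) = tenA M f' g' \<cdot> tenA M f g"
    and unt: "unt M \<in> Obj C"
    and asc: "\<lbrakk>X \<in> Obj C; Y \<in> Obj C; Z \<in> Obj C\<rbrakk> \<Longrightarrow>
      asc M X Y Z \<in> Hom C (tenO M (tenO M X Y) Z) (tenO M X (tenO M Y Z)) \<and> iso_arr C (asc M X Y Z)"
    and asc_nat: "\<lbrakk>f \<in> Hom C X X'; g \<in> Hom C Y Y'; h \<in> Hom C Z Z'\<rbrakk> \<Longrightarrow>
      asc M X' Y' Z' \<cdot> tenA M (tenA M f g) h = tenA M f (tenA M g h) \<cdot> asc M X Y Z"
    and lun: "X \<in> Obj C \<Longrightarrow> lun M X \<in> Hom C (tenO M (unt M) X) X \<and> iso_arr C (lun M X)"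
    and lun_nat: "f \<in> Hom C X X' \<Longrightarrow> lun M X' \<cdot> tenA M (Idt C (unt M)) f = f \<cdot> lun M X"
    and run: "X \<in> Obj C \<Longrightarrow> run M X \<in> Hom C (tenO M X (unt M)) X \<and> iso_arr C (run M X)"
    and run_nat: "f \<in> Hom C X X' \<Longrightarrow> run M X' \<cdot> tenA M f (Idt C (unt M)) = f \<cdot> run M X"
    and swp: "\<lbrakk>X \<in> Obj C; Y \<in> Obj C\<rbrakk> \<Longrightarrow> swp M X Y \<in> Hom C (tenO M X Y) (tenO M Y X)"
    and swp_nat: "\<lbrakk>f \<in> Hom C X X'; g \<in> Hom C Y Y'\<rbrakk> \<Longrightarrow>
      swp M X' Y' \<cdot> tenA M f g = tenA M g f \<cdot> swp M X Y"
    and swp_swp: "\<lbrakk>X \<in> Obj C; Y \<in> Obj C\<rbrakk> \<Longrightarrow> swp M Y X \<cdot> swp M X Y = Idt C (tenO M X Y)"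
    and pentagon: "\<lbrakk>W \<in> Obj C; X \<in> Obj C; Y \<in> Obj C; Z \<in> Obj C\<rbrakk> \<Longrightarrow>
      asc M W X (tenO M Y Z) \<cdot> asc M (tenO M W X) Y Z =
      tenA M (Idt C W) (asc M X Y Z) \<cdot> asc M W (tenO M X Y) Z \<cdot> tenA M (asc M W X Y) (Idt C Z)"
    and triangle: "\<lbrakk>X \<in> Obj C; Y \<in> Obj C\<rbrakk> \<Longrightarrow>
      tenA M (Idt C X) (lun M Y) \<cdot> asc M X (unt M) Y = tenA M (run M X) (Idt C Y)"
    and hexagon: "\<lbrakk>X \<in> Obj C; Y \<in> Obj C; Z \<in> Obj C\<rbrakk> \<Longrightarrow>
      asc M Y Z X \<cdot> swp M X (tenO M Y Z) \<cdot> asc M X Y Z =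
      tenA M (Idt C Y) (swp M X Z) \<cdot> asc M Y X Z \<cdot> tenA M (swp M X Y) (Idt C Z)"

locale symmetric_abelian_monoidal = abelian_category A + symmetric_monoidal A M
  for A :: "('o,'a,'z) acat_scheme" (structure) and M +
  assumes tenA_Add_left: "\<lbrakk>f \<in> Hom A X X'; g \<in> Hom A X X'; h \<in> Hom A Y Y'\<rbrakk> \<Longrightarrow>
      tenA M (Add A f g) h = Add A (tenA M f h) (tenA M g h)"
    and tenA_Add_right: "\<lbrakk>f \<in> Hom A X X'; g \<in> Hom A Y Y'; h \<in> Hom A Y Y'\<rbrakk> \<Longrightarrow>
      tenA M f (Add A g h) = Add A (tenA M f g) (tenA M f h)"

record ('o,'a,'p,'b) smf =
  sfun :: "('o,'a,'p,'b) fctr"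
  kap :: "'o \<Rightarrow> 'o \<Rightarrow> 'b"
  eta :: 'b

definition is_smf ::
  "('o,'a,'y) cat_scheme \<Rightarrow> ('o,'a) mon \<Rightarrow> ('p,'b,'z) cat_scheme \<Rightarrow> ('p,'b) mon \<Rightarrow>
   ('o,'a,'p,'b) smf \<Rightarrow> bool" where
  "is_smf C M D N F \<longleftrightarrow> (let f = fo (sfun F) in
     is_functor C D (sfun F) \<and>
     (\<forall>X Y. X \<notin> Obj C \<or> Y \<notin> Obj C \<longrightarrow> kap F X Y = undefined) \<and>
     (\<forall>X \<in> Obj C. \<forall>Y \<in> Obj C. kap F X Y \<in> Hom D (tenO N (f X) (f Y)) (f (tenO M X Y))) \<and>
     eta F \<in> Hom D (unt N) (f (unt M)) \<and>
     (\<forall>u \<in> Arr C. \<forall>v \<in> Arr C. kap F (Cod C u) (Cod C v) \<cdot>\<^bsub>D\<^esub> tenA N (fa (sfun F) u) (fa (sfun F) v)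
        = fa (sfun F) (tenA M u v) \<cdot>\<^bsub>D\<^esub> kap F (Dom C u) (Dom C v)) \<and>
     (\<forall>X \<in> Obj C. \<forall>Y \<in> Obj C. \<forall>Z \<in> Obj C.
        fa (sfun F) (asc M X Y Z) \<cdot>\<^bsub>D\<^esub> kap F (tenO M X Y) Z \<cdot>\<^bsub>D\<^esub> tenA N (kap F X Y) (Idt D (f Z))
        = kap F X (tenO M Y Z) \<cdot>\<^bsub>D\<^esub> tenA N (Idt D (f X)) (kap F Y Z) \<cdot>\<^bsub>D\<^esub> asc N (f X) (f Y) (f Z)) \<and>
     (\<forall>X \<in> Obj C. fa (sfun F) (lun M X) \<cdot>\<^bsub>D\<^esub> kap F (unt M) X \<cdot>\<^bsub>D\<^esub> tenA N (eta F) (Idt D (f X))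
        = lun N (f X)) \<and>
     (\<forall>X \<in> Obj C. fa (sfun F) (run M X) \<cdot>\<^bsub>D\<^esub> kap F X (unt M) \<cdot>\<^bsub>D\<^esub> tenA N (Idt D (f X)) (eta F)
        = run N (f X)) \<and>
     (\<forall>X \<in> Obj C. \<forall>Y \<in> Obj C. fa (sfun F) (swp M X Y) \<cdot>\<^bsub>D\<^esub> kap F X Y
        = kap F Y X \<cdot>\<^bsub>D\<^esub> swp N (f X) (f Y)))"

record ('o,'a,'p,'b) mnt =
  mtdom :: "('o,'a,'p,'b) smf"
  mtcod :: "('o,'a,'p,'b) smf"
  mtcomp :: "'o \<Rightarrow> 'b"

definition is_mnt ::
  "('o,'a,'y) cat_scheme \<Rightarrow> ('o,'a) mon \<Rightarrow> ('p,'b,'z) cat_scheme \<Rightarrow> ('p,'b) mon \<Rightarrow>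
   ('o,'a,'p,'b) mnt \<Rightarrow> bool" where
  "is_mnt C M D N t \<longleftrightarrow> is_smf C M D N (mtdom t) \<and> is_smf C M D N (mtcod t) \<and>
     is_ntr C D \<lparr>ndom = sfun (mtdom t), ncod = sfun (mtcod t), ncomp = mtcomp t\<rparr> \<and>
     (\<forall>X \<in> Obj C. \<forall>Y \<in> Obj C. mtcomp t (tenO M X Y) \<cdot>\<^bsub>D\<^esub> kap (mtdom t) X Y
        = kap (mtcod t) X Y \<cdot>\<^bsub>D\<^esub> tenA N (mtcomp t X) (mtcomp t Y)) \<and>
     mtcomp t (unt M) \<cdot>\<^bsub>D\<^esub> eta (mtdom t) = eta (mtcod t)"

definition SyMon ::
  "('o,'a,'y) cat_scheme \<Rightarrow> ('o,'a) mon \<Rightarrow> ('p,'b,'z) cat_scheme \<Rightarrow> ('p,'b) mon \<Rightarrow>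
   (('o,'a,'p,'b) smf, ('o,'a,'p,'b) mnt) cat" where
  "SyMon C M D N = \<lparr>Obj = {F. is_smf C M D N F}, Arr = {t. is_mnt C M D N t},
     Dom = mtdom, Cod = mtcod,
     Idt = (\<lambda>F. \<lparr>mtdom = F, mtcod = F, mtcomp = (\<lambda>X \<in> Obj C. Idt D (fo (sfun F) X))\<rparr>),
     Comp = (\<lambda>t s. \<lparr>mtdom = mtdom s, mtcod = mtcod t,
       mtcomp = (\<lambda>X \<in> Obj C. mtcomp t X \<cdot>\<^bsub>D\<^esub> mtcomp s X)\<rparr>)\<rparr>"


section \<open>Chain complexes\<close>

text \<open>The differential of \<open>C\<close> in degree \<open>n\<close> is \<open>cdf C n : cob C n \<rightarrow> cob C (n - 1)\<close>.\<close>

record ('o,'a) cpx =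
  cob :: "int \<Rightarrow> 'o"
  cdf :: "int \<Rightarrow> 'a"

record ('o,'a) cmap =
  mdom :: "('o,'a) cpx"
  mcod :: "('o,'a) cpx"
  mcomp :: "int \<Rightarrow> 'a"

definition is_cpx :: "('o,'a,'z) acat_scheme \<Rightarrow> ('o,'a) cpx \<Rightarrow> bool" where
  "is_cpx A C \<longleftrightarrow> (\<forall>n. cob C n \<in> Obj A \<and> cdf C n \<in> Hom A (cob C n) (cob C (n - 1)) \<and>
      cdf C (n - 1) \<cdot>\<^bsub>A\<^esub> cdf C n = Zer A (cob C n) (cob C (n - 2)))"

definition bounded_below :: "('o,'a,'z) acat_scheme \<Rightarrow> ('o,'a) cpx \<Rightarrow> bool" where
  "bounded_below A C \<longleftrightarrow> (\<exists>m. \<forall>n < m. is_zero A (cob C n))"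

definition Ch :: "('o,'a,'z) acat_scheme \<Rightarrow> (('o,'a) cpx, ('o,'a) cmap) cat" where
  "Ch A = \<lparr>Obj = {C. is_cpx A C \<and> bounded_below A C},
     Arr = {f. is_cpx A (mdom f) \<and> bounded_below A (mdom f) \<and>
       is_cpx A (mcod f) \<and> bounded_below A (mcod f) \<and>
       (\<forall>n. mcomp f n \<in> Hom A (cob (mdom f) n) (cob (mcod f) n) \<and>
         cdf (mcod f) n \<cdot>\<^bsub>A\<^esub> mcomp f n = mcomp f (n - 1) \<cdot>\<^bsub>A\<^esub> cdf (mdom f) n)},
     Dom = mdom, Cod = mcod,
     Idt = (\<lambda>C. \<lparr>mdom = C, mcod = C, mcomp = (\<lambda>n. Idt A (cob C n))\<rparr>),
     Comp = (\<lambda>g f. \<lparr>mdom = mdom f, mcod = mcod g, mcomp = (\<lambda>n. mcomp g n \<cdot>\<^bsub>A\<^esub> mcomp f n)\<rparr>)\<rparr>"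

definition homotopic :: "('o,'a,'z) acat_scheme \<Rightarrow> ('o,'a) cmap \<Rightarrow> ('o,'a) cmap \<Rightarrow> bool" where
  "homotopic A f g \<longleftrightarrow> mdom f = mdom g \<and> mcod f = mcod g \<and>
     (\<exists>h. \<forall>n. h n \<in> Hom A (cob (mdom f) n) (cob (mcod f) (n + 1)) \<and>
       mcomp f n = Add A (mcomp g n)
         (Add A (cdf (mcod f) (n + 1) \<cdot>\<^bsub>A\<^esub> h n) (h (n - 1) \<cdot>\<^bsub>A\<^esub> cdf (mdom f) n)))"

definition homotopy_equivalent :: "('o,'a,'z) acat_scheme \<Rightarrow> ('o,'a) cpx \<Rightarrow> ('o,'a) cpx \<Rightarrow> bool" where
  "homotopy_equivalent A C D \<longleftrightarrow> (\<exists>f \<in> Hom (Ch A) C D. \<exists>g \<in> Hom (Ch A) D C.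
     homotopic A (g \<cdot>\<^bsub>Ch A\<^esub> f) (Idt (Ch A) C) \<and> homotopic A (f \<cdot>\<^bsub>Ch A\<^esub> g) (Idt (Ch A) D))"

definition conc_cpx :: "('o,'a,'z) acat_scheme \<Rightarrow> 'o \<Rightarrow> ('o,'a) cpx" where
  "conc_cpx A X = (let c = (\<lambda>n. if n = 0 then X else zero_obj A) in
     \<lparr>cob = c, cdf = (\<lambda>n. Zer A (c n) (c (n - 1)))\<rparr>)"

text \<open>The chain map which is \<open>f\<close> in degree \<open>0\<close> and zero in all other degrees.\<close>
definition deg0_map :: "('o,'a,'z) acat_scheme \<Rightarrow> ('o,'a) cpx \<Rightarrow> ('o,'a) cpx \<Rightarrow> 'a \<Rightarrow> ('o,'a) cmap" where
  "deg0_map A C D f = \<lparr>mdom = C, mcod = D,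
     mcomp = (\<lambda>n. if n = 0 then f else Zer A (cob C n) (cob D n))\<rparr>"

definition zero_cpx :: "('o,'a,'z) acat_scheme \<Rightarrow> ('o,'a) cpx" where
  "zero_cpx A = conc_cpx A (zero_obj A)"

definition shift :: "('o,'a,'z) acat_scheme \<Rightarrow> ('o,'a) cpx \<Rightarrow> ('o,'a) cpx" where
  "shift A C = \<lparr>cob = (\<lambda>n. cob C (n - 1)), cdf = (\<lambda>n. neg A (cdf C (n - 1)))\<rparr>"

text \<open>\<open>cone f\<close> is \<open>C (n - 1) \<oplus> D n\<close> in degree \<open>n\<close> with \<open>d (c, e) = (- d c, f c + d e)\<close>;
  the summand of \<open>C\<close> has index \<open>False\<close>, that of \<open>D\<close> has index \<open>True\<close>.\<close>
definition cone :: "('o,'a,'z) acat_scheme \<Rightarrow> ('o,'a) cmap \<Rightarrow> ('o,'a) cpx" where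
  "cone A f = (let C = mdom f; D = mcod f;
       fam = (\<lambda>n b. if b then cob D n else cob C (n - 1)) in
     \<lparr>cob = (\<lambda>n. dS A (fam n)),
      cdf = (\<lambda>n. dmat A (fam n) (fam (n - 1)) (\<lambda>b b'.
        if b then (if b' then cdf D n else Zer A (cob D n) (cob C (n - 2)))
        else (if b' then mcomp f (n - 1) else neg A (cdf C (n - 1)))))\<rparr>)"

text \<open>Double complexes have commuting differentials \<open>dd1 p q : dob p q \<rightarrow> dob (p - 1) q\<close> and
  \<open>dd2 p q : dob p q \<rightarrow> dob p (q - 1)\<close>; the total differential is \<open>d1 + (-1)^p d2\<close>.\<close>

record ('o,'a) dcpx =
  dob :: "int \<Rightarrow> int \<Rightarrow> 'o"
  dd1 :: "int \<Rightarrow> int \<Rightarrow> 'a"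
  dd2 :: "int \<Rightarrow> int \<Rightarrow> 'a"

definition is_dcpx :: "('o,'a,'z) acat_scheme \<Rightarrow> ('o,'a) dcpx \<Rightarrow> bool" where
  "is_dcpx A E \<longleftrightarrow> (\<forall>p q. dob E p q \<in> Obj A \<and>
     dd1 E p q \<in> Hom A (dob E p q) (dob E (p - 1) q) \<and>
     dd2 E p q \<in> Hom A (dob E p q) (dob E p (q - 1)) \<and>
     dd1 E (p - 1) q \<cdot>\<^bsub>A\<^esub> dd1 E p q = Zer A (dob E p q) (dob E (p - 2) q) \<and>
     dd2 E p (q - 1) \<cdot>\<^bsub>A\<^esub> dd2 E p q = Zer A (dob E p q) (dob E p (q - 2)) \<and>
     dd1 E p (q - 1) \<cdot>\<^bsub>A\<^esub> dd2 E p q = dd2 E (p - 1) q \<cdot>\<^bsub>A\<^esub> dd1 E p q)"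

definition dcpx_bounded_below :: "('o,'a,'z) acat_scheme \<Rightarrow> ('o,'a) dcpx \<Rightarrow> bool" where
  "dcpx_bounded_below A E \<longleftrightarrow> (\<exists>m. \<forall>p q. p < m \<or> q < m \<longrightarrow> is_zero A (dob E p q))"

definition row :: "('o,'a) dcpx \<Rightarrow> int \<Rightarrow> ('o,'a) cpx" where
  "row E q = \<lparr>cob = (\<lambda>p. dob E p q), cdf = (\<lambda>p. dd1 E p q)\<rparr>"

definition diag :: "('o,'a) dcpx \<Rightarrow> int \<Rightarrow> int \<Rightarrow> 'o" where
  "diag E n = (\<lambda>p. dob E p (n - p))"

definition Tot :: "('o,'a,'z) acat_scheme \<Rightarrow> ('o,'a) dcpx \<Rightarrow> ('o,'a) cpx" where
  "Tot A E = \<lparr>cob = (\<lambda>n. dS A (diag E n)),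
     cdf = (\<lambda>n. dmat A (diag E n) (diag E (n - 1)) (\<lambda>p p'.
       if p' = p - 1 then dd1 E p (n - p)
       else if p' = p then sgnm A p (dd2 E p (n - p))
       else Zer A (diag E n p) (diag E (n - 1) p')))\<rparr>"


section \<open>The symmetric monoidal structure on chain complexes\<close>

definition tens_d :: "('o,'a,'z) acat_scheme \<Rightarrow> ('o,'a) mon \<Rightarrow> ('o,'a) cpx \<Rightarrow> ('o,'a) cpx \<Rightarrow> ('o,'a) dcpx" where
  "tens_d A M C D = \<lparr>dob = (\<lambda>p q. tenO M (cob C p) (cob D q)),
     dd1 = (\<lambda>p q. tenA M (cdf C p) (Idt A (cob D q))),
     dd2 = (\<lambda>p q. tenA M (Idt A (cob C p)) (cdf D q))\<rparr>"

abbreviation tens :: "('o,'a,'z) acat_scheme \<Rightarrow> ('o,'a) mon \<Rightarrow> ('o,'a) cpx \<Rightarrow> ('o,'a) cpx \<Rightarrow> ('o,'a) cpx" where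
  "tens A M C D \<equiv> Tot A (tens_d A M C D)"

text \<open>The inclusion of \<open>C_p \<otimes> D_(n-p)\<close> into \<open>(C \<otimes> D)_n\<close>, and the projection onto it.\<close>

definition tens_in ::
  "('o,'a,'z) acat_scheme \<Rightarrow> ('o,'a) mon \<Rightarrow> ('o,'a) cpx \<Rightarrow> ('o,'a) cpx \<Rightarrow> int \<Rightarrow> int \<Rightarrow> 'a" where
  "tens_in A M C D n p = dI A (diag (tens_d A M C D) n) p"

definition tens_pr ::
  "('o,'a,'z) acat_scheme \<Rightarrow> ('o,'a) mon \<Rightarrow> ('o,'a) cpx \<Rightarrow> ('o,'a) cpx \<Rightarrow> int \<Rightarrow> int \<Rightarrow> 'a" where
  "tens_pr A M C D n p = dP A (diag (tens_d A M C D) n) p"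

definition ChM :: "('o,'a,'z) acat_scheme \<Rightarrow> ('o,'a) mon \<Rightarrow> (('o,'a) cpx, ('o,'a) cmap) mon" where
  "ChM A M = \<lparr>tenO = tens A M,
     tenA = (\<lambda>f g. \<lparr>mdom = tens A M (mdom f) (mdom g), mcod = tens A M (mcod f) (mcod g),
       mcomp = (\<lambda>n.
         let X = diag (tens_d A M (mdom f) (mdom g)) n; Y = diag (tens_d A M (mcod f) (mcod g)) n in
         dmat A X Y (\<lambda>p p'. if p' = p then tenA M (mcomp f p) (mcomp g (n - p))
                             else Zer A (X p) (Y p')))\<rparr>),
     unt = conc_cpx A (unt M),
     asc = (\<lambda>C D E. \<lparr>mdom = tens A M (tens A M C D) E, mcod = tens A M C (tens A M D E),
       mcomp = (\<lambda>n. dmat A (diag (tens_d A M (tens A M C D) E) n) (diag (tens_d A M C (tens A M D E)) n)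
         (\<lambda>m p. tenA M (Idt A (cob C p)) (tens_in A M D E (n - p) (m - p))
              \<cdot>\<^bsub>A\<^esub> asc M (cob C p) (cob D (m - p)) (cob E (n - m))
              \<cdot>\<^bsub>A\<^esub> tenA M (tens_pr A M C D m p) (Idt A (cob E (n - m)))))\<rparr>),
     lun = (\<lambda>C. \<lparr>mdom = tens A M (conc_cpx A (unt M)) C, mcod = C,
       mcomp = (\<lambda>n. lun M (cob C n) \<cdot>\<^bsub>A\<^esub> tens_pr A M (conc_cpx A (unt M)) C n 0)\<rparr>),
     run = (\<lambda>C. \<lparr>mdom = tens A M C (conc_cpx A (unt M)), mcod = C,
       mcomp = (\<lambda>n. run M (cob C n) \<cdot>\<^bsub>A\<^esub> tens_pr A M C (conc_cpx A (unt M)) n n)\<rparr>),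
     swp = (\<lambda>C D. \<lparr>mdom = tens A M C D, mcod = tens A M D C,
       mcomp = (\<lambda>n. let X = diag (tens_d A M C D) n; Y = diag (tens_d A M D C) n in
         dmat A X Y (\<lambda>p q. if q = n - p then sgnm A (p * q) (swp M (cob C p) (cob D q))
                            else Zer A (X p) (Y q)))\<rparr>)\<rparr>"


section \<open>Homology\<close>

definition cyc :: "('o,'a,'z) acat_scheme \<Rightarrow> ('o,'a) cpx \<Rightarrow> int \<Rightarrow> 'a" where
  "cyc A C n = ker A (cdf C n)"

text \<open>\<open>hpr A C n : Z_n \<rightarrow> H_n\<close> is the cokernel of \<open>C_(n+1) \<rightarrow> Z_n\<close>.\<close>
definition hpr :: "('o,'a,'z) acat_scheme \<Rightarrow> ('o,'a) cpx \<Rightarrow> int \<Rightarrow> 'a" where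
  "hpr A C n = coker A (lift A (cyc A C n) (cdf C (n + 1)))"

definition homol :: "('o,'a,'z) acat_scheme \<Rightarrow> ('o,'a) cpx \<Rightarrow> int \<Rightarrow> 'o" where
  "homol A C n = Cod A (hpr A C n)"

definition homol_map :: "('o,'a,'z) acat_scheme \<Rightarrow> ('o,'a) cmap \<Rightarrow> int \<Rightarrow> 'a" where
  "homol_map A f n = desc A (hpr A (mdom f) n)
     (hpr A (mcod f) n \<cdot>\<^bsub>A\<^esub> lift A (cyc A (mcod f) n) (mcomp f n \<cdot>\<^bsub>A\<^esub> cyc A (mdom f) n))"

text \<open>The Kuenneth morphism \<open>H_p(C) \<otimes> H_q(D) \<rightarrow> H_(p+q)(C \<otimes> D)\<close>, induced by
  \<open>Z_p(C) \<otimes> Z_q(D) \<rightarrow> Z_(p+q)(C \<otimes> D)\<close>.\<close>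
definition kuenneth ::
  "('o,'a,'z) acat_scheme \<Rightarrow> ('o,'a) mon \<Rightarrow> ('o,'a) cpx \<Rightarrow> ('o,'a) cpx \<Rightarrow> int \<Rightarrow> int \<Rightarrow> 'a" where
  "kuenneth A M C D p q = desc A (tenA M (hpr A C p) (hpr A D q))
     (hpr A (tens A M C D) (p + q) \<cdot>\<^bsub>A\<^esub>
      lift A (cyc A (tens A M C D) (p + q))
        (tens_in A M C D (p + q) p \<cdot>\<^bsub>A\<^esub> tenA M (cyc A C p) (cyc A D q)))"

text \<open>The projection \<open>C_0 \<rightarrow> H_0(C)\<close> of a complex with vanishing differential in degree \<open>0\<close>.\<close>
definition h0pr :: "('o,'a,'z) acat_scheme \<Rightarrow> ('o,'a) cpx \<Rightarrow> 'a" where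
  "h0pr A C = hpr A C 0 \<cdot>\<^bsub>A\<^esub> lift A (cyc A C 0) (Idt A (cob C 0))"


section \<open>Acyclic classes\<close>

locale acyclic_class =
  fixes B :: "('o,'a,'z) acat_scheme" and \<Gamma> :: "('o,'a) cpx set"
  assumes sub: "\<Gamma> \<subseteq> Obj (Ch B)"
    and AC1: "zero_cpx B \<in> \<Gamma>"
    and AC2: "C \<in> Obj (Ch B) \<Longrightarrow> C \<in> \<Gamma> \<longleftrightarrow> shift B C \<in> \<Gamma>"
    and AC3: "\<lbrakk>C \<in> Obj (Ch B); D \<in> Obj (Ch B); homotopy_equivalent B C D\<rbrakk> \<Longrightarrow> C \<in> \<Gamma> \<longleftrightarrow> D \<in> \<Gamma>"
    and AC4: "C \<in> \<Gamma> \<Longrightarrow> is_zero B (homol B C n)"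
    and AC5: "\<lbrakk>is_dcpx B E; dcpx_bounded_below B E; \<And>q. row E q \<in> \<Gamma>\<rbrakk> \<Longrightarrow> Tot B E \<in> \<Gamma>"


section \<open>Symmetric monoidal functors to chain complexes\<close>

text \<open>\<open>SyMonCh C MC A MA\<close> is the category of symmetric monoidal functors from \<open>C\<close> to complexes
  in \<open>A\<close> whose lower bound does not depend on the object of \<open>C\<close>.\<close>

definition unif_bounded ::
  "('o,'a,'y) cat_scheme \<Rightarrow> ('p,'b,'z) acat_scheme \<Rightarrow> ('o,'a,('p,'b) cpx,('p,'b) cmap) smf \<Rightarrow> bool" where
  "unif_bounded C A K \<longleftrightarrow> (\<exists>m. \<forall>X \<in> Obj C. \<forall>n < m. is_zero A (cob (fo (sfun K) X) n))"

definition SyMonCh ::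
  "('o,'a,'y) cat_scheme \<Rightarrow> ('o,'a) mon \<Rightarrow> ('p,'b,'z) acat_scheme \<Rightarrow> ('p,'b) mon \<Rightarrow>
   (('o,'a,('p,'b) cpx,('p,'b) cmap) smf, ('o,'a,('p,'b) cpx,('p,'b) cmap) mnt) cat" where
  "SyMonCh C MC A MA = full_subcat (SyMon C MC (Ch A) (ChM A MA)) (unif_bounded C A)"

definition nonneg ::
  "('o,'a,'y) cat_scheme \<Rightarrow> ('p,'b,'z) acat_scheme \<Rightarrow> ('o,'a,('p,'b) cpx,('p,'b) cmap) smf \<Rightarrow> bool" where
  "nonneg C A K \<longleftrightarrow> (\<forall>X \<in> Obj C. \<forall>n < 0. is_zero A (cob (fo (sfun K) X) n))"

text \<open>The identification of uniformly bounded functors to complexes (and of their natural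
  transformations) with complexes of functors.\<close>

definition cpx_of ::
  "('o,'a,'y) cat_scheme \<Rightarrow> ('o,'a,('p,'b) cpx,('p,'b) cmap) fctr \<Rightarrow>
   (('o,'a,'p,'b) fctr, ('o,'a,'p,'b) ntr) cpx" where
  "cpx_of C F = (let c = (\<lambda>n. \<lparr>fo = (\<lambda>X \<in> Obj C. cob (fo F X) n),
                               fa = (\<lambda>f \<in> Arr C. mcomp (fa F f) n)\<rparr>) in
     \<lparr>cob = c, cdf = (\<lambda>n. \<lparr>ndom = c n, ncod = c (n - 1), ncomp = (\<lambda>X \<in> Obj C. cdf (fo F X) n)\<rparr>)\<rparr>)"

definition cmap_of ::
  "('o,'a,'y) cat_scheme \<Rightarrow> ('o,'a,('p,'b) cpx,('p,'b) cmap) mnt \<Rightarrow>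
   (('o,'a,'p,'b) fctr, ('o,'a,'p,'b) ntr) cmap" where
  "cmap_of C t = (let P = cpx_of C (sfun (mtdom t)); Q = cpx_of C (sfun (mtcod t)) in
     \<lparr>mdom = P, mcod = Q,
      mcomp = (\<lambda>n. \<lparr>ndom = cob P n, ncod = cob Q n, ncomp = (\<lambda>X \<in> Obj C. mcomp (mtcomp t X) n)\<rparr>)\<rparr>)"

definition weqs ::
  "('o,'a,'y) cat_scheme \<Rightarrow> ('o,'a) mon \<Rightarrow> ('p,'b,'z) acat_scheme \<Rightarrow> ('p,'b) mon \<Rightarrow>
   (('o,'a,'p,'b) fctr, ('o,'a,'p,'b) ntr) cpx set \<Rightarrow>
   ('o,'a,('p,'b) cpx,('p,'b) cmap) mnt set" where
  "weqs C MC A MA \<Gamma> = {t \<in> Arr (SyMonCh C MC A MA). cone (FunA C A) (cmap_of C t) \<in> \<Gamma>}"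

text \<open>\<open>H_0\<close> of a symmetric monoidal functor, concentrated in degree \<open>0\<close>, and the augmentation
  from a functor in non-negative degrees to it.\<close>

definition H0 ::
  "('o,'a,'y) cat_scheme \<Rightarrow> ('o,'a) mon \<Rightarrow> ('p,'b,'z) acat_scheme \<Rightarrow> ('p,'b) mon \<Rightarrow>
   ('o,'a,('p,'b) cpx,('p,'b) cmap) smf \<Rightarrow> ('o,'a,('p,'b) cpx,('p,'b) cmap) smf" where
  "H0 C MC A MA K = (let F = sfun K; h = (\<lambda>X. conc_cpx A (homol A (fo F X) 0)) in
     \<lparr>sfun = \<lparr>fo = (\<lambda>X \<in> Obj C. h X),
              fa = (\<lambda>f \<in> Arr C. deg0_map A (h (Dom C f)) (h (Cod C f)) (homol_map A (fa F f) 0))\<rparr>,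
      kap = (\<lambda>X Y. if X \<in> Obj C \<and> Y \<in> Obj C then
        deg0_map A (tens A MA (h X) (h Y)) (h (tenO MC X Y))
          (homol_map A (kap K X Y) 0 \<cdot>\<^bsub>A\<^esub> kuenneth A MA (fo F X) (fo F Y) 0 0
             \<cdot>\<^bsub>A\<^esub> tens_pr A MA (h X) (h Y) 0 0)
        else undefined),
      eta = deg0_map A (conc_cpx A (unt MA)) (h (unt MC))
        (homol_map A (eta K) 0 \<cdot>\<^bsub>A\<^esub> h0pr A (conc_cpx A (unt MA)))\<rparr>)"

definition aug ::
  "('o,'a,'y) cat_scheme \<Rightarrow> ('o,'a) mon \<Rightarrow> ('p,'b,'z) acat_scheme \<Rightarrow> ('p,'b) mon \<Rightarrow>
   ('o,'a,('p,'b) cpx,('p,'b) cmap) smf \<Rightarrow> ('o,'a,('p,'b) cpx,('p,'b) cmap) mnt" where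
  "aug C MC A MA K = \<lparr>mtdom = K, mtcod = H0 C MC A MA K,
     mtcomp = (\<lambda>X \<in> Obj C. deg0_map A (fo (sfun K) X) (conc_cpx A (homol A (fo (sfun K) X) 0))
       (h0pr A (fo (sfun K) X)))\<rparr>"


section \<open>The symmetric Eilenberg--MacLane simple functor\<close>

text \<open>\<open>face n i : K_n \<rightarrow> K_(n-1)\<close> and \<open>dgn n i : K_n \<rightarrow> K_(n+1)\<close>, for \<open>i \<le> n\<close>.\<close>

record ('o,'a) simp =
  sob :: "nat \<Rightarrow> 'o"
  face :: "nat \<Rightarrow> nat \<Rightarrow> 'a"
  dgn :: "nat \<Rightarrow> nat \<Rightarrow> 'a"

text \<open>\<open>degs S K p [i\<^sub>1,\<dots>,i\<^sub>q]\<close> is \<open>s_(i\<^sub>q) \<dots> s_(i\<^sub>1) : K_p \<rightarrow> K_(p+q)\<close>.\<close>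
fun degs :: "('o,'a,'z) cat_scheme \<Rightarrow> ('o,'a) simp \<Rightarrow> nat \<Rightarrow> nat list \<Rightarrow> 'a" where
  "degs S K p [] = Idt S (sob K p)"
| "degs S K p (i # is) = degs S K (Suc p) is \<cdot>\<^bsub>S\<^esub> dgn K p i"

text \<open>A shuffle is given by its set \<open>\<mu>\<close>; the set \<open>\<nu>\<close> is the complement of \<open>\<mu>\<close>
  in \<open>{..<p+q}\<close>, and the sign is that of the number of inversions of \<open>(\<mu>,\<nu>)\<close>.\<close>

definition shuffle_sets :: "nat \<Rightarrow> nat \<Rightarrow> nat set set" where
  "shuffle_sets p q = {\<mu>. \<mu> \<subseteq> {..<p + q} \<and> card \<mu> = p}"

definition inversions :: "nat set \<Rightarrow> nat set \<Rightarrow> nat" where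
  "inversions \<mu> \<nu> = card {(i, j). i \<in> \<mu> \<and> j \<in> \<nu> \<and> j < i}"

text \<open>The double complex \<open>K_p(X)_q\<close>, extended by zero to \<open>p < 0\<close>.\<close>
definition sEM_d ::
  "('p,'b,'z) acat_scheme \<Rightarrow>
   (('o,'a,('p,'b) cpx,('p,'b) cmap) smf, ('o,'a,('p,'b) cpx,('p,'b) cmap) mnt) simp \<Rightarrow>
   'o \<Rightarrow> ('p,'b) dcpx" where
  "sEM_d A K X = (let
     ob = (\<lambda>p q. if 0 \<le> p then cob (fo (sfun (sob K (nat p))) X) q else zero_obj A) in
     \<lparr>dob = ob,
      dd1 = (\<lambda>p q. if 0 < p then
          hsum A (ob p q) (ob (p - 1) q)
            (\<lambda>i. sgnm A (int i) (mcomp (mtcomp (face K (nat p) i) X) q)) {..nat p}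
        else Zer A (ob p q) (ob (p - 1) q)),
      dd2 = (\<lambda>p q. if 0 \<le> p then cdf (fo (sfun (sob K (nat p))) X) q
        else Zer A (ob p q) (ob p (q - 1)))\<rparr>)"

text \<open>For \<open>x\<close> in \<open>K_p(X)_i\<close> and \<open>y\<close> in \<open>K_q(Y)_j\<close> the Kuenneth morphism sends
  \<open>x \<otimes> y\<close> to \<open>(-1)^(iq)\<close> times the sum of \<open>\<epsilon>(\<mu>,\<nu>) \<kappa> (s_\<nu> x \<otimes> s_\<mu> y)\<close>, where \<open>\<kappa>\<close> is the
  Kuenneth morphism of \<open>K_(p+q)\<close>; \<open>sEM_sh\<close> is this map
  \<open>K_p(X)_i \<otimes> K_q(Y)_j \<rightarrow> K_(p+q)(X \<otimes> Y)_(i+j)\<close>. In \<open>sEM_kap\<close> the source summand of index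
  \<open>m\<close> is \<open>Tot(X)_m \<otimes> Tot(Y)_(n-m)\<close> and the target summand of index \<open>r\<close> is
  \<open>K_r(X \<otimes> Y)_(n-r)\<close>.\<close>

definition sEM_sh ::
  "('o,'a,'y) cat_scheme \<Rightarrow> ('o,'a) mon \<Rightarrow> ('p,'b,'z) acat_scheme \<Rightarrow> ('p,'b) mon \<Rightarrow>
   (('o,'a,('p,'b) cpx,('p,'b) cmap) smf, ('o,'a,('p,'b) cpx,('p,'b) cmap) mnt) simp \<Rightarrow>
   'o \<Rightarrow> 'o \<Rightarrow> nat \<Rightarrow> nat \<Rightarrow> int \<Rightarrow> int \<Rightarrow> 'b" where
  "sEM_sh C MC A MA K X Y p q i j = (let S = SyMonCh C MC A MA; L = sob K (p + q) in
     sgnm A (i * int q)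
       (hsum A (tenO MA (cob (fo (sfun (sob K p)) X) i) (cob (fo (sfun (sob K q)) Y) j))
               (cob (fo (sfun L) (tenO MC X Y)) (i + j))
         (\<lambda>\<mu>. let \<nu> = {..<p + q} - \<mu> in
            sgnm A (int (inversions \<mu> \<nu>))
              (mcomp (kap L X Y) (i + j)
               \<cdot>\<^bsub>A\<^esub> tens_in A MA (fo (sfun L) X) (fo (sfun L) Y) (i + j) i
               \<cdot>\<^bsub>A\<^esub> tenA MA (mcomp (mtcomp (degs S K p (sorted_list_of_set \<nu>)) X) i)
                           (mcomp (mtcomp (degs S K q (sorted_list_of_set \<mu>)) Y) j)))
         (shuffle_sets p q)))"

definition sEM_kap ::
  "('o,'a,'y) cat_scheme \<Rightarrow> ('o,'a) mon \<Rightarrow> ('p,'b,'z) acat_scheme \<Rightarrow> ('p,'b) mon \<Rightarrow>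
   (('o,'a,('p,'b) cpx,('p,'b) cmap) smf, ('o,'a,('p,'b) cpx,('p,'b) cmap) mnt) simp \<Rightarrow>
   'o \<Rightarrow> 'o \<Rightarrow> ('p,'b) cmap" where
  "sEM_kap C MC A MA K X Y = (let
     T = Tot A (sEM_d A K X); U = Tot A (sEM_d A K Y); V = sEM_d A K (tenO MC X Y) in
     \<lparr>mdom = tens A MA T U, mcod = Tot A V,
      mcomp = (\<lambda>n. dmat A (diag (tens_d A MA T U) n) (diag V n) (\<lambda>m r.
        hsum A (tenO MA (cob T m) (cob U (n - m))) (diag V n r)
          (\<lambda>(p, q). sEM_sh C MC A MA K X Y p q (m - int p) (n - m - int q)
             \<cdot>\<^bsub>A\<^esub> tenA MA (dP A (diag (sEM_d A K X) m) (int p))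
                        (dP A (diag (sEM_d A K Y) (n - m)) (int q)))
          {(p, q). int p + int q = r}))\<rparr>)"

definition sEM ::
  "('o,'a,'y) cat_scheme \<Rightarrow> ('o,'a) mon \<Rightarrow> ('p,'b,'z) acat_scheme \<Rightarrow> ('p,'b) mon \<Rightarrow>
   (('o,'a,('p,'b) cpx,('p,'b) cmap) smf, ('o,'a,('p,'b) cpx,('p,'b) cmap) mnt) simp \<Rightarrow>
   ('o,'a,('p,'b) cpx,('p,'b) cmap) smf" where
  "sEM C MC A MA K =
     \<lparr>sfun = \<lparr>fo = (\<lambda>X \<in> Obj C. Tot A (sEM_d A K X)),
        fa = (\<lambda>f \<in> Arr C. let E = sEM_d A K (Dom C f); E' = sEM_d A K (Cod C f) in
          \<lparr>mdom = Tot A E, mcod = Tot A E',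
           mcomp = (\<lambda>n. dmat A (diag E n) (diag E' n) (\<lambda>p p'.
             if p' = p \<and> 0 \<le> p then mcomp (fa (sfun (sob K (nat p))) f) (n - p)
             else Zer A (diag E n p) (diag E' n p')))\<rparr>)\<rparr>,
      kap = (\<lambda>X Y. if X \<in> Obj C \<and> Y \<in> Obj C then sEM_kap C MC A MA K X Y else undefined),
      eta = deg0_map A (conc_cpx A (unt MA)) (Tot A (sEM_d A K (unt MC)))
        (dI A (diag (sEM_d A K (unt MC)) 0) 0 \<cdot>\<^bsub>A\<^esub> mcomp (eta (sob K 0)) 0)\<rparr>"

text \<open>The total complex has the summands \<open>K_p(X)_q\<close>, \<open>p + q = n\<close>, \<open>p \<ge> 0\<close> in degree \<open>n\<close>, so
  \<open>sEM\<close> is meaningful for those simplicial objects whose lower bound depends neither on the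
  object of \<open>C\<close> nor on the simplicial degree, i.e. for simplicial objects that are, as functors
  to complexes, uniformly bounded below.\<close>

definition simp_unif_bounded ::
  "('o,'a,'y) cat_scheme \<Rightarrow> ('p,'b,'z) acat_scheme \<Rightarrow>
   (('o,'a,('p,'b) cpx,('p,'b) cmap) smf, ('o,'a,('p,'b) cpx,('p,'b) cmap) mnt) simp \<Rightarrow> bool" where
  "simp_unif_bounded C A K \<longleftrightarrow>
     (\<exists>m. \<forall>p. \<forall>X \<in> Obj C. \<forall>n < m. is_zero A (cob (fo (sfun (sob K p)) X) n))"


section \<open>Cotriples\<close>

record ('o,'a) cotriple =
  ctF :: "('o,'a,'o,'a) fctr"
  cte :: "'o \<Rightarrow> 'a"
  ctd :: "'o \<Rightarrow> 'a"

definition is_cotriple :: "('o,'a,'z) cat_scheme \<Rightarrow> ('o,'a) cotriple \<Rightarrow> bool" where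
  "is_cotriple S G \<longleftrightarrow> (let Go = fo (ctF G); Ga = fa (ctF G) in
     is_functor S S (ctF G) \<and>
     (\<forall>K \<in> Obj S. cte G K \<in> Hom S (Go K) K \<and> ctd G K \<in> Hom S (Go K) (Go (Go K))) \<and>
     (\<forall>f \<in> Arr S. cte G (Cod S f) \<cdot>\<^bsub>S\<^esub> Ga f = f \<cdot>\<^bsub>S\<^esub> cte G (Dom S f) \<and>
                  ctd G (Cod S f) \<cdot>\<^bsub>S\<^esub> Ga f = Ga (Ga f) \<cdot>\<^bsub>S\<^esub> ctd G (Dom S f)) \<and>
     (\<forall>K \<in> Obj S. cte G (Go K) \<cdot>\<^bsub>S\<^esub> ctd G K = Idt S (Go K) \<and>
                  Ga (cte G K) \<cdot>\<^bsub>S\<^esub> ctd G K = Idt S (Go K) \<and>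
                  ctd G (Go K) \<cdot>\<^bsub>S\<^esub> ctd G K = Ga (ctd G K) \<cdot>\<^bsub>S\<^esub> ctd G K))"

definition bar :: "('o,'a) cotriple \<Rightarrow> 'o \<Rightarrow> ('o,'a) simp" where
  "bar G K = \<lparr>sob = (\<lambda>n. (fo (ctF G) ^^ Suc n) K),
     face = (\<lambda>n i. (fa (ctF G) ^^ i) (cte G ((fo (ctF G) ^^ (n - i)) K))),
     dgn = (\<lambda>n i. (fa (ctF G) ^^ i) (ctd G ((fo (ctF G) ^^ (n - i)) K)))\<rparr>"

text \<open>The morphism \<open>s\<^sub>E\<^sub>M(B K) \<rightarrow> K\<close> induced by \<open>\<epsilon> : G K \<rightarrow> K\<close>: it is \<open>\<epsilon>\<close> on the summand
  of simplicial degree \<open>0\<close> and zero on the others.\<close>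
definition bar_aug ::
  "('o,'a,'y) cat_scheme \<Rightarrow> ('o,'a) mon \<Rightarrow> ('p,'b,'z) acat_scheme \<Rightarrow> ('p,'b) mon \<Rightarrow>
   (('o,'a,('p,'b) cpx,('p,'b) cmap) smf, ('o,'a,('p,'b) cpx,('p,'b) cmap) mnt) cotriple \<Rightarrow>
   ('o,'a,('p,'b) cpx,('p,'b) cmap) smf \<Rightarrow> ('o,'a,('p,'b) cpx,('p,'b) cmap) mnt" where
  "bar_aug C MC A MA G K = \<lparr>mtdom = sEM C MC A MA (bar G K), mtcod = K,
     mtcomp = (\<lambda>X \<in> Obj C. \<lparr>mdom = Tot A (sEM_d A (bar G K) X), mcod = fo (sfun K) X,
       mcomp = (\<lambda>n. mcomp (mtcomp (cte G K) X) n \<cdot>\<^bsub>A\<^esub> dP A (diag (sEM_d A (bar G K) X) n) 0)\<rparr>)\<rparr>"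

definition presentable ::
  "('o,'a,'y) cat_scheme \<Rightarrow> ('o,'a) mon \<Rightarrow> ('p,'b,'z) acat_scheme \<Rightarrow> ('p,'b) mon \<Rightarrow>
   (('o,'a,'p,'b) fctr, ('o,'a,'p,'b) ntr) cpx set \<Rightarrow>
   (('o,'a,('p,'b) cpx,('p,'b) cmap) smf, ('o,'a,('p,'b) cpx,('p,'b) cmap) mnt) cotriple \<Rightarrow>
   ('o,'a,('p,'b) cpx,('p,'b) cmap) smf \<Rightarrow> bool" where
  "presentable C MC A MA \<Gamma> G K \<longleftrightarrow> bar_aug C MC A MA G K \<in> weqs C MC A MA \<Gamma>"

text \<open>The augmentation is required to be a morphism (in particular \<open>H_0(K)\<close> to be an object):
  without right exactness of the tensor product the Kuenneth morphism of homology, and with it the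
  monoidal structure of \<open>H_0(K)\<close>, need not exist.\<close>
definition G_acyclic ::
  "('o,'a,'y) cat_scheme \<Rightarrow> ('o,'a) mon \<Rightarrow> ('p,'b,'z) acat_scheme \<Rightarrow> ('p,'b) mon \<Rightarrow>
   (('o,'a,'p,'b) fctr, ('o,'a,'p,'b) ntr) cpx set \<Rightarrow>
   (('o,'a,('p,'b) cpx,('p,'b) cmap) smf, ('o,'a,('p,'b) cpx,('p,'b) cmap) mnt) cotriple \<Rightarrow>
   ('o,'a,('p,'b) cpx,('p,'b) cmap) smf \<Rightarrow> bool" where
  "G_acyclic C MC A MA \<Gamma> G K \<longleftrightarrow> nonneg C A K \<and>
     aug C MC A MA K \<in> Arr (SyMonCh C MC A MA) \<and>
     fa (ctF G) (aug C MC A MA K) \<in> weqs C MC A MA \<Gamma>"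


section \<open>Localization\<close>

text \<open>The localization of \<open>S\<close> at \<open>W\<close> in the construction of Gabriel and Zisman: the same objects,
  and as morphisms \<open>X \<rightarrow> Y\<close> the classes of paths of arrows of \<open>S\<close> and formal inverses of
  elements of \<open>W\<close>. Paths are read from left to right.\<close>

datatype 'a zz = Fwd 'a | Bwd 'a

fun zz_path :: "('o,'a,'z) cat_scheme \<Rightarrow> 'a set \<Rightarrow> 'o \<Rightarrow> 'a zz list \<Rightarrow> 'o \<Rightarrow> bool" where
  "zz_path S W X [] Y \<longleftrightarrow> X \<in> Obj S \<and> X = Y"
| "zz_path S W X (Fwd f # p) Y \<longleftrightarrow> f \<in> Arr S \<and> Dom S f = X \<and> zz_path S W (Cod S f) p Y"
| "zz_path S W X (Bwd w # p) Y \<longleftrightarrow> w \<in> W \<and> Cod S w = X \<and> zz_path S W (Dom S w) p Y"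

inductive zz_eq :: "('o,'a,'z) cat_scheme \<Rightarrow> 'a set \<Rightarrow> 'o \<Rightarrow> 'o \<Rightarrow> 'a zz list \<Rightarrow> 'a zz list \<Rightarrow> bool"
  for S :: "('o,'a,'z) cat_scheme" and W :: "'a set" and X Y :: 'o where
  refl: "zz_path S W X p Y \<Longrightarrow> zz_eq S W X Y p p"
| sym: "zz_eq S W X Y p q \<Longrightarrow> zz_eq S W X Y q p"
| trans: "\<lbrakk>zz_eq S W X Y p q; zz_eq S W X Y q r\<rbrakk> \<Longrightarrow> zz_eq S W X Y p r"
| comp: "zz_path S W X (p @ [Fwd f, Fwd g] @ q) Y \<Longrightarrow>
    zz_eq S W X Y (p @ [Fwd f, Fwd g] @ q) (p @ [Fwd (g \<cdot>\<^bsub>S\<^esub> f)] @ q)"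
| ident: "\<lbrakk>Z \<in> Obj S; zz_path S W X (p @ [Fwd (Idt S Z)] @ q) Y\<rbrakk> \<Longrightarrow>
    zz_eq S W X Y (p @ [Fwd (Idt S Z)] @ q) (p @ q)"
| fwd_bwd: "zz_path S W X (p @ [Fwd w, Bwd w] @ q) Y \<Longrightarrow> zz_eq S W X Y (p @ [Fwd w, Bwd w] @ q) (p @ q)"
| bwd_fwd: "zz_path S W X (p @ [Bwd w, Fwd w] @ q) Y \<Longrightarrow> zz_eq S W X Y (p @ [Bwd w, Fwd w] @ q) (p @ q)"

definition zz_class :: "('o,'a,'z) cat_scheme \<Rightarrow> 'a set \<Rightarrow> 'o \<Rightarrow> 'o \<Rightarrow> 'a zz list \<Rightarrow> 'a zz list set" where
  "zz_class S W X Y p = {q. zz_eq S W X Y p q}"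

definition Loc :: "('o,'a,'z) cat_scheme \<Rightarrow> 'a set \<Rightarrow> ('o, 'o \<times> 'o \<times> 'a zz list set) cat" where
  "Loc S W = \<lparr>Obj = Obj S,
     Arr = {(X, Y, zz_class S W X Y p) | X Y p. zz_path S W X p Y},
     Dom = fst, Cod = (\<lambda>f. fst (snd f)),
     Idt = (\<lambda>X. (X, X, zz_class S W X X [])),
     Comp = (\<lambda>(Y, Z, Q) (X, Y', P). (X, Z, \<Union>p \<in> P. \<Union>q \<in> Q. zz_class S W X Z (p @ q)))\<rparr>"

definition loc_arr :: "('o,'a,'z) cat_scheme \<Rightarrow> 'a set \<Rightarrow> 'a \<Rightarrow> 'o \<times> 'o \<times> 'a zz list set" where
  "loc_arr S W f = (Dom S f, Cod S f, zz_class S W (Dom S f) (Cod S f) [Fwd f])"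

definition lifts ::
  "('o,'a,'y) cat_scheme \<Rightarrow> ('o,'a) mon \<Rightarrow> ('p,'b,'z) acat_scheme \<Rightarrow> ('p,'b) mon \<Rightarrow>
   (('o,'a,'p,'b) fctr, ('o,'a,'p,'b) ntr) cpx set \<Rightarrow>
   ('o,'a,('p,'b) cpx,('p,'b) cmap) smf \<Rightarrow> ('o,'a,('p,'b) cpx,('p,'b) cmap) smf \<Rightarrow>
   ('o,'a,('p,'b) cpx,('p,'b) cmap) mnt \<Rightarrow>
   (('o,'a,('p,'b) cpx,('p,'b) cmap) smf \<times> ('o,'a,('p,'b) cpx,('p,'b) cmap) smf \<times>
    ('o,'a,('p,'b) cpx,('p,'b) cmap) mnt zz list set) \<Rightarrow> bool" where
  "lifts C MC A MA \<Gamma> K L \<alpha> f \<longleftrightarrow>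
     (let S = SyMonCh C MC A MA; W = weqs C MC A MA \<Gamma> in
      f \<in> Hom (Loc S W) K L \<and>
      loc_arr S W (aug C MC A MA L) \<cdot>\<^bsub>Loc S W\<^esub> f
        = loc_arr S W \<alpha> \<cdot>\<^bsub>Loc S W\<^esub> loc_arr S W (aug C MC A MA K))"

end

theory Submission
  imports Defs
begin

text \<open>Let \<open>B F\<close> be the simple object of the standard construction of \<open>F\<close>. It is again a symmetric monoidal
  functor, because the shuffle map is natural, associative, unital, symmetric and a chain map. If
  \<open>G f\<close> is a weak equivalence then so is every \<open>G\<^sup>n f\<close> with \<open>n > 0\<close>; their cones are the rows of a double complex
  whose total complex is the cone of \<open>B f\<close> up to signs, so (AC5) makes \<open>B f\<close> a weak equivalence. Hence \<open>B\<close> extends to the localization,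
  where the augmentation \<open>\<epsilon> : B \<rightarrow> id\<close> stays natural. For the augmentation \<open>a\<close> of an acyclic object \<open>B a\<close> is
  invertible, and for a presentable object so is \<open>\<epsilon>\<close>. So a lift \<open>f\<close> of \<open>\<alpha>\<close> satisfies \<open>f \<epsilon>\<^sub>K = \<epsilon>\<^sub>L B f\<close> and
  \<open>B a\<^sub>L B f = B \<alpha> B a\<^sub>K\<close>, which forces \<open>f = \<epsilon>\<^sub>L (B a\<^sub>L)\<^sup>-\<^sup>1 B \<alpha> B a\<^sub>K \<epsilon>\<^sub>K\<^sup>-\<^sup>1\<close>; conversely, this is a lift.\<close>


text \<open>Direct sums are picked by a choice operator, so constructions that ought to coincide are
  only isomorphic; identities are therefore tested on summands. For this, symmetric monoidal
  functors to complexes are rewritten as equations in \<open>A\<close> between bihomogeneous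
  components (\<open>smf_laws\<close>). For the simple functor these become identities of shuffles,
  and a shuffle is read as a lattice path, with its degeneracies as coordinate functions of the
  path. To compute with composites of faces and degeneracies, the standard construction is extended
  to all monotone maps by iterated comultiplications, which replaces relations between words by
  equality of maps. The comparison of the cone of \<open>B f\<close> with a total complex takes
  place among functors, where the chosen \<open>Tot\<close> differs from the one computed
  objectwise; hence the universal description \<open>is_total\<close>. Finally, morphisms of the
  localization are classes of zigzags, so \<open>B\<close> is applied letter by letter.\<close>

notation Comp (infixr "**\<index>" 70)

lemmas conjR = conjunct2

section \<open>Additive categories\<close>

lemma Hom_iff: "f : Hom C X Y \<longleftrightarrow> f : Arr C & Dom C f = X & Cod C f = Y"
 by (simp add: Hom_def)

section \<open>Calculus of arrows in a category\<close>

context category begin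

lemma Comp_simps [simp]:
 assumes "f : Arr C" "g : Arr C" "Cod C f = Dom C g"
 shows "g ** f : Arr C" "Dom C (g ** f) = Dom C f" "Cod C (g ** f) = Cod C g"
 using Comp_Hom[of f "Dom C f" "Cod C f" g "Cod C g"] assms by (auto simp: Hom_iff)

lemma Idt_simps [simp]:
 assumes "X : Obj C"
 shows "Idt C X : Arr C" "Dom C (Idt C X) = X" "Cod C (Idt C X) = X"
 using Idt_Hom[OF assms] by (auto simp: Hom_iff)

lemma Comp_Idt_simp [simp]: "[|f : Arr C; Dom C f = X|] ==> f ** Idt C X = f"
 using Comp_Idt[of f X "Cod C f"] by (auto simp: Hom_iff)

lemma Idt_Comp_simp [simp]: "[|f : Arr C; Cod C f = X|] ==> Idt C X ** f = f"
 using Idt_Comp[of f "Dom C f" X] by (auto simp: Hom_iff)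

lemma Comp_assoc_simp [simp]:
 "[|f : Arr C; g : Arr C; h : Arr C; Cod C f = Dom C g; Cod C g = Dom C h|] ==> (h ** g) ** f = h ** (g ** f)"
 using Comp_assoc[of f "Dom C f" "Cod C f" g "Cod C g" h "Cod C h"] by (auto simp: Hom_iff)

text \<open>Composites are normalized to the right, so an equation for \<open>a ** b\<close> does
  not match inside \<open>a ** (b ** x)\<close>. This form applies it there.\<close>

lemma Comp_reassoc:
 assumes "a ** b = c" "a : Arr C" "b : Arr C" "x : Arr C" "Cod C b = Dom C a" "Cod C x = Dom C b"
 shows "a ** (b ** x) = c ** x"
 using assms by (metis Comp_assoc_simp)

lemma Dom_Cod_Obj [simp]: "f : Arr C ==> Dom C f : Obj C" "f : Arr C ==> Cod C f : Obj C"
 by (auto intro: Dom_Obj Cod_Obj)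

lemma Hom_Obj: "f : Hom C X Y ==> X : Obj C" "f : Hom C X Y ==> Y : Obj C"
 by (auto simp: Hom_iff)

end

text \<open>Each insertion step of the fold evaluates the function only at the inserted element, so
  values outside the index set are never seen.\<close>

lemma foldSetD_cong:
 "(I, z) \<in> foldSetD D (h o f) e ==> ALL i:I. f i = g i ==> (I, z) \<in> foldSetD D (h o g) e"
proof (induction rule: foldSetD.induct)
 case (insertI x A y)
 then have "(h o f) x y = (h o g) x y" by simp
 with insertI show ?case by (metis foldSetD.insertI insertCI)
qed (auto intro: foldSetD.emptyI)

text \<open>Unlike \<open>comm_monoid.finprod_cong\<close>, without closure conditions, so that it can serve as a
 congruence rule of the simplifier.\<close>
lemma finprod_cong_strong:
 assumes "I = J" "!!i. i \<in> J ==> f i = g i"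
 shows "finprod H f I = finprod H g J"
proof -
 have "(J, z) \<in> foldSetD (carrier H) (mult H o f) (one H)
   \<longleftrightarrow> (J, z) \<in> foldSetD (carrier H) (mult H o g) (one H)" for z
  using foldSetD_cong[of J z "carrier H" "mult H" f "one H" g]
   foldSetD_cong[of J z "carrier H" "mult H" g "one H" f] assms(2) by auto
 then show ?thesis
  unfolding finprod_def foldD_def assms(1) by simp
qed

text \<open>As a congruence rule this lets the simplifier rewrite summands under the assumption that
  the index belongs to the set.\<close>

lemma hsum_cong [cong]:
 assumes "X = X'" "Y = Y'" "I = J" "!!i. i \<in> J =simp=> f i = g i"
 shows "hsum A X Y f I = hsum A X' Y' g J"
 unfolding hsum_def assms(1,2)
 by (rule finprod_cong_strong) (use assms(3,4) in "auto simp: simp_implies_def")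

text \<open>The arithmetic of hom groups is separated from kernels and cokernels so that it serves
  both \<open>A\<close> and the functor category \<open>FunA C A\<close>, whose additive structure
  is built by hand later.\<close>

locale preadditive = category A for A :: "('o,'a,'z) acat_scheme" (structure) +
 assumes hom_grp: "[|X : Obj A; Y : Obj A|] ==> comm_group (hom_grp A X Y)"
  and Comp_Add: "[|f : Hom A X Y; g : Hom A X Y; h : Hom A Y Z|] ==>
   h ** Add A f g = Add A (h ** f) (h ** g)"
  and Add_Comp: "[|f : Hom A Y Z; g : Hom A Y Z; h : Hom A X Y|] ==>
   Add A f g ** h = Add A (f ** h) (g ** h)"
begin

lemma carrier_hom_grp [simp]: "carrier (hom_grp A X Y) = Hom A X Y"
 and mult_hom_grp [simp]: "mult (hom_grp A X Y) = Add A"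
 and one_hom_grp [simp]: "one (hom_grp A X Y) = Zer A X Y"
 by (simp_all add: hom_grp_def)

lemma Add_Hom: "[|f : Hom A X Y; g : Hom A X Y|] ==> Add A f g : Hom A X Y"
 using comm_groupE(1)[OF hom_grp[of X Y], of f g] by (auto simp: Hom_Obj)

lemma Zer_Hom: "[|X : Obj A; Y : Obj A|] ==> Zer A X Y : Hom A X Y"
 using comm_groupE(2)[OF hom_grp[of X Y]] by auto

lemma neg_Hom: "f : Hom A X Y ==> neg A f : Hom A X Y"
 using group.inv_closed[OF comm_group.axioms(2)[OF hom_grp[of X Y]], of f] by (auto simp: Hom_iff neg_def)

lemma Add_simps [simp]:
 assumes "f : Arr A" "g : Arr A" "Dom A g = Dom A f" "Cod A g = Cod A f"
 shows "Add A f g : Arr A" "Dom A (Add A f g) = Dom A f" "Cod A (Add A f g) = Cod A f"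
 using Add_Hom[of f "Dom A f" "Cod A f" g] assms by (auto simp: Hom_iff)

lemma Zer_simps [simp]:
 assumes "X : Obj A" "Y : Obj A"
 shows "Zer A X Y : Arr A" "Dom A (Zer A X Y) = X" "Cod A (Zer A X Y) = Y"
 using Zer_Hom[OF assms] by (auto simp: Hom_iff)

lemma neg_simps [simp]:
 assumes "f : Arr A"
 shows "neg A f : Arr A" "Dom A (neg A f) = Dom A f" "Cod A (neg A f) = Cod A f"
 using neg_Hom[of f "Dom A f" "Cod A f"] assms by (auto simp: Hom_iff)

lemma sgnm_simps [simp]:
 assumes "f : Arr A"
 shows "sgnm A n f : Arr A" "Dom A (sgnm A n f) = Dom A f" "Cod A (sgnm A n f) = Cod A f"
 using assms by (auto simp: sgnm_def)

lemma Add_assoc: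
 "[|f : Hom A X Y; g : Hom A X Y; h : Hom A X Y|] ==> Add A (Add A f g) h = Add A f (Add A g h)"
 using comm_groupE(3)[OF hom_grp[of X Y], of f g h] by (auto simp: Hom_Obj)

lemma Add_commute: "[|f : Hom A X Y; g : Hom A X Y|] ==> Add A f g = Add A g f"
 using comm_groupE(4)[OF hom_grp[of X Y], of f g] by (auto simp: Hom_Obj)

lemma Zer_Add: "f : Hom A X Y ==> Add A (Zer A X Y) f = f"
 using comm_groupE(5)[OF hom_grp[of X Y], of f] by (auto simp: Hom_Obj)

lemma Add_Zer: "f : Hom A X Y ==> Add A f (Zer A X Y) = f"
 using Zer_Add Add_commute Zer_Hom Hom_Obj by metis

lemma Add_Zer_simps [simp]:
 assumes "f : Arr A" "Dom A f = X" "Cod A f = Y"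
 shows "Add A (Zer A X Y) f = f" "Add A f (Zer A X Y) = f"
 using assms by (auto intro!: Zer_Add Add_Zer simp: Hom_iff)

lemma Add_neg: "f : Hom A X Y ==> Add A f (neg A f) = Zer A X Y"
 using group.r_inv[OF comm_group.axioms(2)[OF hom_grp[of X Y]], of f] by (auto simp: Hom_iff neg_def)

lemma neg_unique: "[|f : Hom A X Y; g : Hom A X Y; Add A f g = Zer A X Y|] ==> g = neg A f"
 using group.inv_equality[OF comm_group.axioms(2)[OF hom_grp[of X Y]], of g f] Add_commute[of f X Y g]
 by (auto simp: Hom_iff neg_def)

text \<open>Anything additive preserves zero: the image of zero is its own double, and this lemma
  identifies it.\<close>

lemma Add_self_Zer: "[|f : Hom A X Y; Add A f f = f|] ==> f = Zer A X Y"
 using Add_assoc[of f X Y f "neg A f"] neg_Hom[of f X Y] Add_neg[of f X Y] Add_Zer[of f X Y] by simp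

lemma Comp_Zer [simp]:
 assumes "f : Arr A" "Dom A f = Y" "X : Obj A"
 shows "f ** Zer A X Y = Zer A X (Cod A f)" (is "?L = _")
proof -
 have "?L = Add A ?L ?L"
  using Comp_Add[of "Zer A X Y" X Y "Zer A X Y" f "Cod A f"] assms Zer_Hom[of X Y]
  by (auto simp: Hom_iff)
 then show ?thesis
  using Add_self_Zer[of "f ** Zer A X Y" X "Cod A f"] assms by (auto simp: Hom_iff)
qed

lemma Zer_Comp [simp]:
 assumes "f : Arr A" "Cod A f = X" "Y : Obj A"
 shows "Zer A X Y ** f = Zer A (Dom A f) Y" (is "?L = _")
proof -
 have "?L = Add A ?L ?L"
  using Add_Comp[of "Zer A X Y" X Y "Zer A X Y" f "Dom A f"] assms Zer_Hom[of X Y]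
  by (auto simp: Hom_iff)
 then show ?thesis
  using Add_self_Zer[of "Zer A X Y ** f" "Dom A f" Y] assms by (auto simp: Hom_iff)
qed

lemma Comp_Add_simp:
 "[|f : Arr A; g : Arr A; h : Arr A; Dom A g = Dom A f; Cod A g = Cod A f; Dom A h = Cod A f|]
  ==> h ** Add A f g = Add A (h ** f) (h ** g)"
 using Comp_Add[of f "Dom A f" "Cod A f" g h "Cod A h"] by (auto simp: Hom_iff)

lemma Add_Comp_simp:
 "[|f : Arr A; g : Arr A; h : Arr A; Dom A g = Dom A f; Cod A g = Cod A f; Cod A h = Dom A f|]
  ==> Add A f g ** h = Add A (f ** h) (g ** h)"
 using Add_Comp[of f "Dom A f" "Cod A f" g h "Dom A h"] by (auto simp: Hom_iff)

lemma neg_neg [simp]: "f : Arr A ==> neg A (neg A f) = f"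
 using neg_unique[of "neg A f" "Dom A f" "Cod A f" f] Add_neg[of f "Dom A f" "Cod A f"]
  Add_commute[of f "Dom A f" "Cod A f" "neg A f"] by (auto simp: Hom_iff)

lemma neg_Zer [simp]: "[|X : Obj A; Y : Obj A|] ==> neg A (Zer A X Y) = Zer A X Y"
 using neg_unique[of "Zer A X Y" X Y "Zer A X Y"] by (auto simp: Hom_iff)

lemma Comp_neg [simp]:
 assumes "f : Arr A" "h : Arr A" "Dom A h = Cod A f"
 shows "h ** neg A f = neg A (h ** f)" (is "?L = _")
proof (rule neg_unique)
 show "Add A (h ** f) ?L = Zer A (Dom A f) (Cod A h)"
  using assms Add_neg[of f "Dom A f" "Cod A f"] by (simp add: Hom_iff flip: Comp_Add_simp)
qed (use assms in "auto simp: Hom_iff")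

lemma neg_Comp [simp]:
 assumes "f : Arr A" "h : Arr A" "Cod A h = Dom A f"
 shows "neg A f ** h = neg A (f ** h)" (is "?L = _")
proof (rule neg_unique)
 show "Add A (f ** h) ?L = Zer A (Dom A h) (Cod A f)"
  using assms Add_neg[of f "Dom A f" "Cod A f"] by (simp add: Hom_iff flip: Add_Comp_simp)
qed (use assms in "auto simp: Hom_iff")

lemma Add_swap4:
 assumes "a : Hom A X Y" "b : Hom A X Y" "c : Hom A X Y" "d : Hom A X Y"
 shows "Add A (Add A a b) (Add A c d) = Add A (Add A a c) (Add A b d)"
proof -
 have "Add A b (Add A c d) = Add A c (Add A b d)"
  using Add_assoc[of b X Y c d] Add_assoc[of c X Y b d] Add_commute[of b X Y c] assms by simp
 then show ?thesis using assms by (simp add: Add_assoc[of a X Y] Add_Hom)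
qed

lemma neg_Add:
 assumes "f : Hom A X Y" "g : Hom A X Y"
 shows "neg A (Add A f g) = Add A (neg A f) (neg A g)" (is "_ = ?R")
proof (rule neg_unique[symmetric])
 show "Add A (Add A f g) ?R = Zer A X Y"
  using assms by (subst Add_swap4) (auto simp: neg_Hom Add_neg Zer_Add Zer_Hom Hom_Obj)
qed (use assms in "auto intro!: Add_Hom neg_Hom")

lemma sgnm_sgnm [simp]: "f : Arr A ==> sgnm A m (sgnm A n f) = sgnm A (m + n) f"
 by (auto simp: sgnm_def)

lemma Comp_sgnm [simp]:
 "[|f : Arr A; h : Arr A; Dom A h = Cod A f|] ==> h ** sgnm A n f = sgnm A n (h ** f)"
 by (auto simp: sgnm_def)

lemma sgnm_Comp [simp]:
 "[|f : Arr A; h : Arr A; Cod A h = Dom A f|] ==> sgnm A n f ** h = sgnm A n (f ** h)"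
 by (auto simp: sgnm_def)

lemma sgnm_Zer [simp]: "[|X : Obj A; Y : Obj A|] ==> sgnm A n (Zer A X Y) = Zer A X Y"
 by (auto simp: sgnm_def)

lemma sgnm_0 [simp]: "sgnm A 0 f = f"
 by (simp add: sgnm_def)

lemma sgnm_Add: "[|f : Hom A X Y; g : Hom A X Y|] ==> sgnm A n (Add A f g) = Add A (sgnm A n f) (sgnm A n g)"
 by (auto simp: sgnm_def neg_Add)

lemma sgnm_parity: "even (m - n) ==> sgnm A m f = sgnm A n f"
 by (auto simp: sgnm_def)

lemma Add_sgnm_cancel:
 assumes "f : Hom A X Y" "odd (m - n)" shows "Add A (sgnm A m f) (sgnm A n f) = Zer A X Y"
 using assms Add_neg[of f X Y] Add_commute[of f X Y "neg A f"] neg_Hom[of f X Y] by (auto simp: sgnm_def)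

section \<open>Finite sums of arrows\<close>

lemma hom_comm_monoid: "[|X : Obj A; Y : Obj A|] ==> comm_monoid (hom_grp A X Y)"
 using hom_grp comm_group.axioms(1) by blast

lemma hsum_Hom: "[|X : Obj A; Y : Obj A; !!i. i \<in> I ==> f i : Hom A X Y|] ==> hsum A X Y f I : Hom A X Y"
 unfolding hsum_def
 using comm_monoid.finprod_closed[OF hom_comm_monoid[of X Y], of f I] by (auto simp: Pi_iff)

lemma hsum_simps [simp]:
 assumes "X : Obj A" "Y : Obj A" "ALL i:I. f i : Arr A & Dom A (f i) = X & Cod A (f i) = Y"
 shows "hsum A X Y f I : Arr A" "Dom A (hsum A X Y f I) = X" "Cod A (hsum A X Y f I) = Y"
 using hsum_Hom[of X Y I f] assms by (auto simp: Hom_iff)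

lemma hsum_infinite: "infinite I ==> hsum A X Y f I = Zer A X Y"
 by (simp add: hsum_def finprod_def)

lemma hsum_empty [simp]: "[|X : Obj A; Y : Obj A|] ==> hsum A X Y f {} = Zer A X Y"
 unfolding hsum_def using comm_monoid.finprod_empty[OF hom_comm_monoid[of X Y], of f] by simp

lemma hsum_insert:
 assumes "finite I" "i ~: I" "!!j. j \<in> insert i I ==> f j : Hom A X Y"
 shows "hsum A X Y f (insert i I) = Add A (f i) (hsum A X Y f I)"
proof -
 have "X : Obj A" "Y : Obj A" using assms(3)[of i] Hom_Obj by auto
 then show ?thesis
  using comm_monoid.finprod_insert[OF hom_comm_monoid[of X Y] assms(1,2), of f] assms
  by (auto simp: hsum_def Pi_iff)
qed

lemma hsum_singleton [simp]:
 assumes "f i : Hom A X Y" shows "hsum A X Y f {i} = f i"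
 using hsum_insert[of "{}" i f X Y] assms Hom_Obj[OF assms] by (auto simp: Add_Zer)

lemma hsum_Zer:
 assumes "X : Obj A" "Y : Obj A" "!!i. i \<in> I ==> f i = Zer A X Y"
 shows "hsum A X Y f I = Zer A X Y"
 unfolding hsum_def
 using comm_monoid.finprod_one_eqI[OF hom_comm_monoid[of X Y], of I f] assms by simp

lemma hsum_mono_neutral:
 assumes "finite J" "I \<subseteq> J" "!!i. i \<in> I ==> f i : Hom A X Y" "!!i. i \<in> J - I ==> f i = Zer A X Y"
  "X : Obj A" "Y : Obj A"
 shows "hsum A X Y f I = hsum A X Y f J"
proof -
 have "f i : Hom A X Y" if "i \<in> J" for i
  using that assms(3)[of i] assms(4)[of i] Zer_Hom[OF assms(5,6)] by (cases "i \<in> I") auto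
 then show ?thesis
  unfolding hsum_def
  using comm_monoid.finprod_mono_neutral_cong_left[OF hom_comm_monoid[of X Y], of J I f f] assms
  by (auto simp: Pi_iff)
qed

lemma hsum_single:
 assumes "finite I" "i \<in> I" "f i : Hom A X Y" "!!j. [|j \<in> I; j ~= i|] ==> f j = Zer A X Y"
 shows "hsum A X Y f I = f i"
 using hsum_mono_neutral[of I "{i}" f X Y] assms Hom_Obj[of "f i"] by auto

lemma hsum_reindex:
 assumes "inj_on h I" "!!i. i \<in> I ==> f (h i) : Hom A X Y" "X : Obj A" "Y : Obj A"
 shows "hsum A X Y f (h ` I) = hsum A X Y (%i. f (h i)) I"
 unfolding hsum_def
 using comm_monoid.finprod_reindex[OF hom_comm_monoid[of X Y], of f h I] assms by (auto simp: Pi_iff)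

lemma hsum_bij:
 assumes "bij_betw h I J" "!!i. i \<in> I ==> f i = g (h i)" "!!j. j \<in> J ==> g j : Hom A X Y"
  "X : Obj A" "Y : Obj A"
 shows "hsum A X Y f I = hsum A X Y g J"
proof -
 have "hsum A X Y g J = hsum A X Y (%i. g (h i)) I"
  using hsum_reindex[of h I g X Y] assms by (auto simp: bij_betw_def)
 then show ?thesis using assms(2) by simp
qed

lemma hsum_Un_disjoint:
 assumes "finite I" "finite J" "I Int J = {}" "!!i. i \<in> I Un J ==> f i : Hom A X Y" "X : Obj A" "Y : Obj A"
 shows "hsum A X Y f (I Un J) = Add A (hsum A X Y f I) (hsum A X Y f J)"
 unfolding hsum_def
 using comm_monoid.finprod_Un_disjoint[OF hom_comm_monoid[of X Y], of I J f] assms by (auto simp: Pi_iff)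

lemma hsum_Add:
 assumes "!!i. i \<in> I ==> f i : Hom A X Y" "!!i. i \<in> I ==> g i : Hom A X Y" "X : Obj A" "Y : Obj A"
 shows "hsum A X Y (%i. Add A (f i) (g i)) I = Add A (hsum A X Y f I) (hsum A X Y g I)"
 unfolding hsum_def
 using comm_monoid.finprod_multf[OF hom_comm_monoid[of X Y], of f I g] assms by (auto simp: Pi_iff)

text \<open>Besides additivity only \<open>T\<close> of zero is required, and it is found by
  \<open>Add_self_Zer\<close>. Infinite index sets are covered because both sums are then zero by
  convention.\<close>

lemma hsum_additive:
 assumes "X : Obj A" "Y : Obj A" "X' : Obj A" "Y' : Obj A"
  and "!!f g. [|f : Hom A X Y; g : Hom A X Y|] ==> T (Add A f g) = Add A (T f) (T g)"
  and "!!f. f : Hom A X Y ==> T f : Hom A X' Y'"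
  and "!!i. i \<in> I ==> f i : Hom A X Y"
 shows "T (hsum A X Y f I) = hsum A X' Y' (%i. T (f i)) I"
proof -
 let ?t1 = "Zer A X Y"
 have "Add A (T ?t1) (T ?t1) = T ?t1"
  using assms(5)[of "Zer A X Y" "Zer A X Y"] Zer_Hom[of X Y] assms(1,2) by simp
 then have T0: "T ?t1 = Zer A X' Y'"
  using Add_self_Zer[of "T ?t1" X' Y'] assms(6) Zer_Hom[of X Y] assms(1,2) by blast
 show ?thesis
  using assms(7)
 proof (induction I rule: infinite_finite_induct)
  case (insert i I)
  have "hsum A X Y f (insert i I) = Add A (f i) (hsum A X Y f I)"
   by (rule hsum_insert) (use insert in auto)
  then have "T (hsum A X Y f (insert i I)) = Add A (T (f i)) (T (hsum A X Y f I))"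
   using assms(1,2) insert.prems assms(5)[of "f i" "hsum A X Y f I"] by (auto intro: hsum_Hom)
  also have "... = hsum A X' Y' (%i. T (f i)) (insert i I)"
   using hsum_insert[of I i "%i. T (f i)" X' Y'] insert assms(6) by auto
  finally show ?case .
 qed (use assms(1-4) in "simp_all add: T0 hsum_infinite")
qed

lemma Comp_hsum:
 assumes "h : Arr A" "Dom A h = Y" "X : Obj A" "ALL i:I. f i : Arr A & Dom A (f i) = X & Cod A (f i) = Y"
 shows "h ** hsum A X Y f I = hsum A X (Cod A h) (%i. h ** f i) I"
 using hsum_additive[of X Y X "Cod A h" "%f. h ** f" I f] assms
 by (auto simp: Hom_iff Comp_Add_simp)

lemma hsum_Comp:
 assumes "h : Arr A" "Cod A h = X" "Y : Obj A" "ALL i:I. f i : Arr A & Dom A (f i) = X & Cod A (f i) = Y"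
 shows "hsum A X Y f I ** h = hsum A (Dom A h) Y (%i. f i ** h) I"
 using hsum_additive[of X Y "Dom A h" Y "%f. f ** h" I f] assms
 by (auto simp: Hom_iff Add_Comp_simp)

lemma sgnm_hsum:
 assumes "X : Obj A" "Y : Obj A" "ALL i:I. f i : Arr A & Dom A (f i) = X & Cod A (f i) = Y"
 shows "sgnm A n (hsum A X Y f I) = hsum A X Y (%i. sgnm A n (f i)) I"
 using hsum_additive[of X Y X Y "sgnm A n" I f] assms
 by (auto simp: sgnm_Add Hom_iff)

lemma hsum_Sigma:
 assumes "finite I" "!!i. i \<in> I ==> finite (J i)" "!!i j. [|i \<in> I; j \<in> J i|] ==> f i j : Hom A X Y"
  "X : Obj A" "Y : Obj A"
 shows "hsum A X Y (%i. hsum A X Y (f i) (J i)) I = hsum A X Y (%(i, j). f i j) (Sigma I J)"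
 using assms(1-3)
proof (induction I rule: finite_induct)
 case (insert i I)
 have *: "hsum A X Y (f i) (J i) = hsum A X Y (%(i, j). f i j) (Pair i ` J i)"
  using insert assms by (subst hsum_reindex) (auto simp: inj_on_def)
 have "Sigma (insert i I) J = (Pair i ` J i) Un Sigma I J" by auto
 moreover have "hsum A X Y (%(i, j). f i j) ((Pair i ` J i) Un Sigma I J) =
   Add A (hsum A X Y (%(i, j). f i j) (Pair i ` J i)) (hsum A X Y (%(i, j). f i j) (Sigma I J))"
  using insert assms by (intro hsum_Un_disjoint) auto
 moreover have "hsum A X Y (%i. hsum A X Y (f i) (J i)) (insert i I)
   = Add A (hsum A X Y (f i) (J i)) (hsum A X Y (%i. hsum A X Y (f i) (J i)) I)"
  using insert assms by (intro hsum_insert) (auto intro!: hsum_Hom)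
 ultimately show ?case using insert by (simp add: *)
qed (use assms(4,5) in auto)

text \<open>Out-of-range summands, such as those of negative simplicial degree, are disposed of by
  this lemma throughout.\<close>

lemma is_zero_Hom_eq: "[|is_zero A X | is_zero A Y; f : Hom A X Y|] ==> f = Zer A X Y"
 using Hom_Obj[of f X Y] Zer_Hom[of X Y] unfolding is_zero_def by metis

lemma is_zero_iff: "is_zero A X \<longleftrightarrow> X : Obj A & Idt A X = Zer A X X"
proof
 assume "is_zero A X"
 then show "X : Obj A & Idt A X = Zer A X X"
  using is_zero_Hom_eq[of X X "Idt A X"] Idt_Hom[of X] by (auto simp: is_zero_def)
next
 assume X: "X : Obj A & Idt A X = Zer A X X"
 have "f = Zer A Y X" if "f : Hom A Y X" for f Y
  using that X Idt_Comp_simp[of f X] Zer_Comp[of f X X] by (auto simp: Hom_iff)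
 moreover have "f = Zer A X Y" if "f : Hom A X Y" for f Y
  using that X Comp_Idt_simp[of f X] Comp_Zer[of f X X] by (auto simp: Hom_iff)
 ultimately show "is_zero A X"
  unfolding is_zero_def using X Zer_Hom by blast
qed

lemma is_zero_Obj: "is_zero A X ==> X : Obj A"
 by (simp add: is_zero_def)

end

text \<open>The condition under which \<open>dsum\<close> selects an actual biproduct.\<close>

definition fam :: "('o,'a,'z) cat_scheme => ('i => 'o) => bool" where
 "fam A X \<longleftrightarrow> finite (supp A X) & (ALL i. X i : Obj A)"

section \<open>Finite biproducts and matrices of arrows\<close>

locale additive = preadditive A for A :: "('o,'a,'z) acat_scheme" (structure) +
 assumes ex_zero: "EX Z. is_zero A Z"
  and ex_dsum: "[|X : Obj A; Y : Obj A|] ==> EX t. is_dsum A (%b::bool. if b then Y else X) t"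
begin

lemma zero_obj: "is_zero A (zero_obj A)"
 unfolding zero_obj_def using ex_zero by (rule someI_ex)

lemma zero_obj_Obj [simp]: "zero_obj A : Obj A"
 using zero_obj by (simp add: is_zero_def)

lemma ex_binary_dsum:
 assumes "X : Obj A" "Y : Obj A"
 shows "EX S i1 i2 p1 p2. i1 : Hom A X S & i2 : Hom A Y S & p1 : Hom A S X & p2 : Hom A S Y &
  p1 ** i1 = Idt A X & p2 ** i2 = Idt A Y & p2 ** i1 = Zer A X Y & p1 ** i2 = Zer A Y X &
  Idt A S = Add A (i1 ** p1) (i2 ** p2)"
proof -
 define F where "F = (%b::bool. if b then Y else X)"
 obtain S ij pj where d: "is_dsum A F (S, ij, pj)"
  using ex_dsum[OF assms] by (auto simp: F_def)
 have S: "S : Obj A" "!!b. ij b : Hom A (F b) S" "!!b. pj b : Hom A S (F b)"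
  "!!b c. pj c ** ij b = (if b = c then Idt A (F b) else Zer A (F b) (F c))"
  "Idt A S = hsum A S S (%i. ij i ** pj i) (supp A F)"
  using d by (auto simp: is_dsum_def)
 have h: "ij b ** pj b : Hom A S S" for b using S(2,3)[of b] by (auto simp: Hom_iff)
 have "Idt A S = hsum A S S (%i. ij i ** pj i) UNIV"
 proof (unfold S(5), rule hsum_mono_neutral)
  fix b assume "b \<in> UNIV - supp A F"
  then have "ij b = Zer A (F b) S" using is_zero_Hom_eq[of "F b" S "ij b"] S(2) by (auto simp: supp_def)
  then show "ij b ** pj b = Zer A S S" using S(1) S(3)[of b] by (auto simp: Hom_iff)
 qed (use S h d in "auto simp: is_dsum_def")
 also have "... = Add A (ij False ** pj False) (ij True ** pj True)"
  unfolding UNIV_bool using h by (subst hsum_insert) auto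
 finally show ?thesis
  using S(2-4)[of True] S(2-4)[of False]
  by (intro exI[of _ S] exI[of _ "ij False"] exI[of _ "ij True"] exI[of _ "pj False"] exI[of _ "pj True"])
   (auto simp: F_def)
qed

text \<open>Induction on a finite set that contains the support, quantified over all families: the
  summand at the new index is replaced by a zero object, and then adjoined by a binary sum.\<close>

lemma ex_finite_dsum:
 assumes "finite I"
 shows "ALL X :: 'i => 'o. (ALL i. X i : Obj A) --> supp A X \<subseteq> I --> (EX t. is_dsum A X t)"
 using assms
proof (induction I rule: finite_induct)
 case empty
 show ?case
 proof (intro allI impI)
  fix X :: "'i => 'o" assume X: "ALL i. X i : Obj A" "supp A X \<subseteq> {}"
  then have z: "is_zero A (X i)" for i by (auto simp: supp_def)
  have e: "Idt A (X i) = Zer A (X i) (X i)" for i using z is_zero_iff by blast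
  have "is_dsum A X (zero_obj A, %i. Zer A (X i) (zero_obj A), %i. Zer A (zero_obj A) (X i))"
   using X z zero_obj by (auto simp: is_dsum_def Zer_Hom e is_zero_iff)
  then show "EX t. is_dsum A X t" by blast
 qed
next
 case (insert k I)
 show ?case
 proof (intro allI impI)
  fix X :: "'i => 'o" assume X: "ALL i. X i : Obj A" "supp A X \<subseteq> insert k I"
  define X' where "X' = X(k := zero_obj A)"
  have X': "ALL i. X' i : Obj A" "supp A X' \<subseteq> I" "k ~: supp A X'" "supp A X \<subseteq> insert k (supp A X')"
   using X zero_obj by (auto simp: X'_def supp_def)
  then obtain S ij pj where "is_dsum A X' (S, ij, pj)"
   using insert.IH by (metis prod_cases3)
  then have S: "S : Obj A" "!!b. ij b : Hom A (X' b) S" "!!b. pj b : Hom A S (X' b)"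
   "!!b c. pj c ** ij b = (if b = c then Idt A (X' b) else Zer A (X' b) (X' c))"
   "Idt A S = hsum A S S (%i. ij i ** pj i) (supp A X')" "finite (supp A X')"
   by (auto simp: is_dsum_def)
  obtain R i1 i2 p1 p2 where R: "i1 : Hom A S R" "i2 : Hom A (X k) R" "p1 : Hom A R S" "p2 : Hom A R (X k)"
   "p1 ** i1 = Idt A S" "p2 ** i2 = Idt A (X k)" "p2 ** i1 = Zer A S (X k)" "p1 ** i2 = Zer A (X k) S"
   "Idt A R = Add A (i1 ** p1) (i2 ** p2)"
   using ex_binary_dsum[of S "X k"] S(1) X by blast
  have Xk: "X' b = X b" if "b ~= k" for b using that by (simp add: X'_def)
  have RO: "R : Obj A" using R Hom_Obj by blast
  note RS = R(1-4)[unfolded Hom_iff] S(1) RO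
  have Sh: "ij b : Arr A" "Dom A (ij b) = X' b" "Cod A (ij b) = S" "pj b : Arr A" "Dom A (pj b) = S" "Cod A (pj b) = X' b" for b
   using S(2,3)[of b] by (auto simp: Hom_iff)
  define iR where "iR b = (if b = k then i2 else i1 ** ij b)" for b
  define pR where "pR b = (if b = k then p2 else pj b ** p1)" for b
  have hom: "iR b : Hom A (X b) R" "pR b : Hom A R (X b)" for b
   using RS Sh[of b] Xk[of b] by (auto simp: iR_def pR_def Hom_iff)
  have hom2: "iR b ** pR b : Hom A R R" for b using hom[of b] by (auto simp: Hom_iff)
  have orth: "pR c ** iR b = (if b = c then Idt A (X b) else Zer A (X b) (X c))" for b c
  proof -
   have "p1 ** (i1 ** ij b) = Idt A S ** ij b" "p2 ** (i1 ** ij b) = Zer A S (X k) ** ij b"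
    by (rule Comp_reassoc[OF R(5)] Comp_reassoc[OF R(7)]; use RS Sh[of b] in auto)+
   then show ?thesis
    using R RS Sh S(4)[of c b] X' X Xk by (auto simp: iR_def pR_def)
  qed
  have "i1 ** p1 = i1 ** (Idt A S ** p1)" using RS by simp
  also have "... = hsum A R R (%b. iR b ** pR b) (supp A X')"
  proof -
   have "i \<in> supp A X' ==> i ~= k" for i using X'(3) by blast
   then show ?thesis
    unfolding S(5) using RS Sh by (simp add: Comp_hsum hsum_Comp iR_def pR_def)
  qed
  finally have "Idt A R = Add A (hsum A R R (%b. iR b ** pR b) (supp A X')) (iR k ** pR k)"
   using R(9) by (simp add: iR_def pR_def)
  also have "... = hsum A R R (%b. iR b ** pR b) (insert k (supp A X'))"
   using S(6) X'(3) hom2 hsum_Hom[OF RO RO, of "supp A X'" "%b. iR b ** pR b"]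
   by (subst hsum_insert) (auto simp: Add_commute[of _ R R])
  \<comment> \<open>If \<open>X k\<close> happens to be zero, \<open>k\<close> is not in the support
    of \<open>X\<close>; the surplus term then factors through a zero object.\<close>
  also have "... = hsum A R R (%b. iR b ** pR b) (supp A X)"
  proof (rule hsum_mono_neutral[symmetric])
   fix b assume "b \<in> insert k (supp A X') - supp A X"
   then have "iR b = Zer A (X b) R" using is_zero_Hom_eq[of "X b" R "iR b"] hom by (auto simp: supp_def)
   then show "iR b ** pR b = Zer A R R" using RO hom(2)[of b] by (auto simp: Hom_iff)
  qed (use S X' RO hom2 in auto)
  finally have "is_dsum A X (R, iR, pR)"
   using X'(4) S(6) RO hom orth finite_subset[of "supp A X" "insert k (supp A X')"] by (auto simp: is_dsum_def)
  then show "EX t. is_dsum A X t" by blast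
 qed
qed

lemma is_dsum_dsum: "fam A X ==> is_dsum A X (dS A X, dI A X, dP A X)"
 using someI_ex[of "is_dsum A X"] ex_finite_dsum[of "supp A X"]
 by (auto simp: fam_def dsum_def dS_def dI_def dP_def)

lemma dsum_simps [simp]:
 assumes "fam A X"
 shows "dS A X : Obj A" "X i : Obj A" "dI A X i : Arr A" "Dom A (dI A X i) = X i" "Cod A (dI A X i) = dS A X"
  "dP A X i : Arr A" "Dom A (dP A X i) = dS A X" "Cod A (dP A X i) = X i"
  "dP A X j ** dI A X i = (if i = j then Idt A (X i) else Zer A (X i) (X j))"
 using is_dsum_dsum[OF assms] assms by (auto simp: is_dsum_def Hom_iff fam_def)

lemma dsum_simps2 [simp]:
 assumes "fam A X" "f : Arr A" "Cod A f = X i"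
 shows "dP A X j ** (dI A X i ** f) = (if i = j then f else Zer A (Dom A f) (X j))"
 using Comp_reassoc[OF dsum_simps(9)[OF assms(1), of j i], of f] assms by auto

lemma Idt_dS: "fam A X ==> Idt A (dS A X) = hsum A (dS A X) (dS A X) (%i. dI A X i ** dP A X i) (supp A X)"
 using is_dsum_dsum by (auto simp: is_dsum_def)

lemma fam_finite: "fam A X ==> finite (supp A X)"
 by (simp add: fam_def)

lemma supp_zero: "i ~: supp A X ==> is_zero A (X i)"
 by (simp add: supp_def)

lemma dS_eqI:
 assumes "fam A X" "f : Hom A (dS A X) Z" "g : Hom A (dS A X) Z"
  and "!!i. f ** dI A X i = g ** dI A X i"
 shows "f = g"
proof -
 have *: "h = hsum A (dS A X) Z (%i. (h ** dI A X i) ** dP A X i) (supp A X)" if "h : Hom A (dS A X) Z" for h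
 proof -
  have "h = h ** Idt A (dS A X)" using that by (auto simp: Hom_iff)
  also have "... = hsum A (dS A X) Z (%i. (h ** dI A X i) ** dP A X i) (supp A X)"
   using that assms(1) by (subst Idt_dS) (auto simp: Hom_iff Comp_hsum)
  finally show ?thesis .
 qed
 show ?thesis using *[OF assms(2)] *[OF assms(3)] assms(4) by simp
qed

lemma dS_eqI':
 assumes "fam A X" "f : Hom A Z (dS A X)" "g : Hom A Z (dS A X)"
  and "!!i. dP A X i ** f = dP A X i ** g"
 shows "f = g"
proof -
 have *: "h = hsum A Z (dS A X) (%i. dI A X i ** (dP A X i ** h)) (supp A X)" if "h : Hom A Z (dS A X)" for h
 proof -
  have "h = Idt A (dS A X) ** h" using that by (auto simp: Hom_iff)
  also have "... = hsum A Z (dS A X) (%i. dI A X i ** (dP A X i ** h)) (supp A X)"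
   using that assms(1) by (subst Idt_dS) (auto simp: Hom_iff hsum_Comp)
  finally show ?thesis .
 qed
 show ?thesis using *[OF assms(2)] *[OF assms(3)] assms(4) by simp
qed

lemma dmat_Hom:
 assumes "fam A X" "fam A Y" "!!i j. m i j : Hom A (X i) (Y j)"
 shows "dmat A X Y m : Hom A (dS A X) (dS A Y)"
 unfolding dmat_def using assms
 by (intro hsum_Hom) (auto simp: Hom_iff)

lemma dmat_simps [simp]:
 assumes "fam A X" "fam A Y" "ALL i j. m i j : Arr A & Dom A (m i j) = X i & Cod A (m i j) = Y j"
 shows "dmat A X Y m : Arr A" "Dom A (dmat A X Y m) = dS A X" "Cod A (dmat A X Y m) = dS A Y"
 using dmat_Hom[of X Y m] assms by (auto simp: Hom_iff)

text \<open>Composition with the inclusion at \<open>i\<close> kills every row of the matrix but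
  one. If \<open>X i\<close> is zero this row is missing from the sum, but then its entries
  \<open>m i j\<close> vanish as well.\<close>

lemma dmat_dI_supp:
 assumes "fam A X" "fam A Y" "!!j. m i j : Hom A (X i) (Y j)"
  and "!!i j. i \<in> supp A X ==> j \<in> supp A Y ==> m i j : Hom A (X i) (Y j)"
 shows "dmat A X Y m ** dI A X i = hsum A (X i) (dS A Y) (%j. dI A Y j ** m i j) (supp A Y)"
proof -
 let ?t1 = "supp A Y"
 have m: "m i j : Arr A" "Dom A (m i j) = X i" "Cod A (m i j) = Y j" if "i \<in> supp A X" "j \<in> supp A Y" for i j
  using assms(4)[OF that] by (auto simp: Hom_iff)
 have mi: "m i j : Arr A" "Dom A (m i j) = X i" "Cod A (m i j) = Y j" for j
  using assms(3) by (auto simp: Hom_iff)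
 have "dmat A X Y m ** dI A X i = hsum A (X i) (dS A Y)
   (%(k, j). dI A Y j ** (m k j ** (dP A X k ** dI A X i))) (supp A X \<times> supp A Y)"
  unfolding dmat_def using assms(1,2) m
  by (subst hsum_Comp) (auto simp: case_prod_beta mem_Times_iff simp del: dsum_simps(9))
 also have "... = hsum A (X i) (dS A Y) (%k. hsum A (X i) (dS A Y)
   (%j. dI A Y j ** (m k j ** (dP A X k ** dI A X i))) ?t1) (supp A X)"
  using assms(1,2) m fam_finite[OF assms(1)] fam_finite[OF assms(2)]
  by (subst hsum_Sigma) (auto simp: Hom_iff simp del: dsum_simps(9))
 also have "... = hsum A (X i) (dS A Y) (%j. dI A Y j ** m i j) ?t1"
 proof (cases "i \<in> supp A X")
  case True
  then have "hsum A (X i) (dS A Y) (%k. hsum A (X i) (dS A Y)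
   (%j. dI A Y j ** (m k j ** (dP A X k ** dI A X i))) ?t1) (supp A X)
   = hsum A (X i) (dS A Y) (%k. if k = i then hsum A (X i) (dS A Y) (%j. dI A Y j ** m i j) ?t1
   else Zer A (X i) (dS A Y)) (supp A X)"
   using assms(1,2) m by (intro hsum_cong) (auto simp: simp_implies_def intro!: hsum_Zer)
  also have "... = hsum A (X i) (dS A Y) (%j. dI A Y j ** m i j) ?t1"
   using True assms(1,2) fam_finite mi by (subst hsum_single[of _ i]) (auto intro!: hsum_Hom simp: Hom_iff)
  finally show ?thesis .
 next
  case False
  then have z: "m i j = Zer A (X i) (Y j)" for j
   using is_zero_Hom_eq[of "X i" "Y j"] supp_zero[of i X] assms(3) by auto
  have "hsum A (X i) (dS A Y) (%j. dI A Y j ** m i j) ?t1 = Zer A (X i) (dS A Y)"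
   using assms(1,2) by (intro hsum_Zer) (auto simp: z)
  moreover have "hsum A (X i) (dS A Y) (%k. hsum A (X i) (dS A Y)
   (%j. dI A Y j ** (m k j ** (dP A X k ** dI A X i))) ?t1) (supp A X) = Zer A (X i) (dS A Y)"
   using assms(1,2) m False by (intro hsum_Zer) (auto intro!: hsum_Zer)
  ultimately show ?thesis by simp
 qed
 finally show ?thesis .
qed

text \<open>The support of \<open>Y\<close> is exchanged for any finite set that carries the nonzero
  entries of the row, so that rows with few explicit entries can be read off.\<close>

lemma dmat_dI:
 assumes "fam A X" "fam A Y" "!!i j. m i j : Hom A (X i) (Y j)" "finite J"
  "!!j. j ~: J ==> m i j = Zer A (X i) (Y j)"
 shows "dmat A X Y m ** dI A X i = hsum A (X i) (dS A Y) (%j. dI A Y j ** m i j) J"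
proof -
 have m: "dI A Y j ** m i j : Hom A (X i) (dS A Y)" for j using assms(1,2) assms(3)[of i j] by (auto simp: Hom_iff)
 have z: "dI A Y j ** m i j = Zer A (X i) (dS A Y)" if "j ~: supp A Y" for j
 proof -
  have "m i j = Zer A (X i) (Y j)" using is_zero_Hom_eq[of "X i" "Y j"] supp_zero[of j Y] that assms(3) by auto
  then show ?thesis using assms(1,2) by auto
 qed
 have "dmat A X Y m ** dI A X i = hsum A (X i) (dS A Y) (%j. dI A Y j ** m i j) (supp A Y)"
  by (rule dmat_dI_supp) (use assms in auto)
 also have "... = hsum A (X i) (dS A Y) (%j. dI A Y j ** m i j) (supp A Y Un J)"
  using assms(1,2,4) fam_finite m z by (intro hsum_mono_neutral) auto
 also have "... = hsum A (X i) (dS A Y) (%j. dI A Y j ** m i j) J"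
  using assms fam_finite m by (intro hsum_mono_neutral[symmetric]) auto
 finally show ?thesis .
qed

lemma dmat_dI_single:
 assumes "fam A X" "fam A Y" "!!i j. m i j : Hom A (X i) (Y j)" "!!j'. j' ~= j ==> m i j' = Zer A (X i) (Y j')"
 shows "dmat A X Y m ** dI A X i = dI A Y j ** m i j"
 using dmat_dI[of X Y m "{j}" i] assms(1,2,4) assms(3)[of i j] assms(3) by (auto simp: Hom_iff)

lemma dP_dmat_dI:
 assumes "fam A X" "fam A Y" "!!i j. m i j : Hom A (X i) (Y j)"
 shows "dP A Y j ** (dmat A X Y m ** dI A X i) = m i j"
proof -
 have m: "m i j : Arr A" "Dom A (m i j) = X i" "Cod A (m i j) = Y j" for j using assms(3)[of i j] by (auto simp: Hom_iff)
 have "dP A Y j ** (dmat A X Y m ** dI A X i) = hsum A (X i) (Y j) (%k. if k = j then m i j else Zer A (X i) (Y j)) (supp A Y)"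
  using assms m by (subst dmat_dI_supp) (auto simp: Comp_hsum intro!: hsum_cong simp: simp_implies_def)
 also have "... = m i j"
 proof (cases "j \<in> supp A Y")
  case True
  then show ?thesis using assms fam_finite m by (subst hsum_single[of _ j]) (auto simp: Hom_iff)
 next
  case False
  then show ?thesis
   using is_zero_Hom_eq[of "X i" "Y j" "m i j"] supp_zero[of j Y] assms m
   by (subst hsum_Zer) auto
 qed
 finally show ?thesis .
qed

end

sublocale abelian_category \<subseteq> additive
proof (intro additive.intro preadditive.intro)
 show "category A" by (rule category_axioms)
 show "preadditive_axioms A" using hom_grp Comp_Add Add_Comp by (rule preadditive_axioms.intro)
 show "additive_axioms A" using ex_zero ex_dsum by (rule additive_axioms.intro)
qed

section \<open>Total complexes and the tensor product of complexes\<close>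

context symmetric_monoidal begin

lemma tenO_Obj [simp]: "[|X : Obj C; Y : Obj C|] ==> tenO M X Y : Obj C"
 by (rule tenO)

lemma unt_Obj [simp]: "unt M : Obj C"
 by (rule unt)

lemma tenA_simps [simp]:
 assumes "f : Arr C" "g : Arr C"
 shows "tenA M f g : Arr C" "Dom C (tenA M f g) = tenO M (Dom C f) (Dom C g)"
  "Cod C (tenA M f g) = tenO M (Cod C f) (Cod C g)"
 using tenA[of f "Dom C f" "Cod C f" g "Dom C g" "Cod C g"] assms by (auto simp: Hom_iff)

lemma tenA_Idt_simp [simp]: "[|X : Obj C; Y : Obj C|] ==> tenA M (Idt C X) (Idt C Y) = Idt C (tenO M X Y)"
 by (rule tenA_Idt)

lemma tenA_merge [simp]:
 assumes "f : Arr C" "f' : Arr C" "g : Arr C" "g' : Arr C" "Cod C f = Dom C f'" "Cod C g = Dom C g'"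
 shows "tenA M f' g' ** tenA M f g = tenA M (f' ** f) (g' ** g)"
 using tenA_Comp[of f "Dom C f" "Cod C f" f' "Cod C f'" g "Dom C g" "Cod C g" g' "Cod C g'"] assms
 by (auto simp: Hom_iff)

lemma tenA_merge' [simp]:
 assumes "f : Arr C" "f' : Arr C" "g : Arr C" "g' : Arr C" "Cod C f = Dom C f'" "Cod C g = Dom C g'"
  "x : Arr C" "Cod C x = tenO M (Dom C f) (Dom C g)"
 shows "tenA M f' g' ** (tenA M f g ** x) = tenA M (f' ** f) (g' ** g) ** x"
 using assms Comp_reassoc[OF tenA_merge[OF assms(1-6)], of x] by simp

lemma unit_simps [simp]:
 assumes "X : Obj C"
 shows "lun M X : Arr C" "Dom C (lun M X) = tenO M (unt M) X" "Cod C (lun M X) = X"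
  "run M X : Arr C" "Dom C (run M X) = tenO M X (unt M)" "Cod C (run M X) = X"
 using lun[of X] run[of X] assms by (auto simp: Hom_iff)

lemma swp_simps [simp]:
 assumes "X : Obj C" "Y : Obj C"
 shows "swp M X Y : Arr C" "Dom C (swp M X Y) = tenO M X Y" "Cod C (swp M X Y) = tenO M Y X"
 using swp[of X Y] assms by (auto simp: Hom_iff)

lemma asc_simps [simp]:
 assumes "X : Obj C" "Y : Obj C" "Z : Obj C"
 shows "asc M X Y Z : Arr C" "Dom C (asc M X Y Z) = tenO M (tenO M X Y) Z"
  "Cod C (asc M X Y Z) = tenO M X (tenO M Y Z)"
 using asc[of X Y Z] assms by (auto simp: Hom_iff)

end

context symmetric_abelian_monoidal begin

lemma tenA_Zer [simp]:
 assumes "f : Arr A" "X : Obj A" "Y : Obj A"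
 shows "tenA M (Zer A X Y) f = Zer A (tenO M X (Dom A f)) (tenO M Y (Cod A f))"
  "tenA M f (Zer A X Y) = Zer A (tenO M (Dom A f) X) (tenO M (Cod A f) Y)"
 using Add_self_Zer[of "tenA M (Zer A X Y) f" "tenO M X (Dom A f)" "tenO M Y (Cod A f)"]
  Add_self_Zer[of "tenA M f (Zer A X Y)" "tenO M (Dom A f) X" "tenO M (Cod A f) Y"]
  tenA_Add_left[of "Zer A X Y" X Y "Zer A X Y" f "Dom A f" "Cod A f"]
  tenA_Add_right[of f "Dom A f" "Cod A f" "Zer A X Y" X Y "Zer A X Y"] assms
 by (auto simp: Hom_iff)

lemma tenA_neg [simp]:
 assumes "f : Arr A" "g : Arr A"
 shows "tenA M (neg A f) g = neg A (tenA M f g)" "tenA M f (neg A g) = neg A (tenA M f g)"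
proof -
 show "tenA M (neg A f) g = neg A (tenA M f g)"
  using assms Add_neg[of f "Dom A f" "Cod A f"]
   tenA_Add_left[of f "Dom A f" "Cod A f" "neg A f" g "Dom A g" "Cod A g"]
  by (intro neg_unique[of _ "tenO M (Dom A f) (Dom A g)" "tenO M (Cod A f) (Cod A g)"]) (auto simp: Hom_iff)
 show "tenA M f (neg A g) = neg A (tenA M f g)"
  using assms Add_neg[of g "Dom A g" "Cod A g"]
   tenA_Add_right[of f "Dom A f" "Cod A f" g "Dom A g" "Cod A g" "neg A g"]
  by (intro neg_unique[of _ "tenO M (Dom A f) (Dom A g)" "tenO M (Cod A f) (Cod A g)"]) (auto simp: Hom_iff)
qed

lemma tenA_sgnm [simp]:
 assumes "f : Arr A" "g : Arr A"
 shows "tenA M (sgnm A n f) g = sgnm A n (tenA M f g)" "tenA M f (sgnm A n g) = sgnm A n (tenA M f g)"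
 using assms by (auto simp: sgnm_def)

lemma tenA_Add_simps:
 assumes "f : Arr A" "g : Arr A" "h : Arr A" "Dom A g = Dom A f" "Cod A g = Cod A f"
 shows "tenA M (Add A f g) h = Add A (tenA M f h) (tenA M g h)"
  "tenA M h (Add A f g) = Add A (tenA M h f) (tenA M h g)"
 using assms tenA_Add_left[of f "Dom A f" "Cod A f" g h "Dom A h" "Cod A h"]
  tenA_Add_right[of h "Dom A h" "Cod A h" f "Dom A f" "Cod A f" g] by (auto simp: Hom_iff)

lemma tenA_hsum:
 assumes "X : Obj A" "Y : Obj A" "h : Arr A" "ALL i:I. f i : Arr A & Dom A (f i) = X & Cod A (f i) = Y"
 shows "tenA M (hsum A X Y f I) h = hsum A (tenO M X (Dom A h)) (tenO M Y (Cod A h)) (%i. tenA M (f i) h) I"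
  "tenA M h (hsum A X Y f I) = hsum A (tenO M (Dom A h) X) (tenO M (Cod A h) Y) (%i. tenA M h (f i)) I"
 using assms
  hsum_additive[of X Y "tenO M X (Dom A h)" "tenO M Y (Cod A h)" "%f. tenA M f h" I f]
  hsum_additive[of X Y "tenO M (Dom A h) X" "tenO M (Cod A h) Y" "%f. tenA M h f" I f]
 by (auto simp: tenA_Add_simps Hom_iff)

text \<open>The identity of the tensor product is a tensor product of identities, one of which is
  zero.\<close>

lemma is_zero_tenO: "[|X : Obj A; Y : Obj A; is_zero A X | is_zero A Y|] ==> is_zero A (tenO M X Y)"
 using tenA_Zer[of "Idt A Y" X X] tenA_Zer[of "Idt A X" Y Y] tenA_Idt_simp[of X Y]
 by (auto simp: is_zero_iff simp del: tenA_Idt_simp)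

end

text \<open>Summands are addressed by bidegree, so that the total degree is visibly
  \<open>p + q\<close> and both degrees can be matched by rewriting.\<close>

definition inj2 :: "('o,'a,'z) acat_scheme => ('o,'a) dcpx => int => int => 'a" where
 "inj2 A E p q = dI A (diag E (p + q)) p"

definition prj2 :: "('o,'a,'z) acat_scheme => ('o,'a) dcpx => int => int => 'a" where
 "prj2 A E p q = dP A (diag E (p + q)) p"

lemma diag_add [simp]: "diag E (p + q) p = dob E p q"
 by (simp add: diag_def)

lemma diag_apply: "diag E n p = dob E p (n - p)"
 by (simp add: diag_def)

lemma cob_Tot: "cob (Tot A E) n = dS A (diag E n)"
 by (simp add: Tot_def)

section \<open>The total complex and the category of complexes\<close>

context additive begin

lemma cpx_simps [simp]:
 assumes "is_cpx A C"
 shows "cob C n : Obj A" "cdf C n : Arr A" "Dom A (cdf C n) = cob C n" "Cod A (cdf C n) = cob C (n - 1)"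
  "cdf C (n - 1) ** cdf C n = Zer A (cob C n) (cob C (n - 2))"
 using assms by (auto simp: is_cpx_def Hom_iff)

lemma cpx_simps' [simp]:
 assumes "is_cpx A C" "f : Arr A" "Cod A f = cob C n"
 shows "cdf C (n - 1) ** (cdf C n ** f) = Zer A (Dom A f) (cob C (n - 2))"
 using Comp_reassoc[OF cpx_simps(5)[OF assms(1)], where x = f] assms by simp

text \<open>Here the row may have many nonzero entries; it is enough that only the entry at
  \<open>j0\<close> survives composition with \<open>x\<close>. The associativity isomorphism of
  complexes and the Kuenneth morphism of the simple functor are evaluated in this way.\<close>

lemma dmat_dI_Comp:
 assumes "fam A X" "fam A Y" "!!i j. m i j : Hom A (X i) (Y j)" "x : Hom A W (X i)" "y : Hom A W (Y j0)"
  and "m i j0 ** x = y" "!!j. j ~= j0 ==> m i j ** x = Zer A W (Y j)"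
 shows "dmat A X Y m ** (dI A X i ** x) = dI A Y j0 ** y" (is "_ = ?R")
proof (rule dS_eqI')
 have m: "m i j : Arr A" "Dom A (m i j) = X i" "Cod A (m i j) = Y j" for i j
  using assms(3) by (auto simp: Hom_iff)
 fix j
 have "dP A Y j ** (dmat A X Y m ** (dI A X i ** x)) = (dP A Y j ** (dmat A X Y m ** dI A X i)) ** x"
  using assms(1,2,4) m by (simp add: Hom_iff)
 also have "... = m i j ** x" by (subst dP_dmat_dI) (use assms in auto)
 also have "... = dP A Y j ** ?R"
  using assms by (auto simp: Hom_iff)
 finally show "dP A Y j ** (dmat A X Y m ** (dI A X i ** x)) = dP A Y j ** ?R" .
qed (use assms(1-5) in "auto simp: Hom_iff")

context
 fixes E assumes E: "is_dcpx A E" "!!n. fam A (diag E n)"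
begin

lemma dcpx_simps [simp]:
 "dob E p q : Obj A" "dd1 E p q : Arr A" "Dom A (dd1 E p q) = dob E p q" "Cod A (dd1 E p q) = dob E (p - 1) q"
 "dd2 E p q : Arr A" "Dom A (dd2 E p q) = dob E p q" "Cod A (dd2 E p q) = dob E p (q - 1)"
 "dd1 E (p - 1) q ** dd1 E p q = Zer A (dob E p q) (dob E (p - 2) q)"
 "dd2 E p (q - 1) ** dd2 E p q = Zer A (dob E p q) (dob E p (q - 2))"
 "dd1 E p (q - 1) ** dd2 E p q = dd2 E (p - 1) q ** dd1 E p q"
 using E(1) by (auto simp: is_dcpx_def Hom_iff)

lemma Tot_d_Hom: "cdf (Tot A E) n : Hom A (cob (Tot A E) n) (cob (Tot A E) (n - 1))"
 unfolding Tot_def cpx.simps by (intro dmat_Hom) (auto simp: E(2) Hom_iff diag_apply algebra_simps)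

end

lemma Tot_simps [simp]:
 assumes "is_dcpx A E" "!!n. fam A (diag E n)"
 shows "cob (Tot A E) n : Obj A" "cdf (Tot A E) n : Arr A" "Dom A (cdf (Tot A E) n) = cob (Tot A E) n"
  "Cod A (cdf (Tot A E) n) = cob (Tot A E) (n - 1)"
 using Tot_d_Hom[OF assms, of n] assms(2) by (auto simp: Hom_iff Tot_def)

lemma inj2_simps [simp]:
 assumes "!!n. fam A (diag E n)"
 shows "inj2 A E p q : Arr A" "Dom A (inj2 A E p q) = dob E p q" "Cod A (inj2 A E p q) = cob (Tot A E) (p + q)"
  "prj2 A E p q : Arr A" "Dom A (prj2 A E p q) = cob (Tot A E) (p + q)" "Cod A (prj2 A E p q) = dob E p q"
 using assms[of "p + q"] by (simp_all add: inj2_def prj2_def cob_Tot)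

lemma prj2_inj2:
 assumes "!!n. fam A (diag E n)" "p + q = p' + q'"
 shows "prj2 A E p' q' ** inj2 A E p q = (if p = p' then Idt A (dob E p q) else Zer A (dob E p q) (dob E p' q'))"
proof -
 have "diag E (p + q) p' = dob E p' q'" using assms(2) by (simp add: diag_apply)
 then show ?thesis
  using dsum_simps(9)[OF assms(1)[of "p + q"], of p' p] unfolding inj2_def prj2_def assms(2)[symmetric]
  by simp
qed

lemma Tot_eqI:
 assumes "!!n. fam A (diag E n)" "f : Hom A (cob (Tot A E) n) Z" "g : Hom A (cob (Tot A E) n) Z"
  and "!!p q. p + q = n ==> f ** inj2 A E p q = g ** inj2 A E p q"
 shows "f = g"
proof (rule dS_eqI[OF assms(1)[of n]])
 fix p show "f ** dI A (diag E n) p = g ** dI A (diag E n) p"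
  using assms(4)[of p "n - p"] by (simp add: inj2_def)
qed (use assms in "auto simp: cob_Tot")

lemma Tot_d_inj2:
 assumes "is_dcpx A E" "!!n. fam A (diag E n)"
 shows "cdf (Tot A E) (p + q) ** inj2 A E p q =
  Add A (inj2 A E (p - 1) q ** dd1 E p q) (sgnm A p (inj2 A E p (q - 1) ** dd2 E p q))"
proof -
 let ?t1 = "p + q - 1"
 let ?t2 = "diag E (p + q) p"
 note [simp] = dcpx_simps[OF assms]
 let ?m = "%i p'. if p' = i - 1 then dd1 E i (p + q - i)
    else if p' = i then sgnm A i (dd2 E i (p + q - i))
    else Zer A (diag E (p + q) i) (diag E ?t1 p')"
 have m: "?m i j : Hom A (diag E (p + q) i) (diag E ?t1 j)" for i j
  using assms by (auto simp: Hom_iff diag_apply algebra_simps)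
 have e: "p + q - 1 - p = q - 1" "p - 1 + q = p + q - 1" "p + (q - 1) = p + q - 1" by arith+
 have m': "?m p (p - 1) : Hom A ?t2 (diag E ?t1 (p - 1))"
  "?m p p : Hom A ?t2 (diag E ?t1 p)" using m by blast+
 have "cdf (Tot A E) (p + q) ** inj2 A E p q = hsum A ?t2 (dS A (diag E ?t1))
   (%j. dI A (diag E ?t1) j ** ?m p j) {p - 1, p}"
  unfolding Tot_def inj2_def cpx.simps by (rule dmat_dI) (use assms(2) m in auto)
 also have "... = Add A (dI A (diag E ?t1) (p - 1) ** ?m p (p - 1)) (dI A (diag E ?t1) p ** ?m p p)"
  using m' assms(2) by (subst hsum_insert) (auto simp: Hom_iff)
 also have "... = Add A (inj2 A E (p - 1) q ** dd1 E p q) (sgnm A p (inj2 A E p (q - 1) ** dd2 E p q))"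
  using assms(2) by (simp add: inj2_def e diag_apply)
 finally show ?thesis .
qed

lemma Tot_d_inj2':
 assumes "is_dcpx A E" "!!n. fam A (diag E n)" "f : Arr A" "Cod A f = dob E p q"
 shows "cdf (Tot A E) (p + q) ** (inj2 A E p q ** f) =
  Add A (inj2 A E (p - 1) q ** (dd1 E p q ** f)) (sgnm A p (inj2 A E p (q - 1) ** (dd2 E p q ** f)))"
 using Comp_reassoc[OF Tot_d_inj2[OF assms(1,2)], where x = f] assms
 by (simp add: Add_Comp_simp dcpx_simps[OF assms(1,2)] diff_add_eq add_diff_eq)

text \<open>The squares of the two differentials vanish, and the two mixed composites agree up to
  the signs with exponents \<open>p - 1\<close> and \<open>p\<close>, so they cancel.\<close>

lemma is_cpx_Tot:
 assumes "is_dcpx A E" "!!n. fam A (diag E n)"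
 shows "is_cpx A (Tot A E)"
proof -
 note [simp] = dcpx_simps[OF assms]
 have "cdf (Tot A E) (n - 1) ** cdf (Tot A E) n = Zer A (cob (Tot A E) n) (cob (Tot A E) (n - 2))" for n
 proof (rule Tot_eqI[OF assms(2)])
  fix p q assume n: "p + q = n"
  let ?x = "inj2 A E (p - 1) (q - 1) ** (dd1 E p (q - 1) ** dd2 E p q)"
  have a: "cdf (Tot A E) (n - 1) ** (inj2 A E (p - 1) q ** dd1 E p q)
    = Add A (inj2 A E (p - 2) q ** (dd1 E (p - 1) q ** dd1 E p q))
    (sgnm A (p - 1) (inj2 A E (p - 1) (q - 1) ** (dd2 E (p - 1) q ** dd1 E p q)))"
   using Tot_d_inj2'[OF assms, of "dd1 E p q" "p - 1" q] n by (simp add: diff_add_eq)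
  have b: "cdf (Tot A E) (n - 1) ** (inj2 A E p (q - 1) ** dd2 E p q)
    = Add A (inj2 A E (p - 1) (q - 1) ** (dd1 E p (q - 1) ** dd2 E p q))
    (sgnm A p (inj2 A E p (q - 2) ** (dd2 E p (q - 1) ** dd2 E p q)))"
   using Tot_d_inj2'[OF assms, of "dd2 E p q" p "q - 1"] n by (simp add: add_diff_eq)
  have ix: "p - 1 + (q - 1) = n - 2" "p - 2 + q = n - 2" "p + (q - 2) = n - 2" "p + (q - 1) = n - 1" "p - 1 + q = n - 1"
   using n by arith+
  have h: "inj2 A E (p - 1) (q - 1) ** (dd2 E (p - 1) q ** dd1 E p q) : Hom A (dob E p q) (cob (Tot A E) (n - 2))"
   using assms(2) by (simp add: Hom_iff ix)
  have "cdf (Tot A E) (n - 1) ** (cdf (Tot A E) n ** inj2 A E p q)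
    = Add A (cdf (Tot A E) (n - 1) ** (inj2 A E (p - 1) q ** dd1 E p q))
    (sgnm A p (cdf (Tot A E) (n - 1) ** (inj2 A E p (q - 1) ** dd2 E p q)))"
   using Tot_d_inj2[OF assms, of p q] assms n by (simp add: Comp_Add_simp ix)
  also have "... = Add A (sgnm A (p - 1) (inj2 A E (p - 1) (q - 1) ** (dd2 E (p - 1) q ** dd1 E p q)))
    (sgnm A p (inj2 A E (p - 1) (q - 1) ** (dd2 E (p - 1) q ** dd1 E p q)))"
   unfolding a b using assms by (simp add: ix)
  also have "... = Zer A (dob E p q) (cob (Tot A E) (n - 2))"
   by (rule Add_sgnm_cancel[OF h]) simp
  finally show "(cdf (Tot A E) (n - 1) ** cdf (Tot A E) n) ** inj2 A E p q
    = Zer A (cob (Tot A E) n) (cob (Tot A E) (n - 2)) ** inj2 A E p q"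
   using assms n by simp
 qed (simp_all add: Hom_iff Tot_simps[OF assms])
 then show ?thesis
  unfolding is_cpx_def using Tot_simps(1)[OF assms] Tot_d_Hom[OF assms] by blast
qed

lemma is_zero_dS:
 assumes "fam A X" "!!i. is_zero A (X i)" shows "is_zero A (dS A X)"
proof -
 have "supp A X = {}" using assms(2) by (simp add: supp_def)
 then show ?thesis using Idt_dS[OF assms(1)] assms(1) by (simp add: is_zero_iff)
qed

text \<open>On the line of total degree \<open>n\<close> the two bounds confine \<open>p\<close> to
  the interval from \<open>a\<close> to \<open>n - b\<close>.\<close>

lemma fam_diag:
 assumes "!!p q. dob E p q : Obj A" "!!p q. p < a | q < b ==> is_zero A (dob E p q)"
 shows "fam A (diag E n)"
proof -
 have "p \<in> {a..n - b}" if "p \<in> supp A (diag E n)" for p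
  using assms(2)[of p "n - p"] that by (force simp: supp_def diag_apply)
 then have "supp A (diag E n) \<subseteq> {a..n - b}" by blast
 from finite_subset[OF this] show ?thesis using assms(1) by (auto simp: fam_def diag_apply)
qed

lemma is_zero_Tot:
 assumes "!!n. fam A (diag E n)" "!!p q. p < a | q < b ==> is_zero A (dob E p q)" "n < a + b"
 shows "is_zero A (cob (Tot A E) n)"
 unfolding cob_Tot using assms(1)
proof (rule is_zero_dS)
 fix p have "p < a | n - p < b" using assms(3) by arith
 then show "is_zero A (diag E n p)" by (auto simp: diag_apply intro: assms(2))
qed

lemma Obj_Ch: "C : Obj (Ch A) \<longleftrightarrow> is_cpx A C & bounded_below A C"
 by (simp add: Ch_def)

lemma Arr_Ch: "f : Arr (Ch A) \<longleftrightarrow> mdom f : Obj (Ch A) & mcod f : Obj (Ch A) &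
  (ALL n. mcomp f n : Hom A (cob (mdom f) n) (cob (mcod f) n)) &
  (ALL n. cdf (mcod f) n ** mcomp f n = mcomp f (n - 1) ** cdf (mdom f) n)"
 by (auto simp: Ch_def)

lemma Dom_Ch [simp]: "Dom (Ch A) = mdom" and Cod_Ch [simp]: "Cod (Ch A) = mcod"
 and Comp_Ch [simp]: "mdom (g **\<^bsub>Ch A\<^esub> f) = mdom f" "mcod (g **\<^bsub>Ch A\<^esub> f) = mcod g"
  "mcomp (g **\<^bsub>Ch A\<^esub> f) n = mcomp g n ** mcomp f n"
 and Idt_Ch [simp]: "mdom (Idt (Ch A) C) = C" "mcod (Idt (Ch A) C) = C" "mcomp (Idt (Ch A) C) n = Idt A (cob C n)"
 by (simp_all add: Ch_def)

lemma Hom_Ch: "f : Hom (Ch A) C D \<longleftrightarrow> C : Obj (Ch A) & D : Obj (Ch A) & mdom f = C & mcod f = D &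
  (ALL n. mcomp f n : Hom A (cob C n) (cob D n)) & (ALL n. cdf D n ** mcomp f n = mcomp f (n - 1) ** cdf C n)"
 by (auto simp: Hom_iff[of f "Ch A"] Arr_Ch)

lemma mcomp_simps [simp]:
 assumes "f : Arr (Ch A)"
 shows "mcomp f n : Arr A" "Dom A (mcomp f n) = cob (mdom f) n" "Cod A (mcomp f n) = cob (mcod f) n"
  "mdom f : Obj (Ch A)" "mcod f : Obj (Ch A)"
 using assms by (auto simp: Arr_Ch Hom_iff)

lemma Obj_Ch_simps [simp]:
 assumes "C : Obj (Ch A)"
 shows "is_cpx A C" "cob C n : Obj A" "cdf C n : Arr A" "Dom A (cdf C n) = cob C n" "Cod A (cdf C n) = cob C (n - 1)"
 using assms by (auto simp: Obj_Ch)

lemma cmap_eqI: "[|mdom f = mdom g; mcod f = mcod g; !!n. mcomp f n = mcomp g n|] ==> f = (g :: ('o,'a) cmap)"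
 by (rule cmap.equality) auto

lemma category_Ch: "category (Ch A)"
proof
 fix f X Y g Z assume f: "f : Hom (Ch A) X Y" and g: "g : Hom (Ch A) Y Z"
 have F: "mcomp f n : Hom A (cob X n) (cob Y n)" "cdf Y n ** mcomp f n = mcomp f (n - 1) ** cdf X n"
  "X : Obj (Ch A)" "Y : Obj (Ch A)" for n
  using f unfolding Hom_Ch by blast+
 have G: "mcomp g n : Hom A (cob Y n) (cob Z n)" "cdf Z n ** mcomp g n = mcomp g (n - 1) ** cdf Y n"
  "Z : Obj (Ch A)" for n
  using g unfolding Hom_Ch by blast+
 have d: "cdf X n : Hom A (cob X n) (cob X (n - 1))" "cdf Y n : Hom A (cob Y n) (cob Y (n - 1))"
  "cdf Z n : Hom A (cob Z n) (cob Z (n - 1))" for n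
  using F(3,4) G(3) by (simp_all add: Hom_iff)
 have "cdf Z n ** (mcomp g n ** mcomp f n) = (mcomp g (n - 1) ** mcomp f (n - 1)) ** cdf X n" for n
  using Comp_assoc[OF F(1) G(1) d(3), of n] Comp_assoc[OF F(1) d(2) G(1)[of "n - 1"]]
   Comp_assoc[OF d(1)[of n] F(1) G(1)] by (simp only: F(2) G(2))
 then show "g **\<^bsub>Ch A\<^esub> f : Hom (Ch A) X Z"
  unfolding Hom_Ch using f g Comp_Hom[OF F(1) G(1)] F(3) G(3) by (simp add: Hom_iff)
next
 fix f W X g Y h Z assume "f : Hom (Ch A) W X" "g : Hom (Ch A) X Y" "h : Hom (Ch A) Y Z"
 then show "(h **\<^bsub>Ch A\<^esub> g) **\<^bsub>Ch A\<^esub> f = h **\<^bsub>Ch A\<^esub> (g **\<^bsub>Ch A\<^esub> f)"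
  by (intro cmap_eqI) (auto simp: Hom_Ch intro!: Comp_assoc)
next
 fix X assume "X : Obj (Ch A)"
 then show "Idt (Ch A) X : Hom (Ch A) X X"
  unfolding Hom_Ch by (simp add: Idt_Hom)
next
 fix f X Y assume "f : Hom (Ch A) X Y"
 then have h: "mdom f = X" "mcod f = Y" "mcomp f n : Hom A (cob X n) (cob Y n)" for n
  unfolding Hom_Ch by blast+
 show "f **\<^bsub>Ch A\<^esub> Idt (Ch A) X = f" "Idt (Ch A) Y **\<^bsub>Ch A\<^esub> f = f"
  by (intro cmap_eqI; simp add: h Comp_Idt[OF h(3)] Idt_Comp[OF h(3)])+
qed simp_all

end

section \<open>Lax symmetric monoidal functors in components\<close>

abbreviation tin :: "('o,'a,'z) acat_scheme => ('o,'a) mon => ('o,'a) cpx => ('o,'a) cpx => int => int => 'a" where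
 "tin A M C D \<equiv> inj2 A (tens_d A M C D)"

lemma tens_d_simps [simp]:
 "dob (tens_d A M C D) p q = tenO M (cob C p) (cob D q)"
 "dd1 (tens_d A M C D) p q = tenA M (cdf C p) (Idt A (cob D q))"
 "dd2 (tens_d A M C D) p q = tenA M (Idt A (cob C p)) (cdf D q)"
 by (simp_all add: tens_d_def)

lemma tens_in_eq: "tens_in A M C D (i + j) i = tin A M C D i j"
 by (simp add: tens_in_def inj2_def)

lemma ChM_simps [simp]:
 "tenO (ChM A M) = tens A M" "unt (ChM A M) = conc_cpx A (unt M)"
 "mdom (tenA (ChM A M) f g) = tens A M (mdom f) (mdom g)" "mcod (tenA (ChM A M) f g) = tens A M (mcod f) (mcod g)"
 "mdom (asc (ChM A M) C D E) = tens A M (tens A M C D) E" "mcod (asc (ChM A M) C D E) = tens A M C (tens A M D E)"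
 "mdom (lun (ChM A M) C) = tens A M (conc_cpx A (unt M)) C" "mcod (lun (ChM A M) C) = C"
 "mdom (run (ChM A M) C) = tens A M C (conc_cpx A (unt M))" "mcod (run (ChM A M) C) = C"
 "mdom (swp (ChM A M) C D) = tens A M C D" "mcod (swp (ChM A M) C D) = tens A M D C"
 by (simp_all add: ChM_def)

lemma int_diff_diff: "(n::int) - p - (m - p) = n - m"
 by simp

context additive begin

lemma conc_cpx_Obj [simp]: "X : Obj A ==> conc_cpx A X : Obj (Ch A)"
 using zero_obj unfolding Obj_Ch is_cpx_def bounded_below_def conc_cpx_def
 by (auto simp: Let_def Hom_iff)

lemma cob_conc_cpx: "cob (conc_cpx A X) n = (if n = 0 then X else zero_obj A)"
 by (simp add: conc_cpx_def Let_def)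

end

section \<open>The tensor product of complexes on its summands\<close>

context symmetric_abelian_monoidal begin

context
 fixes C D assumes CD: "C : Obj (Ch A)" "D : Obj (Ch A)"
begin

lemma tens_dcpx: "is_dcpx A (tens_d A M C D)"
 unfolding is_dcpx_def using CD by (auto simp: Hom_iff)

lemma tens_bound:
 obtains a b where "!!p q. p < a | q < b ==> is_zero A (dob (tens_d A M C D) p q)"
proof -
 obtain a b where "ALL n<a. is_zero A (cob C n)" "ALL n<b. is_zero A (cob D n)"
  using CD by (auto simp: Obj_Ch bounded_below_def)
 then have "is_zero A (tenO M (cob C p) (cob D q))" if "p < a | q < b" for p q
  using that CD is_zero_tenO[of "cob C p" "cob D q"] by auto
 then show ?thesis using that[of a b] by simp
qed

lemma tens_fam: "fam A (diag (tens_d A M C D) n)"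
 using tens_bound CD by (metis fam_diag Obj_Ch_simps(2) tenO_Obj tens_d_simps(1))

lemma tens_Obj: "tens A M C D : Obj (Ch A)"
 unfolding Obj_Ch
proof
 show "is_cpx A (tens A M C D)" by (rule is_cpx_Tot[OF tens_dcpx tens_fam])
 obtain a b where "!!p q. p < a | q < b ==> is_zero A (dob (tens_d A M C D) p q)"
  using tens_bound by blast
 then show "bounded_below A (tens A M C D)"
  unfolding bounded_below_def using is_zero_Tot[OF tens_fam] by blast
qed

end

declare tens_Obj [simp]

lemma tin_simps [simp]:
 assumes "C : Obj (Ch A)" "D : Obj (Ch A)"
 shows "tin A M C D i j : Arr A" "Dom A (tin A M C D i j) = tenO M (cob C i) (cob D j)"
  "Cod A (tin A M C D i j) = cob (tens A M C D) (i + j)"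
 using inj2_simps[OF tens_fam[OF assms], of i j] by simp_all

lemma tens_eqI:
 assumes "C : Obj (Ch A)" "D : Obj (Ch A)"
  "f : Hom A (cob (tens A M C D) n) Z" "g : Hom A (cob (tens A M C D) n) Z"
  and "!!i j. i + j = n ==> f ** tin A M C D i j = g ** tin A M C D i j"
 shows "f = g"
 by (rule Tot_eqI[OF tens_fam]) (use assms in auto)

lemma tens_d_tin:
 assumes "C : Obj (Ch A)" "D : Obj (Ch A)"
 shows "cdf (tens A M C D) (i + j) ** tin A M C D i j =
  Add A (tin A M C D (i - 1) j ** tenA M (cdf C i) (Idt A (cob D j)))
   (sgnm A i (tin A M C D i (j - 1) ** tenA M (Idt A (cob C i)) (cdf D j)))"
 using Tot_d_inj2[OF tens_dcpx tens_fam, of C D] assms by simp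

text \<open>Tensoring with \<open>W\<close> is additive, so the decomposition of the identity of a
  direct sum stays a decomposition after tensoring, and the tensored inclusions still detect
  equality.\<close>

lemma tenO_dS_eqI_left:
 assumes "fam A X" "W : Obj A" "f : Hom A (tenO M (dS A X) W) Z" "g : Hom A (tenO M (dS A X) W) Z"
  and "!!i. f ** tenA M (dI A X i) (Idt A W) = g ** tenA M (dI A X i) (Idt A W)"
 shows "f = g"
proof -
 let ?t1 = "tenO M (dS A X) W"
 have *: "h = hsum A ?t1 Z (%i. (h ** tenA M (dI A X i) (Idt A W)) ** tenA M (dP A X i) (Idt A W)) (supp A X)"
  if "h : Hom A ?t1 Z" for h
 proof -
  have "h = h ** tenA M (Idt A (dS A X)) (Idt A W)" using that assms(1,2) by (auto simp: Hom_iff)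
  also have "... = hsum A ?t1 Z (%i. (h ** tenA M (dI A X i) (Idt A W)) ** tenA M (dP A X i) (Idt A W)) (supp A X)"
   unfolding Idt_dS[OF assms(1)]
   using that assms(1,2) by (simp add: Hom_iff tenA_hsum Comp_hsum)
  finally show ?thesis .
 qed
 show ?thesis using *[OF assms(3)] *[OF assms(4)] assms(5) by simp
qed

lemma tenO_dS_eqI_right:
 assumes "fam A X" "W : Obj A" "f : Hom A (tenO M W (dS A X)) Z" "g : Hom A (tenO M W (dS A X)) Z"
  and "!!i. f ** tenA M (Idt A W) (dI A X i) = g ** tenA M (Idt A W) (dI A X i)"
 shows "f = g"
proof -
 let ?t1 = "tenO M W (dS A X)"
 have *: "h = hsum A ?t1 Z (%i. (h ** tenA M (Idt A W) (dI A X i)) ** tenA M (Idt A W) (dP A X i)) (supp A X)"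
  if "h : Hom A ?t1 Z" for h
 proof -
  have "h = h ** tenA M (Idt A W) (Idt A (dS A X))" using that assms(1,2) by (auto simp: Hom_iff)
  also have "... = hsum A ?t1 Z (%i. (h ** tenA M (Idt A W) (dI A X i)) ** tenA M (Idt A W) (dP A X i)) (supp A X)"
   unfolding Idt_dS[OF assms(1)]
   using that assms(1,2) by (simp add: Hom_iff tenA_hsum Comp_hsum)
  finally show ?thesis .
 qed
 show ?thesis using *[OF assms(3)] *[OF assms(4)] assms(5) by simp
qed

lemma tens_eqI3:
 assumes "C : Obj (Ch A)" "D : Obj (Ch A)" "E : Obj (Ch A)"
  "f : Hom A (cob (tens A M (tens A M C D) E) n) Z" "g : Hom A (cob (tens A M (tens A M C D) E) n) Z"
  and *: "!!i j k. i + j + k = n ==>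
   f ** (tin A M (tens A M C D) E (i + j) k ** tenA M (tin A M C D i j) (Idt A (cob E k))) =
   g ** (tin A M (tens A M C D) E (i + j) k ** tenA M (tin A M C D i j) (Idt A (cob E k)))"
 shows "f = g"
proof (rule tens_eqI[OF tens_Obj assms(3-5)])
 fix m k assume n: "m + k = n"
 let ?t1 = "diag (tens_d A M C D) m"
 let ?h = "%f. f ** tin A M (tens A M C D) E m k"
 have h: "?h f : Hom A (tenO M (dS A ?t1) (cob E k)) Z" if "f = f | f = g"
  "f : Hom A (cob (tens A M (tens A M C D) E) n) Z" for f
  using that assms n by (auto simp: Hom_iff cob_Tot)
 show "?h f = ?h g"
 proof (rule tenO_dS_eqI_left[OF tens_fam[OF assms(1,2)]])
  fix i
  have "dI A ?t1 i = tin A M C D i (m - i)" by (simp add: inj2_def)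
  then show "?h f ** tenA M (dI A ?t1 i) (Idt A (cob E k)) =
    ?h g ** tenA M (dI A ?t1 i) (Idt A (cob E k))"
   using *[of i "m - i" k] n assms(1-5) by (simp add: Hom_iff cob_Tot[symmetric])
 qed (use assms h in auto)
qed (use assms in auto)

lemma tenA_Ch:
 assumes "f : Arr (Ch A)" "g : Arr (Ch A)"
 shows "mcomp (tenA (ChM A M) f g) n : Hom A (cob (tens A M (mdom f) (mdom g)) n) (cob (tens A M (mcod f) (mcod g)) n)"
  "mcomp (tenA (ChM A M) f g) (i + j) ** tin A M (mdom f) (mdom g) i j =
   tin A M (mcod f) (mcod g) i j ** tenA M (mcomp f i) (mcomp g j)"
proof -
 let ?t1 = "tenA (ChM A M) f g"
 let ?X = "%n. diag (tens_d A M (mdom f) (mdom g)) n"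
 let ?Y = "%n. diag (tens_d A M (mcod f) (mcod g)) n"
 let ?m = "%n p p'. if p' = p then tenA M (mcomp f p) (mcomp g (n - p)) else Zer A (?X n p) (?Y n p')"
 have e: "mcomp ?t1 n = dmat A (?X n) (?Y n) (?m n)" for n
  by (simp add: ChM_def Let_def)
 have fam: "fam A (?X n)" "fam A (?Y n)" for n using assms tens_fam by simp_all
 have m: "?m n p p' : Hom A (?X n p) (?Y n p')" for n p p'
  using assms by (simp add: Hom_iff diag_apply)
 show "mcomp ?t1 n : Hom A (cob (tens A M (mdom f) (mdom g)) n) (cob (tens A M (mcod f) (mcod g)) n)"
  unfolding e cob_Tot by (rule dmat_Hom[OF fam m])
 have "dmat A (?X (i + j)) (?Y (i + j)) (?m (i + j)) ** dI A (?X (i + j)) i = dI A (?Y (i + j)) i ** ?m (i + j) i i"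
  by (rule dmat_dI_single[OF fam m]) simp
 then show "mcomp ?t1 (i + j) ** tin A M (mdom f) (mdom g) i j =
   tin A M (mcod f) (mcod g) i j ** tenA M (mcomp f i) (mcomp g j)"
  unfolding e inj2_def by simp
qed

text \<open>The matrix row with index \<open>i + j\<close> has an entry for every \<open>p\<close>,
  because it starts from the whole of the tensor complex in that degree. The inclusion of bidegree
  \<open>i\<close>, \<open>j\<close> followed by the projection onto index \<open>p\<close> is zero
  unless \<open>p = i\<close>.\<close>

lemma asc_Ch:
 assumes "C : Obj (Ch A)" "D : Obj (Ch A)" "E : Obj (Ch A)"
 shows "mcomp (asc (ChM A M) C D E) n : Hom A (cob (tens A M (tens A M C D) E) n) (cob (tens A M C (tens A M D E)) n)"
  "mcomp (asc (ChM A M) C D E) (i + j + k) **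
    (tin A M (tens A M C D) E (i + j) k ** tenA M (tin A M C D i j) (Idt A (cob E k)))
   = tin A M C (tens A M D E) i (j + k) ** (tenA M (Idt A (cob C i)) (tin A M D E j k) ** asc M (cob C i) (cob D j) (cob E k))"
proof -
 let ?t1 = "tenA M (Idt A (cob C i)) (tin A M D E j k) ** asc M (cob C i) (cob D j) (cob E k)"
 let ?t2 = "tenO M (cob C i) (cob D j)"
 let ?t3 = "i + j + k"
 let ?t4 = "tens A M C D"
 let ?t5 = "tens A M D E"
 let ?t6 = "tin A M C D i j"
 let ?X = "%n. diag (tens_d A M ?t4 E) n"
 let ?Y = "%n. diag (tens_d A M C ?t5) n"
 let ?m = "%n m p. tenA M (Idt A (cob C p)) (tens_in A M D E (n - p) (m - p))
    ** asc M (cob C p) (cob D (m - p)) (cob E (n - m))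
    ** tenA M (tens_pr A M C D m p) (Idt A (cob E (n - m)))"
 have e: "mcomp (asc (ChM A M) C D E) n = dmat A (?X n) (?Y n) (?m n)" for n
  by (simp add: ChM_def Let_def)
 have fam: "fam A (?X n)" "fam A (?Y n)" for n using assms tens_fam by simp_all
 have ti: "tens_in A M D E (n - p) (m - p) : Hom A (tenO M (cob D (m - p)) (cob E (n - m))) (cob ?t5 (n - p))" for n m p
  using tens_fam[OF assms(2,3), of "n - p"] by (simp add: Hom_iff tens_in_def cob_Tot diag_apply int_diff_diff)
 have tp: "tens_pr A M C D m p : Hom A (cob ?t4 m) (tenO M (cob C p) (cob D (m - p)))" for m p
  using tens_fam[OF assms(1,2), of m] by (simp add: Hom_iff tens_pr_def cob_Tot diag_apply)
 have m: "?m n p p' : Hom A (?X n p) (?Y n p')" for n p p'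
  using assms ti[of n p' p] tp[of p p'] by (simp add: Hom_iff diag_apply)
 show "mcomp (asc (ChM A M) C D E) n : Hom A (cob (tens A M ?t4 E) n) (cob (tens A M C ?t5) n)"
  unfolding e cob_Tot by (rule dmat_Hom[OF fam m])
 have ix: "i + j + k - (i + j) = k" "i + j + k - i = j + k" "i + j - i = j" by arith+
 have pt: "tens_pr A M C D (i + j) p ** tin A M C D i j
   = (if p = i then Idt A ?t2 else Zer A ?t2 (tenO M (cob C p) (cob D (i + j - p))))" for p
  using tens_fam[OF assms(1,2), of "i + j"] by (simp add: tens_pr_def inj2_def diag_apply)
 have "dmat A (?X ?t3) (?Y ?t3) (?m ?t3) ** (dI A (?X ?t3) (i + j) ** tenA M ?t6 (Idt A (cob E k)))
  = dI A (?Y ?t3) i ** ?t1"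
 proof (rule dmat_dI_Comp[OF fam m, where W = "tenO M ?t2 (cob E k)"])
  show "?m ?t3 (i + j) i ** tenA M ?t6 (Idt A (cob E k))
   = tenA M (Idt A (cob C i)) (tin A M D E j k) ** asc M (cob C i) (cob D j) (cob E k)"
   using assms tp[of "i + j" i] ti[of "i + j + k" i "i + j"] pt[of i]
   by (simp add: Hom_iff ix tens_in_eq)
  fix p assume "p ~= i"
  then show "?m ?t3 (i + j) p ** tenA M ?t6 (Idt A (cob E k))
   = Zer A (tenO M ?t2 (cob E k)) (?Y ?t3 p)"
   using assms tp[of "i + j" p] ti[of "i + j + k" p "i + j"] pt[of p]
   by (simp add: Hom_iff ix(1) diag_apply)
 qed (use assms in "simp_all add: Hom_iff diag_apply ix")
 then show "mcomp (asc (ChM A M) C D E) ?t3 **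
    (tin A M ?t4 E (i + j) k ** tenA M ?t6 (Idt A (cob E k)))
   = tin A M C ?t5 i (j + k) ** ?t1"
  unfolding e by (simp add: inj2_def[of A "tens_d A M ?t4 E"] inj2_def[of A "tens_d A M C ?t5"] add.assoc)
qed

lemma lun_Ch:
 assumes "C : Obj (Ch A)"
 shows "mcomp (lun (ChM A M) C) n : Hom A (cob (tens A M (conc_cpx A (unt M)) C) n) (cob C n)"
  "mcomp (lun (ChM A M) C) n ** tin A M (conc_cpx A (unt M)) C 0 n = lun M (cob C n)"
  "mcomp (run (ChM A M) C) n : Hom A (cob (tens A M C (conc_cpx A (unt M))) n) (cob C n)"
  "mcomp (run (ChM A M) C) n ** tin A M C (conc_cpx A (unt M)) n 0 = run M (cob C n)"
proof -
 let ?t1 = "conc_cpx A (unt M)"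
 let ?t2 = "run (ChM A M) C"
 let ?t3 = "lun (ChM A M) C"
 let ?u = "conc_cpx A (unt M)"
 have u: "?u : Obj (Ch A)" "cob ?u 0 = unt M" by (simp_all add: cob_conc_cpx)
 have e: "mcomp ?t3 n = lun M (cob C n) ** prj2 A (tens_d A M ?u C) 0 n"
  "mcomp ?t2 n = run M (cob C n) ** prj2 A (tens_d A M C ?u) n 0"
  by (simp_all add: ChM_def tens_pr_def prj2_def)
 note p = inj2_simps[OF tens_fam[OF u(1) assms], of 0 n] inj2_simps[OF tens_fam[OF assms u(1)], of n 0]
  prj2_inj2[OF tens_fam[OF u(1) assms], of 0 n 0 n] prj2_inj2[OF tens_fam[OF assms u(1)], of n 0 n 0]
 show "mcomp ?t3 n : Hom A (cob (tens A M ?t1 C) n) (cob C n)"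
  "mcomp ?t3 n ** tin A M ?t1 C 0 n = lun M (cob C n)"
  "mcomp ?t2 n : Hom A (cob (tens A M C ?t1) n) (cob C n)"
  "mcomp ?t2 n ** tin A M C ?t1 n 0 = run M (cob C n)"
  unfolding e using p u assms by (simp_all add: Hom_iff)
qed

lemma swp_Ch:
 assumes "C : Obj (Ch A)" "D : Obj (Ch A)"
 shows "mcomp (swp (ChM A M) C D) n : Hom A (cob (tens A M C D) n) (cob (tens A M D C) n)"
  "mcomp (swp (ChM A M) C D) (i + j) ** tin A M C D i j = tin A M D C j i ** sgnm A (i * j) (swp M (cob C i) (cob D j))"
proof -
 let ?t1 = "swp (ChM A M) C D"
 let ?X = "%n. diag (tens_d A M C D) n"
 let ?Y = "%n. diag (tens_d A M D C) n"
 let ?m = "%n p q. if q = n - p then sgnm A (p * q) (swp M (cob C p) (cob D q)) else Zer A (?X n p) (?Y n q)"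
 have e: "mcomp ?t1 n = dmat A (?X n) (?Y n) (?m n)" for n
  by (simp add: ChM_def Let_def)
 have fam: "fam A (?X n)" "fam A (?Y n)" for n using assms tens_fam by simp_all
 have m: "?m n p q : Hom A (?X n p) (?Y n q)" for n p q
  using assms by (simp add: Hom_iff diag_apply)
 show "mcomp ?t1 n : Hom A (cob (tens A M C D) n) (cob (tens A M D C) n)"
  unfolding e cob_Tot by (rule dmat_Hom[OF fam m])
 have "dmat A (?X (i + j)) (?Y (i + j)) (?m (i + j)) ** dI A (?X (i + j)) i = dI A (?Y (i + j)) j ** ?m (i + j) i j"
  by (rule dmat_dI_single[OF fam m]) simp
 then show "mcomp ?t1 (i + j) ** tin A M C D i j = tin A M D C j i ** sgnm A (i * j) (swp M (cob C i) (cob D j))"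
  unfolding e inj2_def by (simp add: add.commute)
qed

text \<open>The inclusions of the summands are jointly epimorphic, so the chain map condition turns
  into a Leibniz rule in each bidegree.\<close>

lemma tens_map_chain_iff:
 assumes "C : Obj (Ch A)" "D : Obj (Ch A)" "E : Obj (Ch A)"
  and g: "!!n. g n : Hom A (cob (tens A M C D) n) (cob E n)"
 shows "(ALL n. cdf E n ** g n = g (n - 1) ** cdf (tens A M C D) n) \<longleftrightarrow>
  (ALL i j. cdf E (i + j) ** (g (i + j) ** tin A M C D i j) =
   Add A ((g (i - 1 + j) ** tin A M C D (i - 1) j) ** tenA M (cdf C i) (Idt A (cob D j)))
    (sgnm A i ((g (i + (j - 1)) ** tin A M C D i (j - 1)) ** tenA M (Idt A (cob C i)) (cdf D j))))"
proof -
 let ?t1 = "tens A M C D"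
 have g': "g n : Arr A" "Dom A (g n) = cob ?t1 n" "Cod A (g n) = cob E n" for n
  using g[of n] by (auto simp: Hom_iff)
 have *: "(g (i + j - 1) ** cdf ?t1 (i + j)) ** tin A M C D i j =
   Add A ((g (i - 1 + j) ** tin A M C D (i - 1) j) ** tenA M (cdf C i) (Idt A (cob D j)))
    (sgnm A i ((g (i + (j - 1)) ** tin A M C D i (j - 1)) ** tenA M (Idt A (cob C i)) (cdf D j)))" for i j
  using assms(1-3) g' by (simp add: tens_d_tin Comp_Add_simp add_diff_eq diff_add_eq)
 have "(ALL n. cdf E n ** g n = g (n - 1) ** cdf ?t1 n) \<longleftrightarrow>
   (ALL i j. (cdf E (i + j) ** g (i + j)) ** tin A M C D i j = (g (i + j - 1) ** cdf ?t1 (i + j)) ** tin A M C D i j)"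
 proof safe
  fix n assume a: "ALL i j. (cdf E (i + j) ** g (i + j)) ** tin A M C D i j = (g (i + j - 1) ** cdf ?t1 (i + j)) ** tin A M C D i j"
  show "cdf E n ** g n = g (n - 1) ** cdf ?t1 n"
   by (rule tens_eqI[OF assms(1,2), where n = n and Z = "cob E (n - 1)"])
    (use a assms g' in "auto simp: Hom_iff")
 qed simp
 then show ?thesis
  unfolding * using assms(1-3) g' by simp
qed

end

text \<open>The part of the Kuenneth morphism in bidegree \<open>i\<close>, \<open>j\<close>. In
  terms of these arrows all monoidal laws are equations in \<open>A\<close>, where signs come only
  from the tensor differential and from the commutativity isomorphism.\<close>

definition kc :: "('p,'b,'z) acat_scheme => ('p,'b) mon => ('o,'a,('p,'b) cpx,('p,'b) cmap) smf =>
  'o => 'o => int => int => 'b" where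
 "kc A MA F X Y i j = mcomp (kap F X Y) (i + j) **\<^bsub>A\<^esub> tin A MA (fo (sfun F) X) (fo (sfun F) Y) i j"

locale monoidal_functors = C: symmetric_monoidal C MC + symmetric_abelian_monoidal A MA
 for C :: "('o,'a,'y) cat_scheme" and MC and A :: "('p,'b,'z) acat_scheme" (structure) and MA
begin

lemma functor_Ch_simps:
 assumes "is_functor C (Ch A) F"
 shows "X : Obj C ==> fo F X : Obj (Ch A)" "u : Arr C ==> fa F u : Arr (Ch A)"
  "u : Arr C ==> mdom (fa F u) = fo F (Dom C u)" "u : Arr C ==> mcod (fa F u) = fo F (Cod C u)"
  "X : Obj C ==> fa F (Idt C X) = Idt (Ch A) (fo F X)"
  "[|u : Arr C; v : Arr C; Cod C u = Dom C v|] ==> fa F (v **\<^bsub>C\<^esub> u) = fa F v **\<^bsub>Ch A\<^esub> fa F u"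
 using assms by (auto simp: is_functor_def PiE_iff)

lemma cmap_tens_eq_iff:
 fixes g h :: "('p,'b) cmap"
 assumes "D : Obj (Ch A)" "E : Obj (Ch A)"
  and "mdom g = tens A MA D E" "mdom h = tens A MA D E" "mcod g = Z" "mcod h = Z"
  and "!!n. mcomp g n : Hom A (cob (tens A MA D E) n) (cob Z n)"
  and "!!n. mcomp h n : Hom A (cob (tens A MA D E) n) (cob Z n)"
 shows "g = h \<longleftrightarrow> (ALL i j. mcomp g (i + j) ** tin A MA D E i j = mcomp h (i + j) ** tin A MA D E i j)"
proof
 assume a: "ALL i j. mcomp g (i + j) ** tin A MA D E i j = mcomp h (i + j) ** tin A MA D E i j"
 show "g = h"
 proof (rule cmap_eqI)
  fix n show "mcomp g n = mcomp h n"
   by (rule tens_eqI[OF assms(1,2,7,8)]) (use a in auto)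
 qed (use assms in auto)
qed simp

lemma cmap_tens3_eq_iff:
 fixes g h :: "('p,'b) cmap"
 assumes "D : Obj (Ch A)" "E : Obj (Ch A)" "B : Obj (Ch A)"
  and "mdom g = tens A MA (tens A MA D E) B" "mdom h = tens A MA (tens A MA D E) B" "mcod g = Z" "mcod h = Z"
  and "!!n. mcomp g n : Hom A (cob (tens A MA (tens A MA D E) B) n) (cob Z n)"
  and "!!n. mcomp h n : Hom A (cob (tens A MA (tens A MA D E) B) n) (cob Z n)"
 shows "g = h \<longleftrightarrow> (ALL i j k.
   mcomp g (i + j + k) ** (tin A MA (tens A MA D E) B (i + j) k ** tenA MA (tin A MA D E i j) (Idt A (cob B k))) =
   mcomp h (i + j + k) ** (tin A MA (tens A MA D E) B (i + j) k ** tenA MA (tin A MA D E i j) (Idt A (cob B k))))"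
  (is "_ \<longleftrightarrow> ?R")
proof
 assume a: ?R
 show "g = h"
 proof (rule cmap_eqI)
  fix n show "mcomp g n = mcomp h n"
   by (rule tens_eqI3[OF assms(1,2,3,8,9)]) (use a in auto)
 qed (use assms in auto)
qed simp

text \<open>The typing part of \<open>is_smf\<close>. The Kuenneth morphisms are asked to be graded
  maps only; that they commute with differentials is the first clause of \<open>smf_laws\<close>,
  where it can be proved in components together with the other laws.\<close>

definition smf_shape :: "('o,'a,('p,'b) cpx,('p,'b) cmap) smf => bool" where
 "smf_shape F \<longleftrightarrow> (let f = fo (sfun F) in
   is_functor C (Ch A) (sfun F) &
   (ALL X Y. X ~: Obj C | Y ~: Obj C --> kap F X Y = undefined) &
   (ALL X:Obj C. ALL Y:Obj C. mdom (kap F X Y) = tens A MA (f X) (f Y) & mcod (kap F X Y) = f (tenO MC X Y) &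
    (ALL n. mcomp (kap F X Y) n : Hom A (cob (tens A MA (f X) (f Y)) n) (cob (f (tenO MC X Y)) n))) &
   eta F : Hom (Ch A) (conc_cpx A (unt MA)) (f (unt MC)))"

definition smf_laws :: "('o,'a,('p,'b) cpx,('p,'b) cmap) smf => bool" where
 "smf_laws F \<longleftrightarrow> (let f = fo (sfun F); K = kc A MA F; e = mcomp (eta F) 0 in
   (ALL X:Obj C. ALL Y:Obj C. ALL i j. cdf (f (tenO MC X Y)) (i + j) ** K X Y i j =
    Add A (K X Y (i - 1) j ** tenA MA (cdf (f X) i) (Idt A (cob (f Y) j)))
    (sgnm A i (K X Y i (j - 1) ** tenA MA (Idt A (cob (f X) i)) (cdf (f Y) j)))) &
   (ALL u:Arr C. ALL v:Arr C. ALL i j.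
    K (Cod C u) (Cod C v) i j ** tenA MA (mcomp (fa (sfun F) u) i) (mcomp (fa (sfun F) v) j)
    = mcomp (fa (sfun F) (tenA MC u v)) (i + j) ** K (Dom C u) (Dom C v) i j) &
   (ALL X:Obj C. ALL Y:Obj C. ALL Z:Obj C. ALL i j k.
    mcomp (fa (sfun F) (asc MC X Y Z)) (i + j + k) **
    (K (tenO MC X Y) Z (i + j) k ** tenA MA (K X Y i j) (Idt A (cob (f Z) k))) =
    K X (tenO MC Y Z) i (j + k) ** (tenA MA (Idt A (cob (f X) i)) (K Y Z j k) **
    asc MA (cob (f X) i) (cob (f Y) j) (cob (f Z) k))) &
   (ALL X:Obj C. ALL n. mcomp (fa (sfun F) (lun MC X)) n ** (K (unt MC) X 0 n ** tenA MA e (Idt A (cob (f X) n)))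
    = lun MA (cob (f X) n)) &
   (ALL X:Obj C. ALL n. mcomp (fa (sfun F) (run MC X)) n ** (K X (unt MC) n 0 ** tenA MA (Idt A (cob (f X) n)) e)
    = run MA (cob (f X) n)) &
   (ALL X:Obj C. ALL Y:Obj C. ALL i j. mcomp (fa (sfun F) (swp MC X Y)) (i + j) ** K X Y i j
    = sgnm A (i * j) (K Y X j i ** swp MA (cob (f X) i) (cob (f Y) j))))"

section \<open>Translation of the monoidal laws into components\<close>

context
 fixes F assumes F: "smf_shape F"
begin

lemma F_functor: "is_functor C (Ch A) (sfun F)"
 using F by (simp add: smf_shape_def Let_def)

lemmas F_simps [simp] = functor_Ch_simps(1-4)[OF F_functor]

lemma kap_simps [simp]:
 assumes "X : Obj C" "Y : Obj C"
 shows "mdom (kap F X Y) = tens A MA (fo (sfun F) X) (fo (sfun F) Y)" "mcod (kap F X Y) = fo (sfun F) (tenO MC X Y)"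
  "mcomp (kap F X Y) n : Arr A" "Dom A (mcomp (kap F X Y) n) = cob (tens A MA (fo (sfun F) X) (fo (sfun F) Y)) n"
  "Cod A (mcomp (kap F X Y) n) = cob (fo (sfun F) (tenO MC X Y)) n"
 using F assms by (auto simp: smf_shape_def Let_def Hom_iff[of _ A])

lemma kap_Hom: "[|X : Obj C; Y : Obj C|] ==> mcomp (kap F X Y) n : Hom A (cob (tens A MA (fo (sfun F) X) (fo (sfun F) Y)) n) (cob (fo (sfun F) (tenO MC X Y)) n)"
 by (simp add: Hom_iff)

lemma eta_Arr: "eta F : Arr (Ch A)" "mdom (eta F) = conc_cpx A (unt MA)" "mcod (eta F) = fo (sfun F) (unt MC)"
 using F by (auto simp: smf_shape_def Let_def Hom_iff)

lemma eta_simps [simp]: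
 "mcomp (eta F) 0 : Arr A" "Dom A (mcomp (eta F) 0) = unt MA" "Cod A (mcomp (eta F) 0) = cob (fo (sfun F) (unt MC)) 0"
 using mcomp_simps(1-3)[OF eta_Arr(1), of 0] by (simp_all add: eta_Arr cob_conc_cpx)

lemma kap_Arr_iff:
 assumes "X : Obj C" "Y : Obj C"
 shows "kap F X Y : Hom (Ch A) (tens A MA (fo (sfun F) X) (fo (sfun F) Y)) (fo (sfun F) (tenO MC X Y)) \<longleftrightarrow>
  (ALL i j. cdf (fo (sfun F) (tenO MC X Y)) (i + j) ** kc A MA F X Y i j =
    Add A (kc A MA F X Y (i - 1) j ** tenA MA (cdf (fo (sfun F) X) i) (Idt A (cob (fo (sfun F) Y) j)))
    (sgnm A i (kc A MA F X Y i (j - 1) ** tenA MA (Idt A (cob (fo (sfun F) X) i)) (cdf (fo (sfun F) Y) j))))"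
proof -
 let ?t1 = "tens A MA (fo (sfun F) X) (fo (sfun F) Y)"
 have "kap F X Y : Hom (Ch A) ?t1 (fo (sfun F) (tenO MC X Y)) \<longleftrightarrow>
  (ALL n. cdf (fo (sfun F) (tenO MC X Y)) n ** mcomp (kap F X Y) n
   = mcomp (kap F X Y) (n - 1) ** cdf ?t1 n)"
  unfolding Hom_Ch using assms kap_Hom by simp
 then show ?thesis
  unfolding kc_def
  by (subst (asm) tens_map_chain_iff[where g = "mcomp (kap F X Y)"]) (use assms kap_Hom in auto)
qed

lemma kc_simps [simp]:
 assumes "X : Obj C" "Y : Obj C"
 shows "kc A MA F X Y i j : Arr A" "Dom A (kc A MA F X Y i j) = tenO MA (cob (fo (sfun F) X) i) (cob (fo (sfun F) Y) j)"
  "Cod A (kc A MA F X Y i j) = cob (fo (sfun F) (tenO MC X Y)) (i + j)"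
 using assms by (simp_all add: kc_def)

lemma kap_nat_iff:
 assumes "u : Arr C" "v : Arr C"
 shows "kap F (Cod C u) (Cod C v) **\<^bsub>Ch A\<^esub> tenA (ChM A MA) (fa (sfun F) u) (fa (sfun F) v)
   = fa (sfun F) (tenA MC u v) **\<^bsub>Ch A\<^esub> kap F (Dom C u) (Dom C v) \<longleftrightarrow>
  (ALL i j. kc A MA F (Cod C u) (Cod C v) i j ** tenA MA (mcomp (fa (sfun F) u) i) (mcomp (fa (sfun F) v) j)
    = mcomp (fa (sfun F) (tenA MC u v)) (i + j) ** kc A MA F (Dom C u) (Dom C v) i j)"
proof -
 let ?t1 = "tenA (ChM A MA) (fa (sfun F) u) (fa (sfun F) v)"
 note T = tenA_Ch[of "fa (sfun F) u" "fa (sfun F) v"]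
 have T1: "mcomp ?t1 n : Arr A"
  "Dom A (mcomp ?t1 n) = cob (tens A MA (fo (sfun F) (Dom C u)) (fo (sfun F) (Dom C v))) n"
  "Cod A (mcomp ?t1 n) = cob (tens A MA (fo (sfun F) (Cod C u)) (fo (sfun F) (Cod C v))) n" for n
  using T(1)[of n] assms by (auto simp: Hom_iff)
 show ?thesis
  by (subst cmap_tens_eq_iff[where D = "fo (sfun F) (Dom C u)" and E = "fo (sfun F) (Dom C v)"
    and Z = "fo (sfun F) (tenO MC (Cod C u) (Cod C v))"])
   (use assms T(2) in "simp_all add: T1 kc_def Hom_iff")
qed

text \<open>The Kuenneth morphisms are assumed to be chain maps here because \<open>tenA_Ch\<close>
  evaluates tensor products of arrows of \<open>Ch A\<close> only.\<close>

lemma kap_assoc_iff: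
 assumes "X : Obj C" "Y : Obj C" "Z : Obj C" "kap F X Y : Arr (Ch A)" "kap F Y Z : Arr (Ch A)"
 shows "fa (sfun F) (asc MC X Y Z) **\<^bsub>Ch A\<^esub> kap F (tenO MC X Y) Z **\<^bsub>Ch A\<^esub>
    tenA (ChM A MA) (kap F X Y) (Idt (Ch A) (fo (sfun F) Z))
   = kap F X (tenO MC Y Z) **\<^bsub>Ch A\<^esub> tenA (ChM A MA) (Idt (Ch A) (fo (sfun F) X)) (kap F Y Z) **\<^bsub>Ch A\<^esub>
    asc (ChM A MA) (fo (sfun F) X) (fo (sfun F) Y) (fo (sfun F) Z) \<longleftrightarrow>
  (ALL i j k. mcomp (fa (sfun F) (asc MC X Y Z)) (i + j + k) **
    (kc A MA F (tenO MC X Y) Z (i + j) k ** tenA MA (kc A MA F X Y i j) (Idt A (cob (fo (sfun F) Z) k))) =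
    kc A MA F X (tenO MC Y Z) i (j + k) ** (tenA MA (Idt A (cob (fo (sfun F) X) i)) (kc A MA F Y Z j k) **
    asc MA (cob (fo (sfun F) X) i) (cob (fo (sfun F) Y) j) (cob (fo (sfun F) Z) k)))"
proof -
 let ?t1 = "tenO MC Y Z"
 let ?t2 = "tenO MC X Y"
 let ?t3 = "ChM A MA"
 let ?f = "fo (sfun F)"
 let ?T = "tenA ?t3 (kap F X Y) (Idt (Ch A) (?f Z))"
 let ?U = "tenA ?t3 (Idt (Ch A) (?f X)) (kap F Y Z)"
 have I: "Idt (Ch A) (?f W) : Arr (Ch A)" if "W : Obj C" for W
  using category.Idt_simps(1)[OF category_Ch] that by simp
 have T: "mcomp ?T n : Hom A (cob (tens A MA (tens A MA (?f X) (?f Y)) (?f Z)) n) (cob (tens A MA (?f ?t2) (?f Z)) n)"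
  "mcomp ?T (m + k) ** tin A MA (tens A MA (?f X) (?f Y)) (?f Z) m k
   = tin A MA (?f ?t2) (?f Z) m k ** tenA MA (mcomp (kap F X Y) m) (Idt A (cob (?f Z) k))" for m k n
  using tenA_Ch[OF assms(4) I[OF assms(3)]] assms by simp_all
 have U: "mcomp ?U n : Hom A (cob (tens A MA (?f X) (tens A MA (?f Y) (?f Z))) n) (cob (tens A MA (?f X) (?f ?t1)) n)"
  "mcomp ?U (i + m) ** tin A MA (?f X) (tens A MA (?f Y) (?f Z)) i m
   = tin A MA (?f X) (?f ?t1) i m ** tenA MA (Idt A (cob (?f X) i)) (mcomp (kap F Y Z) m)" for i m n
  using tenA_Ch[OF I[OF assms(1)] assms(5)] assms by simp_all
 note S = asc_Ch[of "?f X" "?f Y" "?f Z"]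
 have H: "mcomp ?T n : Arr A" "Dom A (mcomp ?T n) = cob (tens A MA (tens A MA (?f X) (?f Y)) (?f Z)) n"
  "Cod A (mcomp ?T n) = cob (tens A MA (?f ?t2) (?f Z)) n"
  "mcomp ?U n : Arr A" "Dom A (mcomp ?U n) = cob (tens A MA (?f X) (tens A MA (?f Y) (?f Z))) n"
  "Cod A (mcomp ?U n) = cob (tens A MA (?f X) (?f ?t1)) n"
  "mcomp (asc ?t3 (?f X) (?f Y) (?f Z)) n : Arr A"
  "Dom A (mcomp (asc ?t3 (?f X) (?f Y) (?f Z)) n) = cob (tens A MA (tens A MA (?f X) (?f Y)) (?f Z)) n"
  "Cod A (mcomp (asc ?t3 (?f X) (?f Y) (?f Z)) n) = cob (tens A MA (?f X) (tens A MA (?f Y) (?f Z))) n" for n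
  using T(1)[of n] U(1)[of n] S(1)[of n] assms by (auto simp: Hom_iff)
 have T': "mcomp ?T (i + j + k) ** (tin A MA (tens A MA (?f X) (?f Y)) (?f Z) (i + j) k ** tenA MA (tin A MA (?f X) (?f Y) i j) (Idt A (cob (?f Z) k)))
   = tin A MA (?f ?t2) (?f Z) (i + j) k ** tenA MA (kc A MA F X Y i j) (Idt A (cob (?f Z) k))" for i j k
  using assms by (subst Comp_reassoc[OF T(2)]) (simp_all add: H kc_def)
 have U': "mcomp ?U (i + j + k) ** (tin A MA (?f X) (tens A MA (?f Y) (?f Z)) i (j + k) **
    (tenA MA (Idt A (cob (?f X) i)) (tin A MA (?f Y) (?f Z) j k) ** asc MA (cob (?f X) i) (cob (?f Y) j) (cob (?f Z) k)))
   = tin A MA (?f X) (?f ?t1) i (j + k) ** (tenA MA (Idt A (cob (?f X) i)) (kc A MA F Y Z j k) **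
    asc MA (cob (?f X) i) (cob (?f Y) j) (cob (?f Z) k))" for i j k
  using assms unfolding add.assoc[of i j k] by (subst Comp_reassoc[OF U(2)]) (simp_all add: H kc_def)
 have kX: "mcomp (kap F X ?t1) (i + j + k) = mcomp (kap F X ?t1) (i + (j + k))" for i j k
  by (simp add: add.assoc)
 show ?thesis
  by (subst cmap_tens3_eq_iff[where D = "?f X" and E = "?f Y" and B = "?f Z" and Z = "?f (tenO MC X ?t1)"])
   (use assms in \<open>simp_all add: H Hom_iff T' U' S(2) kc_def[of A MA F "tenO MC X Y" Z] kc_def[of A MA F X "tenO MC Y Z"] add.assoc[symmetric]\<close>)
qed

text \<open>The unit complex is concentrated in degree 0, so of all summands of its tensor product
  with a complex only one in each degree can be nonzero.\<close>

lemma kap_unit_iff: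
 assumes "X : Obj C"
 shows "fa (sfun F) (lun MC X) **\<^bsub>Ch A\<^esub> kap F (unt MC) X **\<^bsub>Ch A\<^esub> tenA (ChM A MA) (eta F) (Idt (Ch A) (fo (sfun F) X))
    = lun (ChM A MA) (fo (sfun F) X) \<longleftrightarrow>
   (ALL n. mcomp (fa (sfun F) (lun MC X)) n ** (kc A MA F (unt MC) X 0 n ** tenA MA (mcomp (eta F) 0) (Idt A (cob (fo (sfun F) X) n)))
    = lun MA (cob (fo (sfun F) X) n))"
  "fa (sfun F) (run MC X) **\<^bsub>Ch A\<^esub> kap F X (unt MC) **\<^bsub>Ch A\<^esub> tenA (ChM A MA) (Idt (Ch A) (fo (sfun F) X)) (eta F)
    = run (ChM A MA) (fo (sfun F) X) \<longleftrightarrow>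
   (ALL n. mcomp (fa (sfun F) (run MC X)) n ** (kc A MA F X (unt MC) n 0 ** tenA MA (Idt A (cob (fo (sfun F) X) n)) (mcomp (eta F) 0))
    = run MA (cob (fo (sfun F) X) n))"
proof -
 let ?t1 = "ChM A MA"
 let ?f = "fo (sfun F)" and ?u = "conc_cpx A (unt MA)"
 let ?T = "tenA ?t1 (eta F) (Idt (Ch A) (?f X))"
 let ?U = "tenA ?t1 (Idt (Ch A) (?f X)) (eta F)"
 have I: "Idt (Ch A) (?f X) : Arr (Ch A)"
  using category.Idt_simps(1)[OF category_Ch] assms by simp
 have T: "mcomp ?T n : Hom A (cob (tens A MA ?u (?f X)) n) (cob (tens A MA (?f (unt MC)) (?f X)) n)"
  "mcomp ?T (i + j) ** tin A MA ?u (?f X) i j = tin A MA (?f (unt MC)) (?f X) i j ** tenA MA (mcomp (eta F) i) (Idt A (cob (?f X) j))" for i j n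
  using tenA_Ch[OF eta_Arr(1) I] assms by (simp_all add: eta_Arr)
 have U: "mcomp ?U n : Hom A (cob (tens A MA (?f X) ?u) n) (cob (tens A MA (?f X) (?f (unt MC))) n)"
  "mcomp ?U (i + j) ** tin A MA (?f X) ?u i j = tin A MA (?f X) (?f (unt MC)) i j ** tenA MA (Idt A (cob (?f X) i)) (mcomp (eta F) j)" for i j n
  using tenA_Ch[OF I eta_Arr(1)] assms by (simp_all add: eta_Arr)
 note S = lun_Ch[of "?f X"]
 have u: "?u : Obj (Ch A)" by simp
 have H: "mcomp ?T n : Arr A" "Dom A (mcomp ?T n) = cob (tens A MA ?u (?f X)) n"
  "Cod A (mcomp ?T n) = cob (tens A MA (?f (unt MC)) (?f X)) n"
  "mcomp ?U n : Arr A" "Dom A (mcomp ?U n) = cob (tens A MA (?f X) ?u) n"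
  "Cod A (mcomp ?U n) = cob (tens A MA (?f X) (?f (unt MC))) n"
  "mcomp (lun ?t1 (?f X)) n : Arr A" "Dom A (mcomp (lun ?t1 (?f X)) n) = cob (tens A MA ?u (?f X)) n"
  "Cod A (mcomp (lun ?t1 (?f X)) n) = cob (?f X) n"
  "mcomp (run ?t1 (?f X)) n : Arr A" "Dom A (mcomp (run ?t1 (?f X)) n) = cob (tens A MA (?f X) ?u) n"
  "Cod A (mcomp (run ?t1 (?f X)) n) = cob (?f X) n" for n
  using T(1)[of n] U(1)[of n] S(1,3)[of n] assms by (auto simp: Hom_iff)
 have S1: "mcomp (lun ?t1 (?f X)) n : Hom A (cob (tens A MA ?u (?f X)) n) (cob (?f X) n)"
  and S3: "mcomp (run ?t1 (?f X)) n : Hom A (cob (tens A MA (?f X) ?u) n) (cob (?f X) n)" for n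
  using S assms by simp_all
 have z: "is_zero A (tenO MA (cob ?u i) (cob (?f X) j))" "is_zero A (tenO MA (cob (?f X) j) (cob ?u i))" if "i ~= 0" for i j
  using that is_zero_tenO zero_obj assms by (simp_all add: cob_conc_cpx)
 show "fa (sfun F) (lun MC X) **\<^bsub>Ch A\<^esub> kap F (unt MC) X **\<^bsub>Ch A\<^esub> ?T = lun ?t1 (?f X) \<longleftrightarrow>
   (ALL n. mcomp (fa (sfun F) (lun MC X)) n ** (kc A MA F (unt MC) X 0 n ** tenA MA (mcomp (eta F) 0) (Idt A (cob (?f X) n)))
    = lun MA (cob (?f X) n))" (is "?L = lun ?t1 (?f X) \<longleftrightarrow> (ALL n. ?g n = _)")
 proof -
  have 1: "mcomp ?L (0 + n) ** tin A MA ?u (?f X) 0 n = ?g n" for n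
   using assms T(2)[of 0 n] by (simp add: H kc_def eta_Arr(2,3))
  have L: "mcomp ?L n : Hom A (cob (tens A MA ?u (?f X)) n) (cob (?f X) n)" for n
   using assms by (simp add: H Hom_iff eta_Arr(2,3))
  have ht: "tin A MA ?u (?f X) i j : Hom A (tenO MA (cob ?u i) (cob (?f X) j)) (cob (tens A MA ?u (?f X)) (i + j))" for i j
   using u assms by (simp add: Hom_iff)
  \<comment> \<open>On all other summands both maps start at a zero object.\<close>
  have 2: "mcomp ?L (i + j) ** tin A MA ?u (?f X) i j = mcomp (lun ?t1 (?f X)) (i + j) ** tin A MA ?u (?f X) i j" if "i ~= 0" for i j
   using is_zero_Hom_eq[OF disjI1 Comp_Hom[OF ht L]] is_zero_Hom_eq[OF disjI1 Comp_Hom[OF ht S1]] z(1)[OF that]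
   by metis
  have 3: "(ALL i j. mcomp ?L (i + j) ** tin A MA ?u (?f X) i j = mcomp (lun ?t1 (?f X)) (i + j) ** tin A MA ?u (?f X) i j)
   \<longleftrightarrow> (ALL n. ?g n = lun MA (cob (?f X) n))" (is "?P \<longleftrightarrow> ?Q")
  proof
   assume ?P
   then have "?g n = mcomp (lun ?t1 (?f X)) (0 + n) ** tin A MA ?u (?f X) 0 n" for n by (simp only: 1[symmetric])
   then show ?Q using S(2) assms by simp
  next
   assume Q: ?Q
   show ?P
   proof (intro allI)
    fix i j show "mcomp ?L (i + j) ** tin A MA ?u (?f X) i j = mcomp (lun ?t1 (?f X)) (i + j) ** tin A MA ?u (?f X) i j"
    proof (cases "i = 0")
    case True
    show ?thesis unfolding True 1 using Q S(2) assms by simp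
    qed (rule 2)
   qed
  qed
  show ?thesis
   unfolding 3[symmetric]
   by (rule cmap_tens_eq_iff[OF u _ _ _ _ _ L S1]) (use assms in "simp_all add: eta_Arr")
 qed
 show "fa (sfun F) (run MC X) **\<^bsub>Ch A\<^esub> kap F X (unt MC) **\<^bsub>Ch A\<^esub> ?U = run ?t1 (?f X) \<longleftrightarrow>
   (ALL n. mcomp (fa (sfun F) (run MC X)) n ** (kc A MA F X (unt MC) n 0 ** tenA MA (Idt A (cob (?f X) n)) (mcomp (eta F) 0))
    = run MA (cob (?f X) n))" (is "?L = run ?t1 (?f X) \<longleftrightarrow> (ALL n. ?g n = _)")
 proof -
  have 1: "mcomp ?L (n + 0) ** tin A MA (?f X) ?u n 0 = ?g n" for n
   using assms U(2)[of n 0] by (simp add: H kc_def eta_Arr(2,3))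
  have L: "mcomp ?L n : Hom A (cob (tens A MA (?f X) ?u) n) (cob (?f X) n)" for n
   using assms by (simp add: H Hom_iff eta_Arr(2,3))
  have ht: "tin A MA (?f X) ?u i j : Hom A (tenO MA (cob (?f X) i) (cob ?u j)) (cob (tens A MA (?f X) ?u) (i + j))" for i j
   using u assms by (simp add: Hom_iff)
  have 2: "mcomp ?L (i + j) ** tin A MA (?f X) ?u i j = mcomp (run ?t1 (?f X)) (i + j) ** tin A MA (?f X) ?u i j" if "j ~= 0" for i j
   using is_zero_Hom_eq[OF disjI1 Comp_Hom[OF ht L]] is_zero_Hom_eq[OF disjI1 Comp_Hom[OF ht S3]] z(2)[OF that]
   by metis
  have 3: "(ALL i j. mcomp ?L (i + j) ** tin A MA (?f X) ?u i j = mcomp (run ?t1 (?f X)) (i + j) ** tin A MA (?f X) ?u i j)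
   \<longleftrightarrow> (ALL n. ?g n = run MA (cob (?f X) n))" (is "?P \<longleftrightarrow> ?Q")
  proof
   assume ?P
   then have "?g n = mcomp (run ?t1 (?f X)) (n + 0) ** tin A MA (?f X) ?u n 0" for n by (simp only: 1[symmetric])
   then show ?Q using S(4) assms by simp
  next
   assume Q: ?Q
   show ?P
   proof (intro allI)
    fix i j show "mcomp ?L (i + j) ** tin A MA (?f X) ?u i j = mcomp (run ?t1 (?f X)) (i + j) ** tin A MA (?f X) ?u i j"
    proof (cases "j = 0")
    case True
    show ?thesis unfolding True 1 using Q S(4) assms by simp
    qed (rule 2)
   qed
  qed
  show ?thesis
   unfolding 3[symmetric]
   by (rule cmap_tens_eq_iff[OF _ u _ _ _ _ L S3]) (use assms in "simp_all add: eta_Arr")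
 qed
qed

lemma kap_swp_iff:
 assumes "X : Obj C" "Y : Obj C"
 shows "fa (sfun F) (swp MC X Y) **\<^bsub>Ch A\<^esub> kap F X Y = kap F Y X **\<^bsub>Ch A\<^esub> swp (ChM A MA) (fo (sfun F) X) (fo (sfun F) Y) \<longleftrightarrow>
  (ALL i j. mcomp (fa (sfun F) (swp MC X Y)) (i + j) ** kc A MA F X Y i j
    = sgnm A (i * j) (kc A MA F Y X j i ** swp MA (cob (fo (sfun F) X) i) (cob (fo (sfun F) Y) j)))"
proof -
 let ?f = "fo (sfun F)"
 note S = swp_Ch[of "?f X" "?f Y"]
 have H: "mcomp (swp (ChM A MA) (?f X) (?f Y)) n : Arr A" "Dom A (mcomp (swp (ChM A MA) (?f X) (?f Y)) n) = cob (tens A MA (?f X) (?f Y)) n"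
  "Cod A (mcomp (swp (ChM A MA) (?f X) (?f Y)) n) = cob (tens A MA (?f Y) (?f X)) n" for n
  using S(1)[of n] assms by (auto simp: Hom_iff)
 show ?thesis
  by (subst cmap_tens_eq_iff[where D = "?f X" and E = "?f Y" and Z = "?f (tenO MC Y X)"])
   (use assms S(2) in "simp_all add: H kc_def Hom_iff add.commute")
qed

end

theorem is_smf_iff: "is_smf C MC (Ch A) (ChM A MA) F \<longleftrightarrow> smf_shape F & smf_laws F"
proof -
 have shape: "smf_shape F" if "is_smf C MC (Ch A) (ChM A MA) F"
  using that unfolding is_smf_def smf_shape_def Let_def ChM_simps by (simp add: Hom_Ch)
 have "smf_laws F" if s: "smf_shape F" and F: "is_smf C MC (Ch A) (ChM A MA) F"
 proof -
  note F' = F[unfolded is_smf_def Let_def ChM_simps]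
  \<comment> \<open>The chain map property has to come before the rest, since the translation of
    associativity relies on it.\<close>
  have k: "kap F X Y : Hom (Ch A) (tens A MA (fo (sfun F) X) (fo (sfun F) Y)) (fo (sfun F) (tenO MC X Y))"
   if "X : Obj C" "Y : Obj C" for X Y
   by (rule F'[THEN conjR, THEN conjR, THEN conjunct1, rule_format, OF that])
  then have k': "kap F X Y : Arr (Ch A)" if "X : Obj C" "Y : Obj C" for X Y using that by (simp add: Hom_iff)
  show ?thesis
   unfolding smf_laws_def Let_def
   apply (intro conjI ballI)
   subgoal by (rule iffD1[OF kap_Arr_iff[OF s] k])
   subgoal by (rule iffD1[OF kap_nat_iff[OF s] F'[THEN conjR, THEN conjR, THEN conjR, THEN conjR, THEN conjunct1, rule_format]])
   subgoal by (rule iffD1[OF kap_assoc_iff[OF s _ _ _ k' k'] F'[THEN conjR, THEN conjR, THEN conjR, THEN conjR, THEN conjR, THEN conjunct1, rule_format]])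
   subgoal by (rule iffD1[OF kap_unit_iff(1)[OF s] F'[THEN conjR, THEN conjR, THEN conjR, THEN conjR, THEN conjR, THEN conjR, THEN conjunct1, rule_format]])
   subgoal by (rule iffD1[OF kap_unit_iff(2)[OF s] F'[THEN conjR, THEN conjR, THEN conjR, THEN conjR, THEN conjR, THEN conjR, THEN conjR, THEN conjunct1, rule_format]])
   subgoal by (rule iffD1[OF kap_swp_iff[OF s] F'[THEN conjR, THEN conjR, THEN conjR, THEN conjR, THEN conjR, THEN conjR, THEN conjR, THEN conjR, rule_format]])
   done
 qed
 moreover have "is_smf C MC (Ch A) (ChM A MA) F" if s: "smf_shape F" and L: "smf_laws F"
 proof -
  note L' = L[unfolded smf_laws_def Let_def]
  have k: "kap F X Y : Hom (Ch A) (tens A MA (fo (sfun F) X) (fo (sfun F) Y)) (fo (sfun F) (tenO MC X Y))"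
   if "X : Obj C" "Y : Obj C" for X Y
   by (rule iffD2[OF kap_Arr_iff[OF s that]]) (intro allI, rule L'[THEN conjunct1, rule_format, OF that])
  then have k': "kap F X Y : Arr (Ch A)" if "X : Obj C" "Y : Obj C" for X Y using that by (simp add: Hom_iff)
  have sh: "is_functor C (Ch A) (sfun F)" "ALL X Y. X ~: Obj C | Y ~: Obj C --> kap F X Y = undefined"
   "eta F : Hom (Ch A) (conc_cpx A (unt MA)) (fo (sfun F) (unt MC))"
   using s unfolding smf_shape_def Let_def by blast+
  show ?thesis
   unfolding is_smf_def Let_def ChM_simps
   apply (intro conjI)
   subgoal by (rule sh(1))
   subgoal by (rule sh(2))
   subgoal by (intro ballI) (rule k)
   subgoal by (rule sh(3))
   subgoal by (intro ballI, rule iffD2[OF kap_nat_iff[OF s]], assumption+) (intro allI, rule L'[THEN conjR, THEN conjunct1, rule_format])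
   subgoal by (intro ballI, rule iffD2[OF kap_assoc_iff[OF s _ _ _ k' k']], assumption+) (intro allI, rule L'[THEN conjR, THEN conjR, THEN conjunct1, rule_format])
   subgoal by (intro ballI, rule iffD2[OF kap_unit_iff(1)[OF s]], assumption+) (intro allI, rule L'[THEN conjR, THEN conjR, THEN conjR, THEN conjunct1, rule_format])
   subgoal by (intro ballI, rule iffD2[OF kap_unit_iff(2)[OF s]], assumption+) (intro allI, rule L'[THEN conjR, THEN conjR, THEN conjR, THEN conjR, THEN conjunct1, rule_format])
   subgoal by (intro ballI, rule iffD2[OF kap_swp_iff[OF s]], assumption+) (intro allI, rule L'[THEN conjR, THEN conjR, THEN conjR, THEN conjR, THEN conjR, rule_format])
   done
 qed
 ultimately show ?thesis using shape by blast
qed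

end

section \<open>The category of symmetric monoidal functors to complexes\<close>

context monoidal_functors begin

abbreviation S where "S \<equiv> SyMonCh C MC A MA"

lemma Obj_S: "F : Obj S \<longleftrightarrow> smf_shape F & smf_laws F & unif_bounded C A F"
 by (simp add: SyMonCh_def full_subcat_def SyMon_def is_smf_iff)

lemma S_simps [simp]:
 "Dom S = mtdom" "Cod S = mtcod"
 "mtdom (Idt S F) = F" "mtcod (Idt S F) = F" "mtcomp (Idt S F) = (\<lambda>X \<in> Obj C. Idt (Ch A) (fo (sfun F) X))"
 "mtdom (t **\<^bsub>S\<^esub> s) = mtdom s" "mtcod (t **\<^bsub>S\<^esub> s) = mtcod t"
 "mtcomp (t **\<^bsub>S\<^esub> s) = (\<lambda>X \<in> Obj C. mtcomp t X **\<^bsub>Ch A\<^esub> mtcomp s X)"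
 by (simp_all add: SyMonCh_def full_subcat_def SyMon_def)

definition mnt_comp :: "('o,'a,('p,'b) cpx,('p,'b) cmap) mnt => bool" where
 "mnt_comp t \<longleftrightarrow> mtcomp t \<in> extensional (Obj C) &
  (ALL X:Obj C. mtcomp t X : Hom (Ch A) (fo (sfun (mtdom t)) X) (fo (sfun (mtcod t)) X)) &
  (ALL u:Arr C. ALL n. mcomp (mtcomp t (Cod C u)) n ** mcomp (fa (sfun (mtdom t)) u) n
    = mcomp (fa (sfun (mtcod t)) u) n ** mcomp (mtcomp t (Dom C u)) n) &
  (ALL X:Obj C. ALL Y:Obj C. ALL i j. mcomp (mtcomp t (tenO MC X Y)) (i + j) ** kc A MA (mtdom t) X Y i j
    = kc A MA (mtcod t) X Y i j ** tenA MA (mcomp (mtcomp t X) i) (mcomp (mtcomp t Y) j)) &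
  mcomp (mtcomp t (unt MC)) 0 ** mcomp (eta (mtdom t)) 0 = mcomp (eta (mtcod t)) 0"

lemma kap_compat_iff:
 assumes F: "smf_shape F" and H: "smf_shape H" and X: "X : Obj C" "Y : Obj C"
  and t: "!!X. X : Obj C ==> t X : Hom (Ch A) (fo (sfun F) X) (fo (sfun H) X)"
 shows "t (tenO MC X Y) **\<^bsub>Ch A\<^esub> kap F X Y = kap H X Y **\<^bsub>Ch A\<^esub> tenA (ChM A MA) (t X) (t Y) \<longleftrightarrow>
  (ALL i j. mcomp (t (tenO MC X Y)) (i + j) ** kc A MA F X Y i j
    = kc A MA H X Y i j ** tenA MA (mcomp (t X) i) (mcomp (t Y) j))"
proof -
 have tt: "t X : Arr (Ch A)" "mdom (t X) = fo (sfun F) X" "mcod (t X) = fo (sfun H) X" if "X : Obj C" for X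
  using t[OF that] by (simp_all add: Hom_iff)
 note T = tenA_Ch[OF tt(1)[OF X(1)] tt(1)[OF X(2)], unfolded tt(2,3)[OF X(1)] tt(2,3)[OF X(2)]]
 note [simp] = F_simps(1)[OF F] F_simps(1)[OF H] kap_simps[OF F] kap_simps[OF H]
 have T': "mcomp (tenA (ChM A MA) (t X) (t Y)) n : Arr A"
  "Dom A (mcomp (tenA (ChM A MA) (t X) (t Y)) n) = cob (tens A MA (fo (sfun F) X) (fo (sfun F) Y)) n"
  "Cod A (mcomp (tenA (ChM A MA) (t X) (t Y)) n) = cob (tens A MA (fo (sfun H) X) (fo (sfun H) Y)) n" for n
  using T(1)[of n] by (simp_all add: Hom_iff)
 show ?thesis
  by (subst cmap_tens_eq_iff[where D = "fo (sfun F) X" and E = "fo (sfun F) Y" and Z = "fo (sfun H) (tenO MC X Y)"])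
   (use X in "simp_all add: tt T' T(2) kc_def Hom_iff")
qed

text \<open>In degrees other than 0 both sides are arrows out of a zero object.\<close>

lemma eta_compat_iff:
 assumes F: "smf_shape F" and H: "smf_shape H"
  and t: "t : Hom (Ch A) (fo (sfun F) (unt MC)) (fo (sfun H) (unt MC))"
 shows "t **\<^bsub>Ch A\<^esub> eta F = eta H \<longleftrightarrow> mcomp t 0 ** mcomp (eta F) 0 = mcomp (eta H) 0"
proof
 assume a: "mcomp t 0 ** mcomp (eta F) 0 = mcomp (eta H) 0"
 note e = eta_Arr[OF F] eta_Arr[OF H]
 have tt: "t : Arr (Ch A)" "mdom t = fo (sfun F) (unt MC)" "mcod t = fo (sfun H) (unt MC)"
  using t by (simp_all add: Hom_iff)
 show "t **\<^bsub>Ch A\<^esub> eta F = eta H"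
 proof (rule cmap_eqI)
  fix n show "mcomp (t **\<^bsub>Ch A\<^esub> eta F) n = mcomp (eta H) n"
  proof (cases "n = 0")
   case False
   then have z: "is_zero A (cob (conc_cpx A (unt MA)) n)" using zero_obj by (simp add: cob_conc_cpx)
   have "mcomp (eta H) n : Hom A (cob (conc_cpx A (unt MA)) n) (cob (fo (sfun H) (unt MC)) n)"
    "mcomp t n ** mcomp (eta F) n : Hom A (cob (conc_cpx A (unt MA)) n) (cob (fo (sfun H) (unt MC)) n)"
    using tt by (simp_all add: Hom_iff e)
   then show ?thesis using is_zero_Hom_eq z by (metis Comp_Ch(3))
  qed (use a in simp)
 qed (simp_all add: tt e)
qed (metis Comp_Ch(3))

lemma Arr_S: "t : Arr S \<longleftrightarrow> mtdom t : Obj S & mtcod t : Obj S & mnt_comp t"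
proof -
 let ?t1 = "sfun (mtdom t)"
 let ?t2 = "sfun (mtcod t)"
 have a: "t : Arr S \<longleftrightarrow> is_mnt C MC (Ch A) (ChM A MA) t & unif_bounded C A (mtdom t) & unif_bounded C A (mtcod t)"
  by (auto simp: SyMonCh_def full_subcat_def SyMon_def)
 have "is_mnt C MC (Ch A) (ChM A MA) t \<longleftrightarrow> mnt_comp t" if s: "smf_shape (mtdom t)" "smf_laws (mtdom t)" "smf_shape (mtcod t)" "smf_laws (mtcod t)"
 \<comment> \<open>The translation of compatibility with the Kuenneth morphisms presupposes that the
   components are chain maps. If one of them is not, both sides are false.\<close>
 proof (cases "ALL X:Obj C. mtcomp t X : Hom (Ch A) (fo ?t1 X) (fo ?t2 X)")
  case True
  then have T: "mtcomp t X : Hom (Ch A) (fo ?t1 X) (fo ?t2 X)" if "X : Obj C" for X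
   using that by blast
  have TT: "mdom (mtcomp t X) = fo ?t1 X" "mcod (mtcomp t X) = fo ?t2 X" if "X : Obj C" for X
   using T[OF that] by (simp_all add: Hom_iff)
  have nat: "mtcomp t (Cod C u) **\<^bsub>Ch A\<^esub> fa ?t1 u = fa ?t2 u **\<^bsub>Ch A\<^esub> mtcomp t (Dom C u) \<longleftrightarrow>
   (ALL n. mcomp (mtcomp t (Cod C u)) n ** mcomp (fa ?t1 u) n
    = mcomp (fa ?t2 u) n ** mcomp (mtcomp t (Dom C u)) n)" if "u : Arr C" for u
  proof
   assume "ALL n. mcomp (mtcomp t (Cod C u)) n ** mcomp (fa ?t1 u) n
    = mcomp (fa ?t2 u) n ** mcomp (mtcomp t (Dom C u)) n"
   then show "mtcomp t (Cod C u) **\<^bsub>Ch A\<^esub> fa ?t1 u = fa ?t2 u **\<^bsub>Ch A\<^esub> mtcomp t (Dom C u)"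
    using that by (intro cmap_eqI) (simp_all add: TT F_simps(2-4)[OF s(1)] F_simps(2-4)[OF s(3)])
  qed (metis Comp_Ch(3))
  have k: "(ALL X:Obj C. ALL Y:Obj C. mtcomp t (tenO MC X Y) **\<^bsub>Ch A\<^esub> kap (mtdom t) X Y
    = kap (mtcod t) X Y **\<^bsub>Ch A\<^esub> tenA (ChM A MA) (mtcomp t X) (mtcomp t Y)) \<longleftrightarrow>
   (ALL X:Obj C. ALL Y:Obj C. ALL i j. mcomp (mtcomp t (tenO MC X Y)) (i + j) ** kc A MA (mtdom t) X Y i j
    = kc A MA (mtcod t) X Y i j ** tenA MA (mcomp (mtcomp t X) i) (mcomp (mtcomp t Y) j))"
   by (intro ball_cong HOL.refl kap_compat_iff s T)
  show ?thesis
   using s True nat is_smf_iff F_functor[OF s(1)] F_functor[OF s(3)]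
    eta_compat_iff[OF s(1) s(3) T[OF C.unt_Obj]]
   unfolding is_mnt_def mnt_comp_def is_ntr_def k by simp
 next
  case False
  then show ?thesis unfolding is_mnt_def is_ntr_def mnt_comp_def by auto
 qed
 then show ?thesis
  unfolding a Obj_S using is_smf_iff by (auto simp: is_mnt_def)
qed

lemma Obj_S_simps:
 assumes "F : Obj S"
 shows "smf_shape F" "smf_laws F" "is_functor C (Ch A) (sfun F)" "unif_bounded C A F"
 using assms F_functor by (simp_all add: Obj_S)

lemma Arr_S_simps:
 assumes "t : Arr S" "X : Obj C"
 shows "mtcomp t X : Arr (Ch A)" "mdom (mtcomp t X) = fo (sfun (mtdom t)) X" "mcod (mtcomp t X) = fo (sfun (mtcod t)) X"
  "mtcomp t X : Hom (Ch A) (fo (sfun (mtdom t)) X) (fo (sfun (mtcod t)) X)"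
  "mcomp (mtcomp t X) n : Arr A" "Dom A (mcomp (mtcomp t X) n) = cob (fo (sfun (mtdom t)) X) n"
  "Cod A (mcomp (mtcomp t X) n) = cob (fo (sfun (mtcod t)) X) n"
proof -
 let ?t1 = "mtcomp t X"
 show *: "mtcomp t X : Hom (Ch A) (fo (sfun (mtdom t)) X) (fo (sfun (mtcod t)) X)"
  using assms by (auto simp: Arr_S mnt_comp_def)
 then show h: "mtcomp t X : Arr (Ch A)" "mdom ?t1 = fo (sfun (mtdom t)) X" "mcod ?t1 = fo (sfun (mtcod t)) X"
  by (auto simp: Hom_iff)
 then show "mcomp ?t1 n : Arr A" "Dom A (mcomp ?t1 n) = cob (fo (sfun (mtdom t)) X) n"
  "Cod A (mcomp ?t1 n) = cob (fo (sfun (mtcod t)) X) n" by simp_all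
qed

lemma mnt_comp_laws:
 assumes "t : Arr S"
 shows "u : Arr C ==> mcomp (mtcomp t (Cod C u)) n ** mcomp (fa (sfun (mtdom t)) u) n
    = mcomp (fa (sfun (mtcod t)) u) n ** mcomp (mtcomp t (Dom C u)) n"
  and "[|X : Obj C; Y : Obj C|] ==> mcomp (mtcomp t (tenO MC X Y)) (i + j) ** kc A MA (mtdom t) X Y i j
    = kc A MA (mtcod t) X Y i j ** tenA MA (mcomp (mtcomp t X) i) (mcomp (mtcomp t Y) j)"
  and "mcomp (mtcomp t (unt MC)) 0 ** mcomp (eta (mtdom t)) 0 = mcomp (eta (mtcod t)) 0"
  and "mtcomp t \<in> extensional (Obj C)"
  and "X : Obj C ==> cdf (fo (sfun (mtcod t)) X) n ** mcomp (mtcomp t X) n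
    = mcomp (mtcomp t X) (n - 1) ** cdf (fo (sfun (mtdom t)) X) n"
 using assms Arr_S_simps(4)[OF assms, of X] unfolding Arr_S mnt_comp_def Hom_Ch by blast+

lemma mnt_eqI:
 fixes s t :: "('o,'a,('p,'b) cpx,('p,'b) cmap) mnt"
 assumes "s : Arr S" "t : Arr S" "mtdom s = mtdom t" "mtcod s = mtcod t"
  and "!!X n. X : Obj C ==> mcomp (mtcomp s X) n = mcomp (mtcomp t X) n"
 shows "s = t"
proof (rule mnt.equality)
 show "mtcomp s = mtcomp t"
 proof (rule extensionalityI)
  show "mtcomp s \<in> extensional (Obj C)" "mtcomp t \<in> extensional (Obj C)"
   using assms mnt_comp_laws(4) by auto
  fix X assume "X : Obj C"
  then show "mtcomp s X = mtcomp t X"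
   using assms by (intro cmap_eqI) (simp_all add: Arr_S_simps)
 qed
qed (use assms in auto)

lemma category_S: "category S"
proof
 fix f assume "f : Arr S" then show "Dom S f : Obj S" "Cod S f : Obj S" by (simp_all add: Arr_S)
next
 fix F assume F: "F : Obj S"
 note s = Obj_S_simps[OF F]
 interpret Ch: category "Ch A" by (rule category_Ch)
 note [simp] = F_simps[OF s(1)] kc_simps[OF s(1)] eta_simps[OF s(1)]
 show "Idt S F : Hom S F F"
  unfolding Hom_iff Arr_S mnt_comp_def using F by (simp add: Ch.Idt_Hom)
next
 fix f F H g J assume f: "f : Hom S F H" and g: "g : Hom S H J"
 then have fg: "f : Arr S" "g : Arr S" "mtdom f = F" "mtcod f = H" "mtdom g = H" "mtcod g = J"
  by (simp_all add: Hom_iff)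
 then have O: "F : Obj S" "H : Obj S" "J : Obj S" using Arr_S by metis+
 note s = Obj_S_simps[OF O(1)] Obj_S_simps[OF O(2)] Obj_S_simps[OF O(3)]
 note F = F_simps[OF s(1)] kc_simps[OF s(1)] eta_simps[OF s(1)] F_simps[OF s(5)] kc_simps[OF s(5)] eta_simps[OF s(5)]
  F_simps[OF s(9)] kc_simps[OF s(9)] eta_simps[OF s(9)]
 note h = Arr_S_simps[OF fg(1), unfolded fg(3,4)] Arr_S_simps[OF fg(2), unfolded fg(5,6)]
 note lf = mnt_comp_laws[OF fg(1), unfolded fg(3,4)] and lg = mnt_comp_laws[OF fg(2), unfolded fg(5,6)]
 interpret Ch: category "Ch A" by (rule category_Ch)
 have "mcomp (mtcomp g (Cod C u)) n ** (mcomp (mtcomp f (Cod C u)) n ** mcomp (fa (sfun F) u) n)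
   = mcomp (fa (sfun J) u) n ** (mcomp (mtcomp g (Dom C u)) n ** mcomp (mtcomp f (Dom C u)) n)" if "u : Arr C" for u n
  unfolding lf(1)[OF that] using that by (subst Comp_reassoc[OF lg(1)[OF that]]) (simp_all add: h F)
 moreover have "mcomp (mtcomp g (tenO MC X Y)) (i + j) ** (mcomp (mtcomp f (tenO MC X Y)) (i + j) ** kc A MA F X Y i j)
   = kc A MA J X Y i j ** tenA MA (mcomp (mtcomp g X) i ** mcomp (mtcomp f X) i) (mcomp (mtcomp g Y) j ** mcomp (mtcomp f Y) j)"
  if "X : Obj C" "Y : Obj C" for X Y i j
  unfolding lf(2)[OF that] using that by (subst Comp_reassoc[OF lg(2)[OF that]]) (simp_all add: h F)
 moreover have "mcomp (mtcomp g (unt MC)) 0 ** (mcomp (mtcomp f (unt MC)) 0 ** mcomp (eta F) 0) = mcomp (eta J) 0"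
  unfolding lf(3) by (rule lg(3))
 moreover have "mtcomp g X **\<^bsub>Ch A\<^esub> mtcomp f X : Hom (Ch A) (fo (sfun F) X) (fo (sfun J) X)" if "X : Obj C" for X
  using Ch.Comp_Hom[OF h(4)[OF that] h(11)[OF that]] .
 ultimately show "g **\<^bsub>S\<^esub> f : Hom S F J"
  unfolding Hom_iff Arr_S mnt_comp_def using O by (simp add: fg h F)
next
 fix f F H assume f: "f : Hom S F H"
 interpret Ch: category "Ch A" by (rule category_Ch)
 have ff: "f : Arr S" "mtdom f = F" "mtcod f = H" using f by (simp_all add: Hom_iff)
 note e = extensionalityI[OF restrict_extensional mnt_comp_laws(4)[OF ff(1)]]
 show "f **\<^bsub>S\<^esub> Idt S F = f" "Idt S H **\<^bsub>S\<^esub> f = f"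
  by (rule mnt.equality; simp add: ff; intro e; simp add: Arr_S_simps[OF ff(1)] ff)+
next
 fix f F H g J h L assume a: "f : Hom S F H" "g : Hom S H J" "h : Hom S J L"
 interpret Ch: category "Ch A" by (rule category_Ch)
 have b: "f : Arr S" "g : Arr S" "h : Arr S" "mtdom f = F" "mtcod f = H" "mtdom g = H" "mtcod g = J" "mtdom h = J" "mtcod h = L"
  using a by (simp_all add: Hom_iff)
 show "(h **\<^bsub>S\<^esub> g) **\<^bsub>S\<^esub> f = h **\<^bsub>S\<^esub> (g **\<^bsub>S\<^esub> f)"
  by (rule mnt.equality; simp; intro restrict_ext; simp add: Arr_S_simps[OF b(1)] Arr_S_simps[OF b(2)] Arr_S_simps[OF b(3)] b)
qed

end

section \<open>Combinatorics of shuffles\<close>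

text \<open>A shuffle is a lattice path with steps numbered from 0 and vertices from 0 to the number
  of steps; \<open>M\<close> is the set of steps in one of the two directions. Then
  \<open>cnt M x\<close> is the coordinate of the vertex \<open>x\<close> in that direction, which
  is also the monotone surjection realized by a string of degeneracies.\<close>

definition cnt :: "nat set => nat => nat" where
 "cnt M x = card (M Int {..<x})"

text \<open>The coface map: the increasing injection that omits the vertex \<open>k\<close>.\<close>

definition cof :: "nat => nat => nat" where
 "cof k x = (if x < k then x else Suc x)"

lemma cnt_0 [simp]: "cnt M 0 = 0"
 by (simp add: cnt_def)

lemma cnt_Suc: "cnt M (Suc x) = cnt M x + (if x \<in> M then 1 else 0)"
proof -
 have "M Int {..<Suc x} = (if x \<in> M then insert x (M Int {..<x}) else M Int {..<x})"
  by (auto simp: lessThan_Suc)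
 then show ?thesis by (simp add: cnt_def)
qed

lemma cnt_mono: "x <= y ==> cnt M x <= cnt M y"
 unfolding cnt_def by (rule card_mono) auto

lemma cnt_le: "cnt M x <= x"
 by (induction x) (auto simp: cnt_Suc)

lemma cnt_less: "[|y \<in> M; y < x|] ==> cnt M y < cnt M x"
 using cnt_mono[of "Suc y" x M] by (simp add: cnt_Suc)

lemma cnt_full: "M \<subseteq> {..<N} ==> cnt M N = card M"
 by (simp add: cnt_def Int_absorb2)

lemma cnt_le_card: "finite M ==> cnt M x <= card M"
 unfolding cnt_def by (rule card_mono) auto

lemma cnt_Un: "M Int M' = {} ==> cnt (M Un M') x = cnt M x + cnt M' x"
 by (simp add: cnt_def Int_Un_distrib2 card_Un_disjoint disjoint_iff)

lemma cnt_compl: "x <= N ==> cnt ({..<N} - M) x = x - cnt M x"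
proof -
 assume "x <= N"
 then have "{..<x} = ({..<N} - M) Int {..<x} Un M Int {..<x}" by auto
 then have "x = cnt ({..<N} - M) x + cnt M x"
  unfolding cnt_def by (metis (no_types, lifting) Diff_disjoint Int_Un_distrib2 Int_ac(3) card_Un_disjoint card_lessThan finite_Int finite_lessThan inf.assoc inf_bot_right)
 then show ?thesis by simp
qed

lemma cnt_eqI:
 assumes "!!y. y < x ==> y \<in> M \<longleftrightarrow> y \<in> M'" shows "cnt M x = cnt M' x"
proof -
 have "M Int {..<x} = M' Int {..<x}" using assms by auto
 then show ?thesis by (simp add: cnt_def)
qed

lemma cnt_inj_on: "inj_on (cnt M) M"
proof (rule inj_onI)
 fix x y assume "x \<in> M" "y \<in> M" "cnt M x = cnt M y"
 then show "x = y" using cnt_less[of x M y] cnt_less[of y M x] by (metis nat_neq_iff)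
qed

lemma cnt_bij: "finite M ==> bij_betw (cnt M) M {..<card M}"
proof -
 assume f: "finite M"
 have "cnt M ` M \<subseteq> {..<card M}"
 proof clarify
  fix x assume "x \<in> M"
  then have "M Int {..<x} \<subset> M" by auto
  then show "cnt M x < card M" using f by (simp add: cnt_def psubset_card_mono)
 qed
 then have "cnt M ` M = {..<card M}"
  using card_image[OF cnt_inj_on[of M]] by (intro card_subset_eq) auto
 then show ?thesis by (simp add: bij_betw_def cnt_inj_on)
qed

text \<open>On elements of \<open>P\<close> the function \<open>cnt P\<close> is strictly
  increasing, so the elements of \<open>M\<close> below \<open>x\<close> correspond to the
  renumbered ones below \<open>cnt P x\<close>. This is how composites of degeneracies are computed
  for nested shuffles.\<close>

lemma cnt_cnt:
 assumes "M \<subseteq> P" "finite P"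
 shows "cnt (cnt P ` M) (cnt P x) = cnt M x"
proof -
 have "cnt P z < cnt P x \<longleftrightarrow> z < x" if "z \<in> M" for z
  using that assms(1) cnt_less[of z P x] cnt_mono[of x z P] by (meson linorder_not_less subsetD)
 then have "cnt P ` M Int {..<cnt P x} = cnt P ` (M Int {..<x})" by auto
 moreover have "inj_on (cnt P) (M Int {..<x})" using cnt_inj_on[of P] assms(1) by (auto intro: inj_on_subset)
 ultimately show ?thesis by (simp add: cnt_def[of "cnt P ` M"] card_image) (simp add: cnt_def)
qed

section \<open>Shuffles and their signs\<close>

lemma finite_shuffle_sets [simp]: "finite (shuffle_sets p q)"
 by (rule finite_subset[of _ "Pow {..<p + q}"]) (auto simp: shuffle_sets_def)

lemma shuffle_compl: "M \<in> shuffle_sets p q ==> {..<p + q} - M \<in> shuffle_sets q p"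
 by (auto simp: shuffle_sets_def card_Diff_subset finite_subset add.commute)

lemma shuffle_compl_bij: "bij_betw (%M. {..<p + q} - M) (shuffle_sets p q) (shuffle_sets q p)"
 by (rule bij_betw_byWitness[where f' = "%M. {..<q + p} - M"])
   (use shuffle_compl[of _ p q] shuffle_compl[of _ q p] in "auto simp: shuffle_sets_def add.commute")

lemma shuffle_0_left [simp]: "shuffle_sets 0 q = {{}}"
 by (auto simp: shuffle_sets_def finite_subset)

lemma shuffle_0_right [simp]: "shuffle_sets p 0 = {{..<p}}"
 by (auto simp: shuffle_sets_def dest: card_subset_eq[rotated])

lemma inversions_empty [simp]: "inversions {} N = 0" "inversions M {} = 0"
 by (simp_all add: inversions_def)

lemma inversions_finite: "[|finite M; finite N|] ==> finite {(i, j). i \<in> M & j \<in> N & j < i}"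
 by (rule finite_subset[of _ "M \<times> N"]) auto

lemma inversions_Un_left:
 assumes "finite M" "finite M'" "finite N" "M Int M' = {}"
 shows "inversions (M Un M') N = inversions M N + inversions M' N"
proof -
 have "{(i, j). i \<in> M Un M' & j \<in> N & j < i} = {(i, j). i \<in> M & j \<in> N & j < i} Un {(i, j). i \<in> M' & j \<in> N & j < i}"
  by auto
 moreover have "{(i, j). i \<in> M & j \<in> N & j < i} Int {(i, j). i \<in> M' & j \<in> N & j < i} = {}"
  using assms by auto
 ultimately show ?thesis using assms by (simp add: inversions_def card_Un_disjoint inversions_finite)
qed

lemma inversions_Un_right:
 assumes "finite M" "finite N" "finite N'" "N Int N' = {}"
 shows "inversions M (N Un N') = inversions M N + inversions M N'"
proof -
 have "{(i, j). i \<in> M & j \<in> N Un N' & j < i} = {(i, j). i \<in> M & j \<in> N & j < i} Un {(i, j). i \<in> M & j \<in> N' & j < i}"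
  by auto
 moreover have "{(i, j). i \<in> M & j \<in> N & j < i} Int {(i, j). i \<in> M & j \<in> N' & j < i} = {}"
  using assms by auto
 ultimately show ?thesis using assms by (simp add: inversions_def card_Un_disjoint inversions_finite)
qed

text \<open>Inversions depend on the relative order only, and \<open>cnt P\<close> preserves the
  order of elements of \<open>P\<close>.\<close>

lemma inversions_image:
 assumes "M \<subseteq> P" "N \<subseteq> P" "finite P"
 shows "inversions (cnt P ` M) (cnt P ` N) = inversions M N"
proof -
 have lt: "cnt P j < cnt P i \<longleftrightarrow> j < i" if "i \<in> P" "j \<in> P" for i j
  using cnt_less[of j P i] cnt_mono[of i j P] that by (metis linorder_not_less)
 have "{(i, j). i \<in> cnt P ` M & j \<in> cnt P ` N & j < i} = map_prod (cnt P) (cnt P) ` {(i, j). i \<in> M & j \<in> N & j < i}"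
 proof (intro equalityI subsetI)
  fix z assume "z \<in> {(i, j). i \<in> cnt P ` M & j \<in> cnt P ` N & j < i}"
  then obtain i j where "z = (cnt P i, cnt P j)" "i \<in> M" "j \<in> N" "cnt P j < cnt P i" by auto
  then show "z \<in> map_prod (cnt P) (cnt P) ` {(i, j). i \<in> M & j \<in> N & j < i}"
   using lt[of i j] assms by (intro image_eqI[of _ _ "(i, j)"]) auto
 next
  fix z assume "z \<in> map_prod (cnt P) (cnt P) ` {(i, j). i \<in> M & j \<in> N & j < i}"
  then obtain i j where "z = (cnt P i, cnt P j)" "i \<in> M" "j \<in> N" "j < i" by auto
  then show "z \<in> {(i, j). i \<in> cnt P ` M & j \<in> cnt P ` N & j < i}"
   using lt[of i j] assms by auto
 qed
 moreover have "inj_on (map_prod (cnt P) (cnt P)) {(i, j). i \<in> M & j \<in> N & j < i}"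
  using map_prod_inj_on[OF cnt_inj_on[of P] cnt_inj_on[of P]] assms by (elim inj_on_subset) auto
 ultimately show ?thesis by (simp add: inversions_def card_image)
qed

text \<open>Two distinct numbers, one from each set, form an inversion for exactly one order of the
  two sets.\<close>

lemma inversions_swap:
 assumes "finite M" "finite N" "M Int N = {}"
 shows "inversions M N + inversions N M = card M * card N"
proof -
 have "M \<times> N = {(i, j). i \<in> M & j \<in> N & j < i} Un prod.swap ` {(i, j). i \<in> N & j \<in> M & j < i}"
  using assms(3) by (auto simp: image_iff disjoint_iff) (metis nat_neq_iff)
 moreover have "{(i, j). i \<in> M & j \<in> N & j < i} Int prod.swap ` {(i, j). i \<in> N & j \<in> M & j < i} = {}"
  by auto
 ultimately have "card (M \<times> N) = inversions M N + card (prod.swap ` {(i, j). i \<in> N & j \<in> M & j < i})"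
  using assms by (simp add: inversions_def card_Un_disjoint inversions_finite)
 also have "card (prod.swap ` {(i, j). i \<in> N & j \<in> M & j < i}) = inversions N M"
  by (simp add: inversions_def card_image)
 finally show ?thesis by (simp add: card_cartesian_product)
qed

text \<open>An element of \<open>M\<close> with r smaller elements in \<open>M\<close> has as many
  smaller elements outside \<open>M\<close> as its value exceeds r. Hence the sign of a shuffle can
  be read off from the sum of its elements, which is easy to follow under changes of the
  path.\<close>

lemma inversions_sum:
 assumes "finite M"
 shows "M \<subseteq> {..<N} ==> inversions M ({..<N} - M) + \<Sum>{..<card M} = \<Sum>M"
 using assms
proof (induction M rule: finite_linorder_max_induct)
 case (insert b M)
 have b: "b ~: M" "finite ({..<N} - insert b M)" using insert by auto
 have 1: "inversions M ({..<N} - M) = inversions M ({..<N} - insert b M)"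
 proof -
  have "{(i, j). i \<in> M & j \<in> {..<N} - M & j < i} = {(i, j). i \<in> M & j \<in> {..<N} - insert b M & j < i}"
   using insert.hyps by (auto dest: less_trans)
  then show ?thesis by (simp add: inversions_def)
 qed
 have "{(i, j). i \<in> {b} & j \<in> {..<N} - insert b M & j < i} = Pair b ` ({..<b} - M)"
  using insert.prems by auto
 then have "inversions {b} ({..<N} - insert b M) = card ({..<b} - M)"
  by (simp add: inversions_def card_image inj_on_def)
 also have "... = b - card M" using insert by (subst card_Diff_subset) auto
 finally have 2: "inversions {b} ({..<N} - insert b M) = b - card M" .
 have "card M <= b" using insert.hyps card_mono[of "{..<b}" M] by auto
 then show ?case
  using insert b inversions_Un_left[of "{b}" M "{..<N} - insert b M"] 1 2 by (simp add: lessThan_Suc)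
qed simp

section \<open>Omission of a vertex from a path\<close>

definition adj :: "nat => nat => nat set" where
 "adj N k = {x. x < N & (x = k | Suc x = k)}"

text \<open>The steps of the path from which the vertex \<open>k\<close> has been omitted: step
  \<open>k\<close> is deleted, or the last step if \<open>k = N\<close>, and later steps are
  renumbered. This describes a face of a shuffle term when the steps at the vertex, collected in
  \<open>adj N k\<close>, have the same direction.\<close>

definition contr :: "nat => nat => nat set => nat set" where
 "contr N k M = {x. Suc x < N & (if x < k then x \<in> M else Suc x \<in> M)}"

lemma contr_compl: "contr N k ({..<N} - M) = {..<N - 1} - contr N k M"
 by (auto simp: contr_def)

lemma contr_subset: "contr N k M \<subseteq> {..<N - 1}"
 by (auto simp: contr_def)

lemma contr_subset': "contr N k M \<subseteq> {..<N}"
 by (auto simp: contr_def)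

lemma cof_inj: "inj_on (cof k) A"
 by (auto simp: inj_on_def cof_def split: if_splits)

lemma cof_contr:
 assumes "M \<subseteq> {..<N}" "k <= N"
 shows "cof k ` contr N k M = M - {if k < N then k else N - 1}"
proof (intro Set.set_eqI iffI)
 fix y assume y: "y \<in> M - {if k < N then k else N - 1}"
 show "y \<in> cof k ` contr N k M"
 proof (cases "y < k")
  case True
  then show ?thesis using y assms by (intro image_eqI[of _ _ y]) (auto simp: contr_def cof_def split: if_splits)
 next
  case False
  then show ?thesis using y assms by (intro image_eqI[of _ _ "y - 1"]) (auto simp: contr_def cof_def split: if_splits)
 qed
qed (use assms in "auto simp: contr_def cof_def split: if_splits")

text \<open>Vertex \<open>x\<close> of the shortened path is vertex \<open>cof k x\<close> of the
  original one, where the deleted step has been passed in addition as soon as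
  \<open>k <= x\<close>.\<close>

lemma cnt_contr:
 assumes "M \<subseteq> {..<N}" "k <= N" "x < N"
 shows "cnt M (cof k x) = cnt (contr N k M) x + (if k <= x & k \<in> M then 1 else 0)"
 using assms(3)
proof (induction x)
 case 0
 then show ?case by (simp add: cof_def cnt_Suc)
next
 case (Suc x)
 then have IH: "cnt M (cof k x) = cnt (contr N k M) x + (if k <= x & k \<in> M then 1 else 0)" by simp
 consider "Suc x < k" | "Suc x = k" | "k <= x" by linarith
 then show ?case
 proof cases
  case 1
  then show ?thesis using IH Suc.prems by (auto simp: cof_def cnt_Suc contr_def)
 next
  case 2
  then show ?thesis using IH Suc.prems by (auto simp: cof_def cnt_Suc contr_def)
 next
  case 3
  then show ?thesis using IH Suc.prems by (auto simp: cof_def cnt_Suc[of M "Suc x"] cnt_Suc[of _ x] contr_def)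
 qed
qed

text \<open>The path does not move in the direction of \<open>M\<close> at the vertex
  \<open>k\<close>, so omitting this vertex only shortens the constant stretch of that
  coordinate.\<close>

lemma face_degeneracy_disjoint:
 assumes "M \<subseteq> {..<N}" "k <= N" "adj N k Int M = {}" "x < N"
 shows "cnt M (cof k x) = cnt (contr N k M) x"
 using cnt_contr[OF assms(1,2,4)] assms(3,4) by (auto simp: adj_def disjoint_iff)

text \<open>When the steps at vertex \<open>k\<close> all lie in \<open>M\<close>, the coordinate
  passes \<open>cnt M k\<close> at this vertex only. Omitting the vertex of the path therefore omits
  a vertex of the factor.\<close>

lemma face_degeneracy_subset:
 assumes "M \<subseteq> {..<N}" "k <= N" "adj N k \<subseteq> M" "x < N"
 shows "cnt M (cof k x) = cof (cnt M k) (cnt (contr N k M) x)"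
proof (cases "x < k")
 case True
 then have "k - 1 \<in> M" using assms by (auto simp: adj_def)
 then have "cnt M (k - 1) < cnt M k" using True cnt_less[of "k - 1" M k] by auto
 moreover have "cnt M x <= cnt M (k - 1)" using True cnt_mono[of x "k - 1" M] by auto
 ultimately show ?thesis using cnt_contr[OF assms(1,2,4)] True by (simp add: cof_def)
next
 case False
 then have "k \<in> M" using assms by (auto simp: adj_def)
 moreover have "cnt M (Suc k) <= cnt M (Suc x)" using False by (intro cnt_mono) auto
 ultimately show ?thesis using cnt_contr[OF assms(1,2,4)] False by (simp add: cof_def cnt_Suc[of M k])
qed

lemma card_contr_subset:
 assumes "M \<subseteq> {..<N}" "k <= N" "adj N k \<subseteq> M" "0 < N"
 shows "card (contr N k M) = card M - 1"
proof -
 have "(if k < N then k else N - 1) \<in> M" using assms by (auto simp: adj_def)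
 then show ?thesis
  using cof_contr[OF assms(1,2)] card_image[OF cof_inj[of k "contr N k M"]] by simp
qed

lemma card_contr_disjoint:
 assumes "M \<subseteq> {..<N}" "k <= N" "adj N k Int M = {}" "0 < N"
 shows "card (contr N k M) = card M"
proof -
 have "(if k < N then k else N - 1) ~: M" using assms by (auto simp: adj_def)
 then show ?thesis
  using cof_contr[OF assms(1,2)] card_image[OF cof_inj[of k "contr N k M"]] by simp
qed

text \<open>The map \<open>cof k\<close> raises by one exactly those elements that are not below
  \<open>k\<close>.\<close>

lemma sum_cof: "finite M ==> \<Sum>(cof k ` M) + cnt M k = \<Sum>M + card M"
proof (induction M rule: finite_induct)
 case (insert x M)
 have "cof k x ~: cof k ` M" using insert cof_inj[of k "insert x M"] by (auto simp: inj_on_def)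
 moreover have "cnt (insert x M) k = cnt M k + (if x < k then 1 else 0)"
  using insert by (simp add: cnt_def Int_insert_left)
 moreover have "cof k x = x + (if x < k then 0 else 1)" by (simp add: cof_def)
 moreover have "\<Sum>(cof k ` insert x M) = cof k x + \<Sum>(cof k ` M)" using calculation insert by simp
 ultimately show ?case using insert by (simp del: image_insert)
qed (simp add: cnt_def)

text \<open>Modulo 2 this says that the sign of \<open>M\<close> times (-1)^k is the sign of the
  contracted shuffle times (-1)^l with \<open>l\<close> the omitted vertex \<open>cnt M k\<close> of
  the factor. Both sides are compared through sums of elements.\<close>

lemma sign_face_subset:
 assumes "M \<subseteq> {..<N}" "k <= N" "adj N k \<subseteq> M" "0 < N"
 shows "inversions M ({..<N} - M) + cnt M k = inversions (contr N k M) ({..<N - 1} - contr N k M) + k"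
proof -
 let ?M = "contr N k M" and ?e = "if k < N then k else N - 1"
 have f: "finite M" "finite ?M" using assms(1) contr_subset[of N k M] finite_subset by auto
 have e: "?e \<in> M" using assms by (auto simp: adj_def)
 have "0 < card M" using e f by (auto simp only: card_gt_0_iff)
 then have c: "card M = Suc (card ?M)" using card_contr_subset[OF assms] by simp
 have s: "\<Sum>M = \<Sum>(cof k ` ?M) + ?e"
  using f e by (simp only: cof_contr[OF assms(1,2)] sum.remove[OF f(1) e])
 \<comment> \<open>At the last vertex the deleted step lies before \<open>k\<close> and is counted,
   whereas otherwise the deleted step is \<open>k\<close> itself.\<close>
 have n: "cnt M k = cnt ?M k + (if k < N then 0 else 1)"
 proof (cases "k < N")
  case True
  have "cnt M k = cnt ?M k" using True assms by (intro cnt_eqI) (auto simp: contr_def)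
  then show ?thesis using True by simp
 next
  case False
  then have "k = N" using assms by simp
  then show ?thesis using cnt_full[OF assms(1)] cnt_full[OF contr_subset'[of N k M]] c by auto
 qed
 have "cnt ?M k <= card ?M" using f cnt_le_card by blast
 then show ?thesis
  using inversions_sum[OF f(1) assms(1)] inversions_sum[OF f(2) contr_subset] s sum_cof[OF f(2), of k] n c assms
  by (auto simp: lessThan_Suc split: if_splits)
qed

text \<open>Here \<open>k - cnt M k\<close> is the vertex omitted in the other factor, and the
  surplus \<open>card M\<close> becomes the sign for moving the simplicial differential past the
  first factor.\<close>

lemma sign_face_disjoint:
 assumes "M \<subseteq> {..<N}" "k <= N" "adj N k Int M = {}" "0 < N"
 shows "inversions M ({..<N} - M) + cnt M k = inversions (contr N k M) ({..<N - 1} - contr N k M) + card M"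
proof -
 let ?M = "contr N k M"
 have f: "finite M" "finite ?M" using assms(1) contr_subset[of N k M] finite_subset by auto
 have e: "(if k < N then k else N - 1) ~: M" using assms by (auto simp: adj_def)
 have s: "M = cof k ` ?M" using e by (simp add: cof_contr[OF assms(1,2)])
 have n: "cnt M k = cnt ?M k"
 proof (cases "k < N")
  case False
  then have "k = N" using assms by simp
  then show ?thesis using cnt_full[OF assms(1)] cnt_full[OF contr_subset'[of N k M]] card_contr_disjoint[OF assms] by auto
 qed (use assms in "auto intro!: cnt_eqI simp: contr_def")
 have "\<Sum>M + cnt ?M k = \<Sum>?M + card ?M" using sum_cof[OF f(2), of k] s by simp
 then show ?thesis
  using inversions_sum[OF f(1) assms(1)] inversions_sum[OF f(2) contr_subset] n card_contr_disjoint[OF assms] by simp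
qed

text \<open>The three kinds of terms in the boundary of a shuffle: the steps before and after the omitted
 vertex \<open>k\<close> belong to the same factor, or to different ones. The latter terms cancel.\<close>

definition face_same :: "nat => nat => (nat \<times> nat set) set" where
 "face_same p q = {(k, M). k <= p + q & M \<in> shuffle_sets p q & adj (p + q) k \<subseteq> M}"

definition face_other :: "nat => nat => (nat \<times> nat set) set" where
 "face_other p q = {(k, M). k <= p + q & M \<in> shuffle_sets p q & adj (p + q) k Int M = {}}"

definition face_mixed1 :: "nat => nat => (nat \<times> nat set) set" where
 "face_mixed1 p q = {(k, M). 0 < k & k < p + q & M \<in> shuffle_sets p q & k \<in> M & k - 1 ~: M}"

definition face_mixed2 :: "nat => nat => (nat \<times> nat set) set" where
 "face_mixed2 p q = {(k, M). 0 < k & k < p + q & M \<in> shuffle_sets p q & k ~: M & k - 1 \<in> M}"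

text \<open>There is at least one step, so every vertex has an adjacent one and the first two kinds
  exclude each other. A vertex of neither kind is an inner one whose steps \<open>k - 1\<close> and
  \<open>k\<close> differ in direction, in one order or the other.\<close>

lemma face_partition:
 assumes "0 < p + q"
 shows "{..p + q} \<times> shuffle_sets p q = (face_same p q Un face_other p q) Un (face_mixed1 p q Un face_mixed2 p q)"
  "face_same p q Int face_other p q = {}" "face_mixed1 p q Int face_mixed2 p q = {}"
  "(face_same p q Un face_other p q) Int (face_mixed1 p q Un face_mixed2 p q) = {}"
proof -
 let ?t1 = "face_mixed1 p q Un face_mixed2 p q"
 let ?t2 = "face_same p q Un face_other p q"
 have ne: "adj (p + q) k ~= {}" if "k <= p + q" for k
  using assms that by (cases "k < p + q") (auto simp: adj_def intro!: exI[of _ "k - 1"])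
 have a: "x \<in> adj (p + q) k \<longleftrightarrow> x < p + q & (x = k | (0 < k & x = k - 1))" for x k by (auto simp: adj_def)
 show "face_same p q Int face_other p q = {}" using ne by (auto simp: face_same_def face_other_def)
 show "face_mixed1 p q Int face_mixed2 p q = {}" by (auto simp: face_mixed1_def face_mixed2_def)
 have m: "k - 1 \<in> adj (p + q) k" "k \<in> adj (p + q) k" if "0 < k" "k < p + q" for k using that by (auto simp: a)
 show "?t2 Int ?t1 = {}"
  using m unfolding face_same_def face_other_def face_mixed1_def face_mixed2_def by blast
 show "{..p + q} \<times> shuffle_sets p q = ?t2 Un ?t1"
 proof (intro Set.set_eqI iffI)
  fix z assume z: "z \<in> {..p + q} \<times> shuffle_sets p q"
  obtain k M where kM: "z = (k, M)" "k <= p + q" "M \<in> shuffle_sets p q" using z by auto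
  consider "adj (p + q) k \<subseteq> M" | "adj (p + q) k Int M = {}" | x y where "x \<in> adj (p + q) k" "x \<in> M" "y \<in> adj (p + q) k" "y ~: M"
   by blast
  then show "z \<in> ?t2 Un ?t1"
  proof cases
   case 3
   then have "(0 < k & k < p + q) & ((k \<in> M & k - 1 ~: M) | (k ~: M & k - 1 \<in> M))" using a by metis
   then show ?thesis using kM by (auto simp: face_mixed1_def face_mixed2_def)
  qed (use kM in "auto simp: face_same_def face_other_def")
 qed (auto simp: face_same_def face_other_def face_mixed1_def face_mixed2_def)
qed

lemma face_finite:
 assumes "0 < p + q"
 shows "finite (face_same p q)" "finite (face_other p q)" "finite (face_mixed1 p q)" "finite (face_mixed2 p q)"
proof -
 have "finite ({..p + q} \<times> shuffle_sets p q)" by simp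
 then show "finite (face_same p q)" "finite (face_other p q)" "finite (face_mixed1 p q)" "finite (face_mixed2 p q)"
  unfolding face_partition(1)[OF assms] by simp_all
qed

definition step_swap :: "nat => nat set => nat set" where
 "step_swap k M = insert (k - 1) (M - {k})"

lemma card_swap: "[|finite M; b \<in> M; a ~: M|] ==> card (insert a (M - {b})) = card M"
 by (metis Diff_iff card_Suc_Diff1 card_insert_disjoint finite_Diff)

lemma step_swap_bij: "bij_betw (%(k, M). (k, step_swap k M)) (face_mixed1 p q) (face_mixed2 p q)"
 by (rule bij_betw_byWitness[where f' = "%(k, M). (k, insert k (M - {k - 1}))"])
   (auto simp: face_mixed1_def face_mixed2_def step_swap_def shuffle_sets_def intro!: card_swap intro: finite_subset[OF _ finite_lessThan])

text \<open>Exchanging the two steps at a corner moves the path at the vertex \<open>k\<close> only,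
  and \<open>cof k\<close> skips that vertex.\<close>

lemma step_swap_cnt:
 assumes "(k, M) \<in> face_mixed1 p q"
 shows "cnt (step_swap k M) (cof k x) = cnt M (cof k x)"
  "cnt ({..<p + q} - step_swap k M) (cof k x) = cnt ({..<p + q} - M) (cof k x)"
proof -
 have k: "0 < k" "k \<in> M" "k - 1 ~: M" "k < p + q" using assms by (auto simp: face_mixed1_def)
 have *: "cnt Q (cof k x) = cnt R (cof k x)"
  if "!!y. y ~= k ==> y ~= k - 1 ==> y \<in> Q \<longleftrightarrow> y \<in> R" "k \<in> Q \<longleftrightarrow> k - 1 \<in> R" "k - 1 \<in> Q \<longleftrightarrow> k \<in> R" for Q R
 proof (induction x)
  case 0
  then show ?case using k by (simp add: cof_def)
 next
  case (Suc x)
  consider "Suc x < k" | "Suc x = k" | "k <= x" by linarith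
  then show ?case
  proof cases
   case 1
   then show ?thesis using Suc that(1)[of x] by (auto simp: cof_def cnt_Suc)
  next
   case 2
   then show ?thesis using Suc that(2,3) by (auto simp: cof_def cnt_Suc)
  next
   case 3
   then show ?thesis using Suc that(1)[of "Suc x"] by (auto simp: cof_def cnt_Suc[of _ "Suc x"])
  qed
 qed
 show "cnt (step_swap k M) (cof k x) = cnt M (cof k x)"
  by (rule *) (use k in "auto simp: step_swap_def")
 show "cnt ({..<p + q} - step_swap k M) (cof k x) = cnt ({..<p + q} - M) (cof k x)"
  by (rule *) (use k in "auto simp: step_swap_def")
qed

text \<open>The sum of the elements drops by one, so by \<open>inversions_sum\<close> the number of
  inversions does too, and the flipped path has the opposite sign.\<close>

lemma step_swap_sign:
 assumes "(k, M) \<in> face_mixed1 p q"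
 shows "inversions M ({..<p + q} - M) = Suc (inversions (step_swap k M) ({..<p + q} - step_swap k M))"
proof -
 have k: "0 < k" "k \<in> M" "k - 1 ~: M" "k < p + q" "M \<subseteq> {..<p + q}" using assms by (auto simp: face_mixed1_def shuffle_sets_def)
 have f: "finite M" using k finite_subset by auto
 have s: "step_swap k M \<subseteq> {..<p + q}" "finite (step_swap k M)" using k f by (auto simp: step_swap_def)
 have c: "card (step_swap k M) = card M" unfolding step_swap_def using k f by (intro card_swap)
 have "\<Sum>M = Suc (\<Sum>(step_swap k M))" using k f by (simp add: step_swap_def sum.remove[OF f k(2)])
 then show ?thesis using inversions_sum[OF f k(5)] inversions_sum[OF s(2,1)] c by simp
qed

text \<open>From a vertex \<open>l\<close> of the factor and a shortened path \<open>R\<close> the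
  original is recovered by inserting one more step of the first direction where \<open>R\<close> has
  taken \<open>l\<close> such steps. There may be several such vertices; the condition on adjacent
  steps singles one out.\<close>

lemma face_same_bij:
 assumes "0 < p"
 shows "bij_betw (%(k, M). (cnt M k, contr (p + q) k M)) (face_same p q) ({..p} \<times> shuffle_sets (p - 1) q)"
proof -
 let ?N = "p + q" and ?f = "%(k, M). (cnt M k, contr (p + q) k M)"
 have N: "0 < ?N" "p - 1 + q = ?N - 1" using assms by auto
 have m: "M \<subseteq> {..<?N}" "card M = p" "k <= ?N" "adj ?N k \<subseteq> M" if "(k, M) \<in> face_same p q" for k M
  using that by (auto simp: face_same_def shuffle_sets_def)
 have "inj_on ?f (face_same p q)"
 proof -
  \<comment> \<open>The path of the larger vertex \<open>k'\<close> has its step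
    \<open>k' - 1\<close> in \<open>M'\<close>, so its coordinate at \<open>k'\<close> exceeds the
    coordinate there of the shortened path at \<open>k' - 1\<close>, which is at least the one
    reached at \<open>k\<close>.\<close>
  have *: False if a: "(k, M) \<in> face_same p q" "(k', M') \<in> face_same p q" "cnt M k = cnt M' k'"
   "contr ?N k M = contr ?N k' M'" "k < k'" for k k' M M'
  proof -
   have "k' - 1 \<in> M'" using m[OF a(2)] a(5) by (auto simp: adj_def)
   then have "cnt M' (k' - 1) < cnt M' k'" using a(5) by (intro cnt_less) auto
   moreover have "cnt M' (k' - 1) = cnt (contr ?N k' M') (k' - 1)"
    using m[OF a(2)] by (intro cnt_eqI) (auto simp: contr_def)
   moreover have "cnt (contr ?N k M) k = cnt M k"
    using m[OF a(1)] m[OF a(2)] a(5) by (intro cnt_eqI) (auto simp: contr_def)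
   moreover have "cnt (contr ?N k M) k <= cnt (contr ?N k M) (k' - 1)" using a(5) by (intro cnt_mono) auto
   ultimately show False using a(3,4) by simp
  qed
  have **: "M = M'" if a: "(k, M) \<in> face_same p q" "(k, M') \<in> face_same p q" "contr ?N k M = contr ?N k M'" for k M M'
  proof -
   let ?e = "if k < ?N then k else ?N - 1"
   have "?e \<in> M" "?e \<in> M'" using m[OF a(1)] m[OF a(2)] N by (auto simp: adj_def)
   then show ?thesis using cof_contr[OF m(1,3)[OF a(1)]] cof_contr[OF m(1,3)[OF a(2)]] a(3) by auto
  qed
  show ?thesis
   by (rule inj_onI, clarsimp) (metis * ** nat_neq_iff)
 qed
 moreover have "?f ` face_same p q = {..p} \<times> shuffle_sets (p - 1) q"
 proof (intro equalityI subsetI)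
  fix z assume "z \<in> ?f ` face_same p q"
  then obtain k M where z: "z = (cnt M k, contr ?N k M)" "(k, M) \<in> face_same p q" by auto
  have "cnt M k <= p" using cnt_le_card[of M k] m[OF z(2)] finite_subset by auto
  then show "z \<in> {..p} \<times> shuffle_sets (p - 1) q"
   using card_contr_subset[OF m(1,3,4)[OF z(2)] N(1)] m(2)[OF z(2)] contr_subset[of ?N k M] N(2) z(1)
   by (auto simp: shuffle_sets_def)
 next
  fix z assume "z \<in> {..p} \<times> shuffle_sets (p - 1) q"
  then obtain l R where z: "z = (l, R)" "l <= p" "R \<subseteq> {..<?N - 1}" "card R = p - 1"
   using N(2) by (auto simp: shuffle_sets_def)
  have fR: "finite R" using z finite_subset by auto
  \<comment> \<open>The vertex is the start for \<open>l = 0\<close>, the end for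
    \<open>l = p\<close>, and otherwise the one directly behind the element of \<open>R\<close> with
    \<open>l - 1\<close> predecessors in \<open>R\<close>.\<close>
  have "EX k <= ?N. (k = 0 | k - 1 \<in> R | k = ?N) & (if k = ?N then l = p else cnt R k = l)"
  proof -
   consider "l = p" | "l = 0" "l ~= p" | "0 < l" "l < p" using z(2) by linarith
   then show ?thesis
   proof cases
    case 2
    then show ?thesis using N by (intro exI[of _ 0]) auto
   next
    case 3
    then have "l - 1 \<in> cnt R ` R" using cnt_bij[OF fR] z(4) by (auto simp: bij_betw_def)
    then obtain y where y: "y \<in> R" "cnt R y = l - 1" by auto
    then have "Suc y < ?N" using z(3) by auto
    then show ?thesis using y 3 by (intro exI[of _ "Suc y"]) (auto simp: cnt_Suc)
   qed auto
  qed
  then obtain k where k: "k <= ?N" "k = 0 | k - 1 \<in> R | k = ?N" "if k = ?N then l = p else cnt R k = l" by blast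
  \<comment> \<open>The inserted step is \<open>k\<close>, or the last one if the insertion happens
    at the end of the path.\<close>
  define e where "e = (if k < ?N then k else ?N - 1)"
  define M where "M = insert e (cof k ` R)"
  have Rlt: "x < ?N - 1" if "x \<in> R" for x using z(3) that by auto
  have e: "e ~: cof k ` R" using Rlt by (force simp: e_def cof_def split: if_splits)
  have M: "M \<subseteq> {..<?N}" "card M = p"
   using Rlt N e fR z(4) assms by (fastforce simp: M_def e_def cof_def, simp add: M_def card_image[OF cof_inj])
  have kM: "(k, M) \<in> face_same p q"
  proof -
   have "x \<in> M" if "x \<in> adj ?N k" for x
   proof (cases "x = e")
    case False
    then have "Suc x = k" "k < ?N" using that by (auto simp: adj_def e_def split: if_splits)
    then have "x \<in> R" "cof k x = x" using k(2) by (auto simp: cof_def)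
    then show ?thesis unfolding M_def by (metis image_eqI insertI2)
   qed (simp add: M_def)
   then show ?thesis using M k by (auto simp: face_same_def shuffle_sets_def)
  qed
  have "cof k ` contr ?N k M = cof k ` R"
   using cof_contr[OF M(1) k(1)] e by (auto simp: e_def[symmetric] M_def)
  then have c: "contr ?N k M = R"
   using inj_on_image_eq_iff[OF cof_inj[of k UNIV]] by auto
  have "cnt M k = l"
  proof (cases "k = ?N")
   case True
   then show ?thesis using k(3) cnt_full[OF M(1)] M(2) by simp
  next
   case False
   have "cnt M k = cnt (contr ?N k M) k" using False k(1) M(1) by (intro cnt_eqI) (auto simp: contr_def)
   then show ?thesis using False k(3) c by simp
  qed
  then show "z \<in> ?f ` face_same p q" using kM c z(1) by force
 qed
 ultimately show ?thesis by (simp add: bij_betw_def)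
qed

lemma face_same_empty: "0 < q ==> face_same 0 q = {}"
 by (auto simp: face_same_def adj_def) (metis Suc_pred less_or_eq_imp_le linorder_neqE_nat lessI not_less_zero less_Suc_eq_le order_le_less)

text \<open>Complementation exchanges the two directions of the path and leaves the vertex
  alone.\<close>

lemma face_other_bij:
 "bij_betw (%(k, M). (k, {..<p + q} - M)) (face_other p q) (face_same q p)"
proof -
 have a: "adj (p + q) k \<subseteq> {..<p + q}" for k by (auto simp: adj_def)
 show ?thesis
  by (rule bij_betw_byWitness[where f' = "%(k, M). (k, {..<p + q} - M)"])
   (use a shuffle_compl[of _ p q] shuffle_compl[of _ q p] in
    \<open>auto simp: face_other_def face_same_def add.commute[of q p] shuffle_sets_def\<close>)
qed

text \<open>Paths with three directions, given by the steps in the first two. They index both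
  bracketings of a triple product, which is the combinatorial content of associativity.\<close>

definition double_shuffles :: "nat => nat => nat => (nat set \<times> nat set) set" where
 "double_shuffles p q r = {(M, N). M \<subseteq> {..<p + q + r} & N \<subseteq> {..<p + q + r} & M Int N = {} & card M = p & card N = q}"

lemma cnt_image_sub:
 assumes "finite P" shows "inj_on ((`) (cnt P)) (Pow P)" "(`) (cnt P) ` Pow P = Pow {..<card P}"
 using cnt_bij[OF assms] by (auto simp: bij_betw_def inj_on_image_Pow image_Pow_surj)

text \<open>The first two directions are merged, and their order is remembered after renumbering the
  merged steps. The inverse uses that \<open>cnt P\<close> is a bijection from \<open>P\<close> onto
  an initial segment.\<close>

lemma double_shuffles_left:
 "bij_betw (%(M, N). (M Un N, cnt (M Un N) ` M)) (double_shuffles p q r) (shuffle_sets (p + q) r \<times> shuffle_sets p q)"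
proof -
 let ?f = "%(M, N). (M Un N, cnt (M Un N) ` M)"
 have fin: "finite M" "finite N" if "(M, N) \<in> double_shuffles p q r" for M N
  using that finite_subset by (auto simp: double_shuffles_def)
 have "inj_on ?f (double_shuffles p q r)"
 proof (rule inj_onI, clarsimp)
  fix M N M' N' assume a: "(M, N) \<in> double_shuffles p q r" "(M', N') \<in> double_shuffles p q r" "M Un N = M' Un N'"
   "cnt (M' Un N') ` M = cnt (M' Un N') ` M'"
  have "M = M'"
   using inj_onD[OF cnt_image_sub(1)[of "M' Un N'"] a(4)] fin[OF a(2)] a(3) by auto
  then show "M = M' & N = N'" using a by (auto simp: double_shuffles_def)
 qed
 moreover have "?f ` double_shuffles p q r = shuffle_sets (p + q) r \<times> shuffle_sets p q"
 proof (intro equalityI subsetI)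
  fix z assume "z \<in> ?f ` double_shuffles p q r"
  then obtain M N where z: "z = (M Un N, cnt (M Un N) ` M)" "(M, N) \<in> double_shuffles p q r" by auto
  have "card (M Un N) = p + q" using z(2) fin[OF z(2)] by (auto simp: double_shuffles_def card_Un_disjoint)
  moreover have "card (cnt (M Un N) ` M) = p"
   using z(2) cnt_inj_on[of "M Un N"] by (subst card_image) (auto simp: double_shuffles_def intro: inj_on_subset)
  moreover have "cnt (M Un N) ` M \<subseteq> {..<card (M Un N)}"
   using cnt_bij[of "M Un N"] fin[OF z(2)] by (auto simp: bij_betw_def)
  ultimately show "z \<in> shuffle_sets (p + q) r \<times> shuffle_sets p q"
   using z by (auto simp: shuffle_sets_def double_shuffles_def)
 next
  fix z assume "z \<in> shuffle_sets (p + q) r \<times> shuffle_sets p q"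
  then obtain P Q where z: "z = (P, Q)" "P \<subseteq> {..<p + q + r}" "card P = p + q" "Q \<subseteq> {..<p + q}" "card Q = p"
   by (auto simp: shuffle_sets_def)
  have fP: "finite P" using z finite_subset by auto
  then obtain M where M: "M \<subseteq> P" "Q = cnt P ` M"
   using cnt_image_sub(2)[OF fP] z(3,4) by (metis Pow_iff imageE)
  have "card M = p" using M z(5) cnt_inj_on[of P] by (metis card_image inj_on_subset)
  then have "(M, P - M) \<in> double_shuffles p q r"
   using M z fP by (auto simp: double_shuffles_def card_Diff_subset finite_subset)
  moreover have "M Un (P - M) = P" using M by auto
  ultimately show "z \<in> ?f ` double_shuffles p q r"
   using M(2) z(1) by (intro image_eqI[of _ _ "(M, P - M)"]) (simp_all only: split)
 qed
 ultimately show ?thesis by (simp add: bij_betw_def)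
qed

text \<open>The other bracketing: the last two directions are merged, and the second is renumbered
  within the complement of the first.\<close>

lemma double_shuffles_right:
 "bij_betw (%(M, N). (M, cnt ({..<p + q + r} - M) ` N)) (double_shuffles p q r) (shuffle_sets p (q + r) \<times> shuffle_sets q r)"
proof -
 let ?U = "{..<p + q + r}"
 let ?f = "%(M, N). (M, cnt (?U - M) ` N)"
 have "inj_on ?f (double_shuffles p q r)"
 proof (rule inj_onI, clarsimp)
  fix M N N' assume a: "(M, N) \<in> double_shuffles p q r" "(M, N') \<in> double_shuffles p q r"
   "cnt (?U - M) ` N = cnt (?U - M) ` N'"
  then show "N = N'"
   by (intro inj_onD[OF cnt_image_sub(1)[of "?U - M"] a(3)]) (auto simp: double_shuffles_def)
 qed
 moreover have "?f ` double_shuffles p q r = shuffle_sets p (q + r) \<times> shuffle_sets q r"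
 proof (intro equalityI subsetI)
  fix z assume "z \<in> ?f ` double_shuffles p q r"
  then obtain M N where z: "z = (M, cnt (?U - M) ` N)" "(M, N) \<in> double_shuffles p q r" by auto
  have N: "N \<subseteq> ?U - M" using z(2) by (auto simp: double_shuffles_def)
  have M: "M \<subseteq> ?U" "card M = p" using z(2) by (auto simp: double_shuffles_def)
  have c: "card (?U - M) = q + r"
   using card_Diff_subset[OF finite_subset[OF M(1)] M(1)] M(2) by simp
  have "card (cnt (?U - M) ` N) = q"
   using z(2) cnt_inj_on[of "?U - M"] N by (subst card_image) (auto simp: double_shuffles_def intro: inj_on_subset)
  moreover have "cnt (?U - M) ` N \<subseteq> {..<q + r}"
   using cnt_bij[of "?U - M"] N c by (auto simp: bij_betw_def)
  ultimately show "z \<in> shuffle_sets p (q + r) \<times> shuffle_sets q r"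
   using z by (auto simp: shuffle_sets_def double_shuffles_def add.assoc)
 next
  fix z assume "z \<in> shuffle_sets p (q + r) \<times> shuffle_sets q r"
  then obtain M Q where z: "z = (M, Q)" "M \<subseteq> ?U" "card M = p" "Q \<subseteq> {..<q + r}" "card Q = q"
   by (auto simp: shuffle_sets_def add.assoc)
  have c: "card (?U - M) = q + r"
   using card_Diff_subset[OF finite_subset[OF z(2)] z(2)] z(3) by simp
  obtain N where N: "N \<subseteq> ?U - M" "Q = cnt (?U - M) ` N"
   using cnt_image_sub(2)[of "?U - M"] z(4) c by (metis Pow_iff imageE finite_Diff finite_lessThan)
  have "card N = q" using N z(5) cnt_inj_on[of "?U - M"] by (metis card_image inj_on_subset)
  then have "(M, N) \<in> double_shuffles p q r" using N z by (auto simp: double_shuffles_def)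
  then show "z \<in> ?f ` double_shuffles p q r"
   using N(2) z(1) by (intro image_eqI[of _ _ "(M, N)"]) (simp_all only: split)
 qed
 ultimately show ?thesis by (simp add: bij_betw_def)
qed

section \<open>Simplicial operators of the standard construction\<close>

text \<open>Arrows of the simplex category, from the vertices 0 to \<open>m\<close> to the vertices
  0 to \<open>n\<close>; values beyond \<open>m\<close> are irrelevant.\<close>

definition smono :: "nat => nat => (nat => nat) => bool" where
 "smono m n sg \<longleftrightarrow> (ALL x<=m. sg x <= n) & (ALL x y. x <= y --> y <= m --> sg x <= sg y)"

lemma smono_comp: "[|smono m n sg; smono l m ph|] ==> smono l n (%x. sg (ph x))"
 by (simp add: smono_def)

lemma smono_cof: "0 < n ==> smono (n - 1) n (cof i)"
 by (auto simp: smono_def cof_def)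

lemma smono_cnt: "M \<subseteq> {..<N} ==> smono m (card M) (cnt M)"
 by (auto simp: smono_def cnt_mono finite_subset intro!: cnt_le_card)

text \<open>A monotone map is encoded by the sizes of its initial inverse images; composition becomes
 composition of these functions in the opposite order.\<close>
definition dual :: "nat => (nat => nat) => nat => nat" where
 "dual m sg j = card {x. x <= m & sg x < j}"

text \<open>The inverse image of an initial segment under a monotone map is an initial segment, so
  its size determines it. This is a Galois connection, and composition reverses.\<close>

lemma dual_iff:
 assumes "smono m n sg" "x <= m"
 shows "sg x < j \<longleftrightarrow> x < dual m sg j"
proof
 assume "sg x < j"
 then have "{..x} \<subseteq> {x. x <= m & sg x < j}" using assms by (auto simp: smono_def intro: order_le_less_trans)
 then have "card {..x} <= dual m sg j" unfolding dual_def by (intro card_mono) auto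
 then show "x < dual m sg j" by simp
next
 assume a: "x < dual m sg j"
 show "sg x < j"
 proof (rule ccontr)
  assume n: "~ sg x < j"
  have "{y. y <= m & sg y < j} \<subseteq> {..<x}"
  proof
   fix y assume "y \<in> {y. y <= m & sg y < j}"
   then have "y <= m" "sg y < j" by auto
   moreover have "sg x <= sg y" if "x <= y" using assms that \<open>y <= m\<close> by (simp add: smono_def)
   ultimately show "y \<in> {..<x}" using n by (cases "x <= y") auto
  qed
  then have "dual m sg j <= x" unfolding dual_def using card_mono[of "{..<x}"] by fastforce
  then show False using a by simp
 qed
qed

lemma dual_comp:
 assumes "smono m n sg" "smono l m ph"
 shows "dual l (%x. sg (ph x)) j = dual l ph (dual m sg j)"
proof -
 have "{x. x <= l & sg (ph x) < j} = {x. x <= l & ph x < dual m sg j}"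
  using dual_iff[OF assms(1)] assms(2) by (auto simp: smono_def)
 then show ?thesis by (simp add: dual_def)
qed

lemma dual_cong: "(!!x. x <= m ==> sg x = \<tau> x) ==> dual m sg = dual m \<tau>"
 unfolding dual_def by (intro ext arg_cong[where f = card]) auto

lemma dual_0 [simp]: "dual m sg 0 = 0"
 by (simp add: dual_def)

lemma dual_full: "smono m n sg ==> dual m sg (Suc n) = Suc m"
proof -
 assume "smono m n sg"
 then have "{x. x <= m & sg x < Suc n} = {..m}" by (auto simp: smono_def less_Suc_eq_le)
 then show ?thesis by (simp add: dual_def)
qed

lemma dual_mono: "j <= k ==> dual m sg j <= dual m sg k"
 unfolding dual_def by (rule card_mono) auto

lemma dual_eqI: "(!!x. x <= m ==> sg x < j \<longleftrightarrow> x < c) ==> c <= Suc m ==> dual m sg j = c"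
proof -
 assume "!!x. x <= m ==> sg x < j \<longleftrightarrow> x < c" "c <= Suc m"
 then have "{x. x <= m & sg x < j} = {..<c}" by auto
 then show ?thesis by (simp add: dual_def)
qed

definition codeg :: "nat => nat => nat" where
 "codeg i x = (if x <= i then x else x - 1)"

lemma smono_codeg: "i <= n ==> smono (Suc n) n (codeg i)"
 by (auto simp: smono_def codeg_def)

lemma dual_cof: "[|0 < n; i <= n; j <= Suc n|] ==> dual (n - 1) (cof i) j = (if j <= i then j else j - 1)"
 by (rule dual_eqI) (auto simp: cof_def)

lemma dual_codeg: "[|i <= n; j <= Suc n|] ==> dual (Suc n) (codeg i) j = (if j <= i then j else Suc j)"
 by (rule dual_eqI) (auto simp: codeg_def)

text \<open>A simplicial object extended to a contravariant functor on all monotone maps. Simplicial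
  identities then become equalities of functions on finitely many numbers.\<close>

locale simplicial = category S for S :: "('o,'a,'z) cat_scheme" (structure) +
 fixes B :: "('o,'a) simp" and opr :: "nat => nat => (nat => nat) => 'a"
 assumes sob: "sob B n : Obj S"
  and opr_Hom: "smono m n sg ==> opr n m sg : Hom S (sob B n) (sob B m)"
  and opr_comp: "[|smono m n sg; smono l m ph|] ==> opr m l ph ** opr n m sg = opr n l (%x. sg (ph x))"
  and opr_cong: "(!!x. x <= m ==> sg x = \<tau> x) ==> opr n m sg = opr n m \<tau>"
  and opr_id: "opr n n (%x. x) = Idt S (sob B n)"
  and face: "[|0 < n; i <= n|] ==> face B n i = opr n (n - 1) (cof i)"
  and dgn: "i <= n ==> dgn B n i = opr n (Suc n) (codeg i)"
begin

text \<open>Degenerating along an increasing list collapses exactly the listed steps, so the vertex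
  \<open>x\<close> goes to the number of steps below it that are not listed.\<close>

lemma degs_opr:
 "[|sorted is; distinct is; set is \<subseteq> {..<p + length is}|]
  ==> degs S B p is = opr p (p + length is) (%x. x - cnt (set is) x)"
proof (induction "is" arbitrary: p)
 case Nil
 then show ?case by (simp add: cnt_def opr_id)
next
 case (Cons i "is")
 have lt: "i < j" if "j \<in> set is" for j using Cons.prems that by (auto simp: order_less_le)
 \<comment> \<open>The listed numbers all lie between \<open>i\<close> and
   \<open>p + length (i # is)\<close>; counting them gives \<open>i <= p\<close>, which is needed
   for the first degeneracy to make sense.\<close>
 have "card (set (i # is)) <= card {i..<p + length (i # is)}"
  using Cons.prems lt by (intro card_mono) (auto simp: order_less_le)
 moreover have "card (set (i # is)) = Suc (length is)" using Cons.prems(2) distinct_card by fastforce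
 ultimately have i: "i <= p" using Cons.prems(3) by auto
 let ?sg = "%M x. x - cnt M x"
 have cw: "cnt (set is) x <= x - Suc i" for x
 proof -
  have "set is Int {..<x} \<subseteq> {i<..<x}" using lt by auto
  then have "card (set is Int {..<x}) <= card {i<..<x}" by (intro card_mono) auto
  then show ?thesis by (simp add: cnt_def)
 qed
 have m: "smono (Suc p + length is) (Suc p) (?sg (set is))"
 proof -
  have c: "cnt (set is) (Suc p + length is) = length is"
   using Cons.prems cnt_full[of "set is" "Suc p + length is"] by (auto simp: distinct_card)
  have s: "?sg (set is) x <= ?sg (set is) (Suc x)" for x
   using cnt_le[of "set is" x] by (auto simp: cnt_Suc)
  then have "?sg (set is) x <= ?sg (set is) y" if "x <= y" for x y
   using lift_Suc_mono_le[of "?sg (set is)"] that by blast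
  then show ?thesis unfolding smono_def using c by (metis add_diff_cancel_right')
 qed
 have "degs S B p (i # is) = opr (Suc p) (Suc p + length is) (?sg (set is)) ** opr p (Suc p) (codeg i)"
  using Cons.IH[of "Suc p"] Cons.prems i by (simp add: dgn)
 also have "... = opr p (Suc p + length is) (%x. codeg i (?sg (set is) x))"
  by (rule opr_comp[OF smono_codeg[OF i] m])
 also have "... = opr p (p + length (i # is)) (?sg (set (i # is)))"
 proof (simp, rule opr_cong)
  fix x
  have "i ~: set is" using Cons.prems by auto
  then have "cnt (insert i (set is)) x = cnt (set is) x + (if i < x then 1 else 0)"
   using cnt_Un[of "set is" "{i}" x] by (simp add: cnt_def Int_insert_left)
  then show "codeg i (?sg (set is) x) = ?sg (insert i (set is)) x"
   using cw[of x] by (auto simp: codeg_def)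
 qed
 finally show ?case .
qed

text \<open>Collapsing the steps outside \<open>M\<close> leaves the coordinate in direction
  \<open>M\<close>, and conversely.\<close>

lemma degs_shuffle:
 assumes "M \<in> shuffle_sets p q"
 shows "degs S B p (sorted_list_of_set ({..<p + q} - M)) = opr p (p + q) (cnt M)"
  "degs S B q (sorted_list_of_set M) = opr q (p + q) (cnt ({..<p + q} - M))"
proof -
 have M: "M \<subseteq> {..<p + q}" "card M = p" "finite M" using assms finite_subset by (auto simp: shuffle_sets_def)
 have c: "card ({..<p + q} - M) = q" using M by (simp add: card_Diff_subset)
 have "degs S B p (sorted_list_of_set ({..<p + q} - M)) = opr p (p + q) (%x. x - cnt ({..<p + q} - M) x)"
  using degs_opr[of "sorted_list_of_set ({..<p + q} - M)" p] M c by auto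
 also have "... = opr p (p + q) (cnt M)"
  by (rule opr_cong) (simp add: cnt_compl cnt_le)
 finally show "degs S B p (sorted_list_of_set ({..<p + q} - M)) = opr p (p + q) (cnt M)" .
 have "degs S B q (sorted_list_of_set M) = opr q (q + p) (%x. x - cnt M x)"
  using degs_opr[of "sorted_list_of_set M" q] M by (auto simp: add.commute)
 also have "... = opr q (p + q) (cnt ({..<p + q} - M))"
  unfolding add.commute[of q p] by (rule opr_cong) (simp add: cnt_compl)
 finally show "degs S B q (sorted_list_of_set M) = opr q (p + q) (cnt ({..<p + q} - M))" .
qed

end

section \<open>Functoriality of the standard construction in monotone maps\<close>

locale cotriple_category = category S for S :: "('o,'a,'z) cat_scheme" (structure) +
 fixes G :: "('o,'a) cotriple"
 assumes G: "is_cotriple S G"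
begin

abbreviation "Go \<equiv> fo (ctF G)"
abbreviation "Ga \<equiv> fa (ctF G)"

lemma G_simps [simp]:
 "K : Obj S ==> Go K : Obj S" "f : Arr S ==> Ga f : Arr S"
 "f : Arr S ==> Dom S (Ga f) = Go (Dom S f)" "f : Arr S ==> Cod S (Ga f) = Go (Cod S f)"
 "K : Obj S ==> Ga (Idt S K) = Idt S (Go K)"
 "[|f : Arr S; g : Arr S; Cod S f = Dom S g|] ==> Ga (g ** f) = Ga g ** Ga f"
 using G by (auto simp: is_cotriple_def Let_def is_functor_def PiE_iff)

lemma counit_simps [simp]:
 assumes "K : Obj S"
 shows "cte G K : Arr S" "Dom S (cte G K) = Go K" "Cod S (cte G K) = K"
  "ctd G K : Arr S" "Dom S (ctd G K) = Go K" "Cod S (ctd G K) = Go (Go K)"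
  "cte G (Go K) ** ctd G K = Idt S (Go K)" "Ga (cte G K) ** ctd G K = Idt S (Go K)"
 using G assms by (auto simp: is_cotriple_def Let_def Hom_iff)

lemma coassoc: "K : Obj S ==> ctd G (Go K) ** ctd G K = Ga (ctd G K) ** ctd G K"
 using G by (auto simp: is_cotriple_def Let_def)

lemma cte_nat: "f : Arr S ==> cte G (Cod S f) ** Ga f = f ** cte G (Dom S f)"
 and ctd_nat: "f : Arr S ==> ctd G (Cod S f) ** Ga f = Ga (Ga f) ** ctd G (Dom S f)"
 using G by (auto simp: is_cotriple_def Let_def)

lemma Gpow_simps [simp]:
 "K : Obj S ==> (Go ^^ n) K : Obj S" "f : Arr S ==> (Ga ^^ n) f : Arr S"
 "f : Arr S ==> Dom S ((Ga ^^ n) f) = (Go ^^ n) (Dom S f)" "f : Arr S ==> Cod S ((Ga ^^ n) f) = (Go ^^ n) (Cod S f)"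
 "K : Obj S ==> (Ga ^^ n) (Idt S K) = Idt S ((Go ^^ n) K)"
 "[|f : Arr S; g : Arr S; Cod S f = Dom S g|] ==> (Ga ^^ n) (g ** f) = (Ga ^^ n) g ** (Ga ^^ n) f"
proof -
 show O: "K : Obj S ==> (Go ^^ n) K : Obj S" for n K by (induction n) auto
 show A: "(Ga ^^ n) f : Arr S" "Dom S ((Ga ^^ n) f) = (Go ^^ n) (Dom S f)" "Cod S ((Ga ^^ n) f) = (Go ^^ n) (Cod S f)"
  if "f : Arr S" for f n using that by (induction n) auto
 show "K : Obj S ==> (Ga ^^ n) (Idt S K) = Idt S ((Go ^^ n) K)" for K by (induction n) (auto simp: O)
 show "[|f : Arr S; g : Arr S; Cod S f = Dom S g|] ==> (Ga ^^ n) (g ** f) = (Ga ^^ n) g ** (Ga ^^ n) f"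
  by (induction n) (auto simp: A)
qed

lemma Go_pow: "Go ((Go ^^ n) K) = (Go ^^ Suc n) K" "(Go ^^ n) (Go K) = (Go ^^ Suc n) K"
 "(Go ^^ m) ((Go ^^ n) K) = (Go ^^ (m + n)) K"
 by (simp, simp add: funpow_swap1, simp add: funpow_add)

lemma Ga_pow: "(Ga ^^ m) ((Ga ^^ n) f) = (Ga ^^ (m + n)) f" "(Ga ^^ n) (Ga f) = (Ga ^^ Suc n) f"
 by (simp add: funpow_add, simp add: funpow_swap1)

text \<open>The comultiplication with \<open>k\<close> outputs, from \<open>G\<close> to its
  \<open>k\<close>-th power: the counit for 0, the identity for 1 by a counit law, and
  \<open>ctd\<close> for 2.\<close>

fun delt :: "nat => 'o => 'a" where
 "delt 0 K = cte G K"
| "delt (Suc k) K = Ga (delt k K) ** ctd G K"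

lemma delt_simps [simp]:
 "K : Obj S ==> delt k K : Arr S" "K : Obj S ==> Dom S (delt k K) = Go K"
 "K : Obj S ==> Cod S (delt k K) = (Go ^^ k) K"
 by (induction k) auto

lemma delt_nat:
 assumes "f : Arr S"
 shows "(Ga ^^ k) f ** delt k (Dom S f) = delt k (Cod S f) ** Ga f"
proof (induction k)
 case 0
 then show ?case using cte_nat[OF assms] by simp
next
 case (Suc k)
 have "(Ga ^^ Suc k) f ** delt (Suc k) (Dom S f) = Ga ((Ga ^^ k) f ** delt k (Dom S f)) ** ctd G (Dom S f)"
  using assms by simp
 also have "... = Ga (delt k (Cod S f)) ** (Ga (Ga f) ** ctd G (Dom S f))" unfolding Suc using assms by simp
 also have "... = delt (Suc k) (Cod S f) ** Ga f" unfolding ctd_nat[OF assms, symmetric] using assms by simp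
 finally show ?case .
qed

text \<open>Splitting in two and then into \<open>x\<close> and \<open>y\<close> outputs is
  splitting into \<open>x + y\<close> outputs; the induction on \<open>x\<close> uses naturality and
  coassociativity.\<close>

lemma delt_add:
 assumes "K : Obj S"
 shows "delt x ((Go ^^ y) K) ** (Ga (delt y K) ** ctd G K) = delt (x + y) K"
proof (induction x)
 case 0
 have "cte G ((Go ^^ y) K) ** (Ga (delt y K) ** ctd G K) = (delt y K ** cte G (Go K)) ** ctd G K"
  using assms cte_nat[of "delt y K"] by (intro Comp_reassoc) auto
 then show ?case using assms by simp
next
 case (Suc x)
 have "ctd G ((Go ^^ y) K) ** (Ga (delt y K) ** ctd G K) = (Ga (Ga (delt y K)) ** ctd G (Go K)) ** ctd G K"
  using assms ctd_nat[of "delt y K"] by (intro Comp_reassoc) auto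
 also have "... = Ga (Ga (delt y K)) ** (Ga (ctd G K) ** ctd G K)" using assms coassoc[OF assms] by simp
 finally have "delt (Suc x) ((Go ^^ y) K) ** (Ga (delt y K) ** ctd G K)
   = Ga (delt x ((Go ^^ y) K) ** (Ga (delt y K) ** ctd G K)) ** ctd G K"
  using assms by simp
 then show ?case unfolding Suc by simp
qed

text \<open>The function \<open>c\<close> lists partial sums: the copy of \<open>G\<close> with
  number i, counted from the outside, is split into \<open>c (i + 1) - c i\<close> copies. The last
  copy is the innermost, hence the power of \<open>G\<close> in front of
  \<open>delt\<close>.\<close>

fun act :: "nat => (nat => nat) => 'o => 'a" where
 "act 0 c K = Idt S K"
| "act (Suc n) c K = act n c ((Go ^^ (c (Suc n) - c n)) K) ** (Ga ^^ n) (delt (c (Suc n) - c n) K)"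

definition imono :: "nat => (nat => nat) => bool" where
 "imono n c \<longleftrightarrow> c 0 = 0 & (ALL i j. i <= j --> j <= n --> c i <= c j)"

lemma imono_Suc: "imono (Suc n) c ==> imono n c"
 by (simp add: imono_def)

lemma act_simps [simp]:
 assumes "imono n c" "K : Obj S"
 shows "act n c K : Arr S" "Dom S (act n c K) = (Go ^^ n) K" "Cod S (act n c K) = (Go ^^ c n) K"
proof -
 have "act n c K : Arr S & Dom S (act n c K) = (Go ^^ n) K & Cod S (act n c K) = (Go ^^ c n) K"
  using assms
 proof (induction n arbitrary: K)
  case (Suc n)
  have "c n + (c (Suc n) - c n) = c (Suc n)" using Suc.prems(1) by (simp add: imono_def)
  then show ?case using Suc.IH[OF imono_Suc[OF Suc.prems(1)], of "(Go ^^ (c (Suc n) - c n)) K"] Suc.prems(2)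
   by (simp add: Go_pow del: funpow.simps)
 qed (simp add: imono_def)
 then show "act n c K : Arr S" "Dom S (act n c K) = (Go ^^ n) K" "Cod S (act n c K) = (Go ^^ c n) K" by simp_all
qed

lemma act_nat:
 assumes "imono n c" "f : Arr S"
 shows "(Ga ^^ c n) f ** act n c (Dom S f) = act n c (Cod S f) ** (Ga ^^ n) f"
 using assms
proof (induction n arbitrary: f)
 case 0
 then show ?case by (simp add: imono_def)
next
 case (Suc n)
 let ?e = "c (Suc n) - c n"
 have e: "c (Suc n) = c n + ?e" using Suc.prems(1) by (simp add: imono_def)
 note m = imono_Suc[OF Suc.prems(1)]
 have "(Ga ^^ c (Suc n)) f ** act (Suc n) c (Dom S f)
   = (Ga ^^ c n) ((Ga ^^ ?e) f) ** (act n c ((Go ^^ ?e) (Dom S f)) ** (Ga ^^ n) (delt ?e (Dom S f)))"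
  by (subst e) (simp add: Ga_pow)
 also have "... = (act n c ((Go ^^ ?e) (Cod S f)) ** (Ga ^^ n) ((Ga ^^ ?e) f)) ** (Ga ^^ n) (delt ?e (Dom S f))"
  using Suc.IH[OF m, of "(Ga ^^ ?e) f"] Suc.prems(2) m by (intro Comp_reassoc) (auto simp: Go_pow simp del: funpow.simps)
 also have "... = act n c ((Go ^^ ?e) (Cod S f)) ** (Ga ^^ n) ((Ga ^^ ?e) f ** delt ?e (Dom S f))"
  using Suc.prems(2) m by simp
 also have "... = act n c ((Go ^^ ?e) (Cod S f)) ** ((Ga ^^ n) (delt ?e (Cod S f)) ** (Ga ^^ n) (Ga f))"
  unfolding delt_nat[OF Suc.prems(2)] using Suc.prems(2) by simp
 also have "... = act (Suc n) c (Cod S f) ** (Ga ^^ Suc n) f"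
  using Suc.prems(2) m by (simp add: Ga_pow Go_pow del: funpow.simps)
 finally show ?case .
qed

lemma act_add:
 assumes "imono (a + b) c" "K : Obj S"
 shows "act (a + b) c K = act a c ((Go ^^ (c (a + b) - c a)) K) ** (Ga ^^ a) (act b (%i. c (a + i) - c a) K)"
 using assms
proof (induction b arbitrary: K)
 case 0
 then show ?case by simp
next
 case (Suc b)
 let ?c = "%i. c (a + i) - c a"
 let ?e = "c (Suc (a + b)) - c (a + b)"
 have m: "imono (a + b) c" "imono a c" "imono b ?c" using Suc.prems(1) by (auto simp: imono_def intro: diff_le_mono)
 have l: "c a <= c (a + b)" "c (a + b) <= c (Suc (a + b))" using Suc.prems(1) by (auto simp: imono_def)
 have e: "?c (Suc b) - ?c b = ?e" "c (a + b) - c a + ?e = c (a + Suc b) - c a" using l by auto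
 have "act (a + Suc b) c K = (act a c ((Go ^^ (c (a + b) - c a)) ((Go ^^ ?e) K)) ** (Ga ^^ a) (act b ?c ((Go ^^ ?e) K)))
   ** (Ga ^^ a) ((Ga ^^ b) (delt ?e K))"
  using Suc.IH[OF m(1), of "(Go ^^ ?e) K"] Suc.prems(2) by (simp add: Ga_pow(1))
 also have "... = act a c ((Go ^^ (c (a + Suc b) - c a)) K) ** (Ga ^^ a) (act (Suc b) ?c K)"
  unfolding act.simps e(1) using Suc.prems(2) m l by (simp add: Go_pow e(2) del: funpow.simps)
 finally show ?case .
qed

text \<open>Coassociativity in its general form: splitting into \<open>e\<close> copies and then
  each copy further gives the same as one splitting into all \<open>c e\<close> copies.\<close>

lemma act_delt:
 assumes "imono e c" "K : Obj S"
 shows "act e c K ** delt e K = delt (c e) K"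
 using assms
proof (induction e arbitrary: c)
 case 0
 then show ?case by (simp add: imono_def)
next
 case (Suc e)
 let ?c = "%i. c (1 + i) - c 1" and ?y = "c (Suc e) - c 1"
 have m: "imono e ?c" "imono 1 c" and c0: "c 0 = 0" using Suc.prems(1) by (auto simp: imono_def intro: diff_le_mono)
 have y: "c 1 + ?y = c (Suc e)" using Suc.prems(1) by (simp add: imono_def)
 have "act (Suc e) c K = act 1 c ((Go ^^ ?y) K) ** Ga (act e ?c K)"
  using act_add[of 1 e c K] Suc.prems by simp
 also have "act 1 c ((Go ^^ ?y) K) = delt (c 1) ((Go ^^ ?y) K)" using Suc.prems(2) c0 by simp
 finally have "act (Suc e) c K ** delt (Suc e) K = delt (c 1) ((Go ^^ ?y) K) ** (Ga (act e ?c K ** delt e K) ** ctd G K)"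
  using Suc.prems(2) m by simp
 also have "... = delt (c (Suc e)) K"
  unfolding Suc.IH[OF m(1) Suc.prems(2)] using delt_add[OF Suc.prems(2), of "c 1" ?y] y by simp
 finally show ?case .
qed

text \<open>Induction on the number of copies. Only the last block needs an argument, and there
  splitting twice is merged by \<open>act_delt\<close>.\<close>

lemma act_comp:
 assumes "imono n c" "imono (c n) b" "K : Obj S"
 shows "act (c n) b K ** act n c K = act n (%i. b (c i)) K"
 using assms
proof (induction n arbitrary: K)
 case 0
 then show ?case by (simp add: imono_def)
next
 case (Suc n)
 let ?e = "c (Suc n) - c n" and ?z = "b (c (Suc n)) - b (c n)" and ?b = "%i. b (c n + i) - b (c n)"
 have le: "c n <= c (Suc n)" using Suc.prems(1) by (simp add: imono_def)
 have e: "c n + ?e = c (Suc n)" using le by simp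
 have m: "imono n c" "imono (c n) b" "imono ?e ?b" "imono (c n + ?e) b"
 proof -
  show "imono n c" by (rule imono_Suc[OF Suc.prems(1)])
  show "imono (c n + ?e) b" using Suc.prems(2) e by simp
  have b: "b i <= b j" if "i <= j" "j <= c (Suc n)" for i j using Suc.prems(2) that by (simp add: imono_def)
  show "imono (c n) b" "imono ?e ?b"
   using Suc.prems(2) le e by (auto simp: imono_def intro!: b diff_le_mono)
 qed
 have be: "?b ?e = ?z" using e by simp
 have "act (c (Suc n)) b K = act (c n) b ((Go ^^ ?z) K) ** (Ga ^^ c n) (act ?e ?b K)"
  using act_add[OF m(4) Suc.prems(3)] e by simp
 \<comment> \<open>Naturality moves the second splitting of the last block past the first splitting
   of the earlier copies.\<close>
 moreover have "(Ga ^^ c n) (act ?e ?b K) ** act n c ((Go ^^ ?e) K) = act n c ((Go ^^ ?z) K) ** (Ga ^^ n) (act ?e ?b K)"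
  using act_nat[OF m(1), of "act ?e ?b K"] m(3) Suc.prems(3) be by simp
 ultimately have "act (c (Suc n)) b K ** act (Suc n) c K
   = act (c n) b ((Go ^^ ?z) K) ** ((act n c ((Go ^^ ?z) K) ** (Ga ^^ n) (act ?e ?b K)) ** (Ga ^^ n) (delt ?e K))"
  using m Suc.prems(3) be Comp_reassoc[of "(Ga ^^ c n) (act ?e ?b K)" "act n c ((Go ^^ ?e) K)" _ "(Ga ^^ n) (delt ?e K)"]
  by (simp add: Go_pow del: funpow.simps)
 also have "... = (act (c n) b ((Go ^^ ?z) K) ** act n c ((Go ^^ ?z) K)) ** (Ga ^^ n) (act ?e ?b K ** delt ?e K)"
  using m Suc.prems(3) be by (simp add: Go_pow del: funpow.simps)
 also have "... = act n (%i. b (c i)) ((Go ^^ ?z) K) ** (Ga ^^ n) (delt ?z K)"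
  using Suc.IH[OF m(1,2)] act_delt[OF m(3) Suc.prems(3)] Suc.prems(3) be by simp
 finally show ?case by simp
qed

lemma act_id:
 assumes "K : Obj S" "!!i. i <= n ==> c i = i"
 shows "act n c K = Idt S ((Go ^^ n) K)"
 using assms
proof (induction n arbitrary: K)
 case (Suc n)
 have "c (Suc n) - c n = 1" using Suc.prems(2) by simp
 then have "act (Suc n) c K = act n c (Go K) ** (Ga ^^ n) (Idt S (Go K))" using Suc.prems(1) by simp
 then show ?case using Suc.IH[of "Go K"] Suc.prems by (simp add: Go_pow del: funpow.simps act.simps)
qed simp

text \<open>Only the copy number \<open>i\<close> is changed and all others are kept. The values 0
  and 2 of \<open>e\<close> give the faces and degeneracies of the standard construction.\<close>

lemma act_one_step:
 assumes "K : Obj S" "i <= n" "!!j. j <= i ==> c j = j" "!!j. [|i < j; j <= Suc n|] ==> c j = j + e - 1"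
 shows "act (Suc n) c K = (Ga ^^ i) (delt e ((Go ^^ (n - i)) K))" (is "?L = ?R")
proof -
 let ?t1 = "(Go ^^ (n - i)) K"
 have m: "imono (Suc i + (n - i)) c"
  unfolding imono_def
 proof (intro conjI allI impI)
  fix x y assume "x <= y" "y <= Suc i + (n - i)"
  then show "c x <= c y" using assms(2) assms(3)[of x] assms(3)[of y] assms(4)[of x] assms(4)[of y]
   by (cases "x <= i"; cases "y <= i") auto
 qed (use assms(3) in simp)
 have ci: "c (Suc i) = i + e" "c i = i" using assms(2) assms(3)[of i] assms(4)[of "Suc i"] by auto
 have "act (n - i) (%j. c (Suc i + j) - c (Suc i)) K = Idt S ?t1"
  using assms ci by (intro act_id) auto
 moreover have "c (Suc n) - c (Suc i) = n - i" using assms(2,4) ci by simp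
 ultimately have "?L = act (Suc i) c ?t1"
  using act_add[OF m assms(1)] assms(1,2) imono_def m by (simp del: funpow.simps act.simps add: imono_def)
 also have "... = act i c ((Go ^^ e) ?t1) ** (Ga ^^ i) (delt e ?t1)"
  by (simp add: ci)
 also have "... = ?R"
  using assms by (subst act_id) simp_all
 finally show ?thesis .
qed

text \<open>By the form of \<open>dual\<close>, copy \<open>j\<close> is split into as many copies
  as \<open>sg\<close> takes the value \<open>j\<close>.\<close>

definition bar_opr :: "'o => nat => nat => (nat => nat) => 'a" where
 "bar_opr K n m sg = act (Suc n) (dual m sg) K"

lemma imono_dual: "imono k (dual m sg)"
 by (simp add: imono_def dual_mono)

theorem simplicial_bar:
 assumes K: "K : Obj S"
 shows "simplicial S (bar G K) (bar_opr K)"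
proof
 show "sob (bar G K) n : Obj S" for n using K by (simp add: bar_def del: funpow.simps)
 show "bar_opr K n m sg : Hom S (sob (bar G K) n) (sob (bar G K) m)" if "smono m n sg" for m n sg
  using K imono_dual that by (simp add: bar_def bar_opr_def Hom_iff dual_full del: funpow.simps act.simps)
 show "bar_opr K m l ph ** bar_opr K n m sg = bar_opr K n l (%x. sg (ph x))" if "smono m n sg" "smono l m ph" for m n sg l ph
 proof -
  have d: "dual l (%x. sg (ph x)) = (%j. dual l ph (dual m sg j))" using dual_comp[OF that] by auto
  have "act (dual m sg (Suc n)) (dual l ph) K ** act (Suc n) (dual m sg) K = act (Suc n) (%j. dual l ph (dual m sg j)) K"
   by (rule act_comp[OF imono_dual imono_dual K])
  then show ?thesis unfolding bar_opr_def d dual_full[OF that(1)] .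
 qed
 show "bar_opr K n m sg = bar_opr K n m \<tau>" if "!!x. x <= m ==> sg x = \<tau> x" for m n sg \<tau>
  using dual_cong[OF that] by (simp add: bar_opr_def)
 show "bar_opr K n n (%x. x) = Idt S (sob (bar G K) n)" for n
  unfolding bar_opr_def by (subst act_id[OF K]) (auto simp: bar_def intro!: dual_eqI)
 \<comment> \<open>The map \<open>cof i\<close> never takes the value \<open>i\<close>, so this copy
   is removed by the counit \<open>delt 0\<close>.\<close>
 show "face (bar G K) n i = bar_opr K n (n - 1) (cof i)" if "0 < n" "i <= n" for n i
  using act_one_step[OF K that(2), of "dual (n - 1) (cof i)" 0] dual_cof[OF that] that
  by (simp add: bar_def bar_opr_def del: act.simps)
 \<comment> \<open>The map \<open>codeg i\<close> takes the value \<open>i\<close> twice, so this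
   copy is doubled by \<open>delt 2\<close>.\<close>
 show "dgn (bar G K) n i = bar_opr K n (Suc n) (codeg i)" if "i <= n" for n i
  using act_one_step[OF K that, of "dual (Suc n) (codeg i)" 2] dual_codeg[OF that] that K
  by (simp add: bar_def bar_opr_def numeral_2_eq_2 del: act.simps)
qed

lemma bar_opr_nat:
 assumes "f : Arr S" "smono m n sg"
 shows "(Ga ^^ Suc m) f ** bar_opr (Dom S f) n m sg = bar_opr (Cod S f) n m sg ** (Ga ^^ Suc n) f"
 using act_nat[OF imono_dual assms(1), of m sg "Suc n"] dual_full[OF assms(2)]
 by (simp add: bar_opr_def del: act.simps funpow.simps)

end

section \<open>The shuffle product\<close>

context preadditive begin

lemma hsum_cancel:
 assumes "finite I" "bij_betw h I J" "I Int J = {}" "!!i. i \<in> I Un J ==> f i : Hom A X Y"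
  "!!i. i \<in> I ==> Add A (f i) (f (h i)) = Zer A X Y" "X : Obj A" "Y : Obj A"
 shows "hsum A X Y f (I Un J) = Zer A X Y" (is "?L = _")
proof -
 have J: "finite J" "!!i. i \<in> I ==> h i \<in> J" using assms(1,2) by (auto simp: bij_betw_def)
 have "hsum A X Y f J = hsum A X Y (%i. f (h i)) I"
  by (rule hsum_bij[OF assms(2), symmetric]) (use assms in auto)
 moreover have "?L = Add A (hsum A X Y f I) (hsum A X Y f J)"
  by (rule hsum_Un_disjoint) (use assms J in auto)
 moreover have "hsum A X Y (%i. Add A (f i) (f (h i))) I = Add A (hsum A X Y f I) (hsum A X Y (%i. f (h i)) I)"
  by (rule hsum_Add) (use assms J in auto)
 ultimately have "?L = hsum A X Y (%i. Add A (f i) (f (h i))) I" by simp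
 also have "... = Zer A X Y" using assms by (intro hsum_Zer) auto
 finally show ?thesis .
qed

end

locale simplicial_functors = monoidal_functors C MC A MA + s: simplicial "SyMonCh C MC A MA" B opr
 for C :: "('o,'a,'y) cat_scheme" and MC and A :: "('p,'b,'z) acat_scheme" (structure) and MA and B and opr +
 assumes bounded: "simp_unif_bounded C A B"
begin

abbreviation k where "k p X i \<equiv> cob (fo (sfun (sob B p)) X) i"
abbreviation dv where "dv p X i \<equiv> cdf (fo (sfun (sob B p)) X) i"
abbreviation Fm where "Fm p u i \<equiv> mcomp (fa (sfun (sob B p)) u) i"
abbreviation K where "K p \<equiv> kc A MA (sob B p)"
abbreviation rop where "rop n m sg X i \<equiv> mcomp (mtcomp (opr n m sg) X) i"
abbreviation e0 where "e0 p \<equiv> mcomp (eta (sob B p)) 0"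

lemma B_shape: "smf_shape (sob B p)" and B_laws: "smf_laws (sob B p)"
 using Obj_S_simps[OF s.sob] by blast+

lemmas [simp] = F_simps[OF B_shape] kc_simps[OF B_shape] eta_simps[OF B_shape]

lemma opr_facts:
 assumes "smono m n sg"
 shows "opr n m sg : Arr S" "mtdom (opr n m sg) = sob B n" "mtcod (opr n m sg) = sob B m"
 using s.opr_Hom[OF assms] by (simp_all add: Hom_iff)

lemma rop_simps [simp]:
 assumes "smono m n sg" "X : Obj C"
 shows "rop n m sg X i : Arr A" "Dom A (rop n m sg X i) = k n X i" "Cod A (rop n m sg X i) = k m X i"
 using Arr_S_simps(5-7)[OF opr_facts(1)[OF assms(1)] assms(2)] opr_facts[OF assms(1)] by simp_all

lemma rop_comp:
 assumes "smono m n sg" "smono l m ph" "X : Obj C"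
 shows "rop m l ph X i ** rop n m sg X i = rop n l (%x. sg (ph x)) X i"
 using s.opr_comp[OF assms(1,2), symmetric] assms(3) by simp

lemma rop_cong: "(!!x. x <= m ==> sg x = \<tau> x) ==> rop n m sg X i = rop n m \<tau> X i"
 using s.opr_cong[of m sg \<tau> n] by simp

lemma rop_id: "[|!!x. x <= n ==> sg x = x; X : Obj C|] ==> rop n n sg X i = Idt A (k n X i)"
 using s.opr_cong[of n sg "%x. x" n] s.opr_id[of n] by simp

lemma rop_laws:
 assumes "smono m n sg"
 shows "X : Obj C ==> dv m X i ** rop n m sg X i = rop n m sg X (i - 1) ** dv n X i"
  "u : Arr C ==> rop n m sg (Cod C u) i ** Fm n u i = Fm m u i ** rop n m sg (Dom C u) i"
  "[|X : Obj C; Y : Obj C|] ==> rop n m sg (tenO MC X Y) (i + j) ** K n X Y i j = K m X Y i j ** tenA MA (rop n m sg X i) (rop n m sg Y j)"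
  "rop n m sg (unt MC) 0 ** e0 n = e0 m"
 using mnt_comp_laws[OF opr_facts(1)[OF assms]] opr_facts[OF assms] by simp_all

text \<open>One term of the shuffle map without its sign. By \<open>degs_shuffle\<close> the two
  strings of degeneracies are the operators of the two coordinate functions of the path.\<close>

definition sterm where
 "sterm p q M X Y i j = K (p + q) X Y i j ** tenA MA (rop p (p + q) (cnt M) X i) (rop q (p + q) (cnt ({..<p + q} - M)) Y j)"

definition sh where
 "sh p q X Y i j = sgnm A (i * int q) (hsum A (tenO MA (k p X i) (k q Y j)) (k (p + q) (tenO MC X Y) (i + j))
   (%M. sgnm A (int (inversions M ({..<p + q} - M))) (sterm p q M X Y i j)) (shuffle_sets p q))"

lemma shuffle_smono:
 assumes "M \<in> shuffle_sets p q"
 shows "smono m p (cnt M)" "smono m q (cnt ({..<p + q} - M))"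
 using assms smono_cnt[of M "p + q" m] smono_cnt[of "{..<p + q} - M" "p + q" m] shuffle_compl[OF assms]
 by (auto simp: shuffle_sets_def)

lemma sterm_simps [simp]:
 assumes "M \<in> shuffle_sets p q" "X : Obj C" "Y : Obj C"
 shows "sterm p q M X Y i j : Arr A" "Dom A (sterm p q M X Y i j) = tenO MA (k p X i) (k q Y j)"
  "Cod A (sterm p q M X Y i j) = k (p + q) (tenO MC X Y) (i + j)"
 using assms shuffle_smono[OF assms(1)] by (simp_all add: sterm_def)

lemma sh_simps [simp]:
 assumes "X : Obj C" "Y : Obj C"
 shows "sh p q X Y i j : Arr A" "Dom A (sh p q X Y i j) = tenO MA (k p X i) (k q Y j)"
  "Cod A (sh p q X Y i j) = k (p + q) (tenO MC X Y) (i + j)"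
 using assms by (simp_all add: sh_def)

lemma sEM_sh_eq:
 assumes "X : Obj C" "Y : Obj C"
 shows "sEM_sh C MC A MA B X Y p q i j = sh p q X Y i j"
proof -
 have "mcomp (kap (sob B (p + q)) X Y) (i + j) **
   (tens_in A MA (fo (sfun (sob B (p + q))) X) (fo (sfun (sob B (p + q))) Y) (i + j) i **
    tenA MA (mcomp (mtcomp (degs S B p (sorted_list_of_set ({..<p + q} - M))) X) i)
    (mcomp (mtcomp (degs S B q (sorted_list_of_set M)) Y) j)) = sterm p q M X Y i j"
  if "M \<in> shuffle_sets p q" for M
  unfolding s.degs_shuffle[OF that] sterm_def kc_def tens_in_eq
  using shuffle_smono[OF that] assms kap_simps[OF B_shape] by simp
 then show ?thesis
  unfolding sEM_sh_def sh_def Let_def by simp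
qed

text \<open>Each term obeys the Leibniz rule of the Kuenneth morphism of the functor in degree
  \<open>p + q\<close>, and simplicial operators commute with internal differentials. The sign
  (-1)^q arises because lowering \<open>i\<close> by one changes the factor (-1)^(i q).\<close>

lemma sh_leibniz:
 assumes "X : Obj C" "Y : Obj C"
 shows "dv (p + q) (tenO MC X Y) (i + j) ** sh p q X Y i j =
  Add A (sgnm A (int q) (sh p q X Y (i - 1) j ** tenA MA (dv p X i) (Idt A (k q Y j))))
   (sgnm A i (sh p q X Y i (j - 1) ** tenA MA (Idt A (k p X i)) (dv q Y j)))"
proof -
 let ?t1 = "sgnm A i (K (p + q) X Y i (j - 1) ** tenA MA (Idt A (k (p + q) X i)) (dv (p + q) Y j))"
 let ?t2 = "Idt A (k q Y j)"
 let ?t3 = "Idt A (k p X i)"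
 let ?t4 = "K (p + q) X Y (i - 1) j ** tenA MA (dv (p + q) X i) (Idt A (k (p + q) Y j))"
 let ?t5 = "tenO MC X Y"
 let ?t6 = "shuffle_sets p q"
 note [simp] = assms
 let ?s = "%M. int (inversions M ({..<p + q} - M))"
 let ?H = "hsum A (tenO MA (k p X i) (k q Y j)) (k (p + q) ?t5 (i + j - 1))"
 have ix: "i - 1 + j = i + j - 1" "i + (j - 1) = i + j - 1" by simp_all
 have t: "dv (p + q) ?t5 (i + j) ** sterm p q M X Y i j =
   Add A (sterm p q M X Y (i - 1) j ** tenA MA (dv p X i) ?t2)
    (sgnm A i (sterm p q M X Y i (j - 1) ** tenA MA ?t3 (dv q Y j)))" if M: "M \<in> shuffle_sets p q" for M
 proof -
  note sm = shuffle_smono[OF M]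
  have l: "dv (p + q) ?t5 (i + j) ** K (p + q) X Y i j =
    Add A ?t4
    ?t1"
   using B_laws[of "p + q"] assms by (simp add: smf_laws_def Let_def)
  have "dv (p + q) ?t5 (i + j) ** sterm p q M X Y i j =
    Add A ?t4
    ?t1
    ** tenA MA (rop p (p + q) (cnt M) X i) (rop q (p + q) (cnt ({..<p + q} - M)) Y j)"
   unfolding sterm_def using sm by (intro Comp_reassoc[OF l]) simp_all
  also have "... = Add A (sterm p q M X Y (i - 1) j ** tenA MA (dv p X i) ?t2)
    (sgnm A i (sterm p q M X Y i (j - 1) ** tenA MA ?t3 (dv q Y j)))"
   unfolding sterm_def using sm rop_laws(1)[OF sm(1)] rop_laws(1)[OF sm(2)] by (simp add: Add_Comp_simp ix)
  finally show ?thesis .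
 qed
 have a: "sgnm A (int q) (sh p q X Y (i - 1) j ** tenA MA (dv p X i) ?t2) =
   ?H (%M. sgnm A (i * int q + ?s M) (sterm p q M X Y (i - 1) j ** tenA MA (dv p X i) ?t2)) ?t6"
  unfolding sh_def by (simp add: hsum_Comp sgnm_hsum ix left_diff_distrib)
 have b: "sgnm A i (sh p q X Y i (j - 1) ** tenA MA ?t3 (dv q Y j)) =
   ?H (%M. sgnm A (i * int q + ?s M) (sgnm A i (sterm p q M X Y i (j - 1) ** tenA MA ?t3 (dv q Y j)))) ?t6"
  unfolding sh_def by (simp add: hsum_Comp sgnm_hsum ix add.commute add.left_commute)
 have "dv (p + q) ?t5 (i + j) ** sh p q X Y i j =
   ?H (%M. sgnm A (i * int q + ?s M) (dv (p + q) ?t5 (i + j) ** sterm p q M X Y i j)) ?t6"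
  unfolding sh_def by (simp add: Comp_hsum sgnm_hsum)
 also have "... = ?H (%M. Add A
   (sgnm A (i * int q + ?s M) (sterm p q M X Y (i - 1) j ** tenA MA (dv p X i) ?t2))
   (sgnm A (i * int q + ?s M) (sgnm A i (sterm p q M X Y i (j - 1) ** tenA MA ?t3 (dv q Y j))))) ?t6"
 proof (rule hsum_cong)
  fix M show "M \<in> shuffle_sets p q =simp=> sgnm A (i * int q + ?s M) (dv (p + q) ?t5 (i + j) ** sterm p q M X Y i j) =
   Add A (sgnm A (i * int q + ?s M) (sterm p q M X Y (i - 1) j ** tenA MA (dv p X i) ?t2))
   (sgnm A (i * int q + ?s M) (sgnm A i (sterm p q M X Y i (j - 1) ** tenA MA ?t3 (dv q Y j))))"
   unfolding simp_implies_def
   by (subst t, assumption, rule sgnm_Add[where X = "tenO MA (k p X i) (k q Y j)" and Y = "k (p + q) ?t5 (i + j - 1)"])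
    (simp_all add: Hom_iff ix)
 qed simp_all
 also have "... = Add A (sgnm A (int q) (sh p q X Y (i - 1) j ** tenA MA (dv p X i) ?t2))
   (sgnm A i (sh p q X Y i (j - 1) ** tenA MA ?t3 (dv q Y j)))"
  unfolding a b by (rule hsum_Add) (simp_all add: Hom_iff ix)
 finally show ?thesis .
qed

lemma sh_natural:
 assumes "u : Arr C" "v : Arr C"
 shows "sh p q (Cod C u) (Cod C v) i j ** tenA MA (Fm p u i) (Fm q v j)
  = Fm (p + q) (tenA MC u v) (i + j) ** sh p q (Dom C u) (Dom C v) i j"
proof -
 note [simp] = assms
 have t: "sterm p q M (Cod C u) (Cod C v) i j ** tenA MA (Fm p u i) (Fm q v j)
   = Fm (p + q) (tenA MC u v) (i + j) ** sterm p q M (Dom C u) (Dom C v) i j" if M: "M \<in> shuffle_sets p q" for M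
 proof -
  note sm = shuffle_smono[OF M]
  have l: "K (p + q) (Cod C u) (Cod C v) i j ** tenA MA (Fm (p + q) u i) (Fm (p + q) v j)
    = Fm (p + q) (tenA MC u v) (i + j) ** K (p + q) (Dom C u) (Dom C v) i j"
   using B_laws[of "p + q"] assms by (simp add: smf_laws_def Let_def)
  have "sterm p q M (Cod C u) (Cod C v) i j ** tenA MA (Fm p u i) (Fm q v j)
   = K (p + q) (Cod C u) (Cod C v) i j ** (tenA MA (Fm (p + q) u i) (Fm (p + q) v j) **
    tenA MA (rop p (p + q) (cnt M) (Dom C u) i) (rop q (p + q) (cnt ({..<p + q} - M)) (Dom C v) j))"
   unfolding sterm_def using sm rop_laws(2)[OF sm(1)] rop_laws(2)[OF sm(2)] by simp
  also have "... = (Fm (p + q) (tenA MC u v) (i + j) ** K (p + q) (Dom C u) (Dom C v) i j) **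
    tenA MA (rop p (p + q) (cnt M) (Dom C u) i) (rop q (p + q) (cnt ({..<p + q} - M)) (Dom C v) j)"
   using sm by (intro Comp_reassoc[OF l]) simp_all
  finally show ?thesis unfolding sterm_def using sm by simp
 qed
 show ?thesis unfolding sh_def by (simp add: hsum_Comp Comp_hsum sgnm_hsum t)
qed

text \<open>If one factor has simplicial degree 0 there is a single shuffle, of sign +1, and its
  operator on the other factor is the identity.\<close>

lemma sh_unit:
 assumes "X : Obj C"
 shows "Fm p (lun MC X) i ** (sh 0 p (unt MC) X 0 i ** tenA MA (e0 0) (Idt A (k p X i))) = lun MA (k p X i)"
  "Fm p (run MC X) i ** (sh p 0 X (unt MC) i 0 ** tenA MA (Idt A (k p X i)) (e0 0)) = run MA (k p X i)"
proof -
 let ?t1 = "Idt A (k p X i)"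
 note [simp] = assms
 have id: "rop p p (cnt {..<p}) X i = Idt A (k p X i)"
  by (rule rop_id) (auto simp: cnt_def Int_absorb1)
 have sm: "smono p 0 (cnt {})" "smono p p (cnt {..<p})"
  using shuffle_smono[of "{}" 0 p p] by simp_all
 have eta: "rop 0 p (cnt {}) (unt MC) 0 ** e0 0 = e0 p" by (rule rop_laws(4)[OF sm(1)])
 have l: "Fm p (lun MC X) i ** (K p (unt MC) X 0 i ** tenA MA (e0 p) ?t1) = lun MA (k p X i)"
  "Fm p (run MC X) i ** (K p X (unt MC) i 0 ** tenA MA ?t1 (e0 p)) = run MA (k p X i)"
  using B_laws[of p] by (simp_all add: smf_laws_def Let_def)
 have s1: "sh 0 p (unt MC) X 0 i = K p (unt MC) X 0 i ** tenA MA (rop 0 p (cnt {}) (unt MC) 0) ?t1"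
  using sm id by (simp add: sh_def Hom_iff) (simp add: sterm_def)
 have s2: "sh p 0 X (unt MC) i 0 = K p X (unt MC) i 0 ** tenA MA ?t1 (rop 0 p (cnt {}) (unt MC) 0)"
  using sm id by (simp add: sh_def Hom_iff) (simp add: sterm_def)
 show "Fm p (lun MC X) i ** (sh 0 p (unt MC) X 0 i ** tenA MA (e0 0) ?t1) = lun MA (k p X i)"
  unfolding s1 using sm eta l by simp
 show "Fm p (run MC X) i ** (sh p 0 X (unt MC) i 0 ** tenA MA ?t1 (e0 0)) = run MA (k p X i)"
  unfolding s2 using sm eta l by simp
qed

text \<open>Complementation turns shuffles for one order of the factors into those for the other.
  Its sign (-1)^(p q), given by \<open>inversions_swap\<close>, combines with (-1)^(i j) and the
  Koszul signs in \<open>sh\<close> to the sign in total degrees.\<close>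

lemma sh_symmetry:
 assumes "X : Obj C" "Y : Obj C"
 shows "Fm (p + q) (swp MC X Y) (i + j) ** sh p q X Y i j
  = sgnm A ((int p + i) * (int q + j)) (sh q p Y X j i ** swp MA (k p X i) (k q Y j))" (is "_ = ?R")
proof -
 let ?t1 = "K (p + q) Y X j i ** swp MA (k (p + q) X i) (k (p + q) Y j)"
 note [simp] = assms
 let ?N = "{..<p + q}"
 let ?H = "hsum A (tenO MA (k p X i) (k q Y j)) (k (p + q) (tenO MC Y X) (i + j))"
 have t: "Fm (p + q) (swp MC X Y) (i + j) ** sterm p q M X Y i j
   = sgnm A (i * j) (sterm q p (?N - M) Y X j i ** swp MA (k p X i) (k q Y j))" if M: "M \<in> shuffle_sets p q" for M
 proof -
  note sm = shuffle_smono[OF M]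
  have MM: "?N - (?N - M) = M" using M by (auto simp: shuffle_sets_def)
  have l: "Fm (p + q) (swp MC X Y) (i + j) ** K (p + q) X Y i j
   = sgnm A (i * j) ?t1"
   using B_laws[of "p + q"] by (simp add: smf_laws_def Let_def)
  have n: "swp MA (k (p + q) X i) (k (p + q) Y j) ** tenA MA (rop p (p + q) (cnt M) X i) (rop q (p + q) (cnt (?N - M)) Y j)
   = tenA MA (rop q (p + q) (cnt (?N - M)) Y j) (rop p (p + q) (cnt M) X i) ** swp MA (k p X i) (k q Y j)"
   by (rule swp_nat) (use sm in "simp_all add: Hom_iff")
  have "Fm (p + q) (swp MC X Y) (i + j) ** sterm p q M X Y i j = sgnm A (i * j) ?t1
    ** tenA MA (rop p (p + q) (cnt M) X i) (rop q (p + q) (cnt (?N - M)) Y j)"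
   unfolding sterm_def using sm by (intro Comp_reassoc[OF l]) simp_all
  then show ?thesis unfolding sterm_def using sm n by (simp add: add.commute[of q p] MM add.commute[of j i])
 qed
 have par: "even (i * int q + int (inversions M (?N - M)) + i * j -
   ((int p + i) * (int q + j) + j * int p + int (inversions (?N - M) (?N - (?N - M)))))" if M: "M \<in> shuffle_sets p q" for M
 proof -
  have MM: "?N - (?N - M) = M" using M by (auto simp: shuffle_sets_def)
  have M': "finite M" "card M = p" "card (?N - M) = q" using M shuffle_compl[OF M] finite_subset by (auto simp: shuffle_sets_def)
  have "inversions M (?N - M) + inversions (?N - M) M = p * q"
   using inversions_swap[of M "?N - M"] M' by simp
  then have "int p * int q = int (inversions M (?N - M)) + int (inversions (?N - M) M)"
   by (metis of_nat_add of_nat_mult)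
  then show ?thesis unfolding MM by (simp add: algebra_simps)
 qed
 have "Fm (p + q) (swp MC X Y) (i + j) ** sh p q X Y i j
   = ?H (%M. sgnm A (i * int q + int (inversions M (?N - M)) + i * j) (sterm q p (?N - M) Y X j i ** swp MA (k p X i) (k q Y j))) (shuffle_sets p q)"
  unfolding sh_def using shuffle_compl by (simp add: Comp_hsum sgnm_hsum t add.commute[of q p] add.commute[of j i])
 also have "... = ?H (%M. sgnm A ((int p + i) * (int q + j) + j * int p + int (inversions M (?N - M))) (sterm q p M Y X j i ** swp MA (k p X i) (k q Y j))) (shuffle_sets q p)"
 proof (rule hsum_bij[OF shuffle_compl_bij])
  fix M assume "M \<in> shuffle_sets p q"
  from sgnm_parity[OF par[OF this]] show "sgnm A (i * int q + int (inversions M (?N - M)) + i * j) (sterm q p (?N - M) Y X j i ** swp MA (k p X i) (k q Y j))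
   = sgnm A ((int p + i) * (int q + j) + j * int p + int (inversions (?N - M) (?N - (?N - M)))) (sterm q p (?N - M) Y X j i ** swp MA (k p X i) (k q Y j))" .
 qed (auto simp: Hom_iff add.commute)
 also have "... = ?R"
  unfolding sh_def by (simp add: hsum_Comp sgnm_hsum add.commute[of q p] add.commute[of j i] add.assoc)
 finally show ?thesis .
qed

end

section \<open>Associativity of the shuffle product\<close>

context simplicial_functors begin

lemma double_shuffle_facts:
 assumes "(M, N) \<in> double_shuffles p q r"
 shows "M \<subseteq> {..<p + q + r}" "N \<subseteq> {..<p + q + r}" "M Int N = {}" "card M = p" "card N = q" "finite M" "finite N"
  "card ({..<p + q + r} - (M Un N)) = r" "finite ({..<p + q + r} - (M Un N))"
  "{..<p + q} - cnt (M Un N) ` M = cnt (M Un N) ` N"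
  "{..<q + r} - cnt ({..<p + q + r} - M) ` N = cnt ({..<p + q + r} - M) ` ({..<p + q + r} - (M Un N))"
proof -
 let ?t1 = "M Un N"
 let ?U = "{..<p + q + r}"
 show *: "M \<subseteq> {..<p + q + r}" "N \<subseteq> {..<p + q + r}" "M Int N = {}" "card M = p" "card N = q"
  using assms by (auto simp: double_shuffles_def)
 then show f: "finite M" "finite N" using finite_subset[OF _ finite_lessThan] by blast+
 have c: "card ?t1 = p + q" using * f by (simp add: card_Un_disjoint)
 then show "card ({..<p + q + r} - ?t1) = r"
  using * f by (subst card_Diff_subset) auto
 show "finite ({..<p + q + r} - ?t1)" by simp
 have "cnt ?t1 ` ?t1 = {..<p + q}" using cnt_bij[of "M Un N"] f c by (simp add: bij_betw_def)
 moreover have "cnt ?t1 ` (M Un N - M) = cnt ?t1 ` ?t1 - cnt ?t1 ` M"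
  by (rule inj_on_image_set_diff[OF cnt_inj_on]) auto
 moreover have "M Un N - M = N" using *(3) by auto
 ultimately show "{..<p + q} - cnt ?t1 ` M = cnt ?t1 ` N" by simp
 have c2: "card (?U - M) = q + r" using card_Diff_subset[OF f(1) *(1)] *(4) by simp
 have "cnt (?U - M) ` (?U - M) = {..<q + r}" using cnt_bij[of "?U - M"] c2 by (simp add: bij_betw_def)
 moreover have "cnt (?U - M) ` (?U - M - N) = cnt (?U - M) ` (?U - M) - cnt (?U - M) ` N"
  by (rule inj_on_image_set_diff[OF cnt_inj_on]) (use * in auto)
 moreover have "?U - M - N = ?U - ?t1" by auto
 ultimately show "{..<q + r} - cnt ({..<p + q + r} - M) ` N = cnt ({..<p + q + r} - M) ` ({..<p + q + r} - ?t1)" by simp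
qed

text \<open>A common form for the terms of both bracketings: the three coordinate functions of a
  path with three directions, followed by associativity and Kuenneth morphisms in simplicial degree
  \<open>p + q + r\<close>.\<close>

definition dterm where
 "dterm p q r M N X Y Z i j l = K (p + q + r) X (tenO MC Y Z) i (j + l) ** (tenA MA (Idt A (k (p + q + r) X i)) (K (p + q + r) Y Z j l) **
   (asc MA (k (p + q + r) X i) (k (p + q + r) Y j) (k (p + q + r) Z l) **
   tenA MA (tenA MA (rop p (p + q + r) (cnt M) X i) (rop q (p + q + r) (cnt N) Y j))
    (rop r (p + q + r) (cnt ({..<p + q + r} - (M Un N))) Z l)))"

definition dsign :: "nat set => nat set => nat set => int" where
 "dsign M N P = int (inversions M N) + int (inversions M P) + int (inversions N P)"

text \<open>The Kuenneth morphism is pulled past the outer operators by their monoidality; the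
  composite operators then have the coordinates of the three-directional path by
  \<open>cnt_cnt\<close>.\<close>

lemma dterm_left:
 assumes "(M, N) \<in> double_shuffles p q r" "X : Obj C" "Y : Obj C" "Z : Obj C"
 shows "Fm (p + q + r) (asc MC X Y Z) (i + j + l) **
   (sterm (p + q) r (M Un N) (tenO MC X Y) Z (i + j) l ** tenA MA (sterm p q (cnt (M Un N) ` M) X Y i j) (Idt A (k r Z l)))
  = dterm p q r M N X Y Z i j l"
proof -
 note [simp] = assms(2-4)
 note d = double_shuffle_facts[OF assms(1)]
 let ?n = "p + q + r" and ?P = "M Un N"
 let ?U = "{..<p + q + r}"
 let ?a = "rop p ?n (cnt M) X i" and ?b = "rop q ?n (cnt N) Y j" and ?c = "rop r ?n (cnt (?U - ?P)) Z l"
 have m: "?P \<in> shuffle_sets (p + q) r" "cnt ?P ` M \<in> shuffle_sets p q"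
  using bij_betwE[OF double_shuffles_left] assms(1) by fastforce+
 note sm1 = shuffle_smono[OF m(1)] and sm2 = shuffle_smono[OF m(2)]
 have sm: "smono ?n p (cnt M)" "smono ?n q (cnt N)" "smono ?n r (cnt (?U - ?P))"
  using smono_cnt[of M ?n ?n] smono_cnt[of N ?n ?n] smono_cnt[of "?U - ?P" ?n ?n] d by auto
 have a: "rop (p + q) ?n (cnt ?P) X i ** rop p (p + q) (cnt (cnt ?P ` M)) X i = ?a"
  using d by (subst rop_comp[OF sm2(1) sm1(1)]) (simp_all add: cnt_cnt)
 have b: "rop (p + q) ?n (cnt ?P) Y j ** rop q (p + q) (cnt ({..<p + q} - cnt ?P ` M)) Y j = ?b"
  using d by (subst rop_comp[OF sm2(2) sm1(1)]) (simp_all add: cnt_cnt)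
 let ?R = "tenA MA (rop p (p + q) (cnt (cnt ?P ` M)) X i) (rop q (p + q) (cnt ({..<p + q} - cnt ?P ` M)) Y j)"
 have ab: "rop (p + q) ?n (cnt ?P) (tenO MC X Y) (i + j) ** (K (p + q) X Y i j ** ?R) = K ?n X Y i j ** tenA MA ?a ?b"
 proof -
  have "rop (p + q) ?n (cnt ?P) (tenO MC X Y) (i + j) ** (K (p + q) X Y i j ** ?R)
    = (K ?n X Y i j ** tenA MA (rop (p + q) ?n (cnt ?P) X i) (rop (p + q) ?n (cnt ?P) Y j)) ** ?R"
   using sm1 sm2 by (intro Comp_reassoc[OF rop_laws(3)[OF sm1(1)]]) simp_all
  then show ?thesis using sm1 sm2 a b by simp
 qed
 have l: "Fm ?n (asc MC X Y Z) (i + j + l) ** (K ?n (tenO MC X Y) Z (i + j) l ** tenA MA (K ?n X Y i j) (Idt A (k ?n Z l)))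
   = K ?n X (tenO MC Y Z) i (j + l) ** (tenA MA (Idt A (k ?n X i)) (K ?n Y Z j l) ** asc MA (k ?n X i) (k ?n Y j) (k ?n Z l))"
  using B_laws[of ?n] by (simp add: smf_laws_def Let_def)
 have "sterm (p + q) r ?P (tenO MC X Y) Z (i + j) l ** tenA MA (sterm p q (cnt ?P ` M) X Y i j) (Idt A (k r Z l))
   = (K ?n (tenO MC X Y) Z (i + j) l ** tenA MA (K ?n X Y i j) (Idt A (k ?n Z l))) ** tenA MA (tenA MA ?a ?b) ?c"
  unfolding sterm_def using sm1 sm2 sm ab by simp
 then have "Fm ?n (asc MC X Y Z) (i + j + l) **
   (sterm (p + q) r ?P (tenO MC X Y) Z (i + j) l ** tenA MA (sterm p q (cnt ?P ` M) X Y i j) (Idt A (k r Z l)))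
   = Fm ?n (asc MC X Y Z) (i + j + l) ** ((K ?n (tenO MC X Y) Z (i + j) l ** tenA MA (K ?n X Y i j) (Idt A (k ?n Z l))) ** tenA MA (tenA MA ?a ?b) ?c)"
  by simp
 also have "... = (K ?n X (tenO MC Y Z) i (j + l) ** (tenA MA (Idt A (k ?n X i)) (K ?n Y Z j l) ** asc MA (k ?n X i) (k ?n Y j) (k ?n Z l)))
   ** tenA MA (tenA MA ?a ?b) ?c"
  using sm by (intro Comp_reassoc[OF l]) simp_all
 also have "... = dterm p q r M N X Y Z i j l"
  unfolding dterm_def using sm by (simp add: add.assoc[of i j l])
 finally show ?thesis .
qed

lemma dterm_right:
 assumes "(M, N) \<in> double_shuffles p q r" "X : Obj C" "Y : Obj C" "Z : Obj C"
 shows "sterm p (q + r) M X (tenO MC Y Z) i (j + l) **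
   (tenA MA (Idt A (k p X i)) (sterm q r (cnt ({..<p + q + r} - M) ` N) Y Z j l) ** asc MA (k p X i) (k q Y j) (k r Z l))
  = dterm p q r M N X Y Z i j l"
proof -
 note [simp] = assms(2-4)
 note d = double_shuffle_facts[OF assms(1)]
 let ?n = "p + q + r"
 let ?U = "{..<p + q + r}"
 let ?P = "?U - M" and ?Q = "cnt (?U - M) ` N"
 let ?a = "rop p ?n (cnt M) X i" and ?b = "rop q ?n (cnt N) Y j" and ?c = "rop r ?n (cnt (?U - (M Un N))) Z l"
 have n: "p + (q + r) = ?n" by simp
 have m: "M \<in> shuffle_sets p (q + r)" "?Q \<in> shuffle_sets q r"
  using bij_betwE[OF double_shuffles_right] assms(1) by fastforce+
 note sm1 = shuffle_smono[OF m(1), unfolded n] and sm2 = shuffle_smono[OF m(2)]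
 have sm: "smono ?n p (cnt M)" "smono ?n q (cnt N)" "smono ?n r (cnt (?U - (M Un N)))"
  using smono_cnt[of M ?n ?n] smono_cnt[of N ?n ?n] smono_cnt[of "?U - (M Un N)" ?n ?n] d by auto
 have b: "rop (q + r) ?n (cnt ?P) Y j ** rop q (q + r) (cnt ?Q) Y j = ?b"
  using d by (subst rop_comp[OF sm2(1) sm1(2)]) (auto intro!: rop_cong cnt_cnt)
 have c: "rop (q + r) ?n (cnt ?P) Z l ** rop r (q + r) (cnt ({..<q + r} - ?Q)) Z l = ?c"
  unfolding d(11) using sm2(2)[unfolded d(11)] by (subst rop_comp[OF _ sm1(2)]) (auto intro!: rop_cong cnt_cnt)
 let ?R = "tenA MA (rop q (q + r) (cnt ?Q) Y j) (rop r (q + r) (cnt ({..<q + r} - ?Q)) Z l)"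
 have bc: "rop (q + r) ?n (cnt ?P) (tenO MC Y Z) (j + l) ** (K (q + r) Y Z j l ** ?R) = K ?n Y Z j l ** tenA MA ?b ?c"
 proof -
  have "rop (q + r) ?n (cnt ?P) (tenO MC Y Z) (j + l) ** (K (q + r) Y Z j l ** ?R)
    = (K ?n Y Z j l ** tenA MA (rop (q + r) ?n (cnt ?P) Y j) (rop (q + r) ?n (cnt ?P) Z l)) ** ?R"
   using sm1 sm2 by (intro Comp_reassoc[OF rop_laws(3)[OF sm1(2)]]) simp_all
  then show ?thesis using sm1 sm2 b c by simp
 qed
 have nat: "asc MA (k ?n X i) (k ?n Y j) (k ?n Z l) ** tenA MA (tenA MA ?a ?b) ?c = tenA MA ?a (tenA MA ?b ?c) ** asc MA (k p X i) (k q Y j) (k r Z l)"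
  by (rule asc_nat) (use sm in "simp_all add: Hom_iff")
 have "sterm p (q + r) M X (tenO MC Y Z) i (j + l) **
   (tenA MA (Idt A (k p X i)) (sterm q r ?Q Y Z j l) ** asc MA (k p X i) (k q Y j) (k r Z l))
  = K ?n X (tenO MC Y Z) i (j + l) ** (tenA MA ?a (K ?n Y Z j l ** tenA MA ?b ?c) ** asc MA (k p X i) (k q Y j) (k r Z l))"
  unfolding sterm_def n using sm1 sm2 sm bc by simp
 also have "... = dterm p q r M N X Y Z i j l"
  unfolding dterm_def nat using sm by simp
 finally show ?thesis .
qed

text \<open>Both sides are expanded into double sums and reindexed by paths with three directions.
  In each case the two inversion numbers add up to the inversions between the three pairs of
  directions.\<close>

lemma sh_assoc:
 assumes "X : Obj C" "Y : Obj C" "Z : Obj C"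
 shows "Fm (p + q + r) (asc MC X Y Z) (i + j + l) ** (sh (p + q) r (tenO MC X Y) Z (i + j) l ** tenA MA (sh p q X Y i j) (Idt A (k r Z l)))
  = sh p (q + r) X (tenO MC Y Z) i (j + l) ** (tenA MA (Idt A (k p X i)) (sh q r Y Z j l) ** asc MA (k p X i) (k q Y j) (k r Z l))"
proof -
 note [simp] = assms
 let ?n = "p + q + r"
 let ?U = "{..<p + q + r}"
 let ?A = "tenO MA (tenO MA (k p X i) (k q Y j)) (k r Z l)" and ?B = "k ?n (tenO MC X (tenO MC Y Z)) (i + j + l)"
 let ?H = "%f. hsum A ?A ?B f"
 \<comment> \<open>The Koszul exponent common to both bracketings: the internal degree
   \<open>i\<close> passes \<open>q\<close> and \<open>r\<close>, and \<open>j\<close> passes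
   \<open>r\<close>.\<close>
 let ?s = "i * int q + i * int r + j * int r"
 let ?D = "?H (%(M, N). sgnm A (?s + dsign M N (?U - (M Un N))) (dterm p q r M N X Y Z i j l)) (double_shuffles p q r)"
 have n: "p + (q + r) = ?n" by simp
 have ij: "i + (j + l) = i + j + l" by simp
 have dt: "dterm p q r M N X Y Z i j l : Hom A ?A ?B" if "(M, N) \<in> double_shuffles p q r" for M N
 proof -
  note d = double_shuffle_facts[OF that]
  have sm: "smono ?n p (cnt M)" "smono ?n q (cnt N)" "smono ?n r (cnt (?U - (M Un N)))"
   using smono_cnt[of M ?n ?n] smono_cnt[of N ?n ?n] smono_cnt[of "?U - (M Un N)" ?n ?n] d by auto
  then show ?thesis by (simp add: dterm_def Hom_iff ij)
 qed
 let ?f = "%P Q. sgnm A ((i + j) * int r + int (inversions P (?U - P)) + (i * int q + int (inversions Q ({..<p + q} - Q))))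
   (Fm ?n (asc MC X Y Z) (i + j + l) ** (sterm (p + q) r P (tenO MC X Y) Z (i + j) l ** tenA MA (sterm p q Q X Y i j) (Idt A (k r Z l))))"
 have "Fm ?n (asc MC X Y Z) (i + j + l) ** (sh (p + q) r (tenO MC X Y) Z (i + j) l ** tenA MA (sh p q X Y i j) (Idt A (k r Z l)))
   = ?H (%P. ?H (?f P) (shuffle_sets p q)) (shuffle_sets (p + q) r)"
 proof -
  have "Fm ?n (asc MC X Y Z) (i + j + l) ** (sterm (p + q) r P (tenO MC X Y) Z (i + j) l ** tenA MA (sh p q X Y i j) (Idt A (k r Z l)))
   = ?H (%Q. sgnm A (i * int q + int (inversions Q ({..<p + q} - Q)))
    (Fm ?n (asc MC X Y Z) (i + j + l) ** (sterm (p + q) r P (tenO MC X Y) Z (i + j) l ** tenA MA (sterm p q Q X Y i j) (Idt A (k r Z l))))) (shuffle_sets p q)"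
   if "P \<in> shuffle_sets (p + q) r" for P
   unfolding sh_def using that by (simp add: Comp_hsum sgnm_hsum tenA_hsum)
  moreover have "Fm ?n (asc MC X Y Z) (i + j + l) ** (sh (p + q) r (tenO MC X Y) Z (i + j) l ** tenA MA (sh p q X Y i j) (Idt A (k r Z l)))
   = ?H (%P. sgnm A ((i + j) * int r + int (inversions P (?U - P))) (Fm ?n (asc MC X Y Z) (i + j + l) **
    (sterm (p + q) r P (tenO MC X Y) Z (i + j) l ** tenA MA (sh p q X Y i j) (Idt A (k r Z l))))) (shuffle_sets (p + q) r)"
   unfolding sh_def[of "p + q" r] by (simp add: hsum_Comp Comp_hsum sgnm_hsum)
  ultimately show ?thesis by (simp add: sgnm_hsum)
 qed
 also have "... = ?H (%(P, Q). ?f P Q) (shuffle_sets (p + q) r \<times> shuffle_sets p q)"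
  by (rule hsum_Sigma) (simp_all add: Hom_iff)
 also have "... = ?D"
 proof (rule hsum_bij[OF double_shuffles_left, symmetric])
  fix z assume "z \<in> double_shuffles p q r"
  then obtain M N where z: "z = (M, N)" "(M, N) \<in> double_shuffles p q r" by (cases z) auto
  note d = double_shuffle_facts[OF z(2)]
  have "inversions (M Un N) (?U - (M Un N)) = inversions M (?U - (M Un N)) + inversions N (?U - (M Un N))"
   using d by (intro inversions_Un_left) auto
  moreover have "inversions (cnt (M Un N) ` M) ({..<p + q} - cnt (M Un N) ` M) = inversions M N"
   unfolding d(10) using d by (intro inversions_image) auto
  ultimately show "(case z of (M, N) => sgnm A (?s + dsign M N (?U - (M Un N))) (dterm p q r M N X Y Z i j l)) =
    (case (case z of (M, N) => (M Un N, cnt (M Un N) ` M)) of (P, Q) => ?f P Q)"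
   unfolding z(1) split dterm_left[OF z(2) assms] dsign_def by (simp add: algebra_simps)
 qed (auto simp: Hom_iff)
 finally have L: "Fm ?n (asc MC X Y Z) (i + j + l) ** (sh (p + q) r (tenO MC X Y) Z (i + j) l ** tenA MA (sh p q X Y i j) (Idt A (k r Z l))) = ?D" .
 let ?g = "%P Q. sgnm A (i * int (q + r) + int (inversions P (?U - P)) + (j * int r + int (inversions Q ({..<q + r} - Q))))
   (sterm p (q + r) P X (tenO MC Y Z) i (j + l) ** (tenA MA (Idt A (k p X i)) (sterm q r Q Y Z j l) ** asc MA (k p X i) (k q Y j) (k r Z l)))"
 have "sh p (q + r) X (tenO MC Y Z) i (j + l) ** (tenA MA (Idt A (k p X i)) (sh q r Y Z j l) ** asc MA (k p X i) (k q Y j) (k r Z l))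
   = ?H (%P. ?H (?g P) (shuffle_sets q r)) (shuffle_sets p (q + r))"
 proof -
  let ?w = "%t. tenA MA (Idt A (k p X i)) t ** asc MA (k p X i) (k q Y j) (k r Z l)"
  have "sterm p (q + r) P X (tenO MC Y Z) i (j + l) ** ?w (sh q r Y Z j l)
   = ?H (%Q. sgnm A (j * int r + int (inversions Q ({..<q + r} - Q)))
    (sterm p (q + r) P X (tenO MC Y Z) i (j + l) ** ?w (sterm q r Q Y Z j l))) (shuffle_sets q r)"
   if "P \<in> shuffle_sets p (q + r)" for P
   unfolding sh_def using that by (simp add: Comp_hsum hsum_Comp sgnm_hsum tenA_hsum n ij)
  moreover have "sh p (q + r) X (tenO MC Y Z) i (j + l) ** ?w (sh q r Y Z j l)
   = ?H (%P. sgnm A (i * int (q + r) + int (inversions P (?U - P)))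
    (sterm p (q + r) P X (tenO MC Y Z) i (j + l) ** ?w (sh q r Y Z j l))) (shuffle_sets p (q + r))"
   unfolding sh_def[of p "q + r"] n by (simp add: hsum_Comp sgnm_hsum n ij)
  ultimately show ?thesis by (simp add: sgnm_hsum n ij)
 qed
 also have "... = ?H (%(P, Q). ?g P Q) (shuffle_sets p (q + r) \<times> shuffle_sets q r)"
  by (rule hsum_Sigma) (simp_all add: Hom_iff n ij)
 also have "... = ?D"
 proof (rule hsum_bij[OF double_shuffles_right, symmetric])
  fix z assume "z \<in> double_shuffles p q r"
  then obtain M N where z: "z = (M, N)" "(M, N) \<in> double_shuffles p q r" by (cases z) auto
  note d = double_shuffle_facts[OF z(2)]
  have "?U - M = N Un (?U - (M Un N))" using d by auto
  then have "inversions M (?U - M) = inversions M N + inversions M (?U - (M Un N))"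
   using d inversions_Un_right[of M N "?U - (M Un N)"] by auto
  moreover have "inversions (cnt (?U - M) ` N) ({..<q + r} - cnt (?U - M) ` N) = inversions N (?U - (M Un N))"
   unfolding d(11) using d by (intro inversions_image) auto
  ultimately show "(case z of (M, N) => sgnm A (?s + dsign M N (?U - (M Un N))) (dterm p q r M N X Y Z i j l)) =
    (case (case z of (M, N) => (M, cnt (?U - M) ` N)) of (P, Q) => ?g P Q)"
   unfolding z(1) split dterm_right[OF z(2) assms] dsign_def by (simp add: algebra_simps)
 qed (auto simp: Hom_iff n ij)
 finally show ?thesis unfolding L by simp
qed

section \<open>Compatibility of the shuffle product with the simplicial differential\<close>

definition bd where
 "bd n X i = hsum A (k n X i) (k (n - 1) X i) (%l. sgnm A (int l) (rop n (n - 1) (cof l) X i)) {..n}"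

lemma bd_simps [simp]:
 assumes "X : Obj C" "0 < n"
 shows "bd n X i : Arr A" "Dom A (bd n X i) = k n X i" "Cod A (bd n X i) = k (n - 1) X i"
 using assms by (simp_all add: bd_def smono_cof del: One_nat_def)

text \<open>The term of a shuffle after a face has been applied: its operators are the coordinates
  of the path restricted to the vertices other than \<open>l\<close>.\<close>

definition fterm where
 "fterm p q l M X Y i j = K (p + q - 1) X Y i j ** tenA MA (rop p (p + q - 1) (%x. cnt M (cof l x)) X i)
   (rop q (p + q - 1) (%x. cnt ({..<p + q} - M) (cof l x)) Y j)"

lemma fterm_smono:
 assumes "M \<in> shuffle_sets p q" "0 < p + q"
 shows "smono (p + q - 1) p (%x. cnt M (cof l x))" "smono (p + q - 1) q (%x. cnt ({..<p + q} - M) (cof l x))"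
 using smono_comp[OF shuffle_smono(1)[OF assms(1)] smono_cof[OF assms(2)]]
  smono_comp[OF shuffle_smono(2)[OF assms(1)] smono_cof[OF assms(2)]] by simp_all

lemma fterm_Hom:
 assumes "M \<in> shuffle_sets p q" "0 < p + q" "X : Obj C" "Y : Obj C"
 shows "fterm p q l M X Y i j : Hom A (tenO MA (k p X i) (k q Y j)) (k (p + q - 1) (tenO MC X Y) (i + j))"
 using fterm_smono[OF assms(1,2)] assms(3,4) by (simp add: fterm_def Hom_iff del: One_nat_def)

lemma rop_sterm:
 assumes "M \<in> shuffle_sets p q" "0 < p + q" "X : Obj C" "Y : Obj C"
 shows "rop (p + q) (p + q - 1) (cof l) (tenO MC X Y) (i + j) ** sterm p q M X Y i j = fterm p q l M X Y i j"
proof -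
 note sm = shuffle_smono[OF assms(1), of "p + q"] and sf = smono_cof[OF assms(2), of l]
 have "rop (p + q) (p + q - 1) (cof l) (tenO MC X Y) (i + j) ** sterm p q M X Y i j
   = (K (p + q - 1) X Y i j ** tenA MA (rop (p + q) (p + q - 1) (cof l) X i) (rop (p + q) (p + q - 1) (cof l) Y j))
    ** tenA MA (rop p (p + q) (cnt M) X i) (rop q (p + q) (cnt ({..<p + q} - M)) Y j)"
  unfolding sterm_def using sm sf assms(3,4) by (intro Comp_reassoc[OF rop_laws(3)[OF sf]]) simp_all
 then show ?thesis
  unfolding fterm_def using sm sf assms(3,4) by (simp add: rop_comp del: One_nat_def)
qed

lemma bd_sh:
 assumes "0 < p + q" "X : Obj C" "Y : Obj C"
 shows "bd (p + q) (tenO MC X Y) (i + j) ** sh p q X Y i j =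
  hsum A (tenO MA (k p X i) (k q Y j)) (k (p + q - 1) (tenO MC X Y) (i + j))
   (%(l, M). sgnm A (int l + (i * int q + int (inversions M ({..<p + q} - M)))) (fterm p q l M X Y i j)) ({..p + q} \<times> shuffle_sets p q)"
proof -
 let ?t1 = "k (p + q - 1) (tenO MC X Y) (i + j)"
 let ?t2 = "tenO MA (k p X i) (k q Y j)"
 note [simp] = assms(2,3) smono_cof[OF assms(1)]
 note [simp del] = One_nat_def
 have "bd (p + q) (tenO MC X Y) (i + j) ** sh p q X Y i j =
  hsum A ?t2 ?t1 (%l.
   hsum A ?t2 ?t1
    (%M. sgnm A (int l + (i * int q + int (inversions M ({..<p + q} - M)))) (fterm p q l M X Y i j)) (shuffle_sets p q)) {..p + q}"
 proof -
  have "rop (p + q) (p + q - 1) (cof l) (tenO MC X Y) (i + j) ** sh p q X Y i j =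
   hsum A ?t2 ?t1
    (%M. sgnm A (i * int q + int (inversions M ({..<p + q} - M))) (fterm p q l M X Y i j)) (shuffle_sets p q)" for l
   unfolding sh_def using assms(1) by (simp add: Comp_hsum sgnm_hsum rop_sterm)
  then show ?thesis
   unfolding bd_def using fterm_Hom[OF _ assms] by (subst hsum_Comp) (simp_all add: sgnm_hsum Hom_iff)
 qed
 also have "... = hsum A ?t2 ?t1
   (%(l, M). sgnm A (int l + (i * int q + int (inversions M ({..<p + q} - M)))) (fterm p q l M X Y i j)) ({..p + q} \<times> shuffle_sets p q)"
  using fterm_Hom[OF _ assms] by (intro hsum_Sigma) (auto simp: Hom_iff)
 finally show ?thesis .
qed

text \<open>A vertex whose steps all belong to the first factor yields a face of that factor. Terms
  match along \<open>face_same_bij\<close>, operators by \<open>face_degeneracy_subset\<close>, and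
  signs by \<open>sign_face_subset\<close>.\<close>

lemma bd_sh_left:
 assumes "0 < p" "X : Obj C" "Y : Obj C"
 shows "sh (p - 1) q X Y i j ** tenA MA (bd p X i) (Idt A (k q Y j)) =
  hsum A (tenO MA (k p X i) (k q Y j)) (k (p + q - 1) (tenO MC X Y) (i + j))
   (%(l, M). sgnm A (int l + (i * int q + int (inversions M ({..<p + q} - M)))) (fterm p q l M X Y i j)) (face_same p q)"
proof -
 note [simp] = assms(2,3) smono_cof[OF assms(1)]
 note [simp del] = One_nat_def
 have n: "p - 1 + q = p + q - 1" and N: "0 < p + q" using assms(1) by simp_all
 let ?H = "%f. hsum A (tenO MA (k p X i) (k q Y j)) (k (p + q - 1) (tenO MC X Y) (i + j)) f"
 let ?U = "{..<p + q - 1}"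
 let ?g = "%l M. sgnm A (int l + (i * int q + int (inversions M (?U - M))))
   (sterm (p - 1) q M X Y i j ** tenA MA (rop p (p - 1) (cof l) X i) (Idt A (k q Y j)))"
 have "sh (p - 1) q X Y i j ** tenA MA (bd p X i) (Idt A (k q Y j)) = ?H (%l. ?H (?g l) (shuffle_sets (p - 1) q)) {..p}"
  unfolding sh_def bd_def
  by (simp add: hsum_Comp tenA_hsum Comp_hsum sgnm_hsum n add.commute[of _ "i * int q + _"] add.assoc)
 also have "... = ?H (%(l, M). ?g l M) ({..p} \<times> shuffle_sets (p - 1) q)"
  by (rule hsum_Sigma) (simp_all add: Hom_iff n)
 also have "... = ?H (%(l, M). sgnm A (int l + (i * int q + int (inversions M ({..<p + q} - M)))) (fterm p q l M X Y i j)) (face_same p q)"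
 proof (rule hsum_bij[OF face_same_bij[OF assms(1)], symmetric])
  fix z assume "z \<in> face_same p q"
  then obtain l M where z: "z = (l, M)" "(l, M) \<in> face_same p q" by (cases z) auto
  have m: "M \<in> shuffle_sets p q" "M \<subseteq> {..<p + q}" "card M = p" "l <= p + q" "adj (p + q) l \<subseteq> M"
   using z(2) by (auto simp: face_same_def shuffle_sets_def)
  let ?M = "contr (p + q) l M" and ?l = "cnt M l"
  have "?M \<in> shuffle_sets (p - 1) q"
   using bij_betwE[OF face_same_bij[OF assms(1), of q]] z(2) by fastforce
  note sm = shuffle_smono[OF this, unfolded n]
  have 1: "rop p (p + q - 1) (%x. cnt M (cof l x)) X i = rop (p - 1) (p + q - 1) (cnt ?M) X i ** rop p (p - 1) (cof ?l) X i"
   using face_degeneracy_subset[OF m(2,4,5)] N sm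
   by (subst rop_comp[OF smono_cof[OF assms(1)]]) (auto intro!: rop_cong)
  have 2: "rop q (p + q - 1) (%x. cnt ({..<p + q} - M) (cof l x)) Y j = rop q (p + q - 1) (cnt (?U - ?M)) Y j"
  proof (rule rop_cong)
   fix x assume "x <= p + q - 1"
   then have "x < p + q" using N by linarith
   moreover have "adj (p + q) l Int ({..<p + q} - M) = {}" using m(5) by blast
   ultimately show "cnt ({..<p + q} - M) (cof l x) = cnt (?U - ?M) x"
    using face_degeneracy_disjoint[of "{..<p + q} - M" "p + q" l x] m(4) contr_compl[of "p + q" l M] by simp
  qed
  have 3: "fterm p q l M X Y i j = sterm (p - 1) q ?M X Y i j ** tenA MA (rop p (p - 1) (cof ?l) X i) (Idt A (k q Y j))"
   unfolding fterm_def sterm_def 1 2 n using sm by simp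
  have "inversions M ({..<p + q} - M) + ?l = inversions ?M (?U - ?M) + l"
   by (rule sign_face_subset[OF m(2,4,5) N])
  then have "int (inversions M ({..<p + q} - M)) = int (inversions ?M (?U - ?M)) + int l - int ?l" by linarith
  then have 4: "even (int l + (i * int q + int (inversions M ({..<p + q} - M))) - (int ?l + (i * int q + int (inversions ?M (?U - ?M)))))"
   by simp
  show "(case z of (l, M) => sgnm A (int l + (i * int q + int (inversions M ({..<p + q} - M)))) (fterm p q l M X Y i j)) =
    (case (case z of (l, M) => (cnt M l, contr (p + q) l M)) of (l, M) => ?g l M)"
   unfolding z(1) split 3 by (rule sgnm_parity[OF 4])
 qed (auto simp: Hom_iff n)
 finally show ?thesis .
qed

text \<open>This is \<open>face_same_bij\<close> with the two directions exchanged: complement,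
  contract, complement again. Contraction commutes with complements.\<close>

lemma face_other_bij_contr:
 assumes "0 < q"
 shows "bij_betw (%(l, M). (cnt ({..<p + q} - M) l, contr (p + q) l M)) (face_other p q) ({..q} \<times> shuffle_sets p (q - 1))"
proof -
 have n: "q - 1 + p = p + q - 1" "p + (q - 1) = p + q - 1" using assms by simp_all
 have 1: "bij_betw (%(l, M). (cnt M l, contr (q + p) l M)) (face_same q p) ({..q} \<times> shuffle_sets (q - 1) p)"
  by (rule face_same_bij[OF assms])
 have 2: "bij_betw (%(l, M). (l, {..<q - 1 + p} - M)) ({..q} \<times> shuffle_sets (q - 1) p) ({..q} \<times> shuffle_sets p (q - 1))"
  using bij_betw_map_prod[OF bij_betw_id[of "{..q}"] shuffle_compl_bij[of "q - 1" p]] by (simp add: map_prod_def)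
 have 3: "bij_betw ((%(l, M). (l, {..<q - 1 + p} - M)) o ((%(l, M). (cnt M l, contr (q + p) l M)) o (%(l, M). (l, {..<p + q} - M))))
   (face_other p q) ({..q} \<times> shuffle_sets p (q - 1))"
  by (rule bij_betw_trans[OF bij_betw_trans[OF face_other_bij 1] 2])
 show ?thesis
 proof (rule bij_betw_cong[THEN iffD1, OF _ 3])
  fix z assume "z \<in> face_other p q"
  obtain l M where z: "z = (l, M)" by (cases z)
  have "{..<p + q - 1} - contr (p + q) l ({..<p + q} - M) = contr (p + q) l M"
   using contr_subset[of "p + q" l M] by (auto simp: contr_compl)
  then show "((%(l, M). (l, {..<q - 1 + p} - M)) o ((%(l, M). (cnt M l, contr (q + p) l M)) o (%(l, M). (l, {..<p + q} - M)))) z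
    = (case z of (l, M) => (cnt ({..<p + q} - M) l, contr (p + q) l M))"
   by (simp add: z n add.commute[of q p] del: One_nat_def)
 qed
qed

text \<open>In the sign, \<open>p\<close> comes from \<open>sign_face_disjoint\<close> and
  \<open>i\<close> from replacing \<open>q\<close> by \<open>q - 1\<close> in the factor (-1)^(i
  q).\<close>

lemma bd_sh_right:
 assumes "0 < q" "X : Obj C" "Y : Obj C"
 shows "sgnm A (int p + i) (sh p (q - 1) X Y i j ** tenA MA (Idt A (k p X i)) (bd q Y j)) =
  hsum A (tenO MA (k p X i) (k q Y j)) (k (p + q - 1) (tenO MC X Y) (i + j))
   (%(l, M). sgnm A (int l + (i * int q + int (inversions M ({..<p + q} - M)))) (fterm p q l M X Y i j)) (face_other p q)"
proof -
 note [simp] = assms(2,3) smono_cof[OF assms(1)]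
 note [simp del] = One_nat_def
 have n: "p + (q - 1) = p + q - 1" and N: "0 < p + q" and q1: "int (q - 1) = int q - 1" using assms(1) by simp_all
 let ?H = "%f. hsum A (tenO MA (k p X i) (k q Y j)) (k (p + q - 1) (tenO MC X Y) (i + j)) f"
 let ?U = "{..<p + q - 1}"
 let ?g = "%l M. sgnm A (int l + (int p + i + (i * int (q - 1) + int (inversions M (?U - M)))))
   (sterm p (q - 1) M X Y i j ** tenA MA (Idt A (k p X i)) (rop q (q - 1) (cof l) Y j))"
 have "sgnm A (int p + i) (sh p (q - 1) X Y i j ** tenA MA (Idt A (k p X i)) (bd q Y j)) = ?H (%l. ?H (?g l) (shuffle_sets p (q - 1))) {..q}"
  unfolding sh_def bd_def
  by (simp add: hsum_Comp tenA_hsum Comp_hsum sgnm_hsum n add.commute add.left_commute)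
 also have "... = ?H (%(l, M). ?g l M) ({..q} \<times> shuffle_sets p (q - 1))"
  by (rule hsum_Sigma) (simp_all add: Hom_iff n)
 also have "... = ?H (%(l, M). sgnm A (int l + (i * int q + int (inversions M ({..<p + q} - M)))) (fterm p q l M X Y i j)) (face_other p q)"
 proof (rule hsum_bij[OF face_other_bij_contr[OF assms(1)], symmetric])
  fix z assume "z \<in> face_other p q"
  then obtain l M where z: "z = (l, M)" "(l, M) \<in> face_other p q" by (cases z) auto
  have m: "M \<in> shuffle_sets p q" "M \<subseteq> {..<p + q}" "card M = p" "l <= p + q" "adj (p + q) l Int M = {}"
   using z(2) by (auto simp: face_other_def shuffle_sets_def)
  have a: "adj (p + q) l \<subseteq> {..<p + q} - M" using m(5) by (auto simp: adj_def)
  let ?M = "contr (p + q) l M" and ?l = "cnt ({..<p + q} - M) l"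
  have "?M \<in> shuffle_sets p (q - 1)"
   using bij_betwE[OF face_other_bij_contr[OF assms(1), of p]] z(2) by fastforce
  note sm = shuffle_smono[OF this, unfolded n]
  have 1: "rop q (p + q - 1) (%x. cnt ({..<p + q} - M) (cof l x)) Y j
    = rop (q - 1) (p + q - 1) (cnt (?U - ?M)) Y j ** rop q (q - 1) (cof ?l) Y j"
   using face_degeneracy_subset[OF _ m(4) a] N sm contr_compl[of "p + q" l M]
   by (subst rop_comp[OF smono_cof[OF assms(1)]]) (auto intro!: rop_cong)
  have 2: "rop p (p + q - 1) (%x. cnt M (cof l x)) X i = rop p (p + q - 1) (cnt ?M) X i"
   using face_degeneracy_disjoint[OF m(2,4,5)] N by (intro rop_cong) auto
  have 3: "fterm p q l M X Y i j = sterm p (q - 1) ?M X Y i j ** tenA MA (Idt A (k p X i)) (rop q (q - 1) (cof ?l) Y j)"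
   unfolding fterm_def sterm_def 1 2 n using sm by simp
  have "inversions M ({..<p + q} - M) + cnt M l = inversions ?M (?U - ?M) + p"
   using sign_face_disjoint[OF m(2,4,5) N] m(3) by simp
  moreover have "?l + cnt M l = l" using cnt_compl[OF m(4), of M] cnt_le[of M l] by simp
  ultimately have "int (inversions M ({..<p + q} - M)) = int (inversions ?M (?U - ?M)) + int p - (int l - int ?l)" by linarith
  then have 4: "even (int l + (i * int q + int (inversions M ({..<p + q} - M))) - (int ?l + (int p + i + (i * int (q - 1) + int (inversions ?M (?U - ?M))))))"
   by (simp add: q1 algebra_simps)
  show "(case z of (l, M) => sgnm A (int l + (i * int q + int (inversions M ({..<p + q} - M)))) (fterm p q l M X Y i j)) =
    (case (case z of (l, M) => (cnt ({..<p + q} - M) l, contr (p + q) l M)) of (l, M) => ?g l M)"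
   unfolding z(1) split 3 by (rule sgnm_parity[OF 4])
 qed (auto simp: Hom_iff n)
 finally show ?thesis .
qed

text \<open>At a corner the omitted vertex does not distinguish the path from its flip, while the
  signs of the two shuffles are opposite.\<close>

lemma bd_sh_mixed:
 assumes "0 < p + q" "X : Obj C" "Y : Obj C"
 shows "hsum A (tenO MA (k p X i) (k q Y j)) (k (p + q - 1) (tenO MC X Y) (i + j))
   (%(l, M). sgnm A (int l + (i * int q + int (inversions M ({..<p + q} - M)))) (fterm p q l M X Y i j)) (face_mixed1 p q Un face_mixed2 p q)
  = Zer A (tenO MA (k p X i) (k q Y j)) (k (p + q - 1) (tenO MC X Y) (i + j))"
proof (rule hsum_cancel[OF face_finite(3)[OF assms(1)] step_swap_bij face_partition(3)[OF assms(1)]])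
 fix z assume "z \<in> face_mixed1 p q"
 then obtain l M where z: "z = (l, M)" "(l, M) \<in> face_mixed1 p q" by (cases z) auto
 have f: "fterm p q l (step_swap l M) X Y i j = fterm p q l M X Y i j"
  unfolding fterm_def step_swap_cnt[OF z(2)] ..
 have M: "M \<in> shuffle_sets p q" using z(2) by (simp add: face_mixed1_def)
 show "Add A (case z of (l, M) => sgnm A (int l + (i * int q + int (inversions M ({..<p + q} - M)))) (fterm p q l M X Y i j))
   (case (case z of (l, M) => (l, step_swap l M)) of (l, M) => sgnm A (int l + (i * int q + int (inversions M ({..<p + q} - M)))) (fterm p q l M X Y i j))
  = Zer A (tenO MA (k p X i) (k q Y j)) (k (p + q - 1) (tenO MC X Y) (i + j))"
  unfolding z(1) split f
  by (rule Add_sgnm_cancel[OF fterm_Hom[OF M assms]]) (simp add: step_swap_sign[OF z(2)])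
next
 fix z assume z: "z \<in> face_mixed1 p q Un face_mixed2 p q"
 obtain l M where "z = (l, M)" "M \<in> shuffle_sets p q" using z by (cases z) (auto simp: face_mixed1_def face_mixed2_def)
 then show "(case z of (l, M) => sgnm A (int l + (i * int q + int (inversions M ({..<p + q} - M)))) (fterm p q l M X Y i j))
   : Hom A (tenO MA (k p X i) (k q Y j)) (k (p + q - 1) (tenO MC X Y) (i + j))"
  using fterm_Hom[OF _ assms] by (simp add: Hom_iff del: One_nat_def)
qed (use assms in simp_all)

text \<open>The simplicial half of the chain map property. The cases of degree 0 are separate
  because a factor of simplicial degree 0 has no faces and the corresponding class of vertices is
  empty.\<close>

theorem bd_sh_leibniz:
 assumes "0 < p + q" "X : Obj C" "Y : Obj C"
 shows "bd (p + q) (tenO MC X Y) (i + j) ** sh p q X Y i j = Add A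
  (if p = 0 then Zer A (tenO MA (k p X i) (k q Y j)) (k (p + q - 1) (tenO MC X Y) (i + j))
   else sh (p - 1) q X Y i j ** tenA MA (bd p X i) (Idt A (k q Y j)))
  (if q = 0 then Zer A (tenO MA (k p X i) (k q Y j)) (k (p + q - 1) (tenO MC X Y) (i + j))
   else sgnm A (int p + i) (sh p (q - 1) X Y i j ** tenA MA (Idt A (k p X i)) (bd q Y j)))"
proof -
 let ?t1 = "face_same p q Un face_other p q"
 let ?t2 = "face_mixed1 p q Un face_mixed2 p q"
 note [simp] = assms(2,3)
 note [simp del] = One_nat_def
 let ?X = "tenO MA (k p X i) (k q Y j)" and ?Y = "k (p + q - 1) (tenO MC X Y) (i + j)"
 let ?f = "%(l, M). sgnm A (int l + (i * int q + int (inversions M ({..<p + q} - M)))) (fterm p q l M X Y i j)"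
 have f: "?f z : Hom A ?X ?Y" if "z \<in> {..p + q} \<times> shuffle_sets p q" for z
  using that fterm_Hom[OF _ assms] by (auto simp: Hom_iff)
 note P = face_partition[OF assms(1)] and F = face_finite[OF assms(1)]
 have "bd (p + q) (tenO MC X Y) (i + j) ** sh p q X Y i j
   = hsum A ?X ?Y ?f (?t1 Un ?t2)"
  unfolding bd_sh[OF assms] P(1) ..
 also have "... = Add A (hsum A ?X ?Y ?f ?t1) (hsum A ?X ?Y ?f ?t2)"
  by (rule hsum_Un_disjoint) (use P F f in auto)
 also have "... = hsum A ?X ?Y ?f ?t1"
  unfolding bd_sh_mixed[OF assms] by (rule Add_Zer, rule hsum_Hom) (use P f in auto)
 also have "... = Add A (hsum A ?X ?Y ?f (face_same p q)) (hsum A ?X ?Y ?f (face_other p q))"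
  by (rule hsum_Un_disjoint) (use P F f in auto)
 also have "hsum A ?X ?Y ?f (face_same p q) = (if p = 0 then Zer A ?X ?Y else sh (p - 1) q X Y i j ** tenA MA (bd p X i) (Idt A (k q Y j)))"
  using bd_sh_left[OF _ assms(2,3)] assms(1) by (auto simp: face_same_empty)
 also have "hsum A ?X ?Y ?f (face_other p q) = (if q = 0 then Zer A ?X ?Y else sgnm A (int p + i) (sh p (q - 1) X Y i j ** tenA MA (Idt A (k p X i)) (bd q Y j)))"
 proof (cases "q = 0")
  case True
  then have "face_other p q = {}"
   using face_other_bij[of p q] face_same_empty[of p] assms(1) by (auto simp: bij_betw_def)
  then show ?thesis using True by simp
 qed (use bd_sh_right[OF _ assms(2,3)] in auto)
 finally show ?thesis .
qed

end

section \<open>The Eilenberg--MacLane simple functor\<close>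

text \<open>The common shape of the action of \<open>sEM\<close> on arrows of \<open>C\<close> and
  of the map induced by a simplicial map; entries live in simplicial degrees \<open>p >= 0\<close>
  only.\<close>

definition tot_map :: "('o,'a,'z) acat_scheme => ('o,'a) dcpx => ('o,'a) dcpx => (nat => int => 'a) => ('o,'a) cmap" where
 "tot_map A E E' h = \<lparr>mdom = Tot A E, mcod = Tot A E',
   mcomp = (%n. dmat A (diag E n) (diag E' n) (%p p'.
    if p' = p & 0 <= p then h (nat p) (n - p) else Zer A (diag E n p) (diag E' n p')))\<rparr>"

context additive begin

lemma tot_map_facts:
 assumes "!!n. fam A (diag E n)" "!!n. fam A (diag E' n)"
  and "!!p q. h p q : Hom A (dob E (int p) q) (dob E' (int p) q)"
 shows "mcomp (tot_map A E E' h) n : Hom A (cob (Tot A E) n) (cob (Tot A E') n)"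
  "mcomp (tot_map A E E' h) (int p + q) ** inj2 A E (int p) q = inj2 A E' (int p) q ** h p q"
proof -
 let ?m = "%n p p'. if p' = p & 0 <= p then h (nat p) (n - p) else Zer A (diag E n p) (diag E' n p')"
 have m: "?m n p p' : Hom A (diag E n p) (diag E' n p')" for n p p'
  using assms(3)[of "nat p" "n - p"] assms(1,2) by (auto simp: Hom_iff diag_apply[symmetric])
 show "mcomp (tot_map A E E' h) n : Hom A (cob (Tot A E) n) (cob (Tot A E') n)"
  unfolding tot_map_def cob_Tot cmap.simps by (rule dmat_Hom[OF assms(1,2) m])
 have "dmat A (diag E (int p + q)) (diag E' (int p + q)) (?m (int p + q)) ** dI A (diag E (int p + q)) (int p)
   = dI A (diag E' (int p + q)) (int p) ** ?m (int p + q) (int p) (int p)"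
  by (rule dmat_dI_single[OF assms(1,2) m]) auto
 then show "mcomp (tot_map A E E' h) (int p + q) ** inj2 A E (int p) q = inj2 A E' (int p) q ** h p q"
  unfolding tot_map_def inj2_def by simp
qed

end

section \<open>The double complex and the functor of total complexes\<close>

context simplicial_functors begin

declare of_nat_diff [simp del]

abbreviation E where "E X \<equiv> sEM_d A B X"
abbreviation T where "T X \<equiv> Tot A (sEM_d A B X)"
abbreviation jn where "jn X p q \<equiv> inj2 A (sEM_d A B X) (int p) q"

lemma dob_E: "dob (E X) p q = (if 0 <= p then k (nat p) X q else zero_obj A)"
 by (simp add: sEM_d_def Let_def)

lemma dd2_E: "dd2 (E X) (int p) q = dv p X q"
 by (simp add: sEM_d_def Let_def)

lemma dd1_E: "dd1 (E X) (int p) q = (if p = 0 then Zer A (k 0 X q) (zero_obj A) else bd p X q)"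
proof (cases "p = 0")
 case False
 have "nat (int p - 1) = p - 1" by linarith
 moreover have "face B p l = opr p (p - 1) (cof l)" if "l \<in> {..p}" for l
  using s.face[of p l] False that by simp
 ultimately show ?thesis using False by (simp add: sEM_d_def Let_def bd_def)
qed (simp add: sEM_d_def Let_def)

text \<open>Pairs of faces are split by the order of their indices. The pair (\<open>a\<close>,
  \<open>b\<close>) with \<open>b <= a\<close> and the pair (\<open>b\<close>, \<open>a + 1\<close>)
  give the same composite with opposite signs.\<close>

lemma bd_bd:
 assumes "X : Obj C"
 shows "bd (Suc n) X i ** bd (Suc (Suc n)) X i = Zer A (k (Suc (Suc n)) X i) (k n X i)"
proof -
 note [simp] = assms
 have sm: "smono n (Suc n) (cof a)" "smono (Suc n) (Suc (Suc n)) (cof a)" for a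
  using smono_cof[of "Suc n" a] smono_cof[of "Suc (Suc n)" a] by simp_all
 note [simp] = sm smono_comp[OF sm(2) sm(1)]
 let ?H = "hsum A (k (Suc (Suc n)) X i) (k n X i)"
 let ?f = "%a b. sgnm A (int a + int b) (rop (Suc (Suc n)) n (%x. cof b (cof a x)) X i)"
 let ?I = "{(a, b). b <= a & a <= Suc n}" and ?J = "{(a, b). a < b & b <= Suc (Suc n)}"
 have fI: "finite ?I" by (rule finite_subset[of _ "{..Suc n} \<times> {..Suc n}"]) auto
 have "rop (Suc n) n (cof a) X i ** bd (Suc (Suc n)) X i = ?H (%b. sgnm A (int b) (rop (Suc (Suc n)) n (%x. cof b (cof a x)) X i)) {..Suc (Suc n)}" for a
  unfolding bd_def by (simp add: Comp_hsum rop_comp[OF sm(2) sm(1)])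
 then have "bd (Suc n) X i ** bd (Suc (Suc n)) X i = ?H (%a. ?H (?f a) {..Suc (Suc n)}) {..Suc n}"
  unfolding bd_def[of "Suc n"] by (subst hsum_Comp) (simp_all add: sgnm_hsum)
 also have "... = ?H (%(a, b). ?f a b) ({..Suc n} \<times> {..Suc (Suc n)})"
  by (rule hsum_Sigma) (simp_all add: Hom_iff)
 also have "{..Suc n} \<times> {..Suc (Suc n)} = ?I Un ?J" by auto
 also have "?H (%(a, b). ?f a b) (?I Un ?J) = Zer A (k (Suc (Suc n)) X i) (k n X i)"
 proof (rule hsum_cancel[OF fI, where h = "%(a, b). (b, Suc a)"])
  show "bij_betw (%(a, b). (b, Suc a)) ?I ?J"
   by (rule bij_betw_byWitness[where f' = "%(a, b). (b - 1, a)"]) auto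
  fix z assume "z \<in> ?I"
  then obtain a b where z: "z = (a, b)" "b <= a" by auto
  have c: "cof (Suc a) (cof b x) = cof b (cof a x)" for x using z(2) by (auto simp: cof_def)
  show "Add A (case z of (a, b) => ?f a b) (case (case z of (a, b) => (b, Suc a)) of (a, b) => ?f a b) = Zer A (k (Suc (Suc n)) X i) (k n X i)"
   unfolding z(1) split c by (rule Add_sgnm_cancel) (simp_all add: Hom_iff)
 qed (auto simp: Hom_iff)
 finally show ?thesis .
qed

lemma bd_dv:
 assumes "X : Obj C" "0 < n"
 shows "bd n X (i - 1) ** dv n X i = dv (n - 1) X i ** bd n X i"
proof -
 note [simp] = assms(1) smono_cof[OF assms(2)]
 note [simp del] = One_nat_def
 show ?thesis unfolding bd_def
  by (simp add: hsum_Comp Comp_hsum rop_laws(1)[OF smono_cof[OF assms(2)]])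
qed

lemma bd_natural:
 assumes "u : Arr C" "0 < n"
 shows "bd n (Cod C u) i ** Fm n u i = Fm (n - 1) u i ** bd n (Dom C u) i"
proof -
 note [simp] = assms(1) smono_cof[OF assms(2)]
 note [simp del] = One_nat_def
 show ?thesis unfolding bd_def
  by (simp add: hsum_Comp Comp_hsum rop_laws(2)[OF smono_cof[OF assms(2)]])
qed

lemma int_cases_nat: obtains (neg) "p < 0" | (nat) n where "p = int n"
 using int_cases2 by (metis int_nat_eq linorder_not_less nonneg_int_cases)

context
 fixes X assumes X [simp]: "X : Obj C"
begin

lemma dob_E_Obj: "dob (E X) p q : Obj A"
 by (simp add: dob_E)

lemma dd_E_Hom: "dd1 (E X) p q : Hom A (dob (E X) p q) (dob (E X) (p - 1) q)"
 "dd2 (E X) p q : Hom A (dob (E X) p q) (dob (E X) p (q - 1))"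
proof -
 show "dd1 (E X) p q : Hom A (dob (E X) p q) (dob (E X) (p - 1) q)"
 proof (cases p rule: int_cases_nat)
  case neg
  then show ?thesis by (simp add: sEM_d_def Let_def Hom_iff)
 next
  case (nat n)
  have "nat (int n - 1) = n - 1" by linarith
  then show ?thesis unfolding nat dd1_E dob_E by (auto simp: Hom_iff simp del: One_nat_def)
 qed
 show "dd2 (E X) p q : Hom A (dob (E X) p q) (dob (E X) p (q - 1))"
  by (simp add: sEM_d_def Let_def Hom_iff)
qed

lemma is_dcpx_E: "is_dcpx A (E X)"
 unfolding is_dcpx_def
proof (intro allI conjI)
 fix p q
 note h = dob_E_Obj dd_E_Hom
 show "dob (E X) p q : Obj A" "dd1 (E X) p q : Hom A (dob (E X) p q) (dob (E X) (p - 1) q)"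
  "dd2 (E X) p q : Hom A (dob (E X) p q) (dob (E X) p (q - 1))" by (rule h)+
 have c: "dd1 (E X) (p - 1) q ** dd1 (E X) p q : Hom A (dob (E X) p q) (dob (E X) (p - 2) q)"
  "dd2 (E X) p (q - 1) ** dd2 (E X) p q : Hom A (dob (E X) p q) (dob (E X) p (q - 2))"
  "dd1 (E X) p (q - 1) ** dd2 (E X) p q : Hom A (dob (E X) p q) (dob (E X) (p - 1) (q - 1))"
  "dd2 (E X) (p - 1) q ** dd1 (E X) p q : Hom A (dob (E X) p q) (dob (E X) (p - 1) (q - 1))"
  using Comp_Hom[OF h(2)[of p q] h(2)[of "p - 1" q]] Comp_Hom[OF h(3)[of p q] h(3)[of p "q - 1"]]
   Comp_Hom[OF h(3)[of p q] h(2)[of p "q - 1"]] Comp_Hom[OF h(2)[of p q] h(3)[of "p - 1" q]] by simp_all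
 have z: "f = g" if "is_zero A (dob (E X) p q) | is_zero A W" "f : Hom A (dob (E X) p q) W" "g : Hom A (dob (E X) p q) W" for f g W
  using is_zero_Hom_eq that by metis
 show "dd1 (E X) (p - 1) q ** dd1 (E X) p q = Zer A (dob (E X) p q) (dob (E X) (p - 2) q)"
 proof (cases "p < 2")
  case True
  then have "is_zero A (dob (E X) (p - 2) q)" using zero_obj by (simp add: dob_E)
  then show ?thesis using z c(1) by (metis Zer_Hom h(1))
 next
  case False
  define n where "n = nat (p - 2)"
  have p: "p = int (Suc (Suc n))" "p - 1 = int (Suc n)" "p - 2 = int n" using False by (simp_all add: n_def)
  have "nat (2 + int n) = Suc (Suc n)" by linarith
  then show ?thesis unfolding p(2,3) unfolding p(1) dd1_E dob_E using bd_bd[OF X, of n q] by simp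
 qed
 show "dd2 (E X) p (q - 1) ** dd2 (E X) p q = Zer A (dob (E X) p q) (dob (E X) p (q - 2))"
 proof (cases p rule: int_cases_nat)
  case neg
  then show ?thesis using z c(2) zero_obj by (metis Zer_Hom h(1) dob_E linorder_not_less)
 next
  case (nat n)
  show ?thesis unfolding nat dd2_E dob_E using F_simps(1)[OF B_shape X] by simp
 qed
 show "dd1 (E X) p (q - 1) ** dd2 (E X) p q = dd2 (E X) (p - 1) q ** dd1 (E X) p q"
 proof (cases "p < 1")
  case True
  then have "is_zero A (dob (E X) (p - 1) (q - 1))" using zero_obj by (simp add: dob_E)
  then show ?thesis using z c(3,4) by blast
 next
  case False
  define n where "n = nat (p - 1)"
  have p: "p = int (Suc n)" "p - 1 = int n" using False by (simp_all add: n_def)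
  show ?thesis unfolding p(2) unfolding p(1) dd1_E dd2_E using bd_dv[OF X, of "Suc n" q] by simp
 qed
qed

end

lemma bound_E: obtains b where "!!X p q. X : Obj C ==> p < 0 | q < b ==> is_zero A (dob (E X) p q)"
proof -
 obtain b where "ALL p. ALL X:Obj C. ALL n<b. is_zero A (k p X n)" using bounded by (auto simp: simp_unif_bounded_def)
 then have "is_zero A (dob (E X) p q)" if "X : Obj C" "p < 0 | q < b" for X p q
  using that zero_obj by (auto simp: dob_E)
 then show ?thesis using that[of b] by blast
qed

lemma fam_E: "X : Obj C ==> fam A (diag (E X) n)"
 using bound_E fam_diag[OF dob_E_Obj] by metis

lemma T_Obj [simp]: "X : Obj C ==> T X : Obj (Ch A)"
proof -
 assume X: "X : Obj C"
 obtain b where b: "!!p q. p < 0 | q < b ==> is_zero A (dob (E X) p q)" using bound_E X by metis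
 have "is_cpx A (T X)" by (rule is_cpx_Tot[OF is_dcpx_E[OF X] fam_E[OF X]])
 moreover have "is_zero A (cob (T X) n)" if "n < 0 + b" for n by (rule is_zero_Tot[OF fam_E[OF X] b that])
 ultimately show ?thesis by (auto simp: Obj_Ch bounded_below_def)
qed

lemma jn_simps [simp]:
 assumes "X : Obj C"
 shows "jn X p q : Arr A" "Dom A (jn X p q) = k p X q" "Cod A (jn X p q) = cob (T X) (int p + q)"
 using inj2_simps[OF fam_E[OF assms], of "int p" q] by (simp_all add: dob_E)

lemmas jn0_simps [simp] = jn_simps[where p = 0, simplified]

lemma T_eqI:
 assumes "X : Obj C" "f : Hom A (cob (T X) n) Z" "g : Hom A (cob (T X) n) Z"
  and "!!p q. int p + q = n ==> f ** jn X p q = g ** jn X p q"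
 shows "f = g"
proof (rule Tot_eqI[OF fam_E[OF assms(1)] assms(2,3)])
 fix p q assume n: "p + q = n"
 show "f ** inj2 A (E X) p q = g ** inj2 A (E X) p q"
 proof (cases p rule: int_cases_nat)
  case neg
  then have "is_zero A (dob (E X) p q)" using zero_obj by (simp add: dob_E)
  moreover have "inj2 A (E X) p q : Hom A (dob (E X) p q) (cob (T X) n)"
   using inj2_simps[OF fam_E[OF assms(1)], of p q] n by (simp add: Hom_iff)
  ultimately show ?thesis using is_zero_Hom_eq Comp_Hom assms(2,3) by metis
 qed (use assms(4) n in simp)
qed

lemma T_d_jn:
 assumes "X : Obj C"
 shows "cdf (T X) (int p + q) ** jn X p q = Add A
  (if p = 0 then Zer A (k p X q) (cob (T X) (int p + q - 1)) else jn X (p - 1) q ** bd p X q)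
  (sgnm A (int p) (jn X p (q - 1) ** dv p X q))"
proof -
 have "inj2 A (E X) (int p - 1) q ** dd1 (E X) (int p) q
   = (if p = 0 then Zer A (k p X q) (cob (T X) (int p + q - 1)) else jn X (p - 1) q ** bd p X q)"
 proof (cases "p = 0")
  case True
  then show ?thesis using assms inj2_simps[OF fam_E[OF assms], of "-1" q] dd1_E[of X 0 q] dob_E[of X "-1" q] by simp
 next
  case False
  then have "int p - 1 = int (p - 1)" by simp
  then show ?thesis using False by (simp only: dd1_E if_False)
 qed
 then show ?thesis
  using Tot_d_inj2[OF is_dcpx_E[OF assms] fam_E[OF assms], of "int p" q] by (simp add: dd2_E)
qed

text \<open>The two factors are decomposed one after the other; columns of negative index contribute
  zero objects and can be ignored.\<close>

lemma tenT_eqI: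
 assumes "X : Obj C" "Y : Obj C"
  and "f : Hom A (tenO MA (cob (T X) m) (cob (T Y) n)) Z" "g : Hom A (tenO MA (cob (T X) m) (cob (T Y) n)) Z"
  and *: "!!p i q j. [|int p + i = m; int q + j = n|] ==> f ** tenA MA (jn X p i) (jn Y q j) = g ** tenA MA (jn X p i) (jn Y q j)"
 shows "f = g"
proof -
 let ?t1 = "cob (T Y) n"
 let ?t2 = "diag (E Y) n"
 let ?t3 = "diag (E X) m"
 have 1: "f ** tenA MA (jn X p i) (Idt A ?t1) = g ** tenA MA (jn X p i) (Idt A ?t1)"
  if p: "int p + i = m" for p i
 proof (unfold cob_Tot, rule tenO_dS_eqI_right[OF fam_E[OF assms(2)], where W = "k p X i" and Z = Z])
  let ?f = "%f. f ** tenA MA (jn X p i) (Idt A ?t1)"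
  have h: "?f f : Hom A (tenO MA (k p X i) ?t1) Z" "?f g : Hom A (tenO MA (k p X i) ?t1) Z"
   using assms p by (auto simp: Hom_iff)
  then show "f ** tenA MA (jn X p i) (Idt A (dS A ?t2)) : Hom A (tenO MA (k p X i) (dS A ?t2)) Z"
   "g ** tenA MA (jn X p i) (Idt A (dS A ?t2)) : Hom A (tenO MA (k p X i) (dS A ?t2)) Z"
   by (simp_all add: cob_Tot)
  show "k p X i : Obj A" using assms(1) by simp
  fix q
  show "(f ** tenA MA (jn X p i) (Idt A (dS A ?t2))) ** tenA MA (Idt A (k p X i)) (dI A ?t2 q)
    = (g ** tenA MA (jn X p i) (Idt A (dS A ?t2))) ** tenA MA (Idt A (k p X i)) (dI A ?t2 q)"
  proof (cases q rule: int_cases_nat)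
   case neg
   then have z: "is_zero A (diag (E Y) n q)" using zero_obj by (simp add: diag_apply dob_E)
   have z2: "is_zero A (tenO MA (k p X i) (diag (E Y) n q))" using z assms(1) is_zero_Obj by (intro is_zero_tenO) auto
   have "tenA MA (Idt A (k p X i)) (dI A ?t2 q) : Hom A (tenO MA (k p X i) (diag (E Y) n q)) (tenO MA (k p X i) ?t1)"
    using assms fam_E[OF assms(2), of n] by (simp add: Hom_iff cob_Tot)
   from Comp_Hom[OF this h(1)] Comp_Hom[OF this h(2)] show ?thesis
    using is_zero_Hom_eq[OF disjI1[OF z2]] unfolding cob_Tot by metis
  next
   case (nat q')
   have "dI A ?t2 q = jn Y q' (n - int q')" unfolding inj2_def nat by simp
   then show ?thesis using *[OF p, of q' "n - int q'"] assms p by (simp add: Hom_iff cob_Tot[symmetric])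
  qed
 qed
 show ?thesis
 proof (rule tenO_dS_eqI_left[OF fam_E[OF assms(1)], where W = "cob (T Y) n" and Z = Z])
  show "cob (T Y) n : Obj A" using assms(2) by simp
  show h: "f : Hom A (tenO MA (dS A ?t3) ?t1) Z" "g : Hom A (tenO MA (dS A ?t3) ?t1) Z"
   using assms(3,4) by (simp_all add: cob_Tot)
  fix p
  show "f ** tenA MA (dI A ?t3 p) (Idt A ?t1) = g ** tenA MA (dI A ?t3 p) (Idt A ?t1)"
  proof (cases p rule: int_cases_nat)
   case neg
   then have z: "is_zero A (diag (E X) m p)" using zero_obj by (simp add: diag_apply dob_E)
   have z2: "is_zero A (tenO MA (diag (E X) m p) ?t1)" using z assms(2) is_zero_Obj by (intro is_zero_tenO) auto
   have "tenA MA (dI A ?t3 p) (Idt A ?t1) : Hom A (tenO MA (diag (E X) m p) ?t1) (tenO MA (dS A ?t3) ?t1)"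
    using assms fam_E[OF assms(1), of m] by (simp add: Hom_iff)
   from Comp_Hom[OF this h(1)] Comp_Hom[OF this h(2)] show ?thesis
    using is_zero_Hom_eq[OF disjI1[OF z2]] by metis
  next
   case (nat p')
   have "dI A ?t3 p = jn X p' (m - int p')" unfolding inj2_def nat by simp
   then show ?thesis using 1[of p' "m - int p'"] by simp
  qed
 qed
qed

abbreviation R where "R \<equiv> sEM C MC A MA B"

lemma fo_R: "X : Obj C ==> fo (sfun R) X = T X"
 by (simp add: sEM_def)

lemma fa_R: "u : Arr C ==> fa (sfun R) u = tot_map A (E (Dom C u)) (E (Cod C u)) (%p q. Fm p u q)"
 by (simp add: sEM_def tot_map_def Let_def)

lemma fa_R_facts:
 assumes "u : Arr C"
 shows "mcomp (fa (sfun R) u) n : Hom A (cob (T (Dom C u)) n) (cob (T (Cod C u)) n)"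
  "mcomp (fa (sfun R) u) (int p + q) ** jn (Dom C u) p q = jn (Cod C u) p q ** Fm p u q"
proof -
 have "Fm p u q : Hom A (dob (E (Dom C u)) (int p) q) (dob (E (Cod C u)) (int p) q)" for p q
  using assms by (simp add: dob_E Hom_iff)
 note t = tot_map_facts[OF fam_E fam_E this]
 show "mcomp (fa (sfun R) u) n : Hom A (cob (T (Dom C u)) n) (cob (T (Cod C u)) n)"
  "mcomp (fa (sfun R) u) (int p + q) ** jn (Dom C u) p q = jn (Cod C u) p q ** Fm p u q"
  unfolding fa_R[OF assms] by (rule t; use assms in simp)+
qed

lemma fa_R_simps [simp]:
 assumes "u : Arr C"
 shows "mcomp (fa (sfun R) u) n : Arr A" "Dom A (mcomp (fa (sfun R) u) n) = cob (T (Dom C u)) n"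
  "Cod A (mcomp (fa (sfun R) u) n) = cob (T (Cod C u)) n"
  "mdom (fa (sfun R) u) = T (Dom C u)" "mcod (fa (sfun R) u) = T (Cod C u)"
 using fa_R_facts(1)[OF assms, of n] assms by (simp_all add: Hom_iff fa_R tot_map_def)

text \<open>The internal part is the chain map law of each functor \<open>sob B p\<close>, the
  simplicial part is \<open>bd_natural\<close>. Column 0 is treated separately throughout since it
  has no simplicial differential.\<close>

lemma fa_R_chain:
 assumes "u : Arr C"
 shows "cdf (T (Cod C u)) n ** mcomp (fa (sfun R) u) n = mcomp (fa (sfun R) u) (n - 1) ** cdf (T (Dom C u)) n"
proof (rule T_eqI)
 let ?X = "Dom C u" and ?Y = "Cod C u"
 note [simp] = assms
 note [simp del] = One_nat_def
 fix p q assume n: "int p + q = n"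
 let ?t1 = "fa (sfun R) u"
 have d: "dv p ?Y q ** Fm p u q = Fm p u (q - 1) ** dv p ?X q"
  using F_simps(2-4)[OF B_shape assms] by (metis Arr_Ch)
 have f1: "mcomp ?t1 (n - 1) ** jn ?X p (q - 1) = jn ?Y p (q - 1) ** Fm p u (q - 1)"
  using fa_R_facts(2)[OF assms, of p "q - 1"] n by (simp add: add_diff_eq)
 have f2: "mcomp ?t1 (n - 1) ** jn ?X (p - 1) q = jn ?Y (p - 1) q ** Fm (p - 1) u q" if "0 < p"
 proof -
  have "int (p - 1) + q = n - 1" using n that by simp
  then show ?thesis using fa_R_facts(2)[OF assms, of "p - 1" q] by simp
 qed
 have ix: "int p + (q - 1) = n - 1" "0 < p ==> int (p - 1) + q = n - 1" using n by auto
 have "mcomp ?t1 (n - 1) ** (cdf (T ?X) n ** jn ?X p q) = Add A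
  (if p = 0 then Zer A (k p ?X q) (cob (T ?Y) (n - 1)) else (jn ?Y (p - 1) q ** Fm (p - 1) u q) ** bd p ?X q)
  (sgnm A (int p) ((jn ?Y p (q - 1) ** Fm p u (q - 1)) ** dv p ?X q))"
 proof (cases "p = 0")
  case True
  then have "q = n" using n by simp
  then show ?thesis using True T_d_jn[of ?X p q] Comp_reassoc[OF f1] by (simp add: Comp_Add_simp)
 next
  case False
  then show ?thesis using T_d_jn[of ?X p q, unfolded n] Comp_reassoc[OF f1] Comp_reassoc[OF f2]
   by (simp add: Comp_Add_simp ix n)
 qed
 also have "... = cdf (T ?Y) n ** (jn ?Y p q ** Fm p u q)"
 proof -
  have "cdf (T ?Y) n ** (jn ?Y p q ** Fm p u q) = Add A
   (if p = 0 then Zer A (k p ?Y q) (cob (T ?Y) (n - 1)) else jn ?Y (p - 1) q ** bd p ?Y q)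
   (sgnm A (int p) (jn ?Y p (q - 1) ** dv p ?Y q)) ** Fm p u q"
   using n by (intro Comp_reassoc[OF T_d_jn[of ?Y p q, unfolded n]]) simp_all
  moreover have "q = n" if "p = 0" using n that by simp
  ultimately show ?thesis using d bd_natural[OF assms, of p q]
   by (cases "p = 0") (simp_all add: Add_Comp_simp ix n)
 qed
 also have "... = cdf (T ?Y) n ** (mcomp ?t1 n ** jn ?X p q)"
  using fa_R_facts(2)[OF assms, of p q] n by simp
 finally show "(cdf (T ?Y) n ** mcomp ?t1 n) ** jn ?X p q = (mcomp ?t1 (n - 1) ** cdf (T ?X) n) ** jn ?X p q"
  using n by simp
qed (use assms in "simp_all add: Hom_iff")

lemma R_functor: "is_functor C (Ch A) (sfun R)"
 unfolding is_functor_def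
proof (intro conjI ballI impI)
 show "fo (sfun R) : Obj C \<rightarrow>\<^sub>E Obj (Ch A)" by (simp add: sEM_def)
 have "fa (sfun R) u : Hom (Ch A) (T (Dom C u)) (T (Cod C u))" if "u : Arr C" for u
  unfolding Hom_Ch using that fa_R_facts(1) fa_R_chain by simp
 then have a: "fa (sfun R) u : Arr (Ch A)" if "u : Arr C" for u using that by (simp add: Hom_iff)
 have "fa (sfun R) \<in> extensional (Arr C)" by (simp add: sEM_def)
 then show "fa (sfun R) : Arr C \<rightarrow>\<^sub>E Arr (Ch A)" using a by (auto simp: PiE_iff)
 fix u assume u: "u : Arr C"
 show "Dom (Ch A) (fa (sfun R) u) = fo (sfun R) (Dom C u)" "Cod (Ch A) (fa (sfun R) u) = fo (sfun R) (Cod C u)"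
  using u by (simp_all add: fo_R)
next
 fix X assume X: "X : Obj C"
 show "fa (sfun R) (Idt C X) = Idt (Ch A) (fo (sfun R) X)"
 proof (rule cmap_eqI)
  fix n show "mcomp (fa (sfun R) (Idt C X)) n = mcomp (Idt (Ch A) (fo (sfun R) X)) n"
  proof (rule T_eqI[OF X])
   fix p q assume "int p + q = n"
   then show "mcomp (fa (sfun R) (Idt C X)) n ** jn X p q = mcomp (Idt (Ch A) (fo (sfun R) X)) n ** jn X p q"
    using fa_R_facts(2)[of "Idt C X" p q] X functor_Ch_simps(5)[OF F_functor[OF B_shape]] by (simp add: fo_R)
  qed (use X in "simp_all add: Hom_iff fo_R")
 qed (use X in "simp_all add: fo_R")
next
 fix u v assume uv: "u : Arr C" "v : Arr C" "Cod C u = Dom C v"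
 let ?t1 = "v **\<^bsub>C\<^esub> u"
 let ?t2 = "fa (sfun R) v **\<^bsub>Ch A\<^esub> fa (sfun R) u"
 show "fa (sfun R) ?t1 = fa (sfun R) v **\<^bsub>Ch A\<^esub> fa (sfun R) u"
 proof (rule cmap_eqI)
  fix n show "mcomp (fa (sfun R) ?t1) n = mcomp ?t2 n"
  proof (rule T_eqI[of "Dom C u"])
   fix p q assume n: "int p + q = n"
   have "mcomp (fa (sfun R) v) n ** (jn (Cod C u) p q ** Fm p u q) = (jn (Cod C v) p q ** Fm p v q) ** Fm p u q"
    using fa_R_facts(2)[OF uv(2), of p q] uv n by (intro Comp_reassoc) auto
   then show "mcomp (fa (sfun R) ?t1) n ** jn (Dom C u) p q = mcomp ?t2 n ** jn (Dom C u) p q"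
    using fa_R_facts(2)[of "v **\<^bsub>C\<^esub> u" p q] fa_R_facts(2)[of u p q] uv n functor_Ch_simps(6)[OF F_functor[OF B_shape]] by simp
  qed (use uv in "simp_all add: Hom_iff")
 qed (use uv in simp_all)
qed

end

section \<open>The monoidal structure of the functor of total complexes\<close>

context simplicial_functors begin

definition kent where
 "kent X Y n m r = hsum A (tenO MA (cob (T X) m) (cob (T Y) (n - m))) (diag (E (tenO MC X Y)) n r)
   (%(p, q). sEM_sh C MC A MA B X Y p q (m - int p) (n - m - int q) **
    tenA MA (dP A (diag (E X) m) (int p)) (dP A (diag (E Y) (n - m)) (int q))) {(p, q). int p + int q = r}"

lemma kap_R:
 assumes "X : Obj C" "Y : Obj C"
 shows "mdom (kap R X Y) = tens A MA (T X) (T Y)" "mcod (kap R X Y) = T (tenO MC X Y)"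
  "mcomp (kap R X Y) n = dmat A (diag (tens_d A MA (T X) (T Y)) n) (diag (E (tenO MC X Y)) n) (kent X Y n)"
 using assms by (simp_all add: sEM_def sEM_kap_def Let_def kent_def[abs_def])

lemma kent_term_Hom:
 assumes "X : Obj C" "Y : Obj C" "int p + int q = r"
 shows "sEM_sh C MC A MA B X Y p q (m - int p) (n - m - int q) **
    tenA MA (dP A (diag (E X) m) (int p)) (dP A (diag (E Y) (n - m)) (int q))
   : Hom A (tenO MA (cob (T X) m) (cob (T Y) (n - m))) (diag (E (tenO MC X Y)) n r)"
proof -
 have r: "nat r = p + q" "0 <= r" "n - r = m - int p + (n - m - int q)" using assms(3) by auto
 have c: "diag (E (tenO MC X Y)) n r = k (p + q) (tenO MC X Y) (m - int p + (n - m - int q))"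
  unfolding diag_apply dob_E r(3) using r(1,2) by simp
 show ?thesis
  unfolding c sEM_sh_eq[OF assms(1,2)]
  using assms(1,2) fam_E[OF assms(1), of m] fam_E[OF assms(2), of "n - m"]
  by (simp add: Hom_iff cob_Tot diag_apply dob_E)
qed

lemma finite_pairs: "finite {(p, q). int p + int q = r}"
 by (rule finite_subset[of _ "{..nat r} \<times> {..nat r}"]) auto

lemma kent_Hom:
 assumes "X : Obj C" "Y : Obj C"
 shows "kent X Y n m r : Hom A (diag (tens_d A MA (T X) (T Y)) n m) (diag (E (tenO MC X Y)) n r)"
 unfolding kent_def diag_apply[of "tens_d A MA (T X) (T Y)"] tens_d_simps
 using assms fam_E[of "tenO MC X Y" n] kent_term_Hom[OF assms]
 by (intro hsum_Hom) (auto simp: fam_def)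

lemma tensT_fam: "[|X : Obj C; Y : Obj C|] ==> fam A (diag (tens_d A MA (T X) (T Y)) n)"
 by (rule tens_fam) simp_all

lemma kap_R_Hom:
 assumes "X : Obj C" "Y : Obj C"
 shows "mcomp (kap R X Y) n : Hom A (cob (tens A MA (T X) (T Y)) n) (cob (T (tenO MC X Y)) n)"
 unfolding kap_R(3)[OF assms] cob_Tot
 by (rule dmat_Hom[OF tensT_fam[OF assms] fam_E kent_Hom[OF assms]]) (use assms in simp)

lemma eta_R: "eta R = deg0_map A (conc_cpx A (unt MA)) (T (unt MC)) (jn (unt MC) 0 0 ** e0 0)"
 by (simp add: sEM_def inj2_def)

lemma eta_R_Hom: "eta R : Hom (Ch A) (conc_cpx A (unt MA)) (T (unt MC))"
proof -
 let ?t1 = "T (unt MC)"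
 let ?u = "conc_cpx A (unt MA)"
 have c0: "cob ?u 0 = unt MA" "!!n. n ~= 0 ==> is_zero A (cob ?u n)" using zero_obj by (simp_all add: cob_conc_cpx)
 have h: "mcomp (eta R) n : Hom A (cob ?u n) (cob ?t1 n)" for n
  using c0(1) by (simp add: eta_R deg0_map_def Hom_iff cob_conc_cpx)
 have du: "cdf ?u n : Hom A (cob ?u n) (cob ?u (n - 1))" for n
  using conc_cpx_Obj[OF unt_Obj] by (simp add: Hom_iff)
 have "cdf ?t1 n ** mcomp (eta R) n = mcomp (eta R) (n - 1) ** cdf ?u n" for n
 proof (cases "n = 0")
  case False
  have "cdf ?t1 n ** mcomp (eta R) n : Hom A (cob ?u n) (cob ?t1 (n - 1))"
   by (rule Comp_Hom[OF h]) (simp add: Hom_iff)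
  moreover have "mcomp (eta R) (n - 1) ** cdf ?u n : Hom A (cob ?u n) (cob ?t1 (n - 1))"
   by (rule Comp_Hom[OF du h])
  ultimately show ?thesis using is_zero_Hom_eq[OF disjI1[OF c0(2)[OF False]]] by metis
 next
  \<comment> \<open>Only in degree 0 is the source nonzero. There the unit of \<open>sob B 0\<close>
    is a cycle, being a chain map from a complex that vanishes in degree -1.\<close>
  case True
  have e: "eta (sob B 0) : Hom (Ch A) ?u (fo (sfun (sob B 0)) (unt MC))"
   using eta_Arr[OF B_shape, of 0] by (simp add: Hom_iff)
  have z: "f = Zer A (cob ?u (-1)) W" if "f : Hom A (cob ?u (-1)) W" for f W
   using is_zero_Hom_eq[OF disjI1[OF c0(2)[of "-1"]] that] by simp
  have "dv 0 (unt MC) 0 ** e0 0 = mcomp (eta (sob B 0)) (0 - 1) ** cdf ?u 0"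
   using e unfolding Hom_Ch by blast
  moreover have "mcomp (eta (sob B 0)) (0 - 1) : Hom A (cob ?u (-1)) (k 0 (unt MC) (-1))"
   using mcomp_simps(1-3)[OF eta_Arr(1)[OF B_shape], of 0 "-1"] eta_Arr[OF B_shape, of 0] by (simp add: Hom_iff)
  ultimately have d: "dv 0 (unt MC) 0 ** e0 0 = Zer A (unt MA) (k 0 (unt MC) (-1))"
   using z[of "mcomp (eta (sob B 0)) (0 - 1)" "k 0 (unt MC) (-1)"] du[of 0] c0(1) by (simp add: Hom_iff)
  have "cdf ?t1 0 ** (jn (unt MC) 0 0 ** e0 0) = Add A
   (if (0::nat) = 0 then Zer A (k 0 (unt MC) 0) (cob ?t1 (int 0 + 0 - 1)) else jn (unt MC) (0 - 1) 0 ** bd 0 (unt MC) 0)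
   (sgnm A (int 0) (jn (unt MC) 0 (0 - 1) ** dv 0 (unt MC) 0)) ** e0 0"
   using T_d_jn[OF C.unt_Obj, of 0 0] by (intro Comp_reassoc) simp_all
  then have "cdf ?t1 0 ** mcomp (eta R) 0 = Zer A (unt MA) (cob ?t1 (-1))"
   using d by (simp add: Add_Comp_simp eta_R deg0_map_def)
  moreover have "mcomp (eta R) (0 - 1) ** cdf ?u 0 = Zer A (unt MA) (cob ?t1 (-1))"
   using z[OF h[of "-1"]] du[of 0] c0(1) by (simp add: Hom_iff)
  ultimately show ?thesis unfolding True by simp
 qed
 then show ?thesis unfolding Hom_Ch using h by (simp add: eta_R deg0_map_def)
qed

lemma R_shape: "smf_shape R"
 unfolding smf_shape_def Let_def
proof (intro conjI ballI allI impI)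
 show "is_functor C (Ch A) (sfun R)" by (rule R_functor)
 show "X ~: Obj C | Y ~: Obj C ==> kap R X Y = undefined" for X Y by (auto simp: sEM_def)
 fix X Y n assume X: "X : Obj C" "Y : Obj C"
 then show "mdom (kap R X Y) = tens A MA (fo (sfun R) X) (fo (sfun R) Y)" "mcod (kap R X Y) = fo (sfun R) (tenO MC X Y)"
  by (simp_all add: kap_R fo_R)
 show "mcomp (kap R X Y) n : Hom A (cob (tens A MA (fo (sfun R) X) (fo (sfun R) Y)) n) (cob (fo (sfun R) (tenO MC X Y)) n)"
  using kap_R_Hom[OF X] X by (simp add: fo_R)
next
 show "eta R : Hom (Ch A) (conc_cpx A (unt MA)) (fo (sfun R) (unt MC))" using eta_R_Hom by (simp add: fo_R)
qed

abbreviation kT where "kT \<equiv> kc A MA R"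

lemma kT_simps [simp]:
 assumes "X : Obj C" "Y : Obj C"
 shows "kT X Y m n : Arr A" "Dom A (kT X Y m n) = tenO MA (cob (T X) m) (cob (T Y) n)"
  "Cod A (kT X Y m n) = cob (T (tenO MC X Y)) (m + n)"
 using kc_simps[OF R_shape assms, of m n] assms by (simp_all add: fo_R)

lemma dP_jn:
 assumes "X : Obj C"
 shows "dP A (diag (E X) (int p + i)) (int p') ** jn X p i
  = (if p = p' then Idt A (k p X i) else Zer A (k p X i) (k p' X (int p + i - int p')))"
 using dsum_simps(9)[OF fam_E[OF assms], of "int p + i" "int p'" "int p"]
 by (auto simp: inj2_def diag_apply dob_E)

text \<open>With this description of the Kuenneth morphism on a summand, every law of the total
  complex is reduced to the corresponding law of \<open>sh\<close>.\<close>

lemma kT_jn: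
 assumes X: "X : Obj C" "Y : Obj C" and m: "int p + i = m" "int q + j = n"
 shows "kT X Y m n ** tenA MA (jn X p i) (jn Y q j) = jn (tenO MC X Y) (p + q) (i + j) ** sh p q X Y i j"
proof -
 note [simp] = X
 let ?X = "diag (tens_d A MA (T X) (T Y)) (m + n)" and ?Y = "diag (E (tenO MC X Y)) (m + n)"
 let ?x = "tenA MA (jn X p i) (jn Y q j)"
 have nn: "m + n - m = n" by simp
 have mn': "int (p + q) + (i + j) = m + n" using m by simp
 have c: "?Y (int (p + q)) = k (p + q) (tenO MC X Y) (i + j)"
 proof -
  have "m + n - int (p + q) = i + j" using m by simp
  then show ?thesis by (simp add: diag_apply dob_E nat_add_distrib)
 qed
 \<comment> \<open>The projections onto the columns \<open>p'\<close> and \<open>q'\<close>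
   annihilate the chosen summand unless \<open>p' = p\<close> and \<open>q' = q\<close>.\<close>
 have pr: "sEM_sh C MC A MA B X Y p' q' (m - int p') (m + n - m - int q') **
    tenA MA (dP A (diag (E X) m) (int p')) (dP A (diag (E Y) (m + n - m)) (int q')) ** ?x
   = (if p' = p & q' = q then sh p q X Y i j else Zer A (tenO MA (k p X i) (k q Y j)) (?Y (int p' + int q')))" for p' q'
 proof -
  have r: "m + n - (int p' + int q') = m - int p' + (n - int q')" by simp
  have c': "?Y (int p' + int q') = k (p' + q') (tenO MC X Y) (m - int p' + (n - int q'))"
   unfolding diag_apply dob_E r by (simp add: nat_add_distrib)
  have fX: "fam A (diag (E X) m)" "fam A (diag (E Y) n)" using fam_E X by simp_all
  have dX: "diag (E X) m (int p') = k p' X (m - int p')" "diag (E Y) n (int q') = k q' Y (n - int q')"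
   by (simp_all add: diag_apply dob_E)
  have "m - int p = i" "n - int q = j" using m by auto
  then show ?thesis
   using fX dX dP_jn[of X p i p'] dP_jn[of Y q j q'] m
   unfolding c' sEM_sh_eq[OF X] nn by (auto simp: cob_Tot[symmetric])
 qed
 have "dmat A ?X ?Y (kent X Y (m + n)) ** (dI A ?X m ** ?x) = dI A ?Y (int (p + q)) ** sh p q X Y i j"
 proof (rule dmat_dI_Comp[OF tensT_fam[OF X] fam_E kent_Hom[OF X], where W = "tenO MA (k p X i) (k q Y j)"])
  show "?x : Hom A (tenO MA (k p X i) (k q Y j)) (?X m)" using m by (simp add: Hom_iff diag_apply)
  show "sh p q X Y i j : Hom A (tenO MA (k p X i) (k q Y j)) (?Y (int (p + q)))" unfolding c by (simp add: Hom_iff)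
  have ent: "kent X Y (m + n) m r ** ?x = hsum A (tenO MA (k p X i) (k q Y j)) (?Y r)
    (%(p', q'). if p' = p & q' = q then sh p q X Y i j else Zer A (tenO MA (k p X i) (k q Y j)) (?Y r)) {(p, q). int p + int q = r}" for r
  proof -
   have "kent X Y (m + n) m r ** ?x = hsum A (tenO MA (k p X i) (k q Y j)) (?Y r)
    (%z. (case z of (p', q') => sEM_sh C MC A MA B X Y p' q' (m - int p') (m + n - m - int q') **
    tenA MA (dP A (diag (E X) m) (int p')) (dP A (diag (E Y) (m + n - m)) (int q'))) ** ?x) {(p, q). int p + int q = r}"
   proof -
    have "ALL z:{(p, q). int p + int q = r}. (case z of (p', q') => sEM_sh C MC A MA B X Y p' q' (m - int p') (m + n - m - int q') **
    tenA MA (dP A (diag (E X) m) (int p')) (dP A (diag (E Y) (m + n - m)) (int q')))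
    : Hom A (tenO MA (cob (T X) m) (cob (T Y) (m + n - m))) (?Y r)"
    proof
    fix z :: "nat \<times> nat" assume "z \<in> {(p, q). int p + int q = r}"
    then obtain p' q' where z: "z = (p', q')" "int p' + int q' = r" by auto
    show "(case z of (p', q') => sEM_sh C MC A MA B X Y p' q' (m - int p') (m + n - m - int q') **
    tenA MA (dP A (diag (E X) m) (int p')) (dP A (diag (E Y) (m + n - m)) (int q')))
    : Hom A (tenO MA (cob (T X) m) (cob (T Y) (m + n - m))) (?Y r)"
    unfolding z(1) split by (rule kent_term_Hom[OF X z(2)])
    qed
    from hsum_Comp[OF _ _ _ this[unfolded Hom_iff], of ?x] show ?thesis
    unfolding kent_def using m fam_E[of "tenO MC X Y" "m + n"] by simp
   qed
   also have "... = hsum A (tenO MA (k p X i) (k q Y j)) (?Y r)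
    (%(p', q'). if p' = p & q' = q then sh p q X Y i j else Zer A (tenO MA (k p X i) (k q Y j)) (?Y r)) {(p, q). int p + int q = r}"
   proof (rule hsum_cong[OF HOL.refl HOL.refl HOL.refl], unfold simp_implies_def)
    fix z :: "nat \<times> nat" assume "z \<in> {(p, q). int p + int q = r}"
    then obtain p' q' where z: "z = (p', q')" "int p' + int q' = r" by auto
    have "(sEM_sh C MC A MA B X Y p' q' (m - int p') (m + n - m - int q') **
    tenA MA (dP A (diag (E X) m) (int p')) (dP A (diag (E Y) (m + n - m)) (int q'))) ** ?x
    = sEM_sh C MC A MA B X Y p' q' (m - int p') (m + n - m - int q') **
    tenA MA (dP A (diag (E X) m) (int p')) (dP A (diag (E Y) (m + n - m)) (int q')) ** ?x"
    unfolding sEM_sh_eq[OF X] nn using m fam_E[of X m] fam_E[of Y n]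
    by (intro Comp_assoc_simp) (simp_all add: cob_Tot diag_apply dob_E)
    then show "(case z of (p', q') => sEM_sh C MC A MA B X Y p' q' (m - int p') (m + n - m - int q') **
    tenA MA (dP A (diag (E X) m) (int p')) (dP A (diag (E Y) (m + n - m)) (int q'))) ** ?x
    = (case z of (p', q') => if p' = p & q' = q then sh p q X Y i j else Zer A (tenO MA (k p X i) (k q Y j)) (?Y r))"
    unfolding z(1) split pr using z(2) by simp
   qed
   finally show ?thesis .
  qed
  have YO: "?Y r : Obj A" for r using fam_E[of "tenO MC X Y" "m + n"] by simp
  show "kent X Y (m + n) m (int (p + q)) ** ?x = sh p q X Y i j"
   unfolding ent c
   by (subst hsum_single[OF finite_pairs, where i = "(p, q)"]) (auto simp: Hom_iff c simp del: of_nat_add split: if_splits)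
  fix r assume "r ~= int (p + q)"
  then show "kent X Y (m + n) m r ** ?x = Zer A (tenO MA (k p X i) (k q Y j)) (?Y r)"
   unfolding ent using YO by (intro hsum_Zer) auto
 qed (use X in simp)
 then have "dmat A ?X ?Y (kent X Y (m + n)) ** (tin A MA (T X) (T Y) m n ** ?x) = jn (tenO MC X Y) (p + q) (i + j) ** sh p q X Y i j"
  by (simp add: inj2_def m mn' del: of_nat_add)
 moreover have "kT X Y m n ** ?x = mcomp (kap R X Y) (m + n) ** (tin A MA (T X) (T Y) m n ** ?x)"
  unfolding kc_def using kap_simps[OF R_shape X] m by (simp add: fo_R)
 ultimately show ?thesis by (simp only: kap_R(3)[OF X])
qed

lemma eta_R0: "mcomp (eta R) 0 = jn (unt MC) 0 0 ** e0 0"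
 by (simp add: eta_R deg0_map_def)

text \<open>On a summand the total differential splits into a simplicial and an internal part, and
  each part obeys its own Leibniz rule with one term for \<open>X\<close> and one for
  \<open>Y\<close>. Regrouping the four terms by factors gives the claim.\<close>

lemma R_leibniz:
 assumes X: "X : Obj C" "Y : Obj C"
 shows "cdf (T (tenO MC X Y)) (m + n) ** kT X Y m n =
    Add A (kT X Y (m - 1) n ** tenA MA (cdf (T X) m) (Idt A (cob (T Y) n)))
    (sgnm A m (kT X Y m (n - 1) ** tenA MA (Idt A (cob (T X) m)) (cdf (T Y) n)))"
proof (rule tenT_eqI[OF X, where Z = "cob (T (tenO MC X Y)) (m + n - 1)"])
 note [simp] = X
 note [simp del] = One_nat_def
 fix p i q j assume mn: "int p + i = m" "int q + j = n"
 let ?t1 = "sh p q X Y i (j - 1) ** tenA MA (Idt A (k p X i)) (dv q Y j)"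
 let ?t2 = "Add A (kT X Y (m - 1) n ** tenA MA (cdf (T X) m) (Idt A (cob (T Y) n))) (sgnm A m (kT X Y m (n - 1) ** tenA MA (Idt A (cob (T X) m)) (cdf (T Y) n)))"
 let ?t3 = "sh p (q - 1) X Y i j ** tenA MA (Idt A (k p X i)) (bd q Y j)"
 let ?t4 = "i + j - 1"
 let ?t5 = "cdf (T Y) n ** jn Y q j"
 let ?t6 = "p + q - 1"
 let ?x = "tenA MA (jn X p i) (jn Y q j)" and ?XY = "tenO MC X Y"
 let ?W = "tenO MA (k p X i) (k q Y j)" and ?V = "cob (T (tenO MC X Y)) (m + n - 1)"
 have ix: "int (p + q) + (i + j) = m + n" "int (p + q) + ?t4 = m + n - 1" "int p + (i - 1) = m - 1" "int q + (j - 1) = n - 1"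
  "m - 1 + n = m + n - 1" "m + (n - 1) = m + n - 1" "i - 1 + j = i + j - 1" "i + (j - 1) = i + j - 1"
  "0 < p + q ==> int ?t6 + (i + j) = m + n - 1" "0 < p ==> int (p - 1) + i = m - 1" "0 < q ==> int (q - 1) + j = n - 1"
  using mn by auto
 note [simp del] = of_nat_add
 let ?L1 = "if p = 0 then Zer A ?W ?V else jn ?XY ?t6 (i + j) ** (sh (p - 1) q X Y i j ** tenA MA (bd p X i) (Idt A (k q Y j)))"
 let ?R1 = "if q = 0 then Zer A ?W ?V else sgnm A (int p + i) (jn ?XY ?t6 (i + j) ** ?t3)"
 let ?L2 = "sgnm A (int p) (jn ?XY (p + q) ?t4 ** (sh p q X Y (i - 1) j ** tenA MA (dv p X i) (Idt A (k q Y j))))"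
 let ?R2 = "sgnm A (m + int q) (jn ?XY (p + q) ?t4 ** ?t1)"
 have H: "?L1 : Hom A ?W ?V" "?R1 : Hom A ?W ?V" "?L2 : Hom A ?W ?V" "?R2 : Hom A ?W ?V"
 proof -
  have pq: "0 < p ==> p - 1 + q = p + q - 1" "0 < q ==> p + (q - 1) = p + q - 1" by simp_all
  show "?L1 : Hom A ?W ?V" by (cases "p = 0") (simp_all add: Hom_iff ix pq)
  show "?R1 : Hom A ?W ?V" by (cases "q = 0") (simp_all add: Hom_iff ix pq)
  show "?L2 : Hom A ?W ?V" "?R2 : Hom A ?W ?V" by (simp_all add: Hom_iff ix)
 qed
 have lhs: "cdf (T ?XY) (m + n) ** (kT X Y m n ** ?x) = Add A (Add A ?L1 ?R1) (Add A ?L2 ?R2)"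
 proof -
  have "cdf (T ?XY) (m + n) ** (jn ?XY (p + q) (i + j) ** sh p q X Y i j)
   = Add A (if p + q = 0 then Zer A (k (p + q) ?XY (i + j)) (cob (T ?XY) (m + n - 1)) else jn ?XY ?t6 (i + j) ** bd (p + q) ?XY (i + j))
    (sgnm A (int (p + q)) (jn ?XY (p + q) ?t4 ** dv (p + q) ?XY (i + j))) ** sh p q X Y i j"
   by (rule Comp_reassoc[OF T_d_jn[of ?XY "p + q" "i + j", unfolded ix(1)]]) (simp_all add: ix(1))
  also have "... = Add A (if p + q = 0 then Zer A ?W ?V else jn ?XY ?t6 (i + j) ** (bd (p + q) ?XY (i + j) ** sh p q X Y i j))
    (sgnm A (int (p + q)) (jn ?XY (p + q) ?t4 ** (dv (p + q) ?XY (i + j) ** sh p q X Y i j)))"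
  proof (cases "p + q = 0")
   case True
   moreover have "i + j = m + n" using True mn by simp
   ultimately show ?thesis by (simp add: Add_Comp_simp)
  next
   case False
   then have "0 < p + q" by simp
   then show ?thesis unfolding if_not_P[OF False] by (simp add: Add_Comp_simp ix(1,2) ix(9))
  qed
  also have "(if p + q = 0 then Zer A ?W ?V else jn ?XY ?t6 (i + j) ** (bd (p + q) ?XY (i + j) ** sh p q X Y i j)) = Add A ?L1 ?R1"
  proof (cases "p + q = 0")
   case False
   then have N: "0 < p + q" by simp
   have pq: "0 < p ==> p - 1 + q = p + q - 1" "0 < q ==> p + (q - 1) = p + q - 1" by simp_all
   have z: "q = 0 ==> 0 < p ==> int (p - 1) + (i + j) = m + n - 1" "p = 0 ==> 0 < q ==> int (q - 1) + (i + j) = m + n - 1"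
    using ix(9) by auto
   show ?thesis unfolding bd_sh_leibniz[OF N X] if_not_P[OF False]
    by (cases "p = 0"; cases "q = 0") (use False in "simp_all add: Comp_Add_simp ix pq z mn")
  qed (use H in "simp add: Hom_iff")
  also have "sgnm A (int (p + q)) (jn ?XY (p + q) ?t4 ** (dv (p + q) ?XY (i + j) ** sh p q X Y i j)) = Add A ?L2 ?R2"
  proof -
   \<comment> \<open>The internal differential carries the sign of its column \<open>p + q\<close>.
     Combined with the sign (-1)^q of \<open>sh_leibniz\<close> it leaves (-1)^p for
     \<open>X\<close>, and for \<open>Y\<close> the sign (-1)^(m + q), as
     \<open>m = p + i\<close>.\<close>
   have s: "sgnm A (int (p + q) + int q) = sgnm A (int p)" "sgnm A (int (p + q) + i) = sgnm A (m + int q)"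
    using mn by (auto intro!: ext sgnm_parity)
   have "jn ?XY (p + q) ?t4 ** (dv (p + q) ?XY (i + j) ** sh p q X Y i j) =
    Add A (sgnm A (int q) (jn ?XY (p + q) ?t4 ** (sh p q X Y (i - 1) j ** tenA MA (dv p X i) (Idt A (k q Y j)))))
    (sgnm A i (jn ?XY (p + q) ?t4 ** ?t1))"
    unfolding sh_leibniz[OF X] by (simp add: Comp_Add_simp ix(7,8))
   then show ?thesis
    by (subst (asm) HOL.refl, simp only:) (subst sgnm_Add[where X = ?W and Y = ?V]; simp add: Hom_iff ix s del: of_nat_add)
  qed
  finally show ?thesis unfolding kT_jn[OF X mn] .
 qed
 have rhs1: "kT X Y (m - 1) n ** tenA MA (cdf (T X) m ** jn X p i) (jn Y q j) = Add A ?L1 ?L2"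
 proof -
  have e: "cdf (T X) m ** jn X p i = Add A (if p = 0 then Zer A (k p X i) (cob (T X) (m - 1)) else jn X (p - 1) i ** bd p X i)
   (sgnm A (int p) (jn X p (i - 1) ** dv p X i))" using T_d_jn[OF X(1), of p i, unfolded mn] .
  have z: "p = 0 ==> i = m" using mn by simp
  have "kT X Y (m - 1) n ** tenA MA (cdf (T X) m ** jn X p i) (jn Y q j) =
    Add A (if p = 0 then Zer A ?W ?V else (kT X Y (m - 1) n ** tenA MA (jn X (p - 1) i) (jn Y q j)) ** tenA MA (bd p X i) (Idt A (k q Y j)))
    (sgnm A (int p) ((kT X Y (m - 1) n ** tenA MA (jn X p (i - 1)) (jn Y q j)) ** tenA MA (dv p X i) (Idt A (k q Y j))))"
   unfolding e by (cases "p = 0") (simp_all add: tenA_Add_simps Comp_Add_simp ix mn z)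
  also have "... = Add A ?L1 ?L2"
  proof -
   have "kT X Y (m - 1) n ** tenA MA (jn X p (i - 1)) (jn Y q j) = jn ?XY (p + q) ?t4 ** sh p q X Y (i - 1) j"
    using kT_jn[OF X ix(3) mn(2)] by (simp add: ix(7))
   moreover have "kT X Y (m - 1) n ** tenA MA (jn X (p - 1) i) (jn Y q j) = jn ?XY ?t6 (i + j) ** sh (p - 1) q X Y i j" if "0 < p"
   proof -
    have "p - 1 + q = p + q - 1" using that by simp
    then show ?thesis using kT_jn[OF X ix(10)[OF that] mn(2)] by simp
   qed
   moreover have "0 < p ==> p - 1 + q = p + q - 1" by simp
   ultimately show ?thesis by (cases "p = 0") (simp_all add: ix)
  qed
  finally show ?thesis .
 qed
 have rhs2: "sgnm A m (kT X Y m (n - 1) ** tenA MA (jn X p i) ?t5) = Add A ?R1 ?R2"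
 proof -
  have e: "cdf (T Y) n ** jn Y q j = Add A (if q = 0 then Zer A (k q Y j) (cob (T Y) (n - 1)) else jn Y (q - 1) j ** bd q Y j)
   (sgnm A (int q) (jn Y q (j - 1) ** dv q Y j))" using T_d_jn[OF X(2), of q j, unfolded mn] .
  have z: "q = 0 ==> j = n" using mn by simp
  have "kT X Y m (n - 1) ** tenA MA (jn X p i) ?t5 =
    Add A (if q = 0 then Zer A ?W ?V else (kT X Y m (n - 1) ** tenA MA (jn X p i) (jn Y (q - 1) j)) ** tenA MA (Idt A (k p X i)) (bd q Y j))
    (sgnm A (int q) ((kT X Y m (n - 1) ** tenA MA (jn X p i) (jn Y q (j - 1))) ** tenA MA (Idt A (k p X i)) (dv q Y j)))"
   unfolding e by (cases "q = 0") (simp_all add: tenA_Add_simps Comp_Add_simp ix mn z)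
  also have "... = Add A (if q = 0 then Zer A ?W ?V else jn ?XY ?t6 (i + j) ** ?t3)
    (sgnm A (int q) (jn ?XY (p + q) ?t4 ** ?t1))"
  proof -
   have "kT X Y m (n - 1) ** tenA MA (jn X p i) (jn Y q (j - 1)) = jn ?XY (p + q) ?t4 ** sh p q X Y i (j - 1)"
    using kT_jn[OF X mn(1) ix(4)] by (simp add: ix(8))
   moreover have "kT X Y m (n - 1) ** tenA MA (jn X p i) (jn Y (q - 1) j) = jn ?XY ?t6 (i + j) ** sh p (q - 1) X Y i j" if "0 < q"
   proof -
    have "p + (q - 1) = p + q - 1" using that by simp
    then show ?thesis using kT_jn[OF X mn(1) ix(11)[OF that]] by simp
   qed
   moreover have "0 < q ==> p + (q - 1) = p + q - 1" by simp
   ultimately show ?thesis by (cases "q = 0") (simp_all add: ix)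
  qed
  finally have *: "kT X Y m (n - 1) ** tenA MA (jn X p i) ?t5 = Add A (if q = 0 then Zer A ?W ?V else jn ?XY ?t6 (i + j) ** ?t3)
    (sgnm A (int q) (jn ?XY (p + q) ?t4 ** ?t1))" .
  have "0 < q ==> p + (q - 1) = p + q - 1" and z2: "q = 0 ==> int p + ?t4 = m + n - 1"
   using ix(2) by simp_all
  then show ?thesis
   unfolding * by (subst sgnm_Add[where X = ?W and Y = ?V]; cases "q = 0") (simp_all add: Hom_iff ix mn z2)
 qed
 have "?t2 ** ?x
   = Add A (kT X Y (m - 1) n ** tenA MA (cdf (T X) m ** jn X p i) (jn Y q j))
    (sgnm A m (kT X Y m (n - 1) ** tenA MA (jn X p i) ?t5))"
  by (simp add: Add_Comp_simp mn ix)
 also have "... = cdf (T ?XY) (m + n) ** (kT X Y m n ** ?x)"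
  unfolding rhs1 rhs2 lhs by (rule Add_swap4[OF H(1,3,2,4)])
 finally show "(cdf (T ?XY) (m + n) ** kT X Y m n) ** ?x = ?t2 ** ?x"
  using mn by simp
qed (use X in "simp_all add: Hom_iff add_diff_eq diff_add_eq")

lemma R_natural:
 assumes "u : Arr C" "v : Arr C"
 shows "kT (Cod C u) (Cod C v) m n ** tenA MA (mcomp (fa (sfun R) u) m) (mcomp (fa (sfun R) v) n)
  = mcomp (fa (sfun R) (tenA MC u v)) (m + n) ** kT (Dom C u) (Dom C v) m n" (is "?L = ?R")
proof (rule tenT_eqI[where X = "Dom C u" and Y = "Dom C v"])
 note [simp] = assms
 fix p i q j assume mn: "int p + i = m" "int q + j = n"
 let ?t1 = "jn (Dom C u) p i"
 let ?t2 = "jn (Dom C v) q j"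
 let ?t3 = "tenA MC u v"
 have f: "mcomp (fa (sfun R) u) m ** jn (Dom C u) p i = jn (Cod C u) p i ** Fm p u i"
  "mcomp (fa (sfun R) v) n ** jn (Dom C v) q j = jn (Cod C v) q j ** Fm q v j"
  using fa_R_facts(2)[of u p i] fa_R_facts(2)[of v q j] mn by simp_all
 have ix: "int (p + q) + (i + j) = m + n" using mn by simp
 have f3: "mcomp (fa (sfun R) ?t3) (m + n) ** jn (tenO MC (Dom C u) (Dom C v)) (p + q) (i + j)
    = jn (tenO MC (Cod C u) (Cod C v)) (p + q) (i + j) ** Fm (p + q) ?t3 (i + j)"
  using fa_R_facts(2)[of "tenA MC u v" "p + q" "i + j", unfolded ix] by simp
 have "?L ** tenA MA ?t1 ?t2
  = (kT (Cod C u) (Cod C v) m n ** tenA MA (jn (Cod C u) p i) (jn (Cod C v) q j)) ** tenA MA (Fm p u i) (Fm q v j)"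
  using mn f by simp
 also have "... = jn (tenO MC (Cod C u) (Cod C v)) (p + q) (i + j) ** (Fm (p + q) ?t3 (i + j) ** sh p q (Dom C u) (Dom C v) i j)"
  unfolding kT_jn[OF C.Dom_Cod_Obj(2)[OF assms(1)] C.Dom_Cod_Obj(2)[OF assms(2)] mn] using sh_natural[OF assms, of p q i j] by (simp del: of_nat_add)
 also have "... = mcomp (fa (sfun R) ?t3) (m + n) ** (jn (tenO MC (Dom C u) (Dom C v)) (p + q) (i + j) ** sh p q (Dom C u) (Dom C v) i j)"
  using ix by (subst Comp_reassoc[OF f3]) (simp_all del: of_nat_add)
 also have "... = ?R ** tenA MA ?t1 ?t2"
  using mn kT_jn[OF C.Dom_Cod_Obj(1)[OF assms(1)] C.Dom_Cod_Obj(1)[OF assms(2)] mn] by simp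
 finally show "?L ** tenA MA ?t1 ?t2
  = ?R ** tenA MA ?t1 ?t2" .
qed (use assms in "simp_all add: Hom_iff")

text \<open>The unit lands in simplicial degree 0, so on the summand of column \<open>p\<close> the
  law becomes \<open>sh_unit\<close>.\<close>

lemma R_unit:
 assumes "X : Obj C"
 shows "mcomp (fa (sfun R) (lun MC X)) n ** (kT (unt MC) X 0 n ** tenA MA (mcomp (eta R) 0) (Idt A (cob (T X) n))) = lun MA (cob (T X) n)"
  "mcomp (fa (sfun R) (run MC X)) n ** (kT X (unt MC) n 0 ** tenA MA (Idt A (cob (T X) n)) (mcomp (eta R) 0)) = run MA (cob (T X) n)"
proof -
 note [simp] = assms
 have l: "lun MA (cob (T X) n) ** tenA MA (Idt A (unt MA)) (jn X p i) = jn X p i ** lun MA (k p X i)"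
  "run MA (cob (T X) n) ** tenA MA (jn X p i) (Idt A (unt MA)) = jn X p i ** run MA (k p X i)" if "int p + i = n" for p i
  using lun_nat[of "jn X p i" "k p X i" "cob (T X) n"] run_nat[of "jn X p i" "k p X i" "cob (T X) n"] that by (auto simp: Hom_iff)
 have inv: "EX h. h : Hom A (cob (T X) n) (tenO MA (unt MA) (cob (T X) n)) & lun MA (cob (T X) n) ** h = Idt A (cob (T X) n)"
  "EX h. h : Hom A (cob (T X) n) (tenO MA (cob (T X) n) (unt MA)) & run MA (cob (T X) n) ** h = Idt A (cob (T X) n)"
  using lun[of "cob (T X) n"] run[of "cob (T X) n"] by (auto simp: iso_arr_def)
 show "mcomp (fa (sfun R) (lun MC X)) n ** (kT (unt MC) X 0 n ** tenA MA (mcomp (eta R) 0) (Idt A (cob (T X) n))) = lun MA (cob (T X) n)"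
 proof (unfold cob_Tot, rule tenO_dS_eqI_right[OF fam_E[OF assms], where W = "unt MA" and Z = "cob (T X) n"], unfold cob_Tot[symmetric])
  let ?f = "mcomp (fa (sfun R) (lun MC X)) n ** (kT (unt MC) X 0 n ** tenA MA (mcomp (eta R) 0) (Idt A (cob (T X) n)))"
  show h: "?f : Hom A (tenO MA (unt MA) (cob (T X) n)) (cob (T X) n)" by (simp add: Hom_iff eta_R0)
  show h2: "lun MA (cob (T X) n) : Hom A (tenO MA (unt MA) (cob (T X) n)) (cob (T X) n)" by (simp add: Hom_iff)
  fix p' show "?f ** tenA MA (Idt A (unt MA)) (dI A (diag (E X) n) p') = lun MA (cob (T X) n) ** tenA MA (Idt A (unt MA)) (dI A (diag (E X) n) p')"
  proof (cases p' rule: int_cases_nat)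
   case neg
   then have z: "is_zero A (diag (E X) n p')" using zero_obj by (simp add: diag_apply dob_E)
   have z2: "is_zero A (tenO MA (unt MA) (diag (E X) n p'))" using z is_zero_Obj by (intro is_zero_tenO) auto
   have "tenA MA (Idt A (unt MA)) (dI A (diag (E X) n) p') : Hom A (tenO MA (unt MA) (diag (E X) n p')) (tenO MA (unt MA) (cob (T X) n))"
    using fam_E[of X n] by (simp add: Hom_iff cob_Tot)
   from Comp_Hom[OF this h] Comp_Hom[OF this h2] show ?thesis using is_zero_Hom_eq[OF disjI1[OF z2]] by metis
  next
   case (nat p)
   define i where "i = n - int p"
   have n: "int p + i = n" by (simp add: i_def)
   have d: "dI A (diag (E X) n) p' = jn X p i" unfolding inj2_def nat n ..
   note s0 = sh_simps[OF C.unt_Obj assms, of 0 p 0 i, simplified]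
   have "?f ** tenA MA (Idt A (unt MA)) (jn X p i) = mcomp (fa (sfun R) (lun MC X)) n **
    ((kT (unt MC) X 0 n ** tenA MA (jn (unt MC) 0 0) (jn X p i)) ** tenA MA (e0 0) (Idt A (k p X i)))"
    using n by (simp add: eta_R0)
   also have "kT (unt MC) X 0 n ** tenA MA (jn (unt MC) 0 0) (jn X p i) = jn (tenO MC (unt MC) X) p i ** sh 0 p (unt MC) X 0 i"
    using kT_jn[OF C.unt_Obj assms _ n, of 0 0 0] by simp
   also have "mcomp (fa (sfun R) (lun MC X)) n ** ((jn (tenO MC (unt MC) X) p i ** sh 0 p (unt MC) X 0 i) ** tenA MA (e0 0) (Idt A (k p X i)))
    = (jn X p i ** Fm p (lun MC X) i) ** (sh 0 p (unt MC) X 0 i ** tenA MA (e0 0) (Idt A (k p X i)))"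
    using fa_R_facts(2)[of "lun MC X" p i, unfolded n] n s0
    Comp_reassoc[of "mcomp (fa (sfun R) (lun MC X)) n" "jn (tenO MC (unt MC) X) p i" _ "sh 0 p (unt MC) X 0 i ** tenA MA (e0 0) (Idt A (k p X i))"]
    by simp
   also have "... = jn X p i ** lun MA (k p X i)" using sh_unit(1)[OF assms, of p i] n s0 by simp
   finally show ?thesis unfolding d l(1)[OF n] .
  qed
 qed simp
 show "mcomp (fa (sfun R) (run MC X)) n ** (kT X (unt MC) n 0 ** tenA MA (Idt A (cob (T X) n)) (mcomp (eta R) 0)) = run MA (cob (T X) n)"
 proof (unfold cob_Tot, rule tenO_dS_eqI_left[OF fam_E[OF assms], where W = "unt MA" and Z = "cob (T X) n"], unfold cob_Tot[symmetric])
  let ?f = "mcomp (fa (sfun R) (run MC X)) n ** (kT X (unt MC) n 0 ** tenA MA (Idt A (cob (T X) n)) (mcomp (eta R) 0))"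
  show h: "?f : Hom A (tenO MA (cob (T X) n) (unt MA)) (cob (T X) n)" by (simp add: Hom_iff eta_R0)
  show h2: "run MA (cob (T X) n) : Hom A (tenO MA (cob (T X) n) (unt MA)) (cob (T X) n)" by (simp add: Hom_iff)
  fix p' show "?f ** tenA MA (dI A (diag (E X) n) p') (Idt A (unt MA)) = run MA (cob (T X) n) ** tenA MA (dI A (diag (E X) n) p') (Idt A (unt MA))"
  proof (cases p' rule: int_cases_nat)
   case neg
   then have z: "is_zero A (diag (E X) n p')" using zero_obj by (simp add: diag_apply dob_E)
   have z2: "is_zero A (tenO MA (diag (E X) n p') (unt MA))" using z is_zero_Obj by (intro is_zero_tenO) auto
   have "tenA MA (dI A (diag (E X) n) p') (Idt A (unt MA)) : Hom A (tenO MA (diag (E X) n p') (unt MA)) (tenO MA (cob (T X) n) (unt MA))"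
    using fam_E[of X n] by (simp add: Hom_iff cob_Tot)
   from Comp_Hom[OF this h] Comp_Hom[OF this h2] show ?thesis using is_zero_Hom_eq[OF disjI1[OF z2]] by metis
  next
   case (nat p)
   define i where "i = n - int p"
   have n: "int p + i = n" by (simp add: i_def)
   have d: "dI A (diag (E X) n) p' = jn X p i" unfolding inj2_def nat n ..
   note s0 = sh_simps[OF assms C.unt_Obj, of p 0 i 0, simplified]
   have "?f ** tenA MA (jn X p i) (Idt A (unt MA)) = mcomp (fa (sfun R) (run MC X)) n **
    ((kT X (unt MC) n 0 ** tenA MA (jn X p i) (jn (unt MC) 0 0)) ** tenA MA (Idt A (k p X i)) (e0 0))"
    using n by (simp add: eta_R0)
   also have "kT X (unt MC) n 0 ** tenA MA (jn X p i) (jn (unt MC) 0 0) = jn (tenO MC X (unt MC)) p i ** sh p 0 X (unt MC) i 0"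
    using kT_jn[OF assms C.unt_Obj n, of 0 0 0] by simp
   also have "mcomp (fa (sfun R) (run MC X)) n ** ((jn (tenO MC X (unt MC)) p i ** sh p 0 X (unt MC) i 0) ** tenA MA (Idt A (k p X i)) (e0 0))
    = (jn X p i ** Fm p (run MC X) i) ** (sh p 0 X (unt MC) i 0 ** tenA MA (Idt A (k p X i)) (e0 0))"
    using fa_R_facts(2)[of "run MC X" p i, unfolded n] n s0
    Comp_reassoc[of "mcomp (fa (sfun R) (run MC X)) n" "jn (tenO MC X (unt MC)) p i" _ "sh p 0 X (unt MC) i 0 ** tenA MA (Idt A (k p X i)) (e0 0)"]
    by simp
   also have "... = jn X p i ** run MA (k p X i)" using sh_unit(2)[OF assms, of p i] n s0 by simp
   finally show ?thesis unfolding d l(2)[OF n] .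
  qed
 qed simp
qed

lemma R_symmetry:
 assumes "X : Obj C" "Y : Obj C"
 shows "mcomp (fa (sfun R) (swp MC X Y)) (m + n) ** kT X Y m n
  = sgnm A (m * n) (kT Y X n m ** swp MA (cob (T X) m) (cob (T Y) n))" (is "?L = _")
proof (rule tenT_eqI[OF assms, where Z = "cob (T (tenO MC Y X)) (m + n)"])
 note [simp] = assms
 fix p i q j assume mn: "int p + i = m" "int q + j = n"
 let ?t1 = "kT Y X n m ** swp MA (cob (T X) m) (cob (T Y) n)"
 let ?t2 = "jn Y q j"
 let ?t3 = "jn X p i"
 have ix: "int (p + q) + (i + j) = m + n" using mn by simp
 have f: "mcomp (fa (sfun R) (swp MC X Y)) (m + n) ** jn (tenO MC X Y) (p + q) (i + j) = jn (tenO MC Y X) (p + q) (i + j) ** Fm (p + q) (swp MC X Y) (i + j)"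
  using fa_R_facts(2)[of "swp MC X Y" "p + q" "i + j"] ix by simp
 have w: "swp MA (cob (T X) m) (cob (T Y) n) ** tenA MA ?t3 ?t2 = tenA MA ?t2 ?t3 ** swp MA (k p X i) (k q Y j)"
  by (rule swp_nat) (use mn in "simp_all add: Hom_iff")
 have qp: "q + p = p + q" "j + i = i + j" "n + m = m + n" by simp_all
 have "?L ** tenA MA ?t3 ?t2
  = mcomp (fa (sfun R) (swp MC X Y)) (m + n) ** (jn (tenO MC X Y) (p + q) (i + j) ** sh p q X Y i j)"
  using mn kT_jn[OF assms mn] by simp
 also have "... = (jn (tenO MC Y X) (p + q) (i + j) ** Fm (p + q) (swp MC X Y) (i + j)) ** sh p q X Y i j"
  using ix by (intro Comp_reassoc[OF f]) (simp_all del: of_nat_add)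
 also have "... = jn (tenO MC Y X) (p + q) (i + j) ** sgnm A (m * n) (sh q p Y X j i ** swp MA (k p X i) (k q Y j))"
  using sh_symmetry[OF assms, of p q i j] mn by (simp del: of_nat_add)
 also have "... = sgnm A (m * n) ((kT Y X n m ** tenA MA ?t2 ?t3) ** swp MA (k p X i) (k q Y j))"
  unfolding kT_jn[OF assms(2,1) mn(2,1)] by (simp add: qp del: of_nat_add)
 also have "... = sgnm A (m * n) ?t1 ** tenA MA ?t3 ?t2"
  using mn w by (simp add: qp)
 finally show "?L ** tenA MA ?t3 ?t2
  = sgnm A (m * n) ?t1 ** tenA MA ?t3 ?t2" .
qed (use assms in "simp_all add: Hom_iff add.commute")

text \<open>The third factor is handled as for two factors. The first two sit inside a nested tensor
  product, so the identities of these factors are decomposed directly and expanded by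
  biadditivity.\<close>

lemma tenT_eqI3:
 assumes X: "X : Obj C" "Y : Obj C" "Z : Obj C"
  and f: "f : Hom A (tenO MA (tenO MA (cob (T X) m) (cob (T Y) n)) (cob (T Z) o')) W"
  and g: "g : Hom A (tenO MA (tenO MA (cob (T X) m) (cob (T Y) n)) (cob (T Z) o')) W"
  and *: "!!p i q j r l. [|int p + i = m; int q + j = n; int r + l = o'|] ==>
   f ** tenA MA (tenA MA (jn X p i) (jn Y q j)) (jn Z r l) = g ** tenA MA (tenA MA (jn X p i) (jn Y q j)) (jn Z r l)"
 shows "f = g"
proof -
 let ?t1 = "cob (T Z) o'"
 let ?t2 = "cob (T Y) n"
 let ?t3 = "diag (E X) m"
 let ?t4 = "diag (E Y) n"
 let ?t5 = "cob (T X) m"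
 let ?a = "asc MA ?t5 ?t2 ?t1"
 note [simp] = X
 have zero: "f' ** h = g' ** h" if "is_zero A V" "h : Hom A V V'" "f' : Hom A V' W'" "g' : Hom A V' W'" for f' g' h V V' W'
  using is_zero_Hom_eq[OF disjI1[OF that(1)]] Comp_Hom[OF that(2,3)] Comp_Hom[OF that(2,4)] by metis
 have 1: "f ** tenA MA (tenA MA (jn X p i) (jn Y q j)) (Idt A ?t1) = g ** tenA MA (tenA MA (jn X p i) (jn Y q j)) (Idt A ?t1)"
  if pq: "int p + i = m" "int q + j = n" for p i q j
 proof (unfold cob_Tot[of A "E Z"], rule tenO_dS_eqI_right[OF fam_E[OF X(3)], where W = "tenO MA (k p X i) (k q Y j)" and Z = W], unfold cob_Tot[of A "E Z", symmetric])
  let ?h = "tenA MA (tenA MA (jn X p i) (jn Y q j)) (Idt A ?t1)"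
  show h: "f ** ?h : Hom A (tenO MA (tenO MA (k p X i) (k q Y j)) ?t1) W" "g ** ?h : Hom A (tenO MA (tenO MA (k p X i) (k q Y j)) ?t1) W"
   using f g pq by (simp_all add: Hom_iff)
  fix r'
  show "(f ** ?h) ** tenA MA (Idt A (tenO MA (k p X i) (k q Y j))) (dI A (diag (E Z) o') r') = (g ** ?h) ** tenA MA (Idt A (tenO MA (k p X i) (k q Y j))) (dI A (diag (E Z) o') r')"
  proof (cases r' rule: int_cases_nat)
   case neg
   then have z: "is_zero A (diag (E Z) o' r')" using zero_obj by (simp add: diag_apply dob_E)
   have "is_zero A (tenO MA (tenO MA (k p X i) (k q Y j)) (diag (E Z) o' r'))" using z is_zero_Obj by (intro is_zero_tenO) auto
   from zero[OF this _ h] show ?thesis using fam_E[OF X(3), of o'] by (simp add: Hom_iff cob_Tot)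
  next
   case (nat r)
   have "dI A (diag (E Z) o') r' = jn Z r (o' - int r)" unfolding inj2_def nat by simp
   then show ?thesis using *[OF pq, of r "o' - int r"] f g pq by (simp add: Hom_iff)
  qed
 qed simp
 have 2: "f ** tenA MA (tenA MA (jn X p i) (Idt A ?t2)) (Idt A ?t1) = g ** tenA MA (tenA MA (jn X p i) (Idt A ?t2)) (Idt A ?t1)"
  if p: "int p + i = m" for p i
 proof -
  let ?h = "%f. %t. f ** tenA MA (tenA MA (jn X p i) t) (Idt A ?t1)"
  have dec: "?h f (Idt A ?t2) = hsum A (tenO MA (tenO MA (k p X i) ?t2) ?t1) W
    (%c. ?h f (dI A ?t4 c) ** tenA MA (tenA MA (Idt A (k p X i)) (dP A ?t4 c)) (Idt A ?t1)) (supp A ?t4)"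
   if "f : Hom A (tenO MA (tenO MA ?t5 ?t2) ?t1) W" for f
   unfolding cob_Tot[of A "E Y"] Idt_dS[OF fam_E[OF X(2)]]
   using that p Hom_Obj[OF that] fam_E[OF X(2), of n] by (simp add: Hom_iff tenA_hsum Comp_hsum cob_Tot[of A "E Y"])
  have "?h f (dI A ?t4 c) = ?h g (dI A ?t4 c)" for c
  proof (cases c rule: int_cases_nat)
   case neg
   then have z: "is_zero A (diag (E Y) n c)" using zero_obj by (simp add: diag_apply dob_E)
   have "is_zero A (tenO MA (tenO MA (k p X i) (diag (E Y) n c)) ?t1)" using z is_zero_Obj by (auto intro!: is_zero_tenO)
   from zero[OF this _ f g] show ?thesis using fam_E[OF X(2), of n] p by (simp add: Hom_iff cob_Tot[of A "E Y"])
  next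
   case (nat q)
   have "dI A ?t4 c = jn Y q (n - int q)" unfolding inj2_def nat by simp
   then show ?thesis using 1[OF p, of q "n - int q"] by simp
  qed
  then show ?thesis unfolding dec[OF f] dec[OF g] by simp
 qed
 let ?h = "%f. %t. f ** tenA MA (tenA MA t (Idt A ?t2)) (Idt A ?t1)"
 have dec: "f = hsum A (tenO MA (tenO MA ?t5 ?t2) ?t1) W
   (%c. ?h f (dI A ?t3 c) ** tenA MA (tenA MA (dP A ?t3 c) (Idt A ?t2)) (Idt A ?t1)) (supp A ?t3)"
  if ff: "f : Hom A (tenO MA (tenO MA ?t5 ?t2) ?t1) W" for f
 proof -
  have "f = ?h f (Idt A ?t5)" using ff by (simp add: Hom_iff)
  also have "... = hsum A (tenO MA (tenO MA ?t5 ?t2) ?t1) W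
   (%c. ?h f (dI A ?t3 c) ** tenA MA (tenA MA (dP A ?t3 c) (Idt A ?t2)) (Idt A ?t1)) (supp A ?t3)"
   unfolding cob_Tot[of A "E X"] Idt_dS[OF fam_E[OF X(1)]]
   using ff Hom_Obj[OF ff] fam_E[OF X(1), of m] by (simp add: Hom_iff tenA_hsum Comp_hsum cob_Tot[of A "E X"])
  finally show ?thesis .
 qed
 have "?h f (dI A ?t3 c) = ?h g (dI A ?t3 c)" for c
 proof (cases c rule: int_cases_nat)
  case neg
  then have z: "is_zero A (diag (E X) m c)" using zero_obj by (simp add: diag_apply dob_E)
  have "is_zero A (tenO MA (tenO MA (diag (E X) m c) ?t2) ?t1)" using z is_zero_Obj by (auto intro!: is_zero_tenO)
  from zero[OF this _ f g] show ?thesis using fam_E[OF X(1), of m] by (simp add: Hom_iff cob_Tot[of A "E X"])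
 next
  case (nat p)
  have "dI A ?t3 c = jn X p (m - int p)" unfolding inj2_def nat by simp
  then show ?thesis using 2[of p "m - int p"] by simp
 qed
 then show ?thesis by (subst dec[OF f], subst dec[OF g]) simp
qed

lemma R_assoc:
 assumes X: "X : Obj C" "Y : Obj C" "Z : Obj C"
 shows "mcomp (fa (sfun R) (asc MC X Y Z)) (m + n + o') ** (kT (tenO MC X Y) Z (m + n) o' ** tenA MA (kT X Y m n) (Idt A (cob (T Z) o')))
  = kT X (tenO MC Y Z) m (n + o') ** (tenA MA (Idt A (cob (T X) m)) (kT Y Z n o') ** asc MA (cob (T X) m) (cob (T Y) n) (cob (T Z) o'))" (is "?L = ?R")
proof (rule tenT_eqI3[OF X, where W = "cob (T (tenO MC X (tenO MC Y Z))) (m + n + o')"])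
 let ?t7 = "tenO MC X Y"
 note [simp] = X
 note [simp del] = of_nat_add
 fix p i q j r l assume mno: "int p + i = m" "int q + j = n" "int r + l = o'"
 let ?t1 = "sh (p + q) r ?t7 Z (i + j) l ** tenA MA (sh p q X Y i j) (Idt A (k r Z l))"
 let ?t2 = "tenA MA (Idt A (k p X i)) (sh q r Y Z j l) ** asc MA (k p X i) (k q Y j) (k r Z l)"
 let ?t3 = "fa (sfun R) (asc MC X Y Z)"
 let ?t4 = "i + j + l"
 let ?t5 = "p + q + r"
 let ?t6 = "tenO MC Y Z"
 let ?x = "tenA MA (tenA MA (jn X p i) (jn Y q j)) (jn Z r l)" and ?XYZ = "tenO MC X ?t6"
 have ix: "int (p + q) + (i + j) = m + n" "int (q + r) + (j + l) = n + o'" "int ?t5 + ?t4 = m + n + o'"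
  using mno by (simp_all add: of_nat_add)
 have f: "mcomp ?t3 (m + n + o') ** jn (tenO MC ?t7 Z) ?t5 ?t4
   = jn ?XYZ ?t5 ?t4 ** Fm ?t5 (asc MC X Y Z) ?t4"
  using fa_R_facts(2)[of "asc MC X Y Z" "p + q + r" "i + j + l", unfolded ix(3)] by simp
 have w: "asc MA (cob (T X) m) (cob (T Y) n) (cob (T Z) o') ** ?x = tenA MA (jn X p i) (tenA MA (jn Y q j) (jn Z r l)) ** asc MA (k p X i) (k q Y j) (k r Z l)"
  by (rule asc_nat) (use mno in "simp_all add: Hom_iff")
 have "?L ** ?x
  = mcomp ?t3 (m + n + o') ** (kT ?t7 Z (m + n) o' ** tenA MA (kT X Y m n ** tenA MA (jn X p i) (jn Y q j)) (jn Z r l))"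
  using mno by simp
 also have "... = mcomp ?t3 (m + n + o') ** ((kT ?t7 Z (m + n) o' ** tenA MA (jn ?t7 (p + q) (i + j)) (jn Z r l))
   ** tenA MA (sh p q X Y i j) (Idt A (k r Z l)))"
  unfolding kT_jn[OF X(1,2) mno(1,2)] by (simp add: ix mno)
 also have "... = mcomp ?t3 (m + n + o') ** (jn (tenO MC ?t7 Z) ?t5 ?t4
   ** ?t1)"
  using kT_jn[OF _ X(3) ix(1) mno(3), of "tenO MC X Y"] by (simp add: ix)
 also have "... = (jn ?XYZ ?t5 ?t4 ** Fm ?t5 (asc MC X Y Z) ?t4)
   ** ?t1"
  by (intro Comp_reassoc[OF f]) (simp_all add: ix)
 also have "... = jn ?XYZ ?t5 ?t4 ** (sh p (q + r) X ?t6 i (j + l) **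
   ?t2)"
  unfolding sh_assoc[OF X, symmetric] by simp
 also have "... = (kT X ?t6 m (n + o') ** tenA MA (jn X p i) (jn ?t6 (q + r) (j + l))) **
   ?t2"
  unfolding kT_jn[OF X(1) _ mno(1) ix(2), OF C.tenO_Obj[OF X(2,3)]] by (simp add: add.assoc)
 also have "... = kT X ?t6 m (n + o') ** (tenA MA (jn X p i) (kT Y Z n o' ** tenA MA (jn Y q j) (jn Z r l)) ** asc MA (k p X i) (k q Y j) (k r Z l))"
  unfolding kT_jn[OF X(2,3) mno(2,3)] by (simp add: ix mno)
 also have "... = ?R ** ?x"
  using mno w by simp
 finally show "?L ** ?x
  = ?R ** ?x" .
qed (use X in "simp_all add: Hom_iff add.assoc")

theorem sEM_Obj: "R : Obj S"
proof -
 have "smf_laws R"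
  unfolding smf_laws_def Let_def
  using R_leibniz R_natural R_assoc R_unit R_symmetry by (simp add: fo_R)
 moreover have "unif_bounded C A R"
 proof -
  obtain b where "!!X p q. X : Obj C ==> p < 0 | q < b ==> is_zero A (dob (E X) p q)" using bound_E by blast
  then have "is_zero A (cob (T X) n)" if "X : Obj C" "n < 0 + b" for X n
   using is_zero_Tot[OF fam_E[OF that(1)] _ that(2)] that(1) by blast
  then show ?thesis by (auto simp: unif_bounded_def fo_R)
 qed
 ultimately show ?thesis using R_shape by (simp add: Obj_S)
qed

end

section \<open>Maps induced by simplicial maps\<close>

locale simplicial_map = monoidal_functors C MC A MA +
 b: simplicial_functors C MC A MA B opr + b': simplicial_functors C MC A MA B' opr'
 for C :: "('o,'a,'y) cat_scheme" and MC and A :: "('p,'b,'z) acat_scheme" (structure) and MA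
  and B opr B' opr' +
 fixes ph
 assumes ph_Hom: "ph p : Hom (SyMonCh C MC A MA) (sob B p) (sob B' p)"
  and ph_opr: "smono m n sg ==> ph m **\<^bsub>SyMonCh C MC A MA\<^esub> opr n m sg = opr' n m sg **\<^bsub>SyMonCh C MC A MA\<^esub> ph n"
begin

abbreviation f where "f p X q \<equiv> mcomp (mtcomp (ph p) X) q"

lemma ph_facts: "ph p : Arr S" "mtdom (ph p) = sob B p" "mtcod (ph p) = sob B' p"
 using ph_Hom[of p] by (simp_all add: Hom_iff)

lemma f_simps [simp]:
 assumes "X : Obj C"
 shows "f p X q : Arr A" "Dom A (f p X q) = b.k p X q" "Cod A (f p X q) = b'.k p X q"
 using Arr_S_simps(5-7)[OF ph_facts(1) assms] ph_facts[of p] by simp_all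

lemmas f_laws = mnt_comp_laws(1,2,3,5)[OF ph_facts(1), unfolded ph_facts(2,3)]

lemma f_rop:
 assumes "smono m n sg" "X : Obj C"
 shows "f m X q ** b.rop n m sg X q = b'.rop n m sg X q ** f n X q"
 using arg_cong[OF ph_opr[OF assms(1)], of "%t. mcomp (mtcomp t X) q"] assms(2) by simp

lemma f_bd:
 assumes "X : Obj C" "0 < p"
 shows "f (p - 1) X q ** b.bd p X q = b'.bd p X q ** f p X q"
proof -
 note [simp] = assms(1) smono_cof[OF assms(2)] f_rop[OF smono_cof[OF assms(2)] assms(1)]
 note [simp del] = One_nat_def
 show ?thesis unfolding b.bd_def b'.bd_def by (simp add: Comp_hsum hsum_Comp)
qed

text \<open>Term by term: the simplicial map commutes with the operators and is monoidal in degree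
  \<open>p + q\<close>; signs are untouched.\<close>

lemma f_sh:
 assumes "X : Obj C" "Y : Obj C"
 shows "f (p + q) (tenO MC X Y) (i + j) ** b.sh p q X Y i j = b'.sh p q X Y i j ** tenA MA (f p X i) (f q Y j)"
proof -
 note [simp] = assms
 have t: "f (p + q) (tenO MC X Y) (i + j) ** b.sterm p q M X Y i j = b'.sterm p q M X Y i j ** tenA MA (f p X i) (f q Y j)"
  if M: "M \<in> shuffle_sets p q" for M
 proof -
  note sm = b.shuffle_smono[OF M]
  have "f (p + q) (tenO MC X Y) (i + j) ** b.sterm p q M X Y i j
   = (b'.K (p + q) X Y i j ** tenA MA (f (p + q) X i) (f (p + q) Y j))
    ** tenA MA (b.rop p (p + q) (cnt M) X i) (b.rop q (p + q) (cnt ({..<p + q} - M)) Y j)"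
   unfolding b.sterm_def using sm by (intro Comp_reassoc[OF f_laws(2)]) simp_all
  then show ?thesis unfolding b'.sterm_def using sm f_rop[OF sm(1)] f_rop[OF sm(2)] by simp
 qed
 show ?thesis unfolding b.sh_def b'.sh_def by (simp add: hsum_Comp Comp_hsum sgnm_hsum t)
qed

definition tmap where
 "tmap = \<lparr>mtdom = b.R, mtcod = b'.R, mtcomp = (\<lambda>X \<in> Obj C. tot_map A (b.E X) (b'.E X) (%p q. f p X q))\<rparr>"

abbreviation tf where "tf X n \<equiv> mcomp (mtcomp tmap X) n"

lemma tf_facts:
 assumes X: "X : Obj C"
 shows "tf X n : Hom A (cob (b.T X) n) (cob (b'.T X) n)"
  "int p + q = n ==> tf X n ** b.jn X p q = b'.jn X p q ** f p X q"
proof -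
 have "f p X q : Hom A (dob (b.E X) (int p) q) (dob (b'.E X) (int p) q)" for p q
  using X by (simp add: b.dob_E b'.dob_E Hom_iff)
 note t = tot_map_facts[OF b.fam_E[OF X] b'.fam_E[OF X] this]
 show "tf X n : Hom A (cob (b.T X) n) (cob (b'.T X) n)"
  unfolding tmap_def using X t(1) by simp
 show "int p + q = n ==> tf X n ** b.jn X p q = b'.jn X p q ** f p X q"
  unfolding tmap_def using X t(2)[of p q] by simp
qed

lemma tf_simps [simp]:
 assumes "X : Obj C"
 shows "tf X n : Arr A" "Dom A (tf X n) = cob (b.T X) n" "Cod A (tf X n) = cob (b'.T X) n"
  "mdom (mtcomp tmap X) = b.T X" "mcod (mtcomp tmap X) = b'.T X"
 using tf_facts(1)[OF assms, of n] assms by (simp_all add: Hom_iff) (simp_all add: tmap_def tot_map_def)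

lemma tf_chain:
 assumes X: "X : Obj C"
 shows "cdf (b'.T X) n ** tf X n = tf X (n - 1) ** cdf (b.T X) n" (is "?L = ?R")
proof (rule b.T_eqI[OF X])
 note [simp] = X
 note [simp del] = One_nat_def
 fix p q assume n: "int p + q = n"
 have ix: "int p + (q - 1) = n - 1" "0 < p ==> int (p - 1) + q = n - 1" "p = 0 ==> q = n" using n by auto
 have f1: "tf X (n - 1) ** b.jn X p (q - 1) = b'.jn X p (q - 1) ** f p X (q - 1)"
  by (rule tf_facts(2)[OF X ix(1)])
 have f2: "tf X (n - 1) ** b.jn X (p - 1) q = b'.jn X (p - 1) q ** f (p - 1) X q" if "0 < p"
  by (rule tf_facts(2)[OF X ix(2)[OF that]])
 have d: "b'.dv p X q ** f p X q = f p X (q - 1) ** b.dv p X q" by (rule f_laws(4)[OF X])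
 have "tf X (n - 1) ** (cdf (b.T X) n ** b.jn X p q) = Add A
  (if p = 0 then Zer A (b.k p X q) (cob (b'.T X) (n - 1)) else (b'.jn X (p - 1) q ** f (p - 1) X q) ** b.bd p X q)
  (sgnm A (int p) ((b'.jn X p (q - 1) ** f p X (q - 1)) ** b.dv p X q))"
  unfolding b.T_d_jn[OF X, of p q, unfolded n]
  using Comp_reassoc[OF f1] Comp_reassoc[OF f2]
  by (cases "p = 0") (simp_all add: Comp_Add_simp ix n)
 also have "... = Add A
   (if p = 0 then Zer A (b'.k p X q) (cob (b'.T X) (n - 1)) else b'.jn X (p - 1) q ** b'.bd p X q)
   (sgnm A (int p) (b'.jn X p (q - 1) ** b'.dv p X q)) ** f p X q"
  using d f_bd[OF X, of p q] by (cases "p = 0") (simp_all add: Add_Comp_simp ix n)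
 also have "... = cdf (b'.T X) n ** (b'.jn X p q ** f p X q)"
  using n by (intro Comp_reassoc[OF b'.T_d_jn[OF X, of p q, unfolded n], symmetric]) simp_all
 also have "... = cdf (b'.T X) n ** (tf X n ** b.jn X p q)" by (simp add: tf_facts(2)[OF X n])
 finally show "?L ** b.jn X p q = ?R ** b.jn X p q"
  using n by simp
qed (use X in "simp_all add: Hom_iff")

lemma tf_nat:
 assumes u: "u : Arr C"
 shows "tf (Cod C u) n ** mcomp (fa (sfun b.R) u) n = mcomp (fa (sfun b'.R) u) n ** tf (Dom C u) n" (is "?L = ?R")
proof (rule b.T_eqI[of "Dom C u"])
 note [simp] = u
 fix p q assume n: "int p + q = n"
 have 1: "mcomp (fa (sfun b.R) u) n ** b.jn (Dom C u) p q = b.jn (Cod C u) p q ** b.Fm p u q"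
  "mcomp (fa (sfun b'.R) u) n ** b'.jn (Dom C u) p q = b'.jn (Cod C u) p q ** b'.Fm p u q"
  using b.fa_R_facts(2)[OF u, of p q] b'.fa_R_facts(2)[OF u, of p q] n by simp_all
 have 2: "tf (Dom C u) n ** b.jn (Dom C u) p q = b'.jn (Dom C u) p q ** f p (Dom C u) q"
  "tf (Cod C u) n ** b.jn (Cod C u) p q = b'.jn (Cod C u) p q ** f p (Cod C u) q"
  using tf_facts(2)[OF _ n] by simp_all
 show "?L ** b.jn (Dom C u) p q
   = ?R ** b.jn (Dom C u) p q"
  using n 1 2 Comp_reassoc[OF 1(2)] Comp_reassoc[OF 2(2)] f_laws(1)[OF u, of p q] by simp
qed (use u in "simp_all add: Hom_iff")

lemma tf_kap:
 assumes X: "X : Obj C" "Y : Obj C"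
 shows "tf (tenO MC X Y) (m + n) ** b.kT X Y m n = b'.kT X Y m n ** tenA MA (tf X m) (tf Y n)" (is "?L = ?R")
proof (rule b.tenT_eqI[OF X, where Z = "cob (b'.T (tenO MC X Y)) (m + n)"])
 note [simp] = X
 note [simp del] = of_nat_add
 fix p i q j assume mn: "int p + i = m" "int q + j = n"
 let ?t1 = "tenO MC X Y"
 have ix: "int (p + q) + (i + j) = m + n" using mn by (simp add: of_nat_add)
 note t = tf_facts(2)[OF X(1) mn(1)] tf_facts(2)[OF X(2) mn(2)]
 have "?L ** tenA MA (b.jn X p i) (b.jn Y q j)
   = tf ?t1 (m + n) ** (b.jn ?t1 (p + q) (i + j) ** b.sh p q X Y i j)"
  using b.kT_jn[OF X mn] by (simp add: mn)
 also have "... = (b'.jn ?t1 (p + q) (i + j) ** f (p + q) ?t1 (i + j)) ** b.sh p q X Y i j"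
  by (rule Comp_reassoc[OF tf_facts(2)[OF _ ix]]) (simp_all add: ix)
 also have "... = (b'.jn ?t1 (p + q) (i + j) ** b'.sh p q X Y i j) ** tenA MA (f p X i) (f q Y j)"
  using f_sh[OF X] by (simp add: ix)
 also have "... = ?R ** tenA MA (b.jn X p i) (b.jn Y q j)"
  unfolding b'.kT_jn[OF X mn, symmetric] using t by (simp add: mn)
 finally show "?L ** tenA MA (b.jn X p i) (b.jn Y q j)
  = ?R ** tenA MA (b.jn X p i) (b.jn Y q j)" .
qed (use X in "simp_all add: Hom_iff")

theorem tmap_Hom: "tmap : Hom S b.R b'.R"
proof -
 have "mtcomp tmap X : Hom (Ch A) (b.T X) (b'.T X)" if "X : Obj C" for X
  unfolding Hom_Ch using that tf_chain by (simp add: Hom_iff)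
 moreover have "tf (unt MC) 0 ** mcomp (eta b.R) 0 = mcomp (eta b'.R) 0"
 proof -
  have "tf (unt MC) 0 ** (b.jn (unt MC) 0 0 ** b.e0 0) = (b'.jn (unt MC) 0 0 ** f 0 (unt MC) 0) ** b.e0 0"
   by (rule Comp_reassoc[OF tf_facts(2)]) simp_all
  then show ?thesis using f_laws(3)[of 0] by (simp add: b.eta_R0 b'.eta_R0)
 qed
 moreover have "mtcomp tmap \<in> extensional (Obj C)" "mtdom tmap = b.R" "mtcod tmap = b'.R"
  by (simp_all add: tmap_def)
 ultimately show ?thesis
  using b.sEM_Obj b'.sEM_Obj tf_nat tf_kap by (simp add: Hom_iff Arr_S mnt_comp_def b.fo_R b'.fo_R)
qed

end

section \<open>Maps induced by augmentations\<close>

locale augmented_simplicial = simplicial_functors +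
 fixes F \<epsilon>
 assumes \<epsilon>_Hom: "\<epsilon> : Hom (SyMonCh C MC A MA) (sob B 0) F"
  and \<epsilon>_faces: "\<epsilon> **\<^bsub>SyMonCh C MC A MA\<^esub> face B 1 0 = \<epsilon> **\<^bsub>SyMonCh C MC A MA\<^esub> face B 1 1"
begin

abbreviation e where "e X q \<equiv> mcomp (mtcomp \<epsilon> X) q"
abbreviation l where "l X q \<equiv> cob (fo (sfun F) X) q"

lemma \<epsilon>_facts: "\<epsilon> : Arr S" "mtdom \<epsilon> = sob B 0" "mtcod \<epsilon> = F" "F : Obj S"
proof -
 show a: "\<epsilon> : Arr S" "mtdom \<epsilon> = sob B 0" "mtcod \<epsilon> = F" using \<epsilon>_Hom by (simp_all add: Hom_iff)
 then show "F : Obj S" using Arr_S by metis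
qed

lemma e_simps [simp]:
 assumes "X : Obj C"
 shows "e X q : Arr A" "Dom A (e X q) = k 0 X q" "Cod A (e X q) = l X q"
 using Arr_S_simps(5-7)[OF \<epsilon>_facts(1) assms] \<epsilon>_facts by simp_all

lemmas e_laws = mnt_comp_laws(1,2,3,5)[OF \<epsilon>_facts(1), unfolded \<epsilon>_facts(2,3)]

lemmas [simp] = F_simps[OF Obj_S_simps(1)[OF \<epsilon>_facts(4)]] kc_simps[OF Obj_S_simps(1)[OF \<epsilon>_facts(4)]]
 eta_simps[OF Obj_S_simps(1)[OF \<epsilon>_facts(4)]]

text \<open>In degree 1 the simplicial differential is the difference of two faces, which the
  augmentation identifies.\<close>

lemma e_bd:
 assumes X: "X : Obj C"
 shows "e X q ** bd 1 X q = Zer A (k 1 X q) (l X q)" (is "?L = ?R")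
proof -
 let ?t1 = "e X q ** rop 1 0 (cof 1) X q"
 have sm: "smono 0 1 (cof 0)" "smono 0 1 (cof 1)" using smono_cof[of 1] by simp_all
 have f: "face B 1 0 = opr 1 0 (cof 0)" "face B 1 1 = opr 1 0 (cof 1)" using s.face[of 1] by simp_all
 have eq: "e X q ** rop 1 0 (cof 0) X q = e X q ** rop 1 0 (cof 1) X q"
  using arg_cong[OF \<epsilon>_faces, of "%t. mcomp (mtcomp t X) q"] X unfolding f by simp
 have s: "{..1::nat} = insert 0 {1}" by auto
 have "bd 1 X q = Add A (rop 1 0 (cof 0) X q) (sgnm A 1 (rop 1 0 (cof 1) X q))"
  unfolding bd_def s using sm X by (subst hsum_insert) (auto simp: hsum_single Hom_iff)
 then have "?L = Add A ?t1 (sgnm A 1 ?t1)"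
  using sm X eq by (simp add: Comp_Add_simp)
 also have "... = ?R"
  using sm X Add_sgnm_cancel[of "e X q ** rop 1 0 (cof 1) X q" "k 1 X q" "l X q" 0 1] by (simp add: Hom_iff)
 finally show ?thesis .
qed

definition aug_map where
 "aug_map = \<lparr>mtdom = R, mtcod = F, mtcomp = (\<lambda>X \<in> Obj C. \<lparr>mdom = T X, mcod = fo (sfun F) X,
   mcomp = (%n. e X n ** dP A (diag (E X) n) 0)\<rparr>)\<rparr>"

abbreviation ae where "ae X n \<equiv> mcomp (mtcomp aug_map X) n"

lemma ae_simps [simp]:
 assumes X: "X : Obj C"
 shows "ae X n : Arr A" "Dom A (ae X n) = cob (T X) n" "Cod A (ae X n) = l X n"
  "mdom (mtcomp aug_map X) = T X" "mcod (mtcomp aug_map X) = fo (sfun F) X"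
 using X fam_E[OF X, of n] by (simp_all add: aug_map_def cob_Tot diag_apply dob_E)

lemma ae_jn:
 assumes X: "X : Obj C" and n: "int p + q = n"
 shows "ae X n ** jn X p q = (if p = 0 then e X q else Zer A (k p X q) (l X n))"
proof -
 have "ae X (int p + q) ** jn X p q = e X (int p + q) ** (dP A (diag (E X) (int p + q)) 0 ** jn X p q)"
  using X fam_E[OF X, of "int p + q"] by (simp add: aug_map_def cob_Tot[symmetric] diag_apply dob_E)
 then show ?thesis using dP_jn[OF X, of p q 0] X n by auto
qed

lemma sh_0_0:
 assumes "X : Obj C" "Y : Obj C"
 shows "sh 0 0 X Y i j = K 0 X Y i j"
proof -
 have id: "rop 0 0 (cnt {}) X i = Idt A (k 0 X i)" if "X : Obj C" for X i
  by (rule rop_id) (use that in "auto simp: cnt_def")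
 have "shuffle_sets 0 0 = {{}}" by (auto simp: shuffle_sets_def)
 then show ?thesis using assms by (simp add: sh_def sterm_def id Hom_iff inversions_def)
qed

lemma ae_chain:
 assumes X: "X : Obj C"
 shows "cdf (fo (sfun F) X) n ** ae X n = ae X (n - 1) ** cdf (T X) n" (is "?L = ?R")
proof (rule T_eqI[OF X])
 note [simp] = X
 note [simp del] = One_nat_def
 fix p q assume n: "int p + q = n"
 let ?t1 = "l X (n - 1)"
 have ix: "int p + (q - 1) = n - 1" "0 < p ==> int (p - 1) + q = n - 1" "p = 0 ==> q = n" "p = 1 ==> q = n - 1" using n by auto
 have f1: "ae X (n - 1) ** jn X p (q - 1) = (if p = 0 then e X (q - 1) else Zer A (k p X (q - 1)) ?t1)"
  by (rule ae_jn[OF X ix(1)])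
 have f2: "ae X (n - 1) ** jn X (p - 1) q = (if p = 1 then e X q else Zer A (k (p - 1) X q) ?t1)" if "0 < p"
  using ae_jn[OF X ix(2)[OF that]] that by auto
 have d: "cdf (fo (sfun F) X) q ** e X q = e X (q - 1) ** dv 0 X q" by (rule e_laws(4)[OF X])
 have "ae X (n - 1) ** (cdf (T X) n ** jn X p q) = Add A
  (if p = 0 then Zer A (k p X q) ?t1 else (ae X (n - 1) ** jn X (p - 1) q) ** bd p X q)
  (sgnm A (int p) ((ae X (n - 1) ** jn X p (q - 1)) ** dv p X q))"
  unfolding T_d_jn[OF X, of p q, unfolded n] by (cases "p = 0") (simp_all add: Comp_Add_simp ix n)
 \<comment> \<open>Only the columns 0 and 1 are mapped to column 0 by the differential, and on
   column 1 the simplicial part is killed by \<open>e_bd\<close>.\<close>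
 also have "... = (if p = 0 then e X (q - 1) ** dv 0 X q else Zer A (k p X q) ?t1)"
 proof (cases "p = 0")
  case False
  have "(if p = 1 then e X q else Zer A (k (p - 1) X q) ?t1) ** bd p X q = Zer A (k p X q) ?t1"
  proof (cases "p = 1")
   case True
   then show ?thesis using e_bd[OF X, of q] ix(4) by simp
  qed (use False in simp)
  then show ?thesis using False f1 f2 by simp
 qed (use f1 ix(3) in simp)
 also have "... = cdf (fo (sfun F) X) n ** (ae X n ** jn X p q)"
  unfolding ae_jn[OF X n] d[symmetric] using ix(3) by auto
 finally show "?L ** jn X p q = ?R ** jn X p q"
  using n by simp
qed (use X in "simp_all add: Hom_iff")

lemma ae_nat:
 assumes u: "u : Arr C"
 shows "ae (Cod C u) n ** mcomp (fa (sfun R) u) n = mcomp (fa (sfun F) u) n ** ae (Dom C u) n" (is "?L = ?R")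
proof (rule T_eqI[of "Dom C u"])
 note [simp] = u
 fix p q assume n: "int p + q = n"
 have "ae (Cod C u) n ** (mcomp (fa (sfun R) u) n ** jn (Dom C u) p q) = (ae (Cod C u) n ** jn (Cod C u) p q) ** Fm p u q"
  using fa_R_facts(2)[OF u, of p q] n by simp
 also have "... = mcomp (fa (sfun F) u) n ** (ae (Dom C u) n ** jn (Dom C u) p q)"
  unfolding ae_jn[OF C.Dom_Cod_Obj(2)[OF u] n] ae_jn[OF C.Dom_Cod_Obj(1)[OF u] n] using e_laws(1)[OF u, of q] n by auto
 finally show "?L ** jn (Dom C u) p q
   = ?R ** jn (Dom C u) p q"
  using n by simp
qed (use u in "simp_all add: Hom_iff")

lemma ae_kap:
 assumes X: "X : Obj C" "Y : Obj C"
 shows "ae (tenO MC X Y) (m + n) ** kT X Y m n = kc A MA F X Y m n ** tenA MA (ae X m) (ae Y n)" (is "?L = ?R")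
proof (rule tenT_eqI[OF X, where Z = "l (tenO MC X Y) (m + n)"])
 note [simp] = X
 note [simp del] = of_nat_add
 fix p i q j assume mn: "int p + i = m" "int q + j = n"
 let ?t1 = "tenO MC X Y"
 have ix: "int (p + q) + (i + j) = m + n" using mn by (simp add: of_nat_add)
 have a: "ae ?t1 (m + n) ** jn ?t1 (p + q) (i + j) =
   (if p + q = 0 then e ?t1 (i + j) else Zer A (k (p + q) ?t1 (i + j)) (l ?t1 (m + n)))"
  by (rule ae_jn[OF _ ix]) simp
 have "?L ** tenA MA (jn X p i) (jn Y q j)
   = ae ?t1 (m + n) ** (jn ?t1 (p + q) (i + j) ** sh p q X Y i j)"
  using kT_jn[OF X mn] by (simp add: mn)
 also have "... = (if p + q = 0 then e ?t1 (i + j) else Zer A (k (p + q) ?t1 (i + j)) (l ?t1 (m + n))) ** sh p q X Y i j"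
  by (rule Comp_reassoc[OF a]) (simp_all add: ix)
 also have "... = kc A MA F X Y m n ** tenA MA (if p = 0 then e X i else Zer A (k p X i) (l X m)) (if q = 0 then e Y j else Zer A (k q Y j) (l Y n))"
 proof (cases "p = 0 & q = 0")
  case True
  then show ?thesis using e_laws(2)[OF X, of i j] mn by (simp add: sh_0_0)
 next
  \<comment> \<open>If one of the factors has positive simplicial degree, so does the product, and
    both sides are zero.\<close>
  case False
  have z: "p = 0 ==> i = m" "q = 0 ==> j = n" using mn by simp_all
  show ?thesis using False by (cases "p = 0"; cases "q = 0") (simp_all add: z)
 qed
 also have "... = ?R ** tenA MA (jn X p i) (jn Y q j)"
  unfolding ae_jn[OF X(1) mn(1), symmetric] ae_jn[OF X(2) mn(2), symmetric] by (simp add: mn)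
 finally show "?L ** tenA MA (jn X p i) (jn Y q j)
  = ?R ** tenA MA (jn X p i) (jn Y q j)" .
qed (use X in "simp_all add: Hom_iff")

theorem aug_map_Hom: "aug_map : Hom S R F"
proof -
 have "mtcomp aug_map X : Hom (Ch A) (T X) (fo (sfun F) X)" if "X : Obj C" for X
  unfolding Hom_Ch using that ae_chain by (simp add: Hom_iff)
 moreover have "ae (unt MC) 0 ** mcomp (eta R) 0 = mcomp (eta F) 0"
 proof -
  have "ae (unt MC) 0 ** (jn (unt MC) 0 0 ** e0 0) = e (unt MC) 0 ** e0 0"
   using ae_jn[of "unt MC" 0 0 0] by (intro Comp_reassoc) simp_all
  then show ?thesis using e_laws(3) by (simp add: eta_R0)
 qed
 moreover have "mtcomp aug_map \<in> extensional (Obj C)" "mtdom aug_map = R" "mtcod aug_map = F"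
  by (simp_all add: aug_map_def)
 ultimately show ?thesis
  using sEM_Obj \<epsilon>_facts(4) ae_nat ae_kap by (simp add: Hom_iff Arr_S mnt_comp_def fo_R)
qed

end

section \<open>Mapping cones of total complexes\<close>

definition cfm :: "('o,'a) cmap => int => bool => 'o" where
 "cfm f n b = (if b then cob (mcod f) n else cob (mdom f) (n - 1))"

lemma cob_cone: "cob (cone A f) n = dS A (cfm f n)"
 by (simp add: cone_def Let_def cfm_def[abs_def])

context additive begin

lemma fam_bool: "X False : Obj A ==> X True : Obj A ==> fam A (X :: bool => 'o)"
 unfolding fam_def by (metis (full_types) finite_code)

lemma dS_desc:
 assumes X: "fam A X" and v: "!!i. v i : Hom A (X i) Z"
 obtains h where "h : Hom A (dS A X) Z" "!!i. h ** dI A X i = v i"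
proof
 let ?h = "hsum A (dS A X) Z (%i. v i ** dP A X i) (supp A X)"
 have v': "v i : Arr A" "Dom A (v i) = X i" "Cod A (v i) = Z" for i using v by (simp_all add: Hom_iff)
 have Z: "Z : Obj A" using Hom_Obj[OF v] by blast
 show "?h : Hom A (dS A X) Z" using X v' Z by (intro hsum_Hom) (auto simp: Hom_iff)
 fix k
 have "?h ** dI A X k = hsum A (X k) Z (%i. if i = k then v k else Zer A (X k) Z) (supp A X)"
  using X v' Z by (subst hsum_Comp) (auto intro!: hsum_cong simp: simp_implies_def)
 also have "... = v k"
 proof (cases "k \<in> supp A X")
  case True
  then show ?thesis using v fam_finite[OF X] by (subst hsum_single[of _ k]) auto
 next
  case False
  then have vk: "v k = Zer A (X k) Z" using is_zero_Hom_eq[OF disjI1 v] supp_zero by metis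
  show ?thesis unfolding vk using X Z by (intro hsum_Zer) auto
 qed
 finally show "?h ** dI A X k = v k" .
qed

lemma sgnm_1: "sgnm A 1 f = neg A f"
 by (simp add: sgnm_def)

context
 fixes f :: "('o,'a) cmap"
 assumes C: "is_cpx A (mdom f)" "is_cpx A (mcod f)" and f: "!!n. mcomp f n : Hom A (cob (mdom f) n) (cob (mcod f) n)"
begin

lemma fam_cfm: "fam A (cfm f n)"
 using C by (intro fam_bool) (simp_all add: cfm_def)

lemma cone_d_facts:
 "cdf (cone A f) n : Hom A (cob (cone A f) n) (cob (cone A f) (n - 1))"
 "cdf (cone A f) n ** dI A (cfm f n) False =
   Add A (dI A (cfm f (n - 1)) True ** mcomp f (n - 1)) (neg A (dI A (cfm f (n - 1)) False ** cdf (mdom f) (n - 1)))"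
 "cdf (cone A f) n ** dI A (cfm f n) True = dI A (cfm f (n - 1)) True ** cdf (mcod f) n"
proof -
 let ?t1 = "cone A f"
 let ?m = "%b b'. if b then (if b' then cdf (mcod f) n else Zer A (cob (mcod f) n) (cob (mdom f) (n - 2)))
    else (if b' then mcomp f (n - 1) else neg A (cdf (mdom f) (n - 1)))"
 have d: "cdf ?t1 n = dmat A (cfm f n) (cfm f (n - 1)) ?m"
  by (simp add: cone_def Let_def cfm_def[abs_def])
 have f': "mcomp f n : Arr A" "Dom A (mcomp f n) = cob (mdom f) n" "Cod A (mcomp f n) = cob (mcod f) n" for n
  using f[of n] by (simp_all add: Hom_iff)
 have m: "?m b b' : Hom A (cfm f n b) (cfm f (n - 1) b')" for b b'
  using C f' by (simp add: cfm_def Hom_iff)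
 show "cdf ?t1 n : Hom A (cob ?t1 n) (cob ?t1 (n - 1))"
  unfolding d cob_cone by (rule dmat_Hom[OF fam_cfm fam_cfm m])
 have "dmat A (cfm f n) (cfm f (n - 1)) ?m ** dI A (cfm f n) False
   = hsum A (cfm f n False) (dS A (cfm f (n - 1))) (%b'. dI A (cfm f (n - 1)) b' ** ?m False b') (insert True {False})"
  by (rule dmat_dI[OF fam_cfm fam_cfm m]) auto
 also have "... = Add A (dI A (cfm f (n - 1)) True ** mcomp f (n - 1)) (neg A (dI A (cfm f (n - 1)) False ** cdf (mdom f) (n - 1)))"
  using fam_cfm C f' by (subst hsum_insert) (auto simp: Hom_iff cfm_def)
 finally show "cdf ?t1 n ** dI A (cfm f n) False =
   Add A (dI A (cfm f (n - 1)) True ** mcomp f (n - 1)) (neg A (dI A (cfm f (n - 1)) False ** cdf (mdom f) (n - 1)))"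
  unfolding d .
 have "dmat A (cfm f n) (cfm f (n - 1)) ?m ** dI A (cfm f n) True = dI A (cfm f (n - 1)) True ** ?m True True"
  by (rule dmat_dI_single[OF fam_cfm fam_cfm m]) (auto simp: cfm_def)
 then show "cdf ?t1 n ** dI A (cfm f n) True = dI A (cfm f (n - 1)) True ** cdf (mcod f) n"
  unfolding d by simp
qed

end

text \<open>A degreewise inverse of a chain map commutes with the differentials automatically, and
  zero homotopies suffice.\<close>

lemma homotopy_equivalent_iso:
 assumes "f : Hom (Ch A) X Y" "!!n. h n : Hom A (cob Y n) (cob X n)"
  "!!n. h n ** mcomp f n = Idt A (cob X n)" "!!n. mcomp f n ** h n = Idt A (cob Y n)"
 shows "homotopy_equivalent A X Y"
proof -
 have X: "X : Obj (Ch A)" "Y : Obj (Ch A)" "f : Arr (Ch A)" "mdom f = X" "mcod f = Y"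
  and c: "!!n. cdf Y n ** mcomp f n = mcomp f (n - 1) ** cdf X n"
  using assms(1) unfolding Hom_Ch by (auto simp: Arr_Ch)
 have fn: "mcomp f n : Arr A" "Dom A (mcomp f n) = cob X n" "Cod A (mcomp f n) = cob Y n" for n
  using X by simp_all
 have hn: "h n : Arr A" "Dom A (h n) = cob Y n" "Cod A (h n) = cob X n" for n
  using assms(2)[of n] by (simp_all add: Hom_iff)
 let ?g = "\<lparr>mdom = Y, mcod = X, mcomp = h\<rparr>"
 have "cdf X n ** h n = h (n - 1) ** cdf Y n" for n
 proof -
  have "cdf X n ** h n = (h (n - 1) ** mcomp f (n - 1)) ** (cdf X n ** h n)"
   unfolding assms(3) using X hn by simp
  also have "... = h (n - 1) ** ((mcomp f (n - 1) ** cdf X n) ** h n)" using X hn fn by simp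
  also have "... = h (n - 1) ** (cdf Y n ** (mcomp f n ** h n))" unfolding c[symmetric] using X hn fn by simp
  finally show ?thesis unfolding assms(4) using X hn by simp
 qed
 then have g: "?g : Hom (Ch A) Y X" unfolding Hom_Ch using X assms(2) by simp
 have refl: "homotopic A u v" if "mdom u = V" "mcod u = V" "mdom v = V" "mcod v = V" "V : Obj (Ch A)" "!!n. mcomp u n = Idt A (cob V n)" "!!n. mcomp v n = Idt A (cob V n)" for u v V
  unfolding homotopic_def using that
  by (intro conjI exI[of _ "%n. Zer A (cob V n) (cob V (n + 1))"]) (simp_all add: Hom_iff)
 have "homotopic A (?g **\<^bsub>Ch A\<^esub> f) (Idt (Ch A) X)" using X assms(3) by (intro refl[of _ X]) simp_all
 moreover have "homotopic A (f **\<^bsub>Ch A\<^esub> ?g) (Idt (Ch A) Y)" using X assms(4) by (intro refl[of _ Y]) simp_all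
 ultimately show ?thesis
  unfolding homotopy_equivalent_def using assms(1) g by blast
qed

text \<open>Total complexes up to isomorphism: the total complex of a double complex of functors is
 computed objectwise, hence is not the one chosen by \<open>Tot\<close>.\<close>
definition is_total :: "('o,'a) dcpx => ('o,'a) cpx => (int => int => 'a) => bool" where
 "is_total E P J \<longleftrightarrow> (ALL p q. J p q : Hom A (dob E p q) (cob P (p + q))) &
   (ALL n Z u. (ALL p. u p : Hom A (dob E p (n - p)) Z) --> (EX h:Hom A (cob P n) Z. ALL p. h ** J p (n - p) = u p)) &
   (ALL n Z f g. f : Hom A (cob P n) Z --> g : Hom A (cob P n) Z --> (ALL p. f ** J p (n - p) = g ** J p (n - p)) --> f = g) &
   (ALL p q. cdf P (p + q) ** J p q = Add A (J (p - 1) q ** dd1 E p q) (sgnm A p (J p (q - 1) ** dd2 E p q)))"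

end

definition col :: "('o,'a) dcpx => int => ('o,'a) cpx" where
 "col E p = \<lparr>cob = dob E p, cdf = dd2 E p\<rparr>"

definition colmap :: "('o,'a) dcpx => ('o,'a) dcpx => (int => int => 'a) => int => ('o,'a) cmap" where
 "colmap E E' h p = \<lparr>mdom = col E p, mcod = col E' p, mcomp = h p\<rparr>"

text \<open>A map of double complexes together with the map \<open>g\<close> it induces on total
  complexes. Compatibility of \<open>h\<close> with the internal differential \<open>dd2\<close> is
  contained in \<open>cone_cpx\<close>, which makes the cones of the columns complexes.\<close>

locale cone_total = additive A for A :: "('o,'a,'z) acat_scheme" (structure) +
 fixes E E' h P P' g J J' and b :: int
 assumes E: "is_dcpx A E" "is_dcpx A E'"
  and bnd: "!!p q. p < b | q < b ==> is_zero A (dob E p q) & is_zero A (dob E' p q)"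
  and h_Hom: "h p q : Hom A (dob E p q) (dob E' p q)"
  and h_dd1: "dd1 E' p q ** h p q = h (p - 1) q ** dd1 E p q"
  and cone_cpx: "is_cpx A (cone A (colmap E E' h p))"
  and g: "g : Hom (Ch A) P P'"
  and tot: "is_total E P J" "is_total E' P' J'"
  and g_J: "mcomp g (p + q) ** J p q = J' p q ** h p q"
begin

lemma famE: "fam A (diag E n)" "fam A (diag E' n)"
proof -
 have "dob E p q : Obj A" "dob E' p q : Obj A" for p q using E unfolding is_dcpx_def by blast+
 then show "fam A (diag E n)" "fam A (diag E' n)" using fam_diag[of E b b n] fam_diag[of E' b b n] bnd by blast+
qed

lemmas [simp] = dcpx_simps[OF E(1) famE(1)] dcpx_simps[OF E(2) famE(2)]

lemma h_simps [simp]: "h p q : Arr A" "Dom A (h p q) = dob E p q" "Cod A (h p q) = dob E' p q"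
 using h_Hom[of p q] by (simp_all add: Hom_iff)

lemma g_simps [simp]: "mdom g = P" "mcod g = P'" "P : Obj (Ch A)" "P' : Obj (Ch A)"
  "mcomp g n : Arr A" "Dom A (mcomp g n) = cob P n" "Cod A (mcomp g n) = cob P' n"
 using g unfolding Hom_Ch by (auto simp: Hom_iff)

lemma J_simps [simp]: "J p q : Arr A" "Dom A (J p q) = dob E p q" "Cod A (J p q) = cob P (p + q)"
 "J' p q : Arr A" "Dom A (J' p q) = dob E' p q" "Cod A (J' p q) = cob P' (p + q)"
 using tot by (simp_all add: is_total_def Hom_iff)

lemma J_d: "cdf P (p + q) ** J p q = Add A (J (p - 1) q ** dd1 E p q) (sgnm A p (J p (q - 1) ** dd2 E p q))"
 "cdf P' (p + q) ** J' p q = Add A (J' (p - 1) q ** dd1 E' p q) (sgnm A p (J' p (q - 1) ** dd2 E' p q))"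
 using tot by (simp_all add: is_total_def)

lemma J_desc:
 "(!!p. u p : Hom A (dob E p (n - p)) Z) ==> EX h:Hom A (cob P n) Z. ALL p. h ** J p (n - p) = u p"
 "(!!p. u p : Hom A (dob E' p (n - p)) Z) ==> EX h:Hom A (cob P' n) Z. ALL p. h ** J' p (n - p) = u p"
 using tot(1)[unfolded is_total_def, THEN conjR, THEN conjunct1, THEN spec[where x = n], THEN spec[where x = Z], THEN spec[where x = u]]
  tot(2)[unfolded is_total_def, THEN conjR, THEN conjunct1, THEN spec[where x = n], THEN spec[where x = Z], THEN spec[where x = u]]
 by blast+

definition fm where "fm a c = cfm (colmap E E' h c) a"

lemma fm: "fm a c False = dob E c (a - 1)" "fm a c True = dob E' c a"
 by (simp_all add: fm_def cfm_def colmap_def col_def)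

lemma fam_fm: "fam A (fm a c)"
 by (rule fam_bool) (simp_all add: fm)

lemma col_cpx: "is_cpx A (col E c)" "is_cpx A (col E' c)"
 by (simp_all add: is_cpx_def col_def Hom_iff)

lemma cobc: "cob (cone A (colmap E E' h c)) a = dS A (fm a c)"
 by (simp add: cob_cone fm_def)

lemma cone_col:
 "cdf (cone A (colmap E E' h c)) a : Hom A (dS A (fm a c)) (dS A (fm (a - 1) c))"
 "cdf (cone A (colmap E E' h c)) a ** dI A (fm a c) False =
   Add A (dI A (fm (a - 1) c) True ** h c (a - 1)) (neg A (dI A (fm (a - 1) c) False ** dd2 E c (a - 1)))"
 "cdf (cone A (colmap E E' h c)) a ** dI A (fm a c) True = dI A (fm (a - 1) c) True ** dd2 E' c a"
 using cone_d_facts[of "colmap E E' h c" a] col_cpx[of c] h_Hom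
 by (simp_all add: colmap_def fm_def cob_cone) (simp_all add: col_def)

text \<open>Since (AC5) speaks of rows while the maps run along columns, the two indices change
  roles: \<open>a\<close> is the degree in the cone of a column and \<open>c\<close> is the
  simplicial degree.\<close>

definition Q :: "('o,'a) dcpx" where
 "Q = \<lparr>dob = (%a c. dS A (fm a c)), dd1 = (%a c. cdf (cone A (colmap E E' h c)) a),
   dd2 = (%a c. dmat A (fm a c) (fm a (c - 1)) (%x y. if x = y then (if x then dd1 E' c a else dd1 E c (a - 1))
    else Zer A (fm a c x) (fm a (c - 1) y)))\<rparr>"

lemma Q_simps: "dob Q a c = dS A (fm a c)" "row Q c = cone A (colmap E E' h c)"
 by (simp_all add: Q_def row_def cobc[symmetric])

lemma Q_d2:
 "dd2 Q a c : Hom A (dS A (fm a c)) (dS A (fm a (c - 1)))"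
 "dd2 Q a c ** dI A (fm a c) False = dI A (fm a (c - 1)) False ** dd1 E c (a - 1)"
 "dd2 Q a c ** dI A (fm a c) True = dI A (fm a (c - 1)) True ** dd1 E' c a"
proof -
 let ?m = "%x y. if x = y then (if x then dd1 E' c a else dd1 E c (a - 1)) else Zer A (fm a c x) (fm a (c - 1) y)"
 have m: "?m x y : Hom A (fm a c x) (fm a (c - 1) y)" for x y
  using dsum_simps(2)[OF fam_fm] by (cases x; cases y) (simp_all add: fm Hom_iff)
 show "dd2 Q a c : Hom A (dS A (fm a c)) (dS A (fm a (c - 1)))"
  unfolding Q_def dcpx.simps by (rule dmat_Hom[OF fam_fm fam_fm m])
 show "dd2 Q a c ** dI A (fm a c) False = dI A (fm a (c - 1)) False ** dd1 E c (a - 1)"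
  using dmat_dI_single[OF fam_fm fam_fm m, of False False] by (simp add: Q_def)
 show "dd2 Q a c ** dI A (fm a c) True = dI A (fm a (c - 1)) True ** dd1 E' c a"
  using dmat_dI_single[OF fam_fm fam_fm m, of True True] by (simp add: Q_def)
qed

lemma dI_fm [simp]: "dI A (fm a c) x : Arr A" "Dom A (dI A (fm a c) x) = fm a c x" "Cod A (dI A (fm a c) x) = dS A (fm a c)"
 "dS A (fm a c) : Obj A"
 using fam_fm[of a c] by simp_all

lemma Q_d1: "dd1 Q a c : Hom A (dS A (fm a c)) (dS A (fm (a - 1) c))"
 "dd1 Q a c ** dI A (fm a c) False = Add A (dI A (fm (a - 1) c) True ** h c (a - 1)) (neg A (dI A (fm (a - 1) c) False ** dd2 E c (a - 1)))"
 "dd1 Q a c ** dI A (fm a c) True = dI A (fm (a - 1) c) True ** dd2 E' c a"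
 using cone_col[of c a] by (simp_all add: Q_def)

lemma Qd_simps [simp]:
 "dd1 Q a c : Arr A" "Dom A (dd1 Q a c) = dS A (fm a c)" "Cod A (dd1 Q a c) = dS A (fm (a - 1) c)"
 "dd2 Q a c : Arr A" "Dom A (dd2 Q a c) = dS A (fm a c)" "Cod A (dd2 Q a c) = dS A (fm a (c - 1))"
 using Q_d1(1)[of a c] Q_d2(1)[of a c] by (simp_all add: Hom_iff)

lemma is_dcpx_Q: "is_dcpx A Q"
 unfolding is_dcpx_def
proof (intro allI conjI)
 fix a c
 show "dob Q a c : Obj A" "dd1 Q a c : Hom A (dob Q a c) (dob Q (a - 1) c)" "dd2 Q a c : Hom A (dob Q a c) (dob Q a (c - 1))"
  by (simp_all add: Q_simps Hom_iff)
 show "dd1 Q (a - 1) c ** dd1 Q a c = Zer A (dob Q a c) (dob Q (a - 2) c)"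
  using cpx_simps(5)[OF cone_cpx, of c a] by (simp add: Q_def cobc)
 show "dd2 Q a (c - 1) ** dd2 Q a c = Zer A (dob Q a c) (dob Q a (c - 2))"
  unfolding Q_simps
 proof (rule dS_eqI[OF fam_fm])
  fix x show "(dd2 Q a (c - 1) ** dd2 Q a c) ** dI A (fm a c) x = Zer A (dS A (fm a c)) (dS A (fm a (c - 2))) ** dI A (fm a c) x"
   using Q_d2(2,3)[of a c] Comp_reassoc[OF Q_d2(2)[of a "c - 1"], of "dd1 E c (a - 1)"] Comp_reassoc[OF Q_d2(3)[of a "c - 1"], of "dd1 E' c a"]
   by (cases x) (simp_all add: fm)
 qed (simp_all add: Hom_iff)
 show "dd1 Q a (c - 1) ** dd2 Q a c = dd2 Q (a - 1) c ** dd1 Q a c"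
 proof (rule dS_eqI[OF fam_fm])
  fix x show "(dd1 Q a (c - 1) ** dd2 Q a c) ** dI A (fm a c) x = (dd2 Q (a - 1) c ** dd1 Q a c) ** dI A (fm a c) x"
  proof (cases x)
   case True
   then show ?thesis using Q_d2(3)[of a c] Q_d1(3)[of a c]
    Comp_reassoc[OF Q_d1(3)[of a "c - 1"], of "dd1 E' c a"] Comp_reassoc[OF Q_d2(3)[of "a - 1" c], of "dd2 E' c a"]
    by (simp add: fm)
  next
   case False
   then show ?thesis using Q_d2(2)[of a c] Q_d1(2)[of a c] h_dd1[of c "a - 1"] dcpx_simps(10)[OF E(1) famE(1), of c "a - 1"]
    Comp_reassoc[OF Q_d1(2)[of a "c - 1"], of "dd1 E c (a - 1)"]
    Comp_reassoc[OF Q_d2(2)[of "a - 1" c], of "dd2 E c (a - 1)"] Comp_reassoc[OF Q_d2(3)[of "a - 1" c], of "h c (a - 1)"]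
    by (simp add: fm Add_Comp_simp Comp_Add_simp)
  qed
 qed (simp_all add: Hom_iff)
qed

lemma zero_Q: "a < b | c < b ==> is_zero A (dob Q a c)"
 unfolding Q_simps
proof (rule is_zero_dS[OF fam_fm])
 fix x assume "a < b | c < b"
 then show "is_zero A (fm a c x)" using bnd[of c "a - 1"] bnd[of c a] by (cases x) (auto simp: fm)
qed

lemma bounded_Q: "dcpx_bounded_below A Q"
 unfolding dcpx_bounded_below_def using zero_Q by blast

lemma famQ: "fam A (diag Q n)"
proof -
 have "dob Q p q : Obj A" for p q using is_dcpx_Q unfolding is_dcpx_def by blast
 then show ?thesis using fam_diag[of Q b b n] zero_Q by blast
qed

lemma fam_g: "fam A (cfm g n)"
 using g by (intro fam_cfm) (simp_all add: Hom_iff)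

lemma cfg: "cfm g n False = cob P (n - 1)" "cfm g n True = cob P' n"
 by (simp_all add: cfm_def)

lemma cone_g:
 "cdf (cone A g) n : Hom A (cob (cone A g) n) (cob (cone A g) (n - 1))"
 "cdf (cone A g) n ** dI A (cfm g n) False =
   Add A (dI A (cfm g (n - 1)) True ** mcomp g (n - 1)) (neg A (dI A (cfm g (n - 1)) False ** cdf P (n - 1)))"
 "cdf (cone A g) n ** dI A (cfm g n) True = dI A (cfm g (n - 1)) True ** cdf P' n"
 using cone_d_facts[of g n] by (simp_all add: Hom_iff)

lemma dI_g [simp]: "dI A (cfm g n) x : Arr A" "Dom A (dI A (cfm g n) x) = cfm g n x" "Cod A (dI A (cfm g n) x) = cob (cone A g) n"
 "cob (cone A g) n : Obj A" "cdf (cone A g) n : Arr A" "Dom A (cdf (cone A g) n) = cob (cone A g) n"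
 "Cod A (cdf (cone A g) n) = cob (cone A g) (n - 1)"
 using fam_g[of n] cone_g(1)[of n] by (simp_all add: cob_cone Hom_iff)

text \<open>In degree \<open>n\<close> the cone of \<open>g\<close> and the total complex of
  \<open>Q\<close> have the same summands: those of \<open>E\<close> with
  \<open>p + q + 1 = n\<close> and those of \<open>E'\<close> with \<open>p + q = n\<close>. The
  inclusions are \<open>x\<close>, \<open>y\<close> for the cone and \<open>x'\<close>,
  \<open>y'\<close> for the total complex.\<close>

definition x where "x n p q = dI A (cfm g n) False ** J p q"
definition y where "y n p q = dI A (cfm g n) True ** J' p q"
definition x' where "x' n p q = dI A (diag Q n) (q + 1) ** dI A (fm (q + 1) p) False"
definition y' where "y' n p q = dI A (diag Q n) q ** dI A (fm q p) True"

lemma xy_simps [simp]: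
 "p + q + 1 = n ==> x n p q : Arr A" "p + q + 1 = n ==> Dom A (x n p q) = dob E p q" "p + q + 1 = n ==> Cod A (x n p q) = cob (cone A g) n"
 "p + q = n ==> y n p q : Arr A" "p + q = n ==> Dom A (y n p q) = dob E' p q" "p + q = n ==> Cod A (y n p q) = cob (cone A g) n"
 "p + q + 1 = n ==> x' n p q : Arr A" "p + q + 1 = n ==> Dom A (x' n p q) = dob E p q" "p + q + 1 = n ==> Cod A (x' n p q) = cob (Tot A Q) n"
 "p + q = n ==> y' n p q : Arr A" "p + q = n ==> Dom A (y' n p q) = dob E' p q" "p + q = n ==> Cod A (y' n p q) = cob (Tot A Q) n"
proof -
 have Q: "diag Q (p + q + 1) (q + 1) = dS A (fm (q + 1) p)" "diag Q (p + q) q = dS A (fm q p)"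
  by (simp_all add: diag_apply Q_simps)
 show "p + q + 1 = n ==> x n p q : Arr A" "p + q + 1 = n ==> Dom A (x n p q) = dob E p q" "p + q + 1 = n ==> Cod A (x n p q) = cob (cone A g) n"
  "p + q = n ==> y n p q : Arr A" "p + q = n ==> Dom A (y n p q) = dob E' p q" "p + q = n ==> Cod A (y n p q) = cob (cone A g) n"
  by (auto simp: x_def y_def cfg)
 show "p + q + 1 = n ==> x' n p q : Arr A" "p + q + 1 = n ==> Dom A (x' n p q) = dob E p q" "p + q + 1 = n ==> Cod A (x' n p q) = cob (Tot A Q) n"
  "p + q = n ==> y' n p q : Arr A" "p + q = n ==> Dom A (y' n p q) = dob E' p q" "p + q = n ==> Cod A (y' n p q) = cob (Tot A Q) n"
  using famQ Q by (auto simp: x'_def y'_def fm cob_Tot)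
qed

lemma cone_eqI:
 assumes "u : Hom A (cob (cone A g) n) Z" "v : Hom A (cob (cone A g) n) Z"
  and 1: "!!p q. p + q + 1 = n ==> u ** x n p q = v ** x n p q" and 2: "!!p q. p + q = n ==> u ** y n p q = v ** y n p q"
 shows "u = v"
proof (rule dS_eqI[OF fam_g])
 show uv: "u : Hom A (dS A (cfm g n)) Z" "v : Hom A (dS A (cfm g n)) Z" using assms(1,2) by (simp_all add: cob_cone)
 fix i
 show "u ** dI A (cfm g n) i = v ** dI A (cfm g n) i"
 proof (cases i)
  case True
  have H: "u ** dI A (cfm g n) i : Hom A (cob P' n) Z" "v ** dI A (cfm g n) i : Hom A (cob P' n) Z"
   using assms(1,2) True by (simp_all add: Hom_iff cfg)
  have "(u ** dI A (cfm g n) i) ** J' p (n - p) = (v ** dI A (cfm g n) i) ** J' p (n - p)" for p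
   using 2[of p "n - p"] assms(1,2) True by (simp add: y_def Hom_iff cfg)
  then show ?thesis using tot(2) H unfolding is_total_def by blast
 next
  case False
  have H: "u ** dI A (cfm g n) i : Hom A (cob P (n - 1)) Z" "v ** dI A (cfm g n) i : Hom A (cob P (n - 1)) Z"
   using assms(1,2) False by (simp_all add: Hom_iff cfg)
  have "(u ** dI A (cfm g n) i) ** J p (n - 1 - p) = (v ** dI A (cfm g n) i) ** J p (n - 1 - p)" for p
   using 1[of p "n - 1 - p"] assms(1,2) False by (simp add: x_def Hom_iff cfg)
  then show ?thesis using tot(1) H unfolding is_total_def by blast
 qed
qed

lemma TotQ_eqI:
 assumes "u : Hom A (cob (Tot A Q) n) Z" "v : Hom A (cob (Tot A Q) n) Z"
  and 1: "!!p q. p + q + 1 = n ==> u ** x' n p q = v ** x' n p q" and 2: "!!p q. p + q = n ==> u ** y' n p q = v ** y' n p q"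
 shows "u = v"
proof (rule dS_eqI[OF famQ])
 let ?t1 = "diag Q n"
 show "u : Hom A (dS A ?t1) Z" "v : Hom A (dS A ?t1) Z" using assms(1,2) by (simp_all add: cob_Tot)
 fix a
 have d: "diag Q n a = dS A (fm a (n - a))" by (simp add: diag_apply Q_simps)
 show "u ** dI A ?t1 a = v ** dI A ?t1 a"
 proof (rule dS_eqI[OF fam_fm])
  show "u ** dI A ?t1 a : Hom A (dS A (fm a (n - a))) Z" "v ** dI A ?t1 a : Hom A (dS A (fm a (n - a))) Z"
   using assms(1,2) famQ[of n] d by (simp_all add: Hom_iff cob_Tot)
  fix i show "(u ** dI A ?t1 a) ** dI A (fm a (n - a)) i = (v ** dI A ?t1 a) ** dI A (fm a (n - a)) i"
   using 1[of "n - a" "a - 1"] 2[of "n - a" a] assms(1,2) famQ[of n] d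
   by (cases i) (simp_all add: x'_def y'_def Hom_iff cob_Tot)
 qed
qed

lemma d_x:
 assumes n: "p + q + 1 = n"
 shows "cdf (cone A g) n ** x n p q = Add A (y (n - 1) p q ** h p q)
   (Add A (sgnm A 1 (x (n - 1) (p - 1) q ** dd1 E p q)) (sgnm A (1 + p) (x (n - 1) p (q - 1) ** dd2 E p q)))" (is "?L = ?R")
proof -
 let ?t1 = "cfm g (n - 1)"
 have pq: "p + q = n - 1" "p - 1 + q = n - 1 - 1" "p + (q - 1) = n - 1 - 1" using n by simp_all
 have ng: "neg A (Add A u (sgnm A p v)) = Add A (sgnm A 1 u) (sgnm A (1 + p) v)"
  if "u : Hom A V W" "v : Hom A V W" for u v V W
  using that sgnm_Add[of u V W "sgnm A p v" 1] sgnm_sgnm[of v 1 p] by (simp add: Hom_iff sgnm_1)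
 have "?L =
   Add A (dI A ?t1 True ** mcomp g (n - 1)) (neg A (dI A ?t1 False ** cdf P (n - 1))) ** J p q"
  unfolding x_def by (rule Comp_reassoc[OF cone_g(2)]) (simp_all add: pq cfg)
 also have "... = Add A (dI A ?t1 True ** (mcomp g (n - 1) ** J p q)) (neg A (dI A ?t1 False ** (cdf P (n - 1) ** J p q)))"
  by (simp add: Add_Comp_simp pq cfg)
 also have "... = Add A (dI A ?t1 True ** (J' p q ** h p q)) (neg A (Add A (dI A ?t1 False ** (J (p - 1) q ** dd1 E p q))
    (sgnm A p (dI A ?t1 False ** (J p (q - 1) ** dd2 E p q)))))"
  using g_J[of p q] J_d(1)[of p q] unfolding pq(1) by (simp add: Comp_Add_simp pq cfg)
 also have "... = ?R"
  by (subst ng[where V = "dob E p q" and W = "cob (cone A g) (n - 1)"]) (simp_all add: x_def y_def Hom_iff pq cfg)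
 finally show ?thesis .
qed

lemma d_y:
 assumes n: "p + q = n"
 shows "cdf (cone A g) n ** y n p q = Add A (y (n - 1) (p - 1) q ** dd1 E' p q) (sgnm A p (y (n - 1) p (q - 1) ** dd2 E' p q))" (is "?L = _")
proof -
 have pq: "p - 1 + q = n - 1" "p + (q - 1) = n - 1" using n by simp_all
 have "?L = (dI A (cfm g (n - 1)) True ** cdf P' n) ** J' p q"
  unfolding y_def by (rule Comp_reassoc[OF cone_g(3)]) (simp_all add: n cfg)
 then show ?thesis using J_d(2)[of p q] unfolding n by (simp add: y_def n cfg Comp_Add_simp pq)
qed

lemma d_x':
 assumes n: "p + q + 1 = n"
 shows "cdf (Tot A Q) n ** x' n p q = Add A (Add A (y' (n - 1) p q ** h p q) (neg A (x' (n - 1) p (q - 1) ** dd2 E p q)))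
   (sgnm A (1 + q) (x' (n - 1) (p - 1) q ** dd1 E p q))" (is "?L = _")
proof -
 let ?t1 = "sgnm A (q + 1) (dI A (diag Q (n - 1)) (q + 1) ** dd2 Q (q + 1) p)"
 let ?t2 = "dI A (diag Q (n - 1)) q ** dd1 Q (q + 1) p"
 have pq: "q + 1 + p = n" "q + p = n - 1" "q + 1 + (p - 1) = n - 1" "1 + q = q + 1" using n by simp_all
 have Qn: "diag Q n (q + 1) = dS A (fm (q + 1) p)" "diag Q (n - 1) q = dS A (fm q p)" "diag Q (n - 1) (q + 1) = dS A (fm (q + 1) (p - 1))"
  using n by (auto simp: diag_apply Q_simps)
 have d: "cdf (Tot A Q) n ** dI A (diag Q n) (q + 1) = Add A ?t2
   ?t1"
  using Tot_d_inj2[OF is_dcpx_Q famQ, of "q + 1" p] pq by (simp add: inj2_def)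
 have "?L = Add A ?t2
   ?t1 ** dI A (fm (q + 1) p) False"
  unfolding x'_def using famQ is_dcpx_Q by (intro Comp_reassoc[OF d]) (simp_all add: Qn cob_Tot[symmetric])
 then show ?thesis
  unfolding pq(4) using famQ Q_d1(2)[of "q + 1" p] Q_d2(2)[of "q + 1" p]
  by (simp add: x'_def y'_def Add_Comp_simp Comp_Add_simp Qn fm)
qed

lemma d_y':
 assumes n: "p + q = n"
 shows "cdf (Tot A Q) n ** y' n p q = Add A (y' (n - 1) p (q - 1) ** dd2 E' p q) (sgnm A q (y' (n - 1) (p - 1) q ** dd1 E' p q))" (is "?L = _")
proof -
 let ?t1 = "sgnm A q (dI A (diag Q (n - 1)) q ** dd2 Q q p)"
 let ?t2 = "dI A (diag Q (n - 1)) (q - 1) ** dd1 Q q p"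
 have pq: "q + p = n" "q - 1 + p = n - 1" "q + (p - 1) = n - 1" using n by simp_all
 have Qn: "diag Q n q = dS A (fm q p)" "diag Q (n - 1) (q - 1) = dS A (fm (q - 1) p)" "diag Q (n - 1) q = dS A (fm q (p - 1))"
  using n by (auto simp: diag_apply Q_simps)
 have d: "cdf (Tot A Q) n ** dI A (diag Q n) q = Add A ?t2
   ?t1"
  using Tot_d_inj2[OF is_dcpx_Q famQ, of q p] pq by (simp add: inj2_def)
 have "?L = Add A ?t2
   ?t1 ** dI A (fm q p) True"
  unfolding y'_def using famQ is_dcpx_Q by (intro Comp_reassoc[OF d]) (simp_all add: Qn cob_Tot[symmetric])
 then show ?thesis
  using famQ Q_d1(3)[of q p] Q_d2(3)[of q p]
  by (simp add: y'_def Add_Comp_simp Qn fm)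
qed

text \<open>Transposing a double complex costs the sign (-1)^(p q). The shift by one in the cone
  does not enter the exponent, so the same expression serves the summands of \<open>E\<close> and of
  \<open>E'\<close>.\<close>

lemma ex_theta:
 obtains t where "t : Hom A (cob (Tot A Q) n) (cob (cone A g) n)"
  "!!p q. p + q + 1 = n ==> t ** x' n p q = sgnm A (p * q) (x n p q)" "!!p q. p + q = n ==> t ** y' n p q = sgnm A (p * q) (y n p q)"
proof -
 let ?t1 = "cob (cone A g) n"
 have "EX v. v : Hom A (diag Q n a) ?t1 & v ** dI A (fm a (n - a)) False = sgnm A ((n - a) * (a - 1)) (x n (n - a) (a - 1)) &
   v ** dI A (fm a (n - a)) True = sgnm A ((n - a) * a) (y n (n - a) a)" for a
 proof -
  have "(if i then sgnm A ((n - a) * a) (y n (n - a) a) else sgnm A ((n - a) * (a - 1)) (x n (n - a) (a - 1))) : Hom A (fm a (n - a) i) ?t1" for i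
   by (cases i) (simp_all add: Hom_iff fm)
  from dS_desc[OF fam_fm this] show ?thesis by (simp add: diag_apply Q_simps) (metis (full_types))
 qed
 then obtain v where v: "!!a. v a : Hom A (diag Q n a) ?t1"
   "!!a. v a ** dI A (fm a (n - a)) False = sgnm A ((n - a) * (a - 1)) (x n (n - a) (a - 1))"
   "!!a. v a ** dI A (fm a (n - a)) True = sgnm A ((n - a) * a) (y n (n - a) a)"
  by metis
 obtain t where t: "t : Hom A (dS A (diag Q n)) ?t1" "!!a. t ** dI A (diag Q n) a = v a"
  using dS_desc[OF famQ v(1)] by blast
 have t': "t : Arr A" "Dom A t = dS A (diag Q n)" "Cod A t = cob (cone A g) n" using t(1) by (simp_all add: Hom_iff)
 show ?thesis
 proof
  show "t : Hom A (cob (Tot A Q) n) ?t1" using t(1) by (simp add: cob_Tot)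
  fix p q
  {
   assume pq: "p + q + 1 = n"
   then have e: "n - (q + 1) = p" "q + 1 - 1 = q" by simp_all
   have "t ** x' n p q = v (q + 1) ** dI A (fm (q + 1) p) False"
    unfolding x'_def using famQ[of n] t' e(1) by (intro Comp_reassoc[OF t(2)]) (simp_all add: diag_apply Q_simps)
   then show "t ** x' n p q = sgnm A (p * q) (x n p q)" using v(2)[of "q + 1"] unfolding e by simp
  }
  {
   assume pq: "p + q = n"
   then have e: "n - q = p" by simp
   have "t ** y' n p q = v q ** dI A (fm q p) True"
    unfolding y'_def using famQ[of n] t' e(1) by (intro Comp_reassoc[OF t(2)]) (simp_all add: diag_apply Q_simps)
   then show "t ** y' n p q = sgnm A (p * q) (y n p q)" using v(3)[of q] unfolding e by simp
  }
 qed
qed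

lemma ex_theta':
 obtains t where "t : Hom A (cob (cone A g) n) (cob (Tot A Q) n)"
  "!!p q. p + q + 1 = n ==> t ** x n p q = sgnm A (p * q) (x' n p q)" "!!p q. p + q = n ==> t ** y n p q = sgnm A (p * q) (y' n p q)"
proof -
 let ?t1 = "cob (Tot A Q) n"
 have "sgnm A (p * (n - 1 - p)) (x' n p (n - 1 - p)) : Hom A (dob E p (n - 1 - p)) ?t1" for p
  by (simp add: Hom_iff)
 then obtain u where u: "u : Hom A (cob P (n - 1)) ?t1" "!!p. u ** J p (n - 1 - p) = sgnm A (p * (n - 1 - p)) (x' n p (n - 1 - p))"
  using J_desc(1)[of "%p. sgnm A (p * (n - 1 - p)) (x' n p (n - 1 - p))" "n - 1"] by blast
 have "sgnm A (p * (n - p)) (y' n p (n - p)) : Hom A (dob E' p (n - p)) ?t1" for p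
  by (simp add: Hom_iff)
 then obtain w where w: "w : Hom A (cob P' n) ?t1" "!!p. w ** J' p (n - p) = sgnm A (p * (n - p)) (y' n p (n - p))"
  using J_desc(2)[of "%p. sgnm A (p * (n - p)) (y' n p (n - p))" n] by blast
 have "(if i then w else u) : Hom A (cfm g n i) ?t1" for i using u w by (cases i) (simp_all add: cfg)
 note dS_desc[OF fam_g this]
 then obtain t where t: "t : Hom A (dS A (cfm g n)) ?t1" "!!i. t ** dI A (cfm g n) i = (if i then w else u)"
  by blast
 have t': "t : Arr A" "Dom A t = cob (cone A g) n" using t(1) by (simp_all add: Hom_iff cob_cone)
 show ?thesis
 proof
  show "t : Hom A (cob (cone A g) n) ?t1" using t(1) by (simp add: cob_cone)
  fix p q
  {
   assume pq: "p + q + 1 = n"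
   then have e: "q = n - 1 - p" by simp
   have "t ** x n p q = u ** J p q" unfolding x_def using t' t(2)[of False] e by (intro Comp_reassoc) (simp_all add: cfg)
   then show "t ** x n p q = sgnm A (p * q) (x' n p q)" using u(2)[of p] unfolding e by simp
  }
  {
   assume pq: "p + q = n"
   then have e: "q = n - p" by simp
   have "t ** y n p q = w ** J' p q" unfolding y_def using t' t(2)[of True] e by (intro Comp_reassoc) (simp_all add: cfg)
   then show "t ** y n p q = sgnm A (p * q) (y' n p q)" using w(2)[of p] unfolding e by simp
  }
 qed
qed

text \<open>The transposition is invertible in each degree because its sign is applied twice in a
  round trip. It then suffices to check on summands that it commutes with differentials.\<close>

theorem cone_Tot_equivalent: "cone A g : Obj (Ch A)" "homotopy_equivalent A (Tot A Q) (cone A g)"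
proof -
 let ?t1 = "cone A g"
 define t where "t n = (SOME t. t : Hom A (cob (Tot A Q) n) (cob ?t1 n) &
  (ALL p q. p + q + 1 = n --> t ** x' n p q = sgnm A (p * q) (x n p q)) & (ALL p q. p + q = n --> t ** y' n p q = sgnm A (p * q) (y n p q)))" for n
 define t' where "t' n = (SOME t. t : Hom A (cob ?t1 n) (cob (Tot A Q) n) &
  (ALL p q. p + q + 1 = n --> t ** x n p q = sgnm A (p * q) (x' n p q)) & (ALL p q. p + q = n --> t ** y n p q = sgnm A (p * q) (y' n p q)))" for n
 have "t n : Hom A (cob (Tot A Q) n) (cob ?t1 n) &
  (ALL p q. p + q + 1 = n --> t n ** x' n p q = sgnm A (p * q) (x n p q)) & (ALL p q. p + q = n --> t n ** y' n p q = sgnm A (p * q) (y n p q))" for n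
  unfolding t_def by (rule someI_ex) (metis ex_theta)
 then have tH: "t n : Hom A (cob (Tot A Q) n) (cob ?t1 n)"
  and t: "p + q + 1 = n ==> t n ** x' n p q = sgnm A (p * q) (x n p q)" "p + q = n ==> t n ** y' n p q = sgnm A (p * q) (y n p q)" for n p q
  by blast+
 have "t' n : Hom A (cob ?t1 n) (cob (Tot A Q) n) &
  (ALL p q. p + q + 1 = n --> t' n ** x n p q = sgnm A (p * q) (x' n p q)) & (ALL p q. p + q = n --> t' n ** y n p q = sgnm A (p * q) (y' n p q))" for n
  unfolding t'_def by (rule someI_ex) (metis ex_theta')
 then have tH': "t' n : Hom A (cob ?t1 n) (cob (Tot A Q) n)"
  and t': "p + q + 1 = n ==> t' n ** x n p q = sgnm A (p * q) (x' n p q)" "p + q = n ==> t' n ** y n p q = sgnm A (p * q) (y' n p q)" for n p q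
  by blast+
 have [simp]: "t n : Arr A" "Dom A (t n) = cob (Tot A Q) n" "Cod A (t n) = cob ?t1 n"
  "t' n : Arr A" "Dom A (t' n) = cob ?t1 n" "Cod A (t' n) = cob (Tot A Q) n" for n
  using tH[of n] tH'[of n] by (simp_all add: Hom_iff)
 note [simp] = Tot_simps[OF is_dcpx_Q famQ]
 have ev: "sgnm A (2 * k) f = f" for k f by (simp add: sgnm_def)
 have "t' n ** t n = Idt A (cob (Tot A Q) n)" for n
 proof (rule TotQ_eqI)
  show "(t' n ** t n) ** x' n p q = Idt A (cob (Tot A Q) n) ** x' n p q" if "p + q + 1 = n" for p q
   using that t(1)[OF that] t'(1)[OF that] by (simp add: ev)
  show "(t' n ** t n) ** y' n p q = Idt A (cob (Tot A Q) n) ** y' n p q" if "p + q = n" for p q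
   using that t(2)[OF that] t'(2)[OF that] by (simp add: ev)
 qed (simp_all add: Hom_iff)
 moreover have tt': "t n ** t' n = Idt A (cob ?t1 n)" for n
 proof (rule cone_eqI)
  show "(t n ** t' n) ** x n p q = Idt A (cob ?t1 n) ** x n p q" if "p + q + 1 = n" for p q
   using that t(1)[OF that] t'(1)[OF that] by (simp add: ev)
  show "(t n ** t' n) ** y n p q = Idt A (cob ?t1 n) ** y n p q" if "p + q = n" for p q
   using that t(2)[OF that] t'(2)[OF that] by (simp add: ev)
 qed (simp_all add: Hom_iff)
 moreover have chain: "cdf ?t1 n ** t n = t (n - 1) ** cdf (Tot A Q) n" for n
 proof (rule TotQ_eqI)
  fix p q
  {
   assume n: "p + q + 1 = n"
   have pq: "p - 1 + q + 1 = n - 1" "p + (q - 1) + 1 = n - 1" "p + q = n - 1" using n by simp_all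
   let ?a = "y (n - 1) p q ** h p q" and ?b = "x (n - 1) (p - 1) q ** dd1 E p q" and ?c = "x (n - 1) p (q - 1) ** dd2 E p q"
   let ?V = "dob E p q" and ?W = "cob ?t1 (n - 1)"
   have H: "?a : Hom A ?V ?W" "?b : Hom A ?V ?W" "?c : Hom A ?V ?W"
    using pq by (simp_all add: Hom_iff)
   \<comment> \<open>The parity of \<open>p * q\<close> changes with \<open>q\<close> when
     \<open>p\<close> drops by one and with \<open>p\<close> when \<open>q\<close> drops by one,
     which is what separates the signs of the two total differentials.\<close>
   have s: "sgnm A (p * q + 1) = sgnm A ((p - 1) * q + (1 + q))" "sgnm A (p * q + (1 + p)) = sgnm A (p * (q - 1) + 1)"
    by (auto intro!: ext sgnm_parity simp: algebra_simps)
   have sH: "sgnm A m u : Hom A ?V ?W" if "u : Hom A ?V ?W" for u m using that by (simp add: Hom_iff)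
   have "(cdf ?t1 n ** t n) ** x' n p q = sgnm A (p * q) (cdf ?t1 n ** x n p q)"
    using n t(1)[OF n] by simp
   also have "... = Add A (sgnm A (p * q) ?a) (Add A (sgnm A (p * q + 1) ?b) (sgnm A (p * q + (1 + p)) ?c))"
    unfolding d_x[OF n] using H by (simp add: sgnm_Add[where X = ?V and Y = ?W] sH Add_Hom) (simp add: Hom_iff)
   also have "... = Add A (Add A (sgnm A (p * q) ?a) (sgnm A (p * (q - 1) + 1) ?c)) (sgnm A ((p - 1) * q + (1 + q)) ?b)"
    unfolding s using H by (subst Add_commute[of "sgnm A ((p - 1) * q + (1 + q)) ?b" ?V ?W]) (simp_all add: Add_assoc[of _ ?V ?W] sH)
   also have "... = Add A (Add A (t (n - 1) ** (y' (n - 1) p q ** h p q)) (neg A (t (n - 1) ** (x' (n - 1) p (q - 1) ** dd2 E p q))))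
    (sgnm A (1 + q) (t (n - 1) ** (x' (n - 1) (p - 1) q ** dd1 E p q)))"
    using pq Comp_reassoc[OF t(2)[OF pq(3)], of "h p q"] Comp_reassoc[OF t(1)[OF pq(2)], of "dd2 E p q"] Comp_reassoc[OF t(1)[OF pq(1)], of "dd1 E p q"]
    by (simp add: sgnm_1[symmetric] add.commute)
   also have "... = t (n - 1) ** (cdf (Tot A Q) n ** x' n p q)"
    unfolding d_x'[OF n] using pq by (simp add: Comp_Add_simp)
   finally show "(cdf ?t1 n ** t n) ** x' n p q = (t (n - 1) ** cdf (Tot A Q) n) ** x' n p q"
    using n by simp
  }
  {
   assume n: "p + q = n"
   have pq: "p - 1 + q = n - 1" "p + (q - 1) = n - 1" using n by simp_all
   let ?b = "y (n - 1) (p - 1) q ** dd1 E' p q" and ?c = "y (n - 1) p (q - 1) ** dd2 E' p q"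
   let ?V = "dob E' p q" and ?W = "cob ?t1 (n - 1)"
   have H: "?b : Hom A ?V ?W" "?c : Hom A ?V ?W"
    using pq by (simp_all add: Hom_iff)
   have s: "sgnm A (p * q) = sgnm A ((p - 1) * q + q)" "sgnm A (p * q + p) = sgnm A (p * (q - 1))"
    by (auto intro!: ext sgnm_parity simp: algebra_simps)
   have sH: "sgnm A m u : Hom A ?V ?W" if "u : Hom A ?V ?W" for u m using that by (simp add: Hom_iff)
   have "(cdf ?t1 n ** t n) ** y' n p q = sgnm A (p * q) (cdf ?t1 n ** y n p q)"
    using n t(2)[OF n] by simp
   also have "... = Add A (sgnm A (p * q) ?b) (sgnm A (p * q + p) ?c)"
    unfolding d_y[OF n] using H by (simp add: sgnm_Add[where X = ?V and Y = ?W] sH) (simp add: Hom_iff)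
   also have "... = Add A (sgnm A (p * (q - 1)) ?c) (sgnm A ((p - 1) * q + q) ?b)"
    unfolding s(2) unfolding s(1) using H by (intro Add_commute[where X = ?V and Y = ?W]) (simp_all add: sH)
   also have "... = Add A (t (n - 1) ** (y' (n - 1) p (q - 1) ** dd2 E' p q)) (sgnm A q (t (n - 1) ** (y' (n - 1) (p - 1) q ** dd1 E' p q)))"
    using pq Comp_reassoc[OF t(2)[OF pq(2)], of "dd2 E' p q"] Comp_reassoc[OF t(2)[OF pq(1)], of "dd1 E' p q"]
    by (simp add: add.commute)
   also have "... = t (n - 1) ** (cdf (Tot A Q) n ** y' n p q)"
    unfolding d_y'[OF n] using pq by (simp add: Comp_Add_simp)
   finally show "(cdf ?t1 n ** t n) ** y' n p q = (t (n - 1) ** cdf (Tot A Q) n) ** y' n p q"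
    using n by simp
  }
 qed (simp_all add: Hom_iff)
 moreover have O: "cone A g : Obj (Ch A)"
 proof -
  \<comment> \<open>That the cone of \<open>g\<close> is a complex is transported from the total
    complex along the isomorphism.\<close>
  have "cdf ?t1 (n - 1) ** cdf ?t1 n = Zer A (cob ?t1 n) (cob ?t1 (n - 2))" for n
  proof -
   have "cdf ?t1 (n - 1) ** cdf ?t1 n = (cdf ?t1 (n - 1) ** (cdf ?t1 n ** t n)) ** t' n"
    using tt'[of n] by simp
   also have "... = (t (n - 2) ** (cdf (Tot A Q) (n - 1) ** cdf (Tot A Q) n)) ** t' n"
    using chain[of n] Comp_reassoc[OF chain[of "n - 1"], of "cdf (Tot A Q) n"] by simp
   also have "... = Zer A (cob ?t1 n) (cob ?t1 (n - 2))"
    using is_cpx_Tot[OF is_dcpx_Q famQ] by simp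
   finally show ?thesis .
  qed
  then have "is_cpx A ?t1" unfolding is_cpx_def using cone_g(1) by simp
  moreover have "bounded_below A ?t1"
  proof -
   obtain m m' where m: "!!n. n < m ==> is_zero A (cob P n)" "!!n. n < m' ==> is_zero A (cob P' n)"
    using g_simps(3,4) unfolding Obj_Ch bounded_below_def by blast
   have "is_zero A (cob ?t1 n)" if "n < min m m'" for n
    unfolding cob_cone
   proof (rule is_zero_dS[OF fam_g])
    fix i show "is_zero A (cfm g n i)" using m that by (cases i) (simp_all add: cfg)
   qed
   then show ?thesis unfolding bounded_below_def by blast
  qed
  ultimately show ?thesis by (simp add: Obj_Ch)
 qed
 moreover have TQ: "Tot A Q : Obj (Ch A)"
  using is_cpx_Tot[OF is_dcpx_Q famQ] is_zero_Tot[OF famQ zero_Q] by (auto simp: Obj_Ch bounded_below_def)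
 moreover have "\<lparr>mdom = Tot A Q, mcod = cone A g, mcomp = t\<rparr> : Hom (Ch A) (Tot A Q) ?t1"
  unfolding Hom_Ch using O TQ chain tH by simp
 ultimately show "cone A g : Obj (Ch A)" "homotopy_equivalent A (Tot A Q) ?t1"
  using homotopy_equivalent_iso[of "\<lparr>mdom = Tot A Q, mcod = cone A g, mcomp = t\<rparr>" "Tot A Q" "cone A g" t'] tH' by simp_all
qed

end

theorem (in additive) cone_total_acyclic:
 assumes "cone_total A E E' h P P' g J J' b" "acyclic_class A \<Gamma>" "!!p. cone A (colmap E E' h p) \<in> \<Gamma>"
 shows "cone A g \<in> \<Gamma>"
proof -
 interpret cone_total A E E' h P P' g J J' b by (rule assms(1))
 interpret acyclic_class A \<Gamma> by (rule assms(2))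
 have "Tot A Q \<in> \<Gamma>" by (rule AC5[OF is_dcpx_Q bounded_Q]) (simp add: Q_simps assms(3))
 then show ?thesis
  using AC3[OF _ cone_Tot_equivalent] sub by blast
qed

section \<open>The additive category of functors\<close>

text \<open>The decomposition of the identity is replaced by the condition that the injections
  detect equality, which for functors can be verified objectwise.\<close>

lemma (in preadditive) is_dsumI:
 assumes S: "S : Obj A" and fin: "finite (supp A X)" and i: "!!i. i1 i : Hom A (X i) S" and p: "!!i. p1 i : Hom A S (X i)"
  and o: "!!i j. p1 j ** i1 i = (if i = j then Idt A (X i) else Zer A (X i) (X j))"
  and e: "!!f g. [|f : Hom A S S; g : Hom A S S; !!i. f ** i1 i = g ** i1 i|] ==> f = g"
 shows "is_dsum A X (S, i1, p1)"
proof -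
 have [simp]: "i1 j : Arr A" "Dom A (i1 j) = X j" "Cod A (i1 j) = S" "p1 j : Arr A" "Dom A (p1 j) = S" "Cod A (p1 j) = X j" "X j : Obj A" for j
  using i[of j] p[of j] Hom_Obj[OF p] by (auto simp: Hom_iff)
 let ?h = "hsum A S S (%j. i1 j ** p1 j) (supp A X)"
 have "Idt A S = ?h"
 proof (rule e)
  show "Idt A S : Hom A S S" "?h : Hom A S S" using S by (auto intro!: hsum_Hom simp: Hom_iff)
  fix k
  have "?h ** i1 k = hsum A (X k) S (%j. i1 j ** (p1 j ** i1 k)) (supp A X)"
   using S by (subst hsum_Comp) auto
  also have "... = hsum A (X k) S (%j. if j = k then i1 k else Zer A (X k) S) (supp A X)"
   unfolding o by (auto intro!: hsum_cong simp: simp_implies_def)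
  also have "... = i1 k"
  proof (cases "k \<in> supp A X")
   case True
   then show ?thesis using i fin S by (subst hsum_single[of _ k]) (auto intro: Zer_Hom simp: Hom_iff)
  next
   case False
   then have z: "i1 k = Zer A (X k) S" using is_zero_Hom_eq[OF disjI1 i] by (simp add: supp_def)
   show ?thesis unfolding z using S False by (intro hsum_Zer) auto
  qed
  finally show "Idt A S ** i1 k = ?h ** i1 k" using S by simp
 qed
 then show ?thesis using S fin i p o by (auto simp: is_dsum_def)
qed

section \<open>Objectwise structure on functors\<close>

locale functors = C: category C + additive A
 for C :: "('o,'a,'y) cat_scheme" and A :: "('p,'b,'z) acat_scheme" (structure)
begin

abbreviation D where "D \<equiv> FunA C A"

lemma D_simps [simp]: "Dom D = ndom" "Cod D = ncod"
 "ndom (Idt D F) = F" "ncod (Idt D F) = F" "ncomp (Idt D F) = (\<lambda>X \<in> Obj C. Idt A (fo F X))"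
 "ndom (t **\<^bsub>D\<^esub> s) = ndom s" "ncod (t **\<^bsub>D\<^esub> s) = ncod t" "ncomp (t **\<^bsub>D\<^esub> s) = (\<lambda>X \<in> Obj C. ncomp t X ** ncomp s X)"
 "ndom (Add D s t) = ndom s" "ncod (Add D s t) = ncod s" "ncomp (Add D s t) = (\<lambda>X \<in> Obj C. Add A (ncomp s X) (ncomp t X))"
 "ndom (Zer D F H) = F" "ncod (Zer D F H) = H" "ncomp (Zer D F H) = (\<lambda>X \<in> Obj C. Zer A (fo F X) (fo H X))"
 by (simp_all add: FunA_def)

lemma Obj_D: "F : Obj D \<longleftrightarrow> is_functor C A F"
 by (simp add: FunA_def)

lemma fctr_simps [simp]:
 assumes "F : Obj D"
 shows "X : Obj C ==> fo F X : Obj A" "u : Arr C ==> fa F u : Arr A" "u : Arr C ==> Dom A (fa F u) = fo F (Dom C u)"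
  "u : Arr C ==> Cod A (fa F u) = fo F (Cod C u)"
 using assms by (auto simp: Obj_D is_functor_def)

lemma Arr_D: "t : Arr D \<longleftrightarrow> ndom t : Obj D & ncod t : Obj D & ncomp t \<in> extensional (Obj C) &
  (ALL X:Obj C. ncomp t X : Hom A (fo (ndom t) X) (fo (ncod t) X)) &
  (ALL u:Arr C. ncomp t (Cod C u) ** fa (ndom t) u = fa (ncod t) u ** ncomp t (Dom C u))"
 by (auto simp: FunA_def is_ntr_def)

lemma Arr_D_simps [simp]:
 assumes "t : Arr D"
 shows "X : Obj C ==> ncomp t X : Arr A" "X : Obj C ==> Dom A (ncomp t X) = fo (ndom t) X"
  "X : Obj C ==> Cod A (ncomp t X) = fo (ncod t) X" "ndom t : Obj D" "ncod t : Obj D"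
 using assms by (auto simp: Arr_D Hom_iff)

lemma ntr_nat: "[|t : Arr D; u : Arr C|] ==> ncomp t (Cod C u) ** fa (ndom t) u = fa (ncod t) u ** ncomp t (Dom C u)"
 unfolding Arr_D by blast

lemma Hom_D_I:
 assumes "F : Obj D" "H : Obj D" "ndom t = F" "ncod t = H" "ncomp t \<in> extensional (Obj C)"
  and "!!X. X : Obj C ==> ncomp t X : Hom A (fo F X) (fo H X)"
  and "!!u. u : Arr C ==> ncomp t (Cod C u) ** fa F u = fa H u ** ncomp t (Dom C u)"
 shows "t : Hom D F H"
 unfolding Hom_iff[of t D] Arr_D using assms by simp

lemma ntr_eqI:
 fixes s t :: "('o,'a,'p,'b) ntr"
 assumes "s : Hom D F H" "t : Hom D F H" "!!X. X : Obj C ==> ncomp s X = ncomp t X"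
 shows "s = t"
proof (rule ntr.equality)
 have "ncomp s \<in> extensional (Obj C)" "ncomp t \<in> extensional (Obj C)" using assms(1,2) unfolding Hom_iff[of _ D] Arr_D by blast+
 then show "ncomp s = ncomp t" using assms(3) by (rule extensionalityI)
qed (use assms in "auto simp: Hom_iff[of _ D]")

lemma category_D: "category D"
proof
 fix f assume "f : Arr D" then show "Dom D f : Obj D" "Cod D f : Obj D" by simp_all
next
 fix F assume F: "F : Obj D"
 then show "Idt D F : Hom D F F" by (intro Hom_D_I) (simp_all add: Hom_iff)
next
 fix f g F H J assume "f : Hom D F H" "g : Hom D H J"
 then have a: "f : Arr D" "g : Arr D" "ndom f = F" "ncod f = H" "ndom g = H" "ncod g = J" by (simp_all add: Hom_iff)
 note h = Arr_D_simps[OF a(1), unfolded a(3,4)] Arr_D_simps[OF a(2), unfolded a(5,6)]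
 show "g **\<^bsub>D\<^esub> f : Hom D F J"
 proof (rule Hom_D_I)
  fix u assume u: "u : Arr C"
  have n: "ncomp f (Cod C u) ** fa F u = fa H u ** ncomp f (Dom C u)" "ncomp g (Cod C u) ** fa H u = fa J u ** ncomp g (Dom C u)"
   using ntr_nat[OF a(1) u] ntr_nat[OF a(2) u] a by simp_all
  show "ncomp (g **\<^bsub>D\<^esub> f) (Cod C u) ** fa F u = fa J u ** ncomp (g **\<^bsub>D\<^esub> f) (Dom C u)"
   using u h a n Comp_reassoc[OF n(2), of "ncomp f (Dom C u)"] by simp
 qed (use h a in "simp_all add: Hom_iff")
next
 fix f F H assume f: "f : Hom D F H"
 then have a: "f : Arr D" "ndom f = F" "ncod f = H" by (simp_all add: Hom_iff)
 have e: "ncomp f \<in> extensional (Obj C)" using a(1) unfolding Arr_D by blast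
 show "f **\<^bsub>D\<^esub> Idt D F = f" "Idt D H **\<^bsub>D\<^esub> f = f"
  by (rule ntr.equality; simp add: a; intro extensionalityI[OF restrict_extensional e]; simp add: a)+
next
 fix f F H g J h L assume "f : Hom D F H" "g : Hom D H J" "h : Hom D J L"
 then have a: "f : Arr D" "g : Arr D" "h : Arr D" "ndom f = F" "ncod f = H" "ndom g = H" "ncod g = J" "ndom h = J" "ncod h = L"
  by (simp_all add: Hom_iff)
 show "(h **\<^bsub>D\<^esub> g) **\<^bsub>D\<^esub> f = h **\<^bsub>D\<^esub> (g **\<^bsub>D\<^esub> f)"
  by (rule ntr.equality; simp; intro restrict_ext; simp add: a)
qed

lemma Add_D_Hom: "[|s : Hom D F H; t : Hom D F H|] ==> Add D s t : Hom D F H"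
proof (rule Hom_D_I)
 let ?t1 = "Add D s t"
 assume st: "s : Hom D F H" "t : Hom D F H"
 then have a: "s : Arr D" "t : Arr D" "ndom s = F" "ncod s = H" "ndom t = F" "ncod t = H" by (simp_all add: Hom_iff)
 show "F : Obj D" "H : Obj D" "ndom ?t1 = F" "ncod ?t1 = H" "ncomp ?t1 \<in> extensional (Obj C)"
  using a Arr_D_simps(4,5)[OF a(1)] by simp_all
 show "ncomp ?t1 X : Hom A (fo F X) (fo H X)" if "X : Obj C" for X
  using a that by (simp add: Hom_iff)
 show "ncomp ?t1 (Cod C u) ** fa F u = fa H u ** ncomp ?t1 (Dom C u)" if "u : Arr C" for u
  using a that ntr_nat[OF a(1) that] ntr_nat[OF a(2) that] Arr_D_simps(4,5)[OF a(1)] by (simp add: Add_Comp_simp Comp_Add_simp)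
qed

lemma Zer_D_Hom: "[|F : Obj D; H : Obj D|] ==> Zer D F H : Hom D F H"
 by (rule Hom_D_I) (simp_all add: Hom_iff)

lemma neg_D_Hom: "t : Hom D F H ==> \<lparr>ndom = F, ncod = H, ncomp = (\<lambda>X \<in> Obj C. neg A (ncomp t X))\<rparr> : Hom D F H"
proof (rule Hom_D_I)
 assume "t : Hom D F H"
 then have a: "t : Arr D" "ndom t = F" "ncod t = H" by (simp_all add: Hom_iff)
 let ?n = "\<lparr>ndom = F, ncod = H, ncomp = (\<lambda>X \<in> Obj C. neg A (ncomp t X))\<rparr>"
 show "F : Obj D" "H : Obj D" using a Arr_D_simps(4,5)[OF a(1)] by simp_all
 show "ncomp ?n X : Hom A (fo F X) (fo H X)" if "X : Obj C" for X
  using a that by (simp add: Hom_iff)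
 show "ncomp ?n (Cod C u) ** fa F u = fa H u ** ncomp ?n (Dom C u)" if "u : Arr C" for u
  using a that ntr_nat[OF a(1) that] Arr_D_simps(4,5)[OF a(1)] by simp
qed simp_all

lemma preadditive_D: "preadditive D"
proof (intro preadditive.intro category_D preadditive_axioms.intro)
  have hd: "t \<in> Arr D" "ndom t = F" "ncod t = H" if "t \<in> Hom D F H" for t F H using that by (simp_all add: Hom_iff)
  fix F H assume O: "F \<in> Obj D" "H \<in> Obj D"
  show "comm_group (hom_grp D F H)"
  proof (rule comm_groupI)
    fix x assume "x \<in> carrier (hom_grp D F H)"
    then have x: "x \<in> Hom D F H" by (simp add: hom_grp_def)
    let ?n = "\<lparr>ndom = F, ncod = H, ncomp = (\<lambda>X \<in> Obj C. neg A (ncomp x X))\<rparr>"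
    have "Add D ?n x = Zer D F H"
    proof (rule ntr_eqI[OF Add_D_Hom[OF neg_D_Hom[OF x] x] Zer_D_Hom[OF O]])
      fix X assume X: "X \<in> Obj C"
      then have h: "ncomp x X \<in> Hom A (fo F X) (fo H X)" using hd[OF x] by (simp add: Hom_iff)
      show "ncomp (Add D ?n x) X = ncomp (Zer D F H) X"
        using X Add_neg[OF h] Add_commute[OF h neg_Hom[OF h]] by simp
    qed
    then show "\<exists>y\<in>carrier (hom_grp D F H). y \<otimes>\<^bsub>hom_grp D F H\<^esub> x = \<one>\<^bsub>hom_grp D F H\<^esub>"
      using neg_D_Hom[OF x] by (auto simp: hom_grp_def)
    show "\<one>\<^bsub>hom_grp D F H\<^esub> \<otimes>\<^bsub>hom_grp D F H\<^esub> x = x"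
      unfolding hom_grp_def monoid.simps
      by (rule ntr_eqI[OF Add_D_Hom[OF Zer_D_Hom[OF O] x] x]) (use hd[OF x] in simp)
  next
    fix x y z assume "x \<in> carrier (hom_grp D F H)" "y \<in> carrier (hom_grp D F H)" "z \<in> carrier (hom_grp D F H)"
    then have x: "x \<in> Hom D F H" "y \<in> Hom D F H" "z \<in> Hom D F H" by (simp_all add: hom_grp_def)
    show "x \<otimes>\<^bsub>hom_grp D F H\<^esub> y \<otimes>\<^bsub>hom_grp D F H\<^esub> z = x \<otimes>\<^bsub>hom_grp D F H\<^esub> (y \<otimes>\<^bsub>hom_grp D F H\<^esub> z)"
      unfolding hom_grp_def monoid.simps
    proof (rule ntr_eqI[where F = F and H = H])
      fix X assume "X \<in> Obj C"
      then show "ncomp (Add D (Add D x y) z) X = ncomp (Add D x (Add D y z)) X"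
        using hd[OF x(1)] hd[OF x(2)] hd[OF x(3)] by (simp add: Add_assoc[of _ "fo F X" "fo H X"] Hom_iff)
    qed (intro Add_D_Hom x)+
  next
    fix x y assume "x \<in> carrier (hom_grp D F H)" "y \<in> carrier (hom_grp D F H)"
    then have x: "x \<in> Hom D F H" "y \<in> Hom D F H" by (simp_all add: hom_grp_def)
    then show "x \<otimes>\<^bsub>hom_grp D F H\<^esub> y \<in> carrier (hom_grp D F H)" by (simp add: hom_grp_def Add_D_Hom)
    show "x \<otimes>\<^bsub>hom_grp D F H\<^esub> y = y \<otimes>\<^bsub>hom_grp D F H\<^esub> x"
      unfolding hom_grp_def monoid.simps
    proof (rule ntr_eqI[where F = F and H = H])
      fix X assume "X \<in> Obj C"
      then show "ncomp (Add D x y) X = ncomp (Add D y x) X"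
        using hd[OF x(1)] hd[OF x(2)] by (simp add: Add_commute[of _ "fo F X" "fo H X"] Hom_iff)
    qed (intro Add_D_Hom x)+
  qed (use O in \<open>simp_all add: hom_grp_def Zer_D_Hom\<close>)
next
  interpret D: category D by (rule category_D)
  have hd: "t \<in> Arr D" "ndom t = F" "ncod t = H" if "t \<in> Hom D F H" for t F H using that by (simp_all add: Hom_iff)
  fix f g h F H J
  {
    assume x: "f \<in> Hom D F H" "g \<in> Hom D F H" "h \<in> Hom D H J"
    show "h \<cdot>\<^bsub>D\<^esub> Add D f g = Add D (h \<cdot>\<^bsub>D\<^esub> f) (h \<cdot>\<^bsub>D\<^esub> g)"
      by (rule ntr_eqI[OF D.Comp_Hom[OF Add_D_Hom[OF x(1,2)] x(3)] Add_D_Hom[OF D.Comp_Hom[OF x(1,3)] D.Comp_Hom[OF x(2,3)]]])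
        (use hd[OF x(1)] hd[OF x(2)] hd[OF x(3)] in \<open>simp add: Comp_Add_simp\<close>)
  }
  {
    assume x: "f \<in> Hom D H J" "g \<in> Hom D H J" "h \<in> Hom D F H"
    show "Add D f g \<cdot>\<^bsub>D\<^esub> h = Add D (f \<cdot>\<^bsub>D\<^esub> h) (g \<cdot>\<^bsub>D\<^esub> h)"
      by (rule ntr_eqI[OF D.Comp_Hom[OF x(3) Add_D_Hom[OF x(1,2)]] Add_D_Hom[OF D.Comp_Hom[OF x(3,1)] D.Comp_Hom[OF x(3,2)]]])
        (use hd[OF x(1)] hd[OF x(2)] hd[OF x(3)] in \<open>simp add: Add_Comp_simp\<close>)
  }
qed

lemma is_zero_D:
 assumes F: "F : Obj D" and z: "!!X. X : Obj C ==> is_zero A (fo F X)"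
 shows "is_zero D F"
proof -
 interpret D: preadditive D by (rule preadditive_D)
 have "Idt D F = Zer D F F"
  by (rule ntr_eqI[OF D.Idt_Hom[OF F] Zer_D_Hom[OF F F]]) (use z in "simp add: is_zero_iff")
 then show ?thesis using F D.is_zero_iff by simp
qed

text \<open>Direct sums are chosen at each object of \<open>C\<close>, and arrows act by diagonal
  matrices. Functoriality and naturality of the projections are tested on the inclusions.\<close>

lemma additive_D: "additive D"
proof (intro additive.intro preadditive_D additive_axioms.intro)
 interpret D: preadditive D by (rule preadditive_D)
 let ?Z = "\<lparr>fo = (\<lambda>X \<in> Obj C. zero_obj A), fa = (\<lambda>u \<in> Arr C. Idt A (zero_obj A))\<rparr>"
 have "?Z : Obj D" by (simp add: Obj_D is_functor_def)
 then have "is_zero D ?Z" using zero_obj by (intro is_zero_D) simp_all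
 then show "EX Z. is_zero D Z" by blast
 fix F H assume O: "F : Obj D" "H : Obj D"
 define c where "c b = (if b then H else F)" for b
 have c [simp]: "c b : Obj D" for b using O by (simp add: c_def)
 let ?X = "%W b. fo (c b) W"
 have fX: "fam A (?X W)" if "W : Obj C" for W using that by (intro fam_bool) simp_all
 let ?m = "%u b b'. if b = b' then fa (c b) u else Zer A (?X (Dom C u) b) (?X (Cod C u) b')"
 have m: "?m u b b' : Hom A (?X (Dom C u) b) (?X (Cod C u) b')" if "u : Arr C" for u b b'
  using that by (simp add: Hom_iff)
 let ?f = "%u. dmat A (?X (Dom C u)) (?X (Cod C u)) (?m u)"
 have fH: "?f u : Hom A (dS A (?X (Dom C u))) (dS A (?X (Cod C u)))" if "u : Arr C" for u
  using that fX m[OF that] by (intro dmat_Hom) simp_all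
 have f: "?f u : Arr A" "Dom A (?f u) = dS A (?X (Dom C u))" "Cod A (?f u) = dS A (?X (Cod C u))" if "u : Arr C" for u
  using fH[OF that] by (simp_all add: Hom_iff)
 have fI: "?f u ** dI A (?X (Dom C u)) b = dI A (?X (Cod C u)) b ** fa (c b) u" if "u : Arr C" for u b
  using dmat_dI_single[OF fX fX m[OF that], of b b] that by simp
 let ?S = "\<lparr>fo = (\<lambda>W \<in> Obj C. dS A (?X W)), fa = (\<lambda>u \<in> Arr C. ?f u)\<rparr>"
 have S: "?S : Obj D"
  unfolding Obj_D is_functor_def
 proof (intro conjI ballI impI)
  show "fo ?S : Obj C \<rightarrow>\<^sub>E Obj A" using fX by simp
  show "fa ?S : Arr C \<rightarrow>\<^sub>E Arr A" using f by simp
  show "Dom A (fa ?S u) = fo ?S (Dom C u)" "Cod A (fa ?S u) = fo ?S (Cod C u)" if "u : Arr C" for u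
   using f[OF that] that by simp_all
  show "fa ?S (Idt C W) = Idt A (fo ?S W)" if W: "W : Obj C" for W
  proof -
   have "?f (Idt C W) = Idt A (dS A (?X W))"
   proof (rule dS_eqI[OF fX[OF W]])
    fix b show "?f (Idt C W) ** dI A (?X W) b = Idt A (dS A (?X W)) ** dI A (?X W) b"
    using fI[of "Idt C W" b] W fX[OF W] c[of b] unfolding Obj_D is_functor_def by simp
   qed (use f[of "Idt C W"] W fX[OF W] in \<open>simp_all add: Hom_iff\<close>)
   then show ?thesis using W by simp
  qed
  show "fa ?S (v **\<^bsub>C\<^esub> u) = fa ?S v ** fa ?S u" if uv: "u : Arr C" "v : Arr C" "Cod C u = Dom C v" for u v
  proof -
   have "?f (v **\<^bsub>C\<^esub> u) = ?f v ** ?f u"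
   proof (rule dS_eqI[OF fX[of "Dom C u"]])
    fix b
    have "fa (c b) (v **\<^bsub>C\<^esub> u) = fa (c b) v ** fa (c b) u"
    using c[of b] uv unfolding Obj_D is_functor_def by blast
    moreover have "?f v ** (dI A (?X (Cod C u)) b ** fa (c b) u) = (dI A (?X (Cod C v)) b ** fa (c b) v) ** fa (c b) u"
    using fI[OF uv(2), of b] f[OF uv(2)] uv fX[of "Dom C v"] by (intro Comp_reassoc) simp_all
    ultimately show "?f (v **\<^bsub>C\<^esub> u) ** dI A (?X (Dom C u)) b = (?f v ** ?f u) ** dI A (?X (Dom C u)) b"
    using fI[of "v **\<^bsub>C\<^esub> u" b] fI[OF uv(1), of b] f[OF uv(1)] f[OF uv(2)] uv fX[of "Dom C u"] fX[of "Cod C v"]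
    by simp
   qed (use f[of "v **\<^bsub>C\<^esub> u"] f[OF uv(1)] f[OF uv(2)] uv in \<open>simp_all add: Hom_iff\<close>)
   then show ?thesis using uv by simp
  qed
 qed
 let ?i = "%b. \<lparr>ndom = c b, ncod = ?S, ncomp = (\<lambda>W \<in> Obj C. dI A (?X W) b)\<rparr>"
 let ?p = "%b. \<lparr>ndom = ?S, ncod = c b, ncomp = (\<lambda>W \<in> Obj C. dP A (?X W) b)\<rparr>"
 have i: "?i b : Hom D (c b) ?S" for b
  by (rule Hom_D_I[OF c S]) (use fX fI in "simp_all add: Hom_iff")
 have p: "?p b : Hom D ?S (c b)" for b
 proof (rule Hom_D_I[OF S c])
  fix u assume u: "u : Arr C"
  have "dP A (?X (Cod C u)) b ** ?f u = fa (c b) u ** dP A (?X (Dom C u)) b"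
  proof (rule dS_eqI[OF fX])
   fix b'
   have "dP A (?X (Cod C u)) b ** (?f u ** dI A (?X (Dom C u)) b') = (fa (c b) u ** dP A (?X (Dom C u)) b) ** dI A (?X (Dom C u)) b'"
    unfolding fI[OF u] using u fX[of "Dom C u"] fX[of "Cod C u"] by simp
   then show "(dP A (?X (Cod C u)) b ** ?f u) ** dI A (?X (Dom C u)) b' = (fa (c b) u ** dP A (?X (Dom C u)) b) ** dI A (?X (Dom C u)) b'"
    using u f[OF u] fX[of "Dom C u"] fX[of "Cod C u"] by simp
  qed (use u f[OF u] fX[of "Dom C u"] fX[of "Cod C u"] in \<open>simp_all add: Hom_iff\<close>)
  then show "ncomp (?p b) (Cod C u) ** fa ?S u = fa (c b) u ** ncomp (?p b) (Dom C u)" using u by simp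
 qed (use fX in "simp_all add: Hom_iff")
 have "is_dsum D c (?S, ?i, ?p)"
 proof (rule D.is_dsumI[OF S _ i p])
  show "finite (supp D c)" by simp
  fix b b'
  have "?p b' **\<^bsub>D\<^esub> ?i b : Hom D (c b) (c b')" by (rule D.Comp_Hom[OF i p])
  moreover have "(if b = b' then Idt D (c b) else Zer D (c b) (c b')) : Hom D (c b) (c b')"
   using D.Idt_Hom[OF c] Zer_D_Hom[OF c c] by auto
  ultimately show "?p b' **\<^bsub>D\<^esub> ?i b = (if b = b' then Idt D (c b) else Zer D (c b) (c b'))"
   by (rule ntr_eqI) (use fX in auto)
 next
  fix f g assume fg: "f : Hom D ?S ?S" "g : Hom D ?S ?S" and e: "!!b. f **\<^bsub>D\<^esub> ?i b = g **\<^bsub>D\<^esub> ?i b"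
  show "f = g"
  proof (rule ntr_eqI[OF fg])
   fix W assume W: "W : Obj C"
   show "ncomp f W = ncomp g W"
   proof (rule dS_eqI[OF fX[OF W], where Z = "dS A (?X W)"])
    show "ncomp f W : Hom A (dS A (?X W)) (dS A (?X W))" "ncomp g W : Hom A (dS A (?X W)) (dS A (?X W))"
    proof -
    have "f : Arr D" "ndom f = ?S" "ncod f = ?S" "g : Arr D" "ndom g = ?S" "ncod g = ?S"
    using fg by (simp_all add: Hom_iff)
    then show "ncomp f W : Hom A (dS A (?X W)) (dS A (?X W))" "ncomp g W : Hom A (dS A (?X W)) (dS A (?X W))"
    using W by (simp_all add: Hom_iff)
    qed
    show "ncomp f W ** dI A (?X W) b = ncomp g W ** dI A (?X W) b" for b
    using arg_cong[OF e[of b], of "%t. ncomp t W"] W by simp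
   qed
  qed
 qed
 then show "EX t. is_dsum D (%b::bool. if b then H else F) t" unfolding c_def by blast
qed

end

sublocale functors \<subseteq> D: additive "FunA C A"
 by (rule additive_D)

section \<open>Weak equivalences of simplicial objects\<close>

text \<open>A complex of zero objects need not be the particular \<open>zero_cpx\<close>, but it is
  homotopy equivalent to it, so (AC1) and (AC3) apply. This is needed for columns of negative
  simplicial degree.\<close>

lemma (in additive) zero_in_acyclic_class:
 assumes "acyclic_class A \<Gamma>" and z: "!!n. is_zero A (cob Z n)" and d: "!!n. cdf Z n : Hom A (cob Z n) (cob Z (n - 1))"
 shows "Z \<in> \<Gamma>"
proof -
 let ?t1 = "zero_cpx A"
 interpret acyclic_class A \<Gamma> by (rule assms(1))
 have zo: "cob Z n : Obj A" for n using z is_zero_Obj by blast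
 have zc: "cob ?t1 n = zero_obj A" for n by (simp add: zero_cpx_def conc_cpx_def Let_def)
 have eq: "f = g" if "f : Hom A X Y" "g : Hom A X Y" "is_zero A X" for f g X Y
  using is_zero_Hom_eq[OF disjI1[OF that(3)]] that(1,2) by metis
 have Z: "Z : Obj (Ch A)"
 proof -
  have "cdf Z (n - 1) ** cdf Z n = Zer A (cob Z n) (cob Z (n - 2))" for n
   using Comp_Hom[OF d[of n] d[of "n - 1"]] by (intro eq[OF _ Zer_Hom z] zo) simp_all
  then show ?thesis unfolding Obj_Ch is_cpx_def bounded_below_def using zo d z by blast
 qed
 have O: "zero_cpx A : Obj (Ch A)" using AC1 sub by blast
 let ?f = "\<lparr>mdom = zero_cpx A, mcod = Z, mcomp = (%n. Zer A (zero_obj A) (cob Z n))\<rparr>"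
 have "?f : Hom (Ch A) ?t1 Z"
  unfolding Hom_Ch using O Z Obj_Ch_simps[OF O] zo by (simp add: zc Hom_iff)
 then have "homotopy_equivalent A ?t1 Z"
 proof (rule homotopy_equivalent_iso)
  fix n
  show "Zer A (cob Z n) (zero_obj A) : Hom A (cob Z n) (cob ?t1 n)" using zo by (simp add: zc Hom_iff)
  show "Zer A (cob Z n) (zero_obj A) ** mcomp ?f n = Idt A (cob ?t1 n)"
   using zero_obj zo by (simp add: zc is_zero_iff)
  show "mcomp ?f n ** Zer A (cob Z n) (zero_obj A) = Idt A (cob Z n)"
   using z[of n] zo by (simp add: is_zero_iff)
 qed
 then show ?thesis using AC1 AC3[OF O Z] by blast
qed

sublocale monoidal_functors \<subseteq> functors C A
 by unfold_locales

context monoidal_functors begin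

abbreviation nt where "nt F H c \<equiv> \<lparr>ndom = F, ncod = H, ncomp = (\<lambda>X \<in> Obj C. c X)\<rparr>"

lemma cpx_of_simps [simp]:
 "X : Obj C ==> fo (cob (cpx_of C F) n) X = cob (fo F X) n"
 "u : Arr C ==> fa (cob (cpx_of C F) n) u = mcomp (fa F u) n"
 "ndom (cdf (cpx_of C F) n) = cob (cpx_of C F) n" "ncod (cdf (cpx_of C F) n) = cob (cpx_of C F) (n - 1)"
 "ncomp (cdf (cpx_of C F) n) = (\<lambda>X \<in> Obj C. cdf (fo F X) n)"
 by (simp_all add: cpx_of_def Let_def)

lemma nt_Hom:
 assumes "F : Obj D" "H : Obj D" "!!X. X : Obj C ==> c X : Hom A (fo F X) (fo H X)"
  and "!!u. u : Arr C ==> c (Cod C u) ** fa F u = fa H u ** c (Dom C u)"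
 shows "nt F H c : Hom D F H"
 by (rule Hom_D_I) (use assms in simp_all)

text \<open>Negation in the functor category is defined as a group inverse; the objectwise negative
  is an inverse, and inverses are unique.\<close>

lemma sgnm_D_ncomp:
 assumes t: "t : Hom D F H" and X: "X : Obj C"
 shows "ncomp (sgnm D a t) X = sgnm A a (ncomp t X)"
proof -
 have O: "F : Obj D" "H : Obj D" using D.Hom_Obj[OF t] by blast+
 have tt: "t : Arr D" "ndom t = F" "ncod t = H" using t by (simp_all add: Hom_iff)
 let ?n = "nt F H (%X. neg A (ncomp t X))"
 have "Add D t ?n = Zer D F H"
 proof (rule ntr_eqI[OF Add_D_Hom[OF t neg_D_Hom[OF t]] Zer_D_Hom[OF O]])
  fix X assume "X : Obj C"
  then show "ncomp (Add D t ?n) X = ncomp (Zer D F H) X"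
   using tt Add_neg[of "ncomp t X" "fo F X" "fo H X"] by (simp add: Hom_iff)
 qed
 then have "?n = neg D t" by (rule D.neg_unique[OF t neg_D_Hom[OF t]])
 then have "ncomp (neg D t) X = neg A (ncomp t X)" using X by (metis ntr.select_convs(3) restrict_apply')
 then show ?thesis by (simp add: sgnm_def)
qed

lemma cpx_of_Hom:
 assumes F: "is_functor C (Ch A) F"
 shows "cob (cpx_of C F) n : Obj D" "cdf (cpx_of C F) n : Hom D (cob (cpx_of C F) n) (cob (cpx_of C F) (n - 1))"
proof -
 let ?t1 = "cpx_of C F"
 note [simp] = functor_Ch_simps[OF F]
 have O: "cob ?t1 n : Obj D" for n
  by (auto simp: Obj_D is_functor_def cpx_of_def Let_def)
 then show "cob ?t1 n : Obj D" .
 have "cdf (fo F (Cod C u)) n ** mcomp (fa F u) n = mcomp (fa F u) (n - 1) ** cdf (fo F (Dom C u)) n" if "u : Arr C" for u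
  using functor_Ch_simps(2-4)[OF F that] by (metis Arr_Ch)
 then show "cdf ?t1 n : Hom D (cob ?t1 n) (cob ?t1 (n - 1))"
  by (intro Hom_D_I O) (simp_all add: Hom_iff)
qed

lemma cpx_of_Obj:
 assumes "F : Obj S"
 shows "cpx_of C (sfun F) : Obj (Ch D)"
proof -
 let ?t1 = "cpx_of C (sfun F)"
 note f = Obj_S_simps(3)[OF assms]
 note h = cpx_of_Hom[OF f]
 have "cdf ?t1 (n - 1) **\<^bsub>D\<^esub> cdf ?t1 n = Zer D (cob ?t1 n) (cob ?t1 (n - 2))" for n
 proof (rule ntr_eqI)
  show "cdf ?t1 (n - 1) **\<^bsub>D\<^esub> cdf ?t1 n : Hom D (cob ?t1 n) (cob ?t1 (n - 2))"
   using D.Comp_Hom[OF h(2)[of n] h(2)[of "n - 1"]] by simp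
 qed (use h(1) functor_Ch_simps(1)[OF f] in "simp_all add: Zer_D_Hom")
 then have "is_cpx D ?t1" unfolding is_cpx_def using h by blast
 moreover obtain m where m: "ALL X:Obj C. ALL n < m. is_zero A (cob (fo (sfun F) X) n)"
  using Obj_S_simps(4)[OF assms] by (auto simp: unif_bounded_def)
 have "is_zero D (cob ?t1 n)" if "n < m" for n
  using h(1) m that by (intro is_zero_D) simp_all
 then have "bounded_below D ?t1" by (auto simp: bounded_below_def)
 ultimately show ?thesis by (simp add: D.Obj_Ch)
qed

lemma cmap_of_simps:
 "mdom (cmap_of C t) = cpx_of C (sfun (mtdom t))" "mcod (cmap_of C t) = cpx_of C (sfun (mtcod t))"
 "mcomp (cmap_of C t) n = nt (cob (cpx_of C (sfun (mtdom t))) n) (cob (cpx_of C (sfun (mtcod t))) n) (%X. mcomp (mtcomp t X) n)"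
 by (simp_all add: cmap_of_def Let_def)

lemma cmap_of_Hom:
 assumes t: "t : Arr S"
 shows "cmap_of C t : Hom (Ch D) (cpx_of C (sfun (mtdom t))) (cpx_of C (sfun (mtcod t)))"
proof -
 have O: "mtdom t : Obj S" "mtcod t : Obj S" using t Arr_S by blast+
 note f = Obj_S_simps(3)[OF O(1)] Obj_S_simps(3)[OF O(2)]
 note h = cpx_of_Hom[OF f(1)] cpx_of_Hom[OF f(2)]
 have m: "mcomp (cmap_of C t) n : Hom D (cob (cpx_of C (sfun (mtdom t))) n) (cob (cpx_of C (sfun (mtcod t))) n)" for n
  unfolding cmap_of_simps by (rule nt_Hom[OF h(1,3)]) (use Arr_S_simps[OF t] mnt_comp_laws(1)[OF t] in "simp_all add: Hom_iff")
 have "cdf (cpx_of C (sfun (mtcod t))) n **\<^bsub>D\<^esub> mcomp (cmap_of C t) n = mcomp (cmap_of C t) (n - 1) **\<^bsub>D\<^esub> cdf (cpx_of C (sfun (mtdom t))) n" for n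
  by (rule ntr_eqI[OF D.Comp_Hom[OF m h(4)] D.Comp_Hom[OF h(2) m]])
   (use mnt_comp_laws(5)[OF t] in "simp add: cmap_of_simps")
 then show ?thesis unfolding D.Hom_Ch using cpx_of_Obj O m by (simp add: cmap_of_simps)
qed

end

section \<open>The total complex in the functor category\<close>

context simplicial_functors begin

abbreviation kn where "kn n q \<equiv> cob (cpx_of C (sfun (sob B n))) q"
abbreviation PR where "PR \<equiv> cpx_of C (sfun R)"

text \<open>The double complexes \<open>sEM_d A B X\<close> for all \<open>X\<close> at once, as one
  double complex of functors, since the acyclic class consists of complexes of functors.\<close>

definition ED :: "(('o,'a,'p,'b) fctr, ('o,'a,'p,'b) ntr) dcpx" where
 "ED = (let ob = (%p q. if 0 <= p then kn (nat p) q else zero_obj D) in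
  \<lparr>dob = ob, dd1 = (%p q. if 0 < p then nt (ob p q) (ob (p - 1) q) (%X. bd (nat p) X q) else Zer D (ob p q) (ob (p - 1) q)),
   dd2 = (%p q. if 0 <= p then cdf (cpx_of C (sfun (sob B (nat p)))) q else Zer D (ob p q) (ob p (q - 1)))\<rparr>)"

lemma B_functor: "is_functor C (Ch A) (sfun (sob B n))"
 using F_functor[OF B_shape] .

lemma dob_ED: "dob ED (int n) q = kn n q" "p < 0 ==> dob ED p q = zero_obj D"
 by (simp_all add: ED_def Let_def)

lemma dob_ED_Obj [simp]: "dob ED p q : Obj D"
 using cpx_of_Hom(1)[OF B_functor] by (simp add: ED_def Let_def)

lemma zero_ED: "p < 0 ==> is_zero D (dob ED p q)"
 using D.zero_obj by (simp add: dob_ED)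

lemma fo_ED: "X : Obj C ==> fo (dob ED (int n) q) X = k n X q"
 by (simp add: dob_ED)

lemma fa_ED: "u : Arr C ==> fa (dob ED (int n) q) u = Fm n u q"
 by (simp add: dob_ED)

lemma dd_ED:
 "dd1 ED (int (Suc n)) q = nt (dob ED (int (Suc n)) q) (dob ED (int n) q) (%X. bd (Suc n) X q)"
 "dd1 ED 0 q = Zer D (dob ED 0 q) (dob ED (-1) q)"
 "dd2 ED (int n) q = cdf (cpx_of C (sfun (sob B n))) q"
proof -
 have "nat (1 + int n) = Suc n" by linarith
 then show "dd1 ED (int (Suc n)) q = nt (dob ED (int (Suc n)) q) (dob ED (int n) q) (%X. bd (Suc n) X q)"
  by (simp add: ED_def Let_def)
qed (simp_all add: ED_def Let_def)

lemma dd_ED_neg: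
 "~ 0 < p ==> dd1 ED p q = Zer D (dob ED p q) (dob ED (p - 1) q)"
 "p < 0 ==> dd2 ED p q = Zer D (dob ED p q) (dob ED p (q - 1))"
 by (simp_all add: ED_def Let_def)

lemma dd1_ED_Hom: "dd1 ED p q : Hom D (dob ED p q) (dob ED (p - 1) q)"
proof (cases "0 < p")
 case True
 define n where "n = nat (p - 1)"
 have p: "p = int (Suc n)" "p - 1 = int n" using True by (simp_all add: n_def)
 show ?thesis unfolding p(2) unfolding p(1) dd_ED
 proof (rule nt_Hom)
  show "bd (Suc n) (Cod C u) q ** fa (dob ED (int (Suc n)) q) u = fa (dob ED (int n) q) u ** bd (Suc n) (Dom C u) q" if "u : Arr C" for u
   unfolding fa_ED[OF that] using bd_natural[OF that, of "Suc n" q] by simp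
 qed (simp_all add: fo_ED Hom_iff del: of_nat_Suc)
next
 case False
 show ?thesis unfolding dd_ED_neg(1)[OF False] by (rule Zer_D_Hom[OF dob_ED_Obj dob_ED_Obj])
qed

lemma dd2_ED_Hom: "dd2 ED p q : Hom D (dob ED p q) (dob ED p (q - 1))"
proof (cases p rule: int_cases_nat)
 case neg
 show ?thesis unfolding dd_ED_neg(2)[OF neg] by (rule Zer_D_Hom[OF dob_ED_Obj dob_ED_Obj])
next
 case (nat n)
 then show ?thesis using cpx_of_Hom(2)[OF B_functor] by (simp add: dd_ED dob_ED)
qed

lemma is_dcpx_ED: "is_dcpx D ED"
 unfolding is_dcpx_def
proof (intro allI conjI)
 fix p q
 note h = dob_ED_Obj dd1_ED_Hom dd2_ED_Hom
 show "dob ED p q : Obj D" "dd1 ED p q : Hom D (dob ED p q) (dob ED (p - 1) q)"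
  "dd2 ED p q : Hom D (dob ED p q) (dob ED p (q - 1))" by (rule h)+
 have c: "dd1 ED (p - 1) q **\<^bsub>D\<^esub> dd1 ED p q : Hom D (dob ED p q) (dob ED (p - 2) q)"
  "dd2 ED p (q - 1) **\<^bsub>D\<^esub> dd2 ED p q : Hom D (dob ED p q) (dob ED p (q - 2))"
  "dd1 ED p (q - 1) **\<^bsub>D\<^esub> dd2 ED p q : Hom D (dob ED p q) (dob ED (p - 1) (q - 1))"
  "dd2 ED (p - 1) q **\<^bsub>D\<^esub> dd1 ED p q : Hom D (dob ED p q) (dob ED (p - 1) (q - 1))"
  using D.Comp_Hom[OF h(2)[of p q] h(2)[of "p - 1" q]] D.Comp_Hom[OF h(3)[of p q] h(3)[of p "q - 1"]]
   D.Comp_Hom[OF h(3)[of p q] h(2)[of p "q - 1"]] D.Comp_Hom[OF h(2)[of p q] h(3)[of "p - 1" q]] by simp_all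
 have z: "f = g" if "is_zero D (dob ED p q) | is_zero D W" "f : Hom D (dob ED p q) W" "g : Hom D (dob ED p q) W" for f g W
  using D.is_zero_Hom_eq that by metis
 have Z: "Zer D (dob ED p q) (dob ED p' q') : Hom D (dob ED p q) (dob ED p' q')" for p' q' by (rule Zer_D_Hom) simp_all
 show "dd1 ED (p - 1) q **\<^bsub>D\<^esub> dd1 ED p q = Zer D (dob ED p q) (dob ED (p - 2) q)"
 proof (cases "p < 2")
  case True
  then show ?thesis using z[OF _ c(1) Z] zero_ED[of "p - 2" q] by simp
 next
  case False
  define n where "n = nat (p - 2)"
  have p: "p = int (Suc (Suc n))" "p - 1 = int (Suc n)" "p - 2 = int n" using False by (simp_all add: n_def)
  show ?thesis
  proof (rule ntr_eqI[OF c(1) Z])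
   fix X assume X: "X : Obj C"
   show "ncomp (dd1 ED (p - 1) q **\<^bsub>D\<^esub> dd1 ED p q) X = ncomp (Zer D (dob ED p q) (dob ED (p - 2) q)) X"
    unfolding p(2,3) unfolding p(1) dd_ED using X bd_bd[OF X, of n q] by (simp add: fo_ED del: of_nat_Suc)
  qed
 qed
 show "dd2 ED p (q - 1) **\<^bsub>D\<^esub> dd2 ED p q = Zer D (dob ED p q) (dob ED p (q - 2))"
 proof (cases p rule: int_cases_nat)
  case neg
  then show ?thesis using z[OF _ c(2) Z] zero_ED by simp
 next
  case (nat n)
  show ?thesis unfolding nat dd_ED dob_ED using cpx_of_Obj[OF s.sob, of n] D.Obj_Ch_simps(1) D.cpx_simps(5) by blast
 qed
 show "dd1 ED p (q - 1) **\<^bsub>D\<^esub> dd2 ED p q = dd2 ED (p - 1) q **\<^bsub>D\<^esub> dd1 ED p q"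
 proof (cases "p < 1")
  case True
  then show ?thesis using z[OF _ c(3,4)] zero_ED[of "p - 1" "q - 1"] by simp
 next
  case False
  define n where "n = nat (p - 1)"
  have p: "p = int (Suc n)" "p - 1 = int n" using False by (simp_all add: n_def)
  show ?thesis
  proof (rule ntr_eqI[OF c(3,4)])
   fix X assume X: "X : Obj C"
   show "ncomp (dd1 ED p (q - 1) **\<^bsub>D\<^esub> dd2 ED p q) X = ncomp (dd2 ED (p - 1) q **\<^bsub>D\<^esub> dd1 ED p q) X"
    unfolding p(2) unfolding p(1) dd_ED using X bd_dv[OF X, of "Suc n" q] by simp
  qed
 qed
qed

lemma bound_ED: obtains b where "!!p q. p < b | q < b ==> is_zero D (dob ED p q)"
proof -
 obtain b where b: "!!X p q. X : Obj C ==> p < 0 | q < b ==> is_zero A (dob (E X) p q)" using bound_E by blast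
 have "is_zero D (dob ED p q)" if pq: "p < min 0 b | q < min 0 b" for p q
 proof (cases p rule: int_cases_nat)
  case neg
  then show ?thesis by (rule zero_ED)
 next
  case (nat n)
  show ?thesis
  proof (rule is_zero_D)
   fix X assume X: "X : Obj C"
   show "is_zero A (fo (dob ED p q) X)" unfolding nat fo_ED[OF X] using b[OF X, of p q] pq nat by (simp add: dob_E)
  qed simp
 qed
 then show ?thesis using that by blast
qed

definition JD where
 "JD p q = (if 0 <= p then nt (dob ED p q) (cob PR (p + q)) (%X. jn X (nat p) q) else Zer D (dob ED p q) (cob PR (p + q)))"

lemma PR_simps: "cob PR n : Obj D" "cdf PR n : Hom D (cob PR n) (cob PR (n - 1))"
 "X : Obj C ==> fo (cob PR n) X = cob (T X) n"
 using cpx_of_Hom[OF R_functor] by (simp_all add: fo_R)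

lemma JD_nat: "JD (int n) q = nt (dob ED (int n) q) (cob PR (int n + q)) (%X. jn X n q)"
 by (simp add: JD_def)

lemma JD_Hom: "JD p q : Hom D (dob ED p q) (cob PR (p + q))"
proof (cases p rule: int_cases_nat)
 case neg
 then show ?thesis using Zer_D_Hom[OF dob_ED_Obj PR_simps(1)] by (simp add: JD_def)
next
 case (nat n)
 show ?thesis unfolding nat JD_nat
 proof (rule nt_Hom[OF dob_ED_Obj PR_simps(1)])
  show "jn (Cod C u) n q ** fa (dob ED (int n) q) u = fa (cob PR (int n + q)) u ** jn (Dom C u) n q" if "u : Arr C" for u
   using that fa_R_facts(2)[OF that, of n q] by (simp add: fa_ED)
 qed (simp add: fo_ED fo_R Hom_iff)
qed

text \<open>The universal property holds at each object by the direct sums chosen there. The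
  resulting arrows form a natural transformation because naturality can be tested on summands, where
  it is naturality of the given maps.\<close>

lemma is_total_JD: "D.is_total ED PR JD"
 unfolding D.is_total_def
proof (intro conjI allI impI)
 show "JD p q : Hom D (dob ED p q) (cob PR (p + q))" for p q by (rule JD_Hom)
next
 fix n Z u assume u: "ALL p. u p : Hom D (dob ED p (n - p)) Z"
 let ?t1 = "cob PR n"
 have ZO: "Z : Obj D" using u D.Hom_Obj(2) by blast
 have uh: "u p : Arr D" "ndom (u p) = dob ED p (n - p)" "ncod (u p) = Z" for p using u by (simp_all add: Hom_iff)
 have un: "ncomp (u (int p)) X : Hom A (k p X (n - int p)) (fo Z X)" if "X : Obj C" for p X
  using Arr_D_simps[OF uh(1), unfolded uh(2,3)] that fo_ED[OF that] by (simp add: Hom_iff)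
 \<comment> \<open>Columns of negative index are absent from \<open>jn\<close>, so the family to be
   extended is set to zero there.\<close>
 have "EX h. h : Hom A (cob (T X) n) (fo Z X) & (ALL p q. int p + q = n --> h ** jn X p q = ncomp (u (int p)) X)" if X: "X : Obj C" for X
 proof -
  define v where "v i = (if 0 <= i then ncomp (u i) X else Zer A (diag (E X) n i) (fo Z X))" for i
  have "v i : Hom A (diag (E X) n i) (fo Z X)" for i
  proof (cases i rule: int_cases_nat)
   case neg
   then show ?thesis using fam_E[OF X, of n] ZO X by (simp add: v_def Hom_iff)
  next
   case (nat p)
   then show ?thesis using un[OF X, of p] by (simp add: v_def diag_apply dob_E)
  qed
  from dS_desc[OF fam_E[OF X] this] obtain h where h: "h : Hom A (dS A (diag (E X) n)) (fo Z X)" "!!i. h ** dI A (diag (E X) n) i = v i"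
   by blast
  have "h ** jn X p q = ncomp (u (int p)) X" if "int p + q = n" for p q
   using h(2)[of "int p"] that by (simp add: inj2_def v_def)
  then show ?thesis using h(1) by (auto simp: cob_Tot)
 qed
 then obtain h where hH: "!!X. X : Obj C ==> h X : Hom A (cob (T X) n) (fo Z X)"
  and hj: "!!X p q. X : Obj C ==> int p + q = n ==> h X ** jn X p q = ncomp (u (int p)) X" by metis
 have hs: "h X : Arr A" "Dom A (h X) = cob (T X) n" "Cod A (h X) = fo Z X" if "X : Obj C" for X
  using hH[OF that] by (simp_all add: Hom_iff)
 have t: "nt ?t1 Z h : Hom D ?t1 Z"
 proof (rule nt_Hom[OF PR_simps(1) ZO])
  fix w assume w: "w : Arr C"
  have "h (Cod C w) ** mcomp (fa (sfun R) w) n = fa Z w ** h (Dom C w)"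
  proof (rule T_eqI[of "Dom C w"])
   fix p q assume pq: "int p + q = n"
   then have q: "n - int p = q" by simp
   have "ncomp (u (int p)) (Cod C w) ** Fm p w q = fa Z w ** ncomp (u (int p)) (Dom C w)"
    using ntr_nat[OF uh(1) w, of "int p"] w fa_ED[OF w, of p q] unfolding uh(2,3) q by simp
   moreover have "h (Cod C w) ** (jn (Cod C w) p q ** Fm p w q) = ncomp (u (int p)) (Cod C w) ** Fm p w q"
    using w hs pq by (intro Comp_reassoc hj) simp_all
   ultimately show "(h (Cod C w) ** mcomp (fa (sfun R) w) n) ** jn (Dom C w) p q = (fa Z w ** h (Dom C w)) ** jn (Dom C w) p q"
    using w hs pq hj[OF _ pq] fa_R_facts(2)[OF w, of p q] ZO by simp
  qed (use w hs ZO in "simp_all add: Hom_iff")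
  then show "h (Cod C w) ** fa ?t1 w = fa Z w ** h (Dom C w)" using w by simp
 qed (use hH in "simp add: fo_R")
 have "nt ?t1 Z h **\<^bsub>D\<^esub> JD p (n - p) = u p" for p
 proof -
  have c: "nt ?t1 Z h **\<^bsub>D\<^esub> JD p (n - p) : Hom D (dob ED p (n - p)) Z"
   using D.Comp_Hom[OF JD_Hom[of p "n - p"]] t by simp
  show ?thesis
  proof (cases p rule: int_cases_nat)
   case neg
   then show ?thesis using D.is_zero_Hom_eq[OF disjI1[OF zero_ED]] c u by metis
  next
   case (nat m)
   show ?thesis
   proof (rule ntr_eqI[OF c])
    show "u p : Hom D (dob ED p (n - p)) Z" using u by blast
    fix X assume X: "X : Obj C"
    show "ncomp (nt ?t1 Z h **\<^bsub>D\<^esub> JD p (n - p)) X = ncomp (u p) X"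
    unfolding nat JD_nat using X hj[OF X, of m "n - int m"] by simp
   qed
  qed
 qed
 then show "EX h:Hom D ?t1 Z. ALL p. h **\<^bsub>D\<^esub> JD p (n - p) = u p" using t by blast
next
 fix n Z f g assume f: "f : Hom D (cob PR n) Z" and g: "g : Hom D (cob PR n) Z" and e: "ALL p. f **\<^bsub>D\<^esub> JD p (n - p) = g **\<^bsub>D\<^esub> JD p (n - p)"
 have fg: "f : Arr D" "ndom f = cob PR n" "ncod f = Z" "g : Arr D" "ndom g = cob PR n" "ncod g = Z"
  using f g by (simp_all add: Hom_iff)
 show "f = g"
 proof (rule ntr_eqI[OF f g])
  fix X assume X: "X : Obj C"
  show "ncomp f X = ncomp g X"
  proof (rule T_eqI[OF X])
   show "ncomp f X : Hom A (cob (T X) n) (fo Z X)" "ncomp g X : Hom A (cob (T X) n) (fo Z X)"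
    using fg X PR_simps(3)[OF X, of n] by (simp_all add: Hom_iff)
   fix p q assume pq: "int p + q = n"
   then have q: "n - int p = q" by simp
   show "ncomp f X ** jn X p q = ncomp g X ** jn X p q"
    using arg_cong[OF e[THEN spec, of "int p"], of "%t. ncomp t X"] X unfolding JD_nat q by simp
  qed
 qed
next
 fix p q :: int
 have ix: "p - 1 + q = p + q - 1" "p + (q - 1) = p + q - 1" by simp_all
 have H: "cdf PR (p + q) **\<^bsub>D\<^esub> JD p q : Hom D (dob ED p q) (cob PR (p + q - 1))"
  "Add D (JD (p - 1) q **\<^bsub>D\<^esub> dd1 ED p q) (sgnm D p (JD p (q - 1) **\<^bsub>D\<^esub> dd2 ED p q)) : Hom D (dob ED p q) (cob PR (p + q - 1))"
 proof -
  show "cdf PR (p + q) **\<^bsub>D\<^esub> JD p q : Hom D (dob ED p q) (cob PR (p + q - 1))"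
   by (rule D.Comp_Hom[OF JD_Hom PR_simps(2)])
  have "JD (p - 1) q **\<^bsub>D\<^esub> dd1 ED p q : Hom D (dob ED p q) (cob PR (p + q - 1))"
   "JD p (q - 1) **\<^bsub>D\<^esub> dd2 ED p q : Hom D (dob ED p q) (cob PR (p + q - 1))"
   using D.Comp_Hom[OF dd1_ED_Hom JD_Hom, of p q] D.Comp_Hom[OF dd2_ED_Hom JD_Hom, of p q] unfolding ix by blast+
  then show "Add D (JD (p - 1) q **\<^bsub>D\<^esub> dd1 ED p q) (sgnm D p (JD p (q - 1) **\<^bsub>D\<^esub> dd2 ED p q)) : Hom D (dob ED p q) (cob PR (p + q - 1))"
   by (intro D.Add_Hom) (auto simp: sgnm_def intro: D.neg_Hom)
 qed
 show "cdf PR (p + q) **\<^bsub>D\<^esub> JD p q = Add D (JD (p - 1) q **\<^bsub>D\<^esub> dd1 ED p q) (sgnm D p (JD p (q - 1) **\<^bsub>D\<^esub> dd2 ED p q))"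
 proof (cases p rule: int_cases_nat)
  case neg
  then show ?thesis using D.is_zero_Hom_eq[OF disjI1[OF zero_ED]] H by metis
 next
  case (nat m)
  show ?thesis
  proof (rule ntr_eqI[OF H])
   fix X assume X: "X : Obj C"
   have s: "ncomp (sgnm D p (JD p (q - 1) **\<^bsub>D\<^esub> dd2 ED p q)) X = sgnm A p (jn X m (q - 1) ** dv m X q)"
    using sgnm_D_ncomp[OF D.Comp_Hom[OF dd2_ED_Hom JD_Hom] X, of p p q] X unfolding nat JD_nat dd_ED by simp
   have d: "ncomp (JD (p - 1) q **\<^bsub>D\<^esub> dd1 ED p q) X = (if m = 0 then Zer A (k m X q) (cob (T X) (int m + q - 1)) else jn X (m - 1) q ** bd m X q)"
   proof (cases m)
    case 0
    then show ?thesis using nat X fctr_simps(1)[OF dob_ED_Obj[of "-1" q] X] fo_ED[OF X, of 0 q] PR_simps(3)[OF X, of "q - 1"]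
    by (simp add: JD_def dd_ED)
   next
    case (Suc m')
    have p': "p - 1 = int m'" using nat Suc by simp
    show ?thesis unfolding p' unfolding nat Suc JD_nat dd_ED using X by simp
   qed
   show "ncomp (cdf PR (p + q) **\<^bsub>D\<^esub> JD p q) X = ncomp (Add D (JD (p - 1) q **\<^bsub>D\<^esub> dd1 ED p q) (sgnm D p (JD p (q - 1) **\<^bsub>D\<^esub> dd2 ED p q))) X"
    unfolding D_simps restrict_apply'[OF X] s d[unfolded D_simps restrict_apply'[OF X]]
    unfolding nat JD_nat using T_d_jn[OF X, of m q] X by (simp add: fo_R)
  qed
 qed
qed

end

section \<open>From degreewise to total weak equivalences\<close>

context simplicial_map begin

definition hD where
 "hD p q = (if 0 <= p then nt (dob b.ED p q) (dob b'.ED p q) (%X. f (nat p) X q) else Zer D (dob b.ED p q) (dob b'.ED p q))"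

lemma hD_nat: "hD (int n) q = nt (dob b.ED (int n) q) (dob b'.ED (int n) q) (%X. f n X q)"
 by (simp add: hD_def)

lemma hD_Hom: "hD p q : Hom D (dob b.ED p q) (dob b'.ED p q)"
proof (cases p rule: b.int_cases_nat)
 case neg
 then show ?thesis using Zer_D_Hom[OF b.dob_ED_Obj b'.dob_ED_Obj] by (simp add: hD_def)
next
 case (nat n)
 show ?thesis unfolding nat hD_nat
 proof (rule nt_Hom[OF b.dob_ED_Obj b'.dob_ED_Obj])
  show "f n (Cod C u) q ** fa (dob b.ED (int n) q) u = fa (dob b'.ED (int n) q) u ** f n (Dom C u) q" if "u : Arr C" for u
   using that f_laws(1)[OF that] by (simp add: b.fa_ED b'.fa_ED)
 qed (simp add: b.fo_ED b'.fo_ED Hom_iff)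
qed

text \<open>The column of nonnegative index is the complex of functors of \<open>sob B n\<close> on
  the nose, so membership of its cone in the acyclic class is literally the hypothesis on
  \<open>ph n\<close>.\<close>

lemma colmap_hD: "colmap b.ED b'.ED hD (int n) = cmap_of C (ph n)" (is "?L = ?R")
proof (rule D.cmap_eqI)
 have c: "col b.ED (int n) = cpx_of C (sfun (sob B n))" "col b'.ED (int n) = cpx_of C (sfun (sob B' n))"
  by (auto intro!: cpx.equality simp: col_def b.dob_ED b'.dob_ED b.dd_ED b'.dd_ED)
 show "mdom ?L = mdom ?R" "mcod ?L = mcod ?R"
  using c by (simp_all add: colmap_def cmap_of_simps ph_facts)
 show "mcomp ?L q = mcomp ?R q" for q
  by (simp add: colmap_def cmap_of_simps ph_facts hD_nat b.dob_ED b'.dob_ED)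
qed

theorem tmap_weq:
 assumes \<Gamma>: "acyclic_class D \<Gamma>" and w: "!!n. ph n \<in> weqs C MC A MA \<Gamma>"
 shows "tmap \<in> weqs C MC A MA \<Gamma>"
proof -
 let ?t1 = "cmap_of C tmap"
 interpret acyclic_class D \<Gamma> by (rule \<Gamma>)
 have tm: "tmap : Arr S" "mtdom tmap = b.R" "mtcod tmap = b'.R" using tmap_Hom by (simp_all add: Hom_iff)
 have cone: "cone D (colmap b.ED b'.ED hD p) \<in> \<Gamma>" for p
 proof (cases p rule: b.int_cases_nat)
  case (nat n)
  then show ?thesis using w[of n] by (simp add: colmap_hD weqs_def)
 next
  \<comment> \<open>Columns of negative simplicial degree consist of zero objects, and so does the
    cone between them.\<close>
  case neg
  let ?f = "colmap b.ED b'.ED hD p"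
  have m: "mdom ?f = col b.ED p" "mcod ?f = col b'.ED p" "mcomp ?f q = hD p q" for q by (simp_all add: colmap_def)
  have c: "cob (col b.ED p) q = dob b.ED p q" "cob (col b'.ED p) q = dob b'.ED p q" for q by (simp_all add: col_def)
  have cp: "is_cpx D (mdom ?f)" "is_cpx D (mcod ?f)"
   unfolding m is_cpx_def col_def cpx.simps using b.is_dcpx_ED b'.is_dcpx_ED unfolding is_dcpx_def by blast+
  have h: "mcomp ?f q : Hom D (cob (mdom ?f) q) (cob (mcod ?f) q)" for q unfolding m c by (rule hD_Hom)
  show ?thesis
  proof (rule D.zero_in_acyclic_class[OF \<Gamma>])
   show "is_zero D (cob (cone D ?f) n)" for n
    unfolding cob_cone
   proof (rule D.is_zero_dS[OF D.fam_cfm[OF cp h]])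
    show "is_zero D (cfm ?f n i)" for i
    using b.zero_ED[OF neg] b'.zero_ED[OF neg] by (simp add: cfm_def m c)
   qed
  qed (rule D.cone_d_facts(1)[OF cp h])
 qed
 obtain b1 b2 where bb: "!!p q. p < b1 | q < b1 ==> is_zero D (dob b.ED p q)" "!!p q. p < b2 | q < b2 ==> is_zero D (dob b'.ED p q)"
  using b.bound_ED b'.bound_ED by metis
 have "cone_total D b.ED b'.ED hD b.PR b'.PR ?t1 b.JD b'.JD (min b1 b2)"
 proof (intro cone_total.intro cone_total_axioms.intro additive_D b.is_dcpx_ED b'.is_dcpx_ED hD_Hom b.is_total_JD b'.is_total_JD)
  show "is_zero D (dob b.ED p q) & is_zero D (dob b'.ED p q)" if "p < min b1 b2 | q < min b1 b2" for p q
   using that bb by auto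
  show "cmap_of C tmap : Hom (Ch D) b.PR b'.PR" using cmap_of_Hom[OF tm(1)] by (simp add: tm)
  show "is_cpx D (cone D (colmap b.ED b'.ED hD p))" for p using cone[of p] sub by (auto simp: D.Obj_Ch)
  fix p q
  have H: "dd1 b'.ED p q **\<^bsub>D\<^esub> hD p q : Hom D (dob b.ED p q) (dob b'.ED (p - 1) q)"
   "hD (p - 1) q **\<^bsub>D\<^esub> dd1 b.ED p q : Hom D (dob b.ED p q) (dob b'.ED (p - 1) q)"
   by (rule D.Comp_Hom[OF hD_Hom b'.dd1_ED_Hom] D.Comp_Hom[OF b.dd1_ED_Hom hD_Hom])+
  show "dd1 b'.ED p q **\<^bsub>D\<^esub> hD p q = hD (p - 1) q **\<^bsub>D\<^esub> dd1 b.ED p q"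
  proof (cases "p < 1")
   case True
   then have "is_zero D (dob b'.ED (p - 1) q)" by (intro b'.zero_ED) simp
   then show ?thesis using D.is_zero_Hom_eq[OF disjI2] H by metis
  next
   case False
   define n where "n = nat (p - 1)"
   have p: "p = int (Suc n)" "p - 1 = int n" using False by (simp_all add: n_def)
   show ?thesis
   proof (rule ntr_eqI[OF H])
    fix X assume X: "X : Obj C"
    show "ncomp (dd1 b'.ED p q **\<^bsub>D\<^esub> hD p q) X = ncomp (hD (p - 1) q **\<^bsub>D\<^esub> dd1 b.ED p q) X"
    unfolding p(2) unfolding p(1) b.dd_ED b'.dd_ED hD_nat using X f_bd[OF X, of "Suc n" q] by simp
   qed
  qed
  have mt: "mcomp ?t1 n = nt (cob b.PR n) (cob b'.PR n) (%X. tf X n)" for n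
   by (simp add: cmap_of_simps tm)
  have mH: "mcomp ?t1 n : Hom D (cob b.PR n) (cob b'.PR n)" for n
   using cmap_of_Hom[OF tm(1)] unfolding D.Hom_Ch tm by blast
  have H': "mcomp ?t1 (p + q) **\<^bsub>D\<^esub> b.JD p q : Hom D (dob b.ED p q) (cob b'.PR (p + q))"
   "b'.JD p q **\<^bsub>D\<^esub> hD p q : Hom D (dob b.ED p q) (cob b'.PR (p + q))"
   by (rule D.Comp_Hom[OF b.JD_Hom mH] D.Comp_Hom[OF hD_Hom b'.JD_Hom])+
  show "mcomp ?t1 (p + q) **\<^bsub>D\<^esub> b.JD p q = b'.JD p q **\<^bsub>D\<^esub> hD p q"
  proof (cases p rule: b.int_cases_nat)
   case neg
   then show ?thesis using D.is_zero_Hom_eq[OF disjI1[OF b.zero_ED]] H' by metis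
  next
   case (nat n)
   show ?thesis
   proof (rule ntr_eqI[OF H'])
    fix X assume X: "X : Obj C"
    show "ncomp (mcomp ?t1 (p + q) **\<^bsub>D\<^esub> b.JD p q) X = ncomp (b'.JD p q **\<^bsub>D\<^esub> hD p q) X"
    unfolding mt unfolding nat b.JD_nat b'.JD_nat hD_nat using X tf_facts(2)[OF X, of n q "int n + q"] by simp
   qed
  qed
 qed
 from D.cone_total_acyclic[OF this \<Gamma> cone] show ?thesis using tm(1) by (simp add: weqs_def)
qed

end

section \<open>Localization\<close>

locale localization = category S for S :: "('o,'a,'z) cat_scheme" (structure) +
 fixes W
 assumes W: "W \<subseteq> Arr S"
begin

abbreviation Lo where "Lo \<equiv> Loc S W"
abbreviation path where "path \<equiv> zz_path S W"
abbreviation eqv where "eqv \<equiv> zz_eq S W"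
abbreviation pc where "pc X Y p \<equiv> (X, Y, zz_class S W X Y p)"

lemma W_Arr [simp]: "w \<in> W ==> w : Arr S"
 using W by blast

lemma path_Obj: "path X p Y ==> X : Obj S & Y : Obj S"
proof (induction p arbitrary: X)
 case (Cons s p)
 then show ?case using W by (cases s) (auto intro: Dom_Obj Cod_Obj)
qed simp

lemma path_append: "path X (p @ q) Z \<longleftrightarrow> (EX Y. path X p Y & path Y q Z)"
proof (induction p arbitrary: X)
 case Nil
 then show ?case using path_Obj by auto
next
 case (Cons s p)
 then show ?case by (cases s) auto
qed

lemma eqv_path: "eqv X Y p q ==> path X p Y & path X q Y"
 by (induction rule: zz_eq.induct) (auto simp: path_append)

lemma eqv_append:
 assumes "eqv X Y p q" "path X' r X" "path Y s Y'"
 shows "eqv X' Y' (r @ p @ s) (r @ q @ s)"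
 using assms
proof (induction rule: zz_eq.induct)
 case (refl p)
 then show ?case by (intro zz_eq.refl) (auto simp: path_append)
next
 case (comp p f g q)
 then have "path X' ((r @ p) @ [Fwd f, Fwd g] @ (q @ s)) Y'" by (fastforce simp: path_append)
 from zz_eq.comp[OF this] show ?case by simp
next
 case (ident Z p q)
 then have "path X' ((r @ p) @ [Fwd (Idt S Z)] @ (q @ s)) Y'" by (fastforce simp: path_append)
 from zz_eq.ident[OF ident(1) this] show ?case by simp
next
 case (fwd_bwd p w q)
 then have "path X' ((r @ p) @ [Fwd w, Bwd w] @ (q @ s)) Y'" by (fastforce simp: path_append)
 from zz_eq.fwd_bwd[OF this] show ?case by simp
next
 case (bwd_fwd p w q)
 then have "path X' ((r @ p) @ [Bwd w, Fwd w] @ (q @ s)) Y'" by (fastforce simp: path_append)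
 from zz_eq.bwd_fwd[OF this] show ?case by simp
next
 case (sym p q)
 then show ?case by (blast intro: zz_eq.sym)
next
 case (trans p q r)
 then show ?case by (blast intro: zz_eq.trans)
qed

lemma class_eq: "path X p Y ==> zz_class S W X Y p = zz_class S W X Y q \<longleftrightarrow> eqv X Y p q"
proof
 assume "path X p Y" "zz_class S W X Y p = zz_class S W X Y q"
 then have "p \<in> zz_class S W X Y q" by (auto simp: zz_class_def intro: zz_eq.refl)
 then show "eqv X Y p q" by (simp add: zz_class_def zz_eq.sym)
next
 assume "eqv X Y p q"
 then show "zz_class S W X Y p = zz_class S W X Y q"
  unfolding zz_class_def by (blast intro: zz_eq.sym zz_eq.trans)
qed

lemma class_eqI: "eqv X Y p q ==> zz_class S W X Y p = zz_class S W X Y q"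
 using class_eq eqv_path by blast

lemma Hom_Loc: "f : Hom Lo X Y \<longleftrightarrow> (EX p. f = pc X Y p & path X p Y)"
 by (auto simp: Hom_def Loc_def)

text \<open>Composition in \<open>Loc\<close> is a union over all representatives; it is a single
  class because equivalence of paths is stable under adding letters on either side.\<close>

lemma Comp_pc:
 assumes "path X p Y" "path Y q Z"
 shows "pc Y Z q **\<^bsub>Lo\<^esub> pc X Y p = pc X Z (p @ q)"
proof -
 have "zz_class S W X Z (p' @ q') = zz_class S W X Z (p @ q)" if "p' \<in> zz_class S W X Y p" "q' \<in> zz_class S W Y Z q" for p' q'
 proof -
  have e: "eqv X Y p p'" "eqv Y Z q q'" using that by (simp_all add: zz_class_def)
  have pp: "path X p' Y" "path X [] X" "path Z [] Z" using eqv_path[OF e(1)] assms path_Obj by auto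
  have "eqv X Z ([] @ p @ q) ([] @ p' @ q)" by (rule eqv_append[OF e(1) pp(2) assms(2)])
  moreover have "eqv X Z (p' @ q @ []) (p' @ q' @ [])" by (rule eqv_append[OF e(2) pp(1,3)])
  ultimately have "eqv X Z (p @ q) (p' @ q')" by (simp, blast intro: zz_eq.trans)
  moreover have "path X (p @ q) Z" using assms by (auto simp: path_append)
  ultimately show ?thesis using class_eq by blast
 qed
 moreover have "p \<in> zz_class S W X Y p" "q \<in> zz_class S W Y Z q" using assms by (simp_all add: zz_class_def zz_eq.refl)
 ultimately have "(\<Union>p'\<in>zz_class S W X Y p. \<Union>q'\<in>zz_class S W Y Z q. zz_class S W X Z (p' @ q')) = zz_class S W X Z (p @ q)"
  by blast
 then show ?thesis by (simp add: Loc_def)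
qed

lemma category_Loc: "category Lo"
proof
 fix f assume "f : Arr Lo" then show "Dom Lo f : Obj Lo" "Cod Lo f : Obj Lo" using path_Obj by (auto simp: Loc_def)
next
 fix X assume "X : Obj Lo"
 then show "Idt Lo X : Hom Lo X X" unfolding Hom_Loc by (intro exI[of _ "[]"]) (simp add: Loc_def)
next
 fix f X Y g Z assume "f : Hom Lo X Y" "g : Hom Lo Y Z"
 then obtain p q where p: "f = pc X Y p" "path X p Y" "g = pc Y Z q" "path Y q Z" unfolding Hom_Loc by blast
 show "g **\<^bsub>Lo\<^esub> f : Hom Lo X Z"
  unfolding p(1,3) Comp_pc[OF p(2,4)] Hom_Loc using p(2,4) by (intro exI[of _ "p @ q"]) (auto simp: path_append)
next
 fix f X Y assume "f : Hom Lo X Y"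
 then obtain p where p: "f = pc X Y p" "path X p Y" unfolding Hom_Loc by blast
 have i: "Idt Lo Z = pc Z Z []" for Z by (simp add: Loc_def)
 have n: "path X [] X" "path Y [] Y" using path_Obj[OF p(2)] by simp_all
 show "f **\<^bsub>Lo\<^esub> Idt Lo X = f" "Idt Lo Y **\<^bsub>Lo\<^esub> f = f"
  unfolding p(1) i Comp_pc[OF n(1) p(2)] Comp_pc[OF p(2) n(2)] by simp_all
next
 fix f X Y g Z h V assume "f : Hom Lo V X" "g : Hom Lo X Y" "h : Hom Lo Y Z"
 then obtain p q r where p: "f = pc V X p" "path V p X" "g = pc X Y q" "path X q Y" "h = pc Y Z r" "path Y r Z" unfolding Hom_Loc by blast
 have c: "path V (p @ q) Y" "path X (q @ r) Z" using p by (auto simp: path_append)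
 show "(h **\<^bsub>Lo\<^esub> g) **\<^bsub>Lo\<^esub> f = h **\<^bsub>Lo\<^esub> (g **\<^bsub>Lo\<^esub> f)"
  unfolding p(1,3,5) Comp_pc[OF p(4,6)] Comp_pc[OF p(2,4)] Comp_pc[OF p(2) c(2)] Comp_pc[OF c(1) p(6)] by simp
qed

sublocale Lo: category Lo by (rule category_Loc)

abbreviation loc where "loc \<equiv> loc_arr S W"

lemma path1: "f : Hom S X Y ==> path X [Fwd f] Y"
 by (auto simp: Hom_iff)

lemma loc_pc: "f : Hom S X Y ==> loc f = pc X Y [Fwd f]"
 by (auto simp: Hom_iff loc_arr_def)

lemma loc_Hom: "f : Hom S X Y ==> loc f : Hom Lo X Y"
 using Hom_Loc path1 loc_pc by metis

lemma loc_Comp: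
 assumes "f : Hom S X Y" "g : Hom S Y Z"
 shows "loc (g ** f) = loc g **\<^bsub>Lo\<^esub> loc f"
proof -
 have p: "path X ([] @ [Fwd f, Fwd g] @ []) Z" using assms by (auto simp: Hom_iff)
 then show ?thesis
  using class_eqI[OF zz_eq.comp[OF p]]
  unfolding loc_pc[OF assms(1)] loc_pc[OF assms(2)] loc_pc[OF Comp_Hom[OF assms]] Comp_pc[OF path1[OF assms(1)] path1[OF assms(2)]]
  by simp
qed

lemma loc_Idt:
 assumes "X : Obj S"
 shows "loc (Idt S X) = Idt Lo X"
proof -
 have p: "path X ([] @ [Fwd (Idt S X)] @ []) X" using assms by simp
 show ?thesis
  using class_eqI[OF zz_eq.ident[OF assms p]]
  unfolding loc_pc[OF Idt_Hom[OF assms]] by (simp add: Loc_def)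
qed

lemma loc_inverse:
 assumes "w \<in> W" "w : Hom S X Y"
 obtains v where "v : Hom Lo Y X" "v **\<^bsub>Lo\<^esub> loc w = Idt Lo X" "loc w **\<^bsub>Lo\<^esub> v = Idt Lo Y"
proof
 have w: "w : Arr S" "Dom S w = X" "Cod S w = Y" using assms(2) by (simp_all add: Hom_iff)
 have b: "path Y [Bwd w] X" using assms(1) w by auto
 have i: "Idt Lo Z = pc Z Z []" for Z by (simp add: Loc_def)
 show "pc Y X [Bwd w] : Hom Lo Y X" unfolding Hom_Loc using b by blast
 have p: "path X ([] @ [Fwd w, Bwd w] @ []) X" "path Y ([] @ [Bwd w, Fwd w] @ []) Y" using assms w by auto
 show "pc Y X [Bwd w] **\<^bsub>Lo\<^esub> loc w = Idt Lo X"
  unfolding loc_pc[OF assms(2)] Comp_pc[OF path1[OF assms(2)] b] i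
  using class_eqI[OF zz_eq.fwd_bwd[OF p(1)]] by simp
 show "loc w **\<^bsub>Lo\<^esub> pc Y X [Bwd w] = Idt Lo Y"
  unfolding loc_pc[OF assms(2)] Comp_pc[OF b path1[OF assms(2)]] i
  using class_eqI[OF zz_eq.bwd_fwd[OF p(2)]] by simp
qed

end

text \<open>An augmented endofunctor preserving \<open>W\<close> extends to paths, hence to the localization; its
 augmentation stays natural there.\<close>
locale augmented_localization = localization +
 fixes Bo Bm e
 assumes Bm_Hom: "f : Arr S ==> Bm f : Hom S (Bo (Dom S f)) (Bo (Cod S f))"
  and Bm_Idt: "X : Obj S ==> Bm (Idt S X) = Idt S (Bo X)"
  and Bm_Comp: "[|f : Hom S X Y; g : Hom S Y Z|] ==> Bm (g ** f) = Bm g ** Bm f"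
  and e_Hom: "X : Obj S ==> e X : Hom S (Bo X) X"
  and e_nat: "f : Arr S ==> e (Cod S f) ** Bm f = f ** e (Dom S f)"
  and Bm_W: "w \<in> W ==> Bm w \<in> W"
begin

lemma Bm_simps [simp]: "f : Arr S ==> Bm f : Arr S" "f : Arr S ==> Dom S (Bm f) = Bo (Dom S f)" "f : Arr S ==> Cod S (Bm f) = Bo (Cod S f)"
 "X : Obj S ==> Bo X : Obj S" "X : Obj S ==> e X : Arr S" "X : Obj S ==> Dom S (e X) = Bo X" "X : Obj S ==> Cod S (e X) = X"
 using Bm_Hom[of f] e_Hom[of X] Hom_Obj[OF e_Hom[of X]] by (simp_all add: Hom_iff)

abbreviation Bp where "Bp \<equiv> map (map_zz Bm)"

lemma Bp_path: "path X p Y ==> path (Bo X) (Bp p) (Bo Y)"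
proof (induction p arbitrary: X)
 case (Cons s p)
 then show ?case by (cases s) (auto simp: Bm_W)
qed simp

lemma Bp_eqv: "eqv X Y p q ==> eqv (Bo X) (Bo Y) (Bp p) (Bp q)"
proof (induction rule: zz_eq.induct)
 case (refl p)
 then show ?case using Bp_path by (blast intro: zz_eq.refl)
next
 case (comp p f g q)
 then have fg: "f : Hom S (Dom S f) (Cod S f)" "g : Hom S (Cod S f) (Cod S g)" by (auto simp: path_append Hom_iff)
 show ?case using zz_eq.comp[of S W "Bo X" "Bp p" "Bm f" "Bm g" "Bp q" "Bo Y"] Bp_path[OF comp] Bm_Comp[OF fg] by simp
next
 case (ident Z p q)
 then show ?case using zz_eq.ident[of "Bo Z" S W "Bo X" "Bp p" "Bp q" "Bo Y"] Bp_path[OF ident(2)] Bm_Idt[OF ident(1)] by simp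
next
 case (fwd_bwd p w q)
 then show ?case using zz_eq.fwd_bwd[of S W "Bo X" "Bp p" "Bm w" "Bp q" "Bo Y"] Bp_path[OF fwd_bwd] by simp
next
 case (bwd_fwd p w q)
 then show ?case using zz_eq.bwd_fwd[of S W "Bo X" "Bp p" "Bm w" "Bp q" "Bo Y"] Bp_path[OF bwd_fwd] by simp
next
 case (sym p q)
 then show ?case by (blast intro: zz_eq.sym)
next
 case (trans p q r)
 then show ?case by (blast intro: zz_eq.trans)
qed

text \<open>Induction along the path, so naturality has to be moved past one letter at a time. A
  forward letter is ordinary naturality; for a backward letter the naturality square of
  \<open>w\<close> is conjugated by the formal inverses.\<close>

lemma e_path: "path X p Y ==> eqv (Bo X) Y (Bp p @ [Fwd (e Y)]) (Fwd (e X) # p)"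
proof (induction p arbitrary: X)
 case Nil
 then show ?case by (auto intro!: zz_eq.refl)
next
 case (Cons s p)
 show ?case
 proof (cases s)
  case (Fwd f)
  let ?Z = "Cod S f"
  have f: "f : Arr S" "Dom S f = X" "path ?Z p Y" using Cons.prems Fwd by simp_all
  note O = path_Obj[OF Cons.prems] path_Obj[OF f(3)]
  have "eqv (Bo X) Y ([Fwd (Bm f)] @ (Bp p @ [Fwd (e Y)]) @ []) ([Fwd (Bm f)] @ (Fwd (e ?Z) # p) @ [])"
   by (rule eqv_append[OF Cons.IH[OF f(3)]]) (use f O in simp_all)
  moreover have "eqv (Bo X) Y ([] @ [Fwd (Bm f), Fwd (e ?Z)] @ p) ([] @ [Fwd (e ?Z ** Bm f)] @ p)"
   by (rule zz_eq.comp) (use f O in simp)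
  moreover have "eqv (Bo X) Y ([] @ [Fwd (e X), Fwd f] @ p) ([] @ [Fwd (f ** e X)] @ p)"
   by (rule zz_eq.comp) (use f O in simp)
  ultimately show ?thesis unfolding Fwd using e_nat[OF f(1)] f(2) by simp (meson zz_eq.sym zz_eq.trans)
 next
  case (Bwd w)
  let ?Z = "Dom S w"
  have w: "w \<in> W" "Cod S w = X" "path ?Z p Y" using Cons.prems Bwd by simp_all
  note O = path_Obj[OF Cons.prems] path_Obj[OF w(3)]
  note Bw = Bm_W[OF w(1)]
  have "eqv (Bo X) Y ([Bwd (Bm w)] @ (Bp p @ [Fwd (e Y)]) @ []) ([Bwd (Bm w)] @ (Fwd (e ?Z) # p) @ [])"
   by (rule eqv_append[OF Cons.IH[OF w(3)]]) (use w O Bw in simp_all)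
  \<comment> \<open>The pair \<open>Fwd w\<close>, \<open>Bwd w\<close> is inserted behind
    \<open>e ?Z\<close>, so that the naturality square of \<open>w\<close> can be used and then
    \<open>Bm w\<close> cancels against its inverse.\<close>
  moreover have "eqv (Bo X) Y ([Bwd (Bm w), Fwd (e ?Z)] @ [Fwd w, Bwd w] @ p) ([Bwd (Bm w), Fwd (e ?Z)] @ p)"
   by (rule zz_eq.fwd_bwd) (use w O Bw in simp)
  moreover have "eqv (Bo X) Y ([Bwd (Bm w)] @ [Fwd (e ?Z), Fwd w] @ Bwd w # p) ([Bwd (Bm w)] @ [Fwd (w ** e ?Z)] @ Bwd w # p)"
   by (rule zz_eq.comp) (use w O Bw in simp)
  moreover have "eqv (Bo X) Y ([Bwd (Bm w)] @ [Fwd (Bm w), Fwd (e X)] @ Bwd w # p) ([Bwd (Bm w)] @ [Fwd (e X ** Bm w)] @ Bwd w # p)"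
   by (rule zz_eq.comp) (use w O Bw in simp)
  moreover have "eqv (Bo X) Y ([] @ [Bwd (Bm w), Fwd (Bm w)] @ Fwd (e X) # Bwd w # p) ([] @ Fwd (e X) # Bwd w # p)"
   by (rule zz_eq.bwd_fwd) (use w O Bw in simp)
  ultimately show ?thesis unfolding Bwd using e_nat[OF W_Arr[OF w(1)]] w(2) by simp (meson zz_eq.sym zz_eq.trans)
 qed
qed

theorem unique_lift:
 assumes a: "a : Hom S K K0" "a' : Hom S L L0" and \<alpha>: "\<alpha> : Hom S K0 L0" "iso_arr S \<alpha>"
  and Ba: "Bm a \<in> W" "Bm a' \<in> W" and eW: "e K \<in> W" "e L \<in> W"
 shows "EX! f. iso_arr Lo f & f : Hom Lo K L & loc a' **\<^bsub>Lo\<^esub> f = loc \<alpha> **\<^bsub>Lo\<^esub> loc a"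
proof -
 have O: "K : Obj S" "L : Obj S" "K0 : Obj S" "L0 : Obj S" using a Hom_Obj by blast+
 obtain \<beta> where \<beta>: "\<beta> : Hom S L0 K0" "\<beta> ** \<alpha> = Idt S K0" "\<alpha> ** \<beta> = Idt S L0"
  using \<alpha> unfolding iso_arr_def by (auto simp: Hom_iff)
 have BH: "Bm f : Hom S (Bo X) (Bo Y)" if "f : Hom S X Y" for f X Y using Bm_Hom[of f] that by (simp add: Hom_iff)
 obtain ia where ia: "ia : Hom Lo (Bo K0) (Bo K)" "ia **\<^bsub>Lo\<^esub> loc (Bm a) = Idt Lo (Bo K)" "loc (Bm a) **\<^bsub>Lo\<^esub> ia = Idt Lo (Bo K0)"
  using loc_inverse[OF Ba(1) BH[OF a(1)]] .
 obtain ia' where ia': "ia' : Hom Lo (Bo L0) (Bo L)" "ia' **\<^bsub>Lo\<^esub> loc (Bm a') = Idt Lo (Bo L)" "loc (Bm a') **\<^bsub>Lo\<^esub> ia' = Idt Lo (Bo L0)"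
  using loc_inverse[OF Ba(2) BH[OF a(2)]] .
 obtain ik where ik: "ik : Hom Lo K (Bo K)" "ik **\<^bsub>Lo\<^esub> loc (e K) = Idt Lo (Bo K)" "loc (e K) **\<^bsub>Lo\<^esub> ik = Idt Lo K"
  using loc_inverse[OF eW(1) e_Hom[OF O(1)]] .
 obtain il where il: "il : Hom Lo L (Bo L)" "il **\<^bsub>Lo\<^esub> loc (e L) = Idt Lo (Bo L)" "loc (e L) **\<^bsub>Lo\<^esub> il = Idt Lo L"
  using loc_inverse[OF eW(2) e_Hom[OF O(2)]] .
 note H = loc_Hom[OF BH[OF a(1)]] loc_Hom[OF BH[OF a(2)]] loc_Hom[OF BH[OF \<alpha>(1)]] loc_Hom[OF BH[OF \<beta>(1)]]
  loc_Hom[OF e_Hom[OF O(1)]] loc_Hom[OF e_Hom[OF O(2)]] loc_Hom[OF e_Hom[OF O(3)]] loc_Hom[OF e_Hom[OF O(4)]]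
  loc_Hom[OF a(1)] loc_Hom[OF a(2)] loc_Hom[OF \<alpha>(1)] ia(1) ia'(1) ik(1) il(1)
 note [simp] = H[unfolded Hom_iff]
 have LO: "Obj Lo = Obj S" by (simp add: Loc_def)
 have nat: "loc (e Y) **\<^bsub>Lo\<^esub> loc (Bm f) = loc f **\<^bsub>Lo\<^esub> loc (e X)" if "f : Hom S X Y" for f X Y
  using loc_Comp[OF BH[OF that] e_Hom[OF Hom_Obj(2)[OF that]]] loc_Comp[OF e_Hom[OF Hom_Obj(1)[OF that]] that] e_nat[of f] that
  by (simp add: Hom_iff)
 \<comment> \<open>The value that the extension of \<open>Bm\<close> must take on any lift, since
   \<open>Bm a'\<close> is inverted by \<open>ia'\<close>.\<close>
 define F where "F = ia' **\<^bsub>Lo\<^esub> (loc (Bm \<alpha>) **\<^bsub>Lo\<^esub> loc (Bm a))"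
 define f where "f = loc (e L) **\<^bsub>Lo\<^esub> (F **\<^bsub>Lo\<^esub> ik)"
 have F: "F : Arr Lo" "Dom Lo F = Bo K" "Cod Lo F = Bo L" by (simp_all add: F_def)
 have f: "f : Hom Lo K L" using F by (simp add: f_def Hom_iff)
 have lift: "loc a' **\<^bsub>Lo\<^esub> f = loc \<alpha> **\<^bsub>Lo\<^esub> loc a"
 proof -
  have "loc a' **\<^bsub>Lo\<^esub> f = (loc (e L0) **\<^bsub>Lo\<^esub> loc (Bm a')) **\<^bsub>Lo\<^esub> (F **\<^bsub>Lo\<^esub> ik)"
   unfolding nat[OF a(2)] f_def using F by simp
  also have "... = loc (e L0) **\<^bsub>Lo\<^esub> ((loc (Bm a') **\<^bsub>Lo\<^esub> ia') **\<^bsub>Lo\<^esub> (loc (Bm \<alpha>) **\<^bsub>Lo\<^esub> (loc (Bm a) **\<^bsub>Lo\<^esub> ik)))"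
   unfolding F_def by simp
  also have "... = (loc (e L0) **\<^bsub>Lo\<^esub> loc (Bm \<alpha>)) **\<^bsub>Lo\<^esub> (loc (Bm a) **\<^bsub>Lo\<^esub> ik)"
   unfolding ia'(3) by simp
  also have "... = loc \<alpha> **\<^bsub>Lo\<^esub> ((loc (e K0) **\<^bsub>Lo\<^esub> loc (Bm a)) **\<^bsub>Lo\<^esub> ik)"
   unfolding nat[OF \<alpha>(1)] by simp
  also have "... = loc \<alpha> **\<^bsub>Lo\<^esub> (loc a **\<^bsub>Lo\<^esub> (loc (e K) **\<^bsub>Lo\<^esub> ik))"
   unfolding nat[OF a(1)] by simp
  finally show ?thesis unfolding ik(3) by simp
 qed
 have iso: "iso_arr Lo f"
 proof -
  define F' where "F' = ia **\<^bsub>Lo\<^esub> (loc (Bm \<beta>) **\<^bsub>Lo\<^esub> loc (Bm a'))"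
  have F': "F' : Arr Lo" "Dom Lo F' = Bo L" "Cod Lo F' = Bo K" by (simp_all add: F'_def)
  have b: "loc (Bm \<beta>) **\<^bsub>Lo\<^esub> loc (Bm \<alpha>) = Idt Lo (Bo K0)" "loc (Bm \<alpha>) **\<^bsub>Lo\<^esub> loc (Bm \<beta>) = Idt Lo (Bo L0)"
   using loc_Comp[OF BH[OF \<alpha>(1)] BH[OF \<beta>(1)]] loc_Comp[OF BH[OF \<beta>(1)] BH[OF \<alpha>(1)]] Bm_Comp[OF \<alpha>(1) \<beta>(1)] Bm_Comp[OF \<beta>(1) \<alpha>(1)] \<beta>(2,3)
    Bm_Idt[OF O(3)] Bm_Idt[OF O(4)] loc_Idt[of "Bo K0"] loc_Idt[of "Bo L0"] O by simp_all
  have "F' **\<^bsub>Lo\<^esub> F = ia **\<^bsub>Lo\<^esub> (loc (Bm \<beta>) **\<^bsub>Lo\<^esub> ((loc (Bm a') **\<^bsub>Lo\<^esub> ia') **\<^bsub>Lo\<^esub> (loc (Bm \<alpha>) **\<^bsub>Lo\<^esub> loc (Bm a))))"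
   unfolding F_def F'_def by simp
  also have "... = ia **\<^bsub>Lo\<^esub> ((loc (Bm \<beta>) **\<^bsub>Lo\<^esub> loc (Bm \<alpha>)) **\<^bsub>Lo\<^esub> loc (Bm a))" unfolding ia'(3) by simp
  finally have F'F: "F' **\<^bsub>Lo\<^esub> F = Idt Lo (Bo K)" unfolding b(1) using ia(2) by simp
  have "F **\<^bsub>Lo\<^esub> F' = ia' **\<^bsub>Lo\<^esub> (loc (Bm \<alpha>) **\<^bsub>Lo\<^esub> ((loc (Bm a) **\<^bsub>Lo\<^esub> ia) **\<^bsub>Lo\<^esub> (loc (Bm \<beta>) **\<^bsub>Lo\<^esub> loc (Bm a'))))"
   unfolding F_def F'_def by simp
  also have "... = ia' **\<^bsub>Lo\<^esub> ((loc (Bm \<alpha>) **\<^bsub>Lo\<^esub> loc (Bm \<beta>)) **\<^bsub>Lo\<^esub> loc (Bm a'))" unfolding ia(3) by simp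
  finally have FF': "F **\<^bsub>Lo\<^esub> F' = Idt Lo (Bo L)" unfolding b(2) using ia'(2) by simp
  define g where "g = loc (e K) **\<^bsub>Lo\<^esub> (F' **\<^bsub>Lo\<^esub> il)"
  have g: "g : Hom Lo L K" using F' by (simp add: g_def Hom_iff)
  have "g **\<^bsub>Lo\<^esub> f = loc (e K) **\<^bsub>Lo\<^esub> (F' **\<^bsub>Lo\<^esub> ((il **\<^bsub>Lo\<^esub> loc (e L)) **\<^bsub>Lo\<^esub> (F **\<^bsub>Lo\<^esub> ik)))"
   unfolding f_def g_def using F F' by simp
  also have "... = loc (e K) **\<^bsub>Lo\<^esub> ((F' **\<^bsub>Lo\<^esub> F) **\<^bsub>Lo\<^esub> ik)" unfolding il(2) using F F' by simp
  finally have gf: "g **\<^bsub>Lo\<^esub> f = Idt Lo K" unfolding F'F using ik(3) by simp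
  have "f **\<^bsub>Lo\<^esub> g = loc (e L) **\<^bsub>Lo\<^esub> (F **\<^bsub>Lo\<^esub> ((ik **\<^bsub>Lo\<^esub> loc (e K)) **\<^bsub>Lo\<^esub> (F' **\<^bsub>Lo\<^esub> il)))"
   unfolding f_def g_def using F F' by simp
  also have "... = loc (e L) **\<^bsub>Lo\<^esub> ((F **\<^bsub>Lo\<^esub> F') **\<^bsub>Lo\<^esub> il)" unfolding ik(2) using F F' by simp
  finally have fg: "f **\<^bsub>Lo\<^esub> g = Idt Lo L" unfolding FF' using il(3) by simp
  show ?thesis unfolding iso_arr_def using f g gf fg by (auto simp: Hom_iff)
 qed
 have uniq: "h = f" if h: "h : Hom Lo K L" "loc a' **\<^bsub>Lo\<^esub> h = loc \<alpha> **\<^bsub>Lo\<^esub> loc a" for h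
 proof -
  obtain p where p: "h = pc K L p" "path K p L" using h(1) unfolding Hom_Loc by blast
  \<comment> \<open>The extension of \<open>Bm\<close> to the localization, evaluated at
    \<open>h\<close> through a path representing it.\<close>
  define H where "H = pc (Bo K) (Bo L) (Bp p)"
  have HH: "H : Hom Lo (Bo K) (Bo L)" unfolding Hom_Loc H_def using Bp_path[OF p(2)] by blast
  have pe: "path (Bo L) [Fwd (e L)] L" "path (Bo K) [Fwd (e K)] K" using O by simp_all
  have 1: "loc (e L) **\<^bsub>Lo\<^esub> H = h **\<^bsub>Lo\<^esub> loc (e K)"
  proof -
   show ?thesis
    unfolding H_def p(1) loc_pc[OF e_Hom[OF O(1)]] loc_pc[OF e_Hom[OF O(2)]] Comp_pc[OF Bp_path[OF p(2)] pe(1)] Comp_pc[OF pe(2) p(2)]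
    using class_eqI[OF e_path[OF p(2)]] by simp
  qed
  have 2: "loc (Bm a') **\<^bsub>Lo\<^esub> H = loc (Bm \<alpha>) **\<^bsub>Lo\<^esub> loc (Bm a)"
  proof -
   \<comment> \<open>The lifting equation is an equality of classes; it is turned into an
     equivalence of paths so that \<open>Bp_eqv\<close> can carry it over.\<close>
   have q: "path K (p @ [Fwd a']) L0" using p(2) path1[OF a(2)] path_append by blast
   have "zz_class S W K L0 (p @ [Fwd a']) = zz_class S W K L0 ([Fwd a] @ [Fwd \<alpha>])"
    using h(2) unfolding p(1) loc_pc[OF a(1)] loc_pc[OF a(2)] loc_pc[OF \<alpha>(1)] Comp_pc[OF p(2) path1[OF a(2)]] Comp_pc[OF path1[OF a(1)] path1[OF \<alpha>(1)]]
    by simp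
   then have "eqv K L0 (p @ [Fwd a']) [Fwd a, Fwd \<alpha>]" using class_eq[OF q] by simp
   from Bp_eqv[OF this] have e: "eqv (Bo K) (Bo L0) (Bp p @ [Fwd (Bm a')]) ([Fwd (Bm a)] @ [Fwd (Bm \<alpha>)])" by simp
   show ?thesis
    unfolding H_def loc_pc[OF BH[OF a(1)]] loc_pc[OF BH[OF a(2)]] loc_pc[OF BH[OF \<alpha>(1)]]
    Comp_pc[OF Bp_path[OF p(2)] path1[OF BH[OF a(2)]]] Comp_pc[OF path1[OF BH[OF a(1)]] path1[OF BH[OF \<alpha>(1)]]]
    using class_eqI[OF e] by simp
  qed
  have hh: "h : Arr Lo" "Dom Lo h = K" "Cod Lo h = L" "H : Arr Lo" "Dom Lo H = Bo K" "Cod Lo H = Bo L" using h(1) HH by (simp_all add: Hom_iff)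
  have "H = (ia' **\<^bsub>Lo\<^esub> loc (Bm a')) **\<^bsub>Lo\<^esub> H" unfolding ia'(2) using hh by simp
  also have "... = F" unfolding F_def 2[symmetric] using hh by simp
  finally have HF: "H = F" .
  have "h = h **\<^bsub>Lo\<^esub> (loc (e K) **\<^bsub>Lo\<^esub> ik)" unfolding ik(3) using hh by simp
  also have "... = (loc (e L) **\<^bsub>Lo\<^esub> H) **\<^bsub>Lo\<^esub> ik" unfolding 1 using hh by simp
  finally show ?thesis unfolding HF f_def using F by simp
 qed
 show ?thesis using f lift iso uniq by blast
qed

end

section \<open>The standard construction\<close>

locale standard_construction = monoidal_functors C MC A MA
 for C :: "('o,'a,'y) cat_scheme" and MC and A :: "('p,'b,'z) acat_scheme" (structure) and MA +
 fixes \<Gamma> G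
 assumes \<Gamma>: "acyclic_class (FunA C A) \<Gamma>"
  and cotriple: "is_cotriple (SyMonCh C MC A MA) G"
  and bar_bounded: "!!F. F : Obj (SyMonCh C MC A MA) ==> simp_unif_bounded C A (bar G F)"
  and compatible: "fa (ctF G) ` weqs C MC A MA \<Gamma> \<subseteq> weqs C MC A MA \<Gamma>"
begin

sublocale G: cotriple_category "SyMonCh C MC A MA" G
 by (rule cotriple_category.intro[OF category_S cotriple_category_axioms.intro[OF cotriple]])

abbreviation Wq where "Wq \<equiv> weqs C MC A MA \<Gamma>"
abbreviation jb where "jb F X p q \<equiv> inj2 A (sEM_d A (bar G F) X) (int p) q"

lemma sob_bar: "sob (bar G F) p = (G.Go ^^ Suc p) F"
 by (simp add: bar_def)

lemma simplicial_functors_bar: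
 assumes "F : Obj S"
 shows "simplicial_functors C MC A MA (bar G F) (G.bar_opr F)"
 using monoidal_functors_axioms G.simplicial_bar[OF assms] simplicial_functors_axioms.intro[OF bar_bounded[OF assms]]
 by (rule simplicial_functors.intro)

lemma simplicial_map_bar:
 assumes f: "f : Arr S"
 shows "simplicial_map C MC A MA (bar G (mtdom f)) (G.bar_opr (mtdom f)) (bar G (mtcod f)) (G.bar_opr (mtcod f)) (%p. (G.Ga ^^ Suc p) f)"
proof -
 have O: "mtdom f : Obj S" "mtcod f : Obj S" using f Arr_S by blast+
 show ?thesis
 proof (intro simplicial_map.intro monoidal_functors_axioms simplicial_functors_bar O simplicial_map_axioms.intro)
  show "(G.Ga ^^ Suc p) f : Hom S (sob (bar G (mtdom f)) p) (sob (bar G (mtcod f)) p)" for p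
   unfolding sob_bar Hom_iff using G.Gpow_simps(2-4)[OF f, of "Suc p"] by simp
  show "(G.Ga ^^ Suc m) f **\<^bsub>S\<^esub> G.bar_opr (mtdom f) n m sg = G.bar_opr (mtcod f) n m sg **\<^bsub>S\<^esub> (G.Ga ^^ Suc n) f" if "smono m n sg" for m n sg
   using G.bar_opr_nat[OF f that] by simp
 qed
qed

definition Bo where "Bo F = sEM C MC A MA (bar G F)"

text \<open>This is \<open>tmap\<close> for the simplicial map of the powers of \<open>f\<close>,
  written out so that it is defined for all arrows simultaneously.\<close>

definition Bm where
 "Bm f = \<lparr>mtdom = Bo (mtdom f), mtcod = Bo (mtcod f), mtcomp = (\<lambda>X \<in> Obj C.
   tot_map A (sEM_d A (bar G (mtdom f)) X) (sEM_d A (bar G (mtcod f)) X) (%p q. mcomp (mtcomp ((G.Ga ^^ Suc p) f) X) q))\<rparr>"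

lemma jb_simps [simp]:
 assumes "F : Obj S" "X : Obj C"
 shows "jb F X p q : Arr A" "Dom A (jb F X p q) = cob (fo (sfun ((G.Go ^^ Suc p) F)) X) q"
  "Cod A (jb F X p q) = cob (fo (sfun (Bo F)) X) (int p + q)"
proof -
 interpret s: simplicial_functors C MC A MA "bar G F" "G.bar_opr F" by (rule simplicial_functors_bar[OF assms(1)])
 show "jb F X p q : Arr A" "Dom A (jb F X p q) = cob (fo (sfun ((G.Go ^^ Suc p) F)) X) q"
  "Cod A (jb F X p q) = cob (fo (sfun (Bo F)) X) (int p + q)"
  using s.jn_simps[OF assms(2)] s.fo_R[OF assms(2)] by (simp_all only: sob_bar Bo_def)
qed

lemma Bo_eqI:
 assumes F: "F : Obj S" and u: "u : Hom S (Bo F) H" "v : Hom S (Bo F) H"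
  and e: "!!X p q n. [|X : Obj C; int p + q = n|] ==> mcomp (mtcomp u X) n ** jb F X p q = mcomp (mtcomp v X) n ** jb F X p q"
 shows "u = v"
proof -
 interpret s: simplicial_functors C MC A MA "bar G F" "G.bar_opr F" by (rule simplicial_functors_bar[OF F])
 have uv: "u : Arr S" "v : Arr S" "mtdom u = Bo F" "mtcod u = H" "mtdom v = Bo F" "mtcod v = H" using u by (simp_all add: Hom_iff)
 show ?thesis
 proof (rule mnt_eqI)
  fix X n assume X: "X : Obj C"
  show "mcomp (mtcomp u X) n = mcomp (mtcomp v X) n"
  proof (rule s.T_eqI[OF X])
   show "mcomp (mtcomp u X) n : Hom A (cob (s.T X) n) (cob (fo (sfun H) X) n)" "mcomp (mtcomp v X) n : Hom A (cob (s.T X) n) (cob (fo (sfun H) X) n)"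
    using Arr_S_simps(5-7)[OF uv(1) X] Arr_S_simps(5-7)[OF uv(2) X] s.fo_R[OF X] unfolding uv Bo_def by (simp_all add: Hom_iff)
  qed (rule e[OF X])
 qed (use uv in simp_all)
qed

lemma Bm_facts:
 assumes f: "f : Arr S"
 shows "Bm f : Hom S (Bo (mtdom f)) (Bo (mtcod f))"
  "[|X : Obj C; int p + q = n|] ==> mcomp (mtcomp (Bm f) X) n ** jb (mtdom f) X p q = jb (mtcod f) X p q ** mcomp (mtcomp ((G.Ga ^^ Suc p) f) X) q"
  "G.Ga f \<in> Wq ==> Bm f \<in> Wq"
proof -
 interpret m: simplicial_map C MC A MA "bar G (mtdom f)" "G.bar_opr (mtdom f)" "bar G (mtcod f)" "G.bar_opr (mtcod f)" "%p. (G.Ga ^^ Suc p) f"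
  by (rule simplicial_map_bar[OF f])
 have t: "m.tmap = Bm f" unfolding m.tmap_def Bm_def Bo_def ..
 show "Bm f : Hom S (Bo (mtdom f)) (Bo (mtcod f))" using m.tmap_Hom unfolding t Bo_def .
 show "[|X : Obj C; int p + q = n|] ==> mcomp (mtcomp (Bm f) X) n ** jb (mtdom f) X p q = jb (mtcod f) X p q ** mcomp (mtcomp ((G.Ga ^^ Suc p) f) X) q"
  using m.tf_facts(2)[of X p q n] unfolding t .
 assume w: "G.Ga f \<in> Wq"
 have "(G.Ga ^^ Suc n) f \<in> Wq" for n
 proof (induction n)
  case (Suc n)
  then show ?case using compatible by auto
 qed (use w in simp)
 from m.tmap_weq[OF \<Gamma> this] show "Bm f \<in> Wq" unfolding t .
qed

lemma Bm_simps [simp]: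
 assumes "f : Arr S"
 shows "Bm f : Arr S" "mtdom (Bm f) = Bo (mtdom f)" "mtcod (Bm f) = Bo (mtcod f)"
 using Bm_facts(1)[OF assms] by (simp_all add: Hom_iff)

lemma Bm_Idt:
 assumes F: "F : Obj S"
 shows "Bm (Idt S F) = Idt S (Bo F)"
proof -
 have O: "Bo F : Obj S" using Bm_facts(1)[OF G.Idt_simps(1)[OF F]] G.Hom_Obj by auto
 show ?thesis
 proof (rule Bo_eqI[OF F])
  show "Bm (Idt S F) : Hom S (Bo F) (Bo F)" using Bm_facts(1)[OF G.Idt_simps(1)[OF F]] by simp
  show "Idt S (Bo F) : Hom S (Bo F) (Bo F)" by (rule G.Idt_Hom[OF O])
  fix X p q n assume X: "X : Obj C" and n: "int p + q = n"
  have "(G.Ga ^^ Suc p) (Idt S F) = Idt S ((G.Go ^^ Suc p) F)" by (rule G.Gpow_simps(5)[OF F])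
  then have "mcomp (mtcomp (Bm (Idt S F)) X) n ** jb F X p q = jb F X p q ** Idt A (cob (fo (sfun ((G.Go ^^ Suc p) F)) X) q)"
   using Bm_facts(2)[OF G.Idt_simps(1)[OF F] X n] X by (simp del: funpow.simps)
  then show "mcomp (mtcomp (Bm (Idt S F)) X) n ** jb F X p q = mcomp (mtcomp (Idt S (Bo F)) X) n ** jb F X p q"
   using X F n by (simp del: funpow.simps)
 qed
qed

lemma Bm_Comp:
 assumes "f : Hom S F H" "g : Hom S H J"
 shows "Bm (g **\<^bsub>S\<^esub> f) = Bm g **\<^bsub>S\<^esub> Bm f" (is "?L = ?R")
proof -
 have a: "f : Arr S" "g : Arr S" "mtdom f = F" "mtcod f = H" "mtdom g = H" "mtcod g = J" using assms by (simp_all add: Hom_iff)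
 have O: "F : Obj S" "H : Obj S" "J : Obj S" using assms G.Hom_Obj by blast+
 have gf: "g **\<^bsub>S\<^esub> f : Arr S" using a by simp
 have h: "Bm f : Hom S (Bo F) (Bo H)" "Bm g : Hom S (Bo H) (Bo J)" using Bm_facts(1)[OF a(1)] Bm_facts(1)[OF a(2)] a by simp_all
 show ?thesis
 proof (rule Bo_eqI[OF O(1)])
  show "Bm (g **\<^bsub>S\<^esub> f) : Hom S (Bo F) (Bo J)" using Bm_facts(1)[OF gf] a by simp
  show "Bm g **\<^bsub>S\<^esub> Bm f : Hom S (Bo F) (Bo J)" by (rule G.Comp_Hom[OF h])
  fix X p q n assume X: "X : Obj C" and n: "int p + q = n"
  let ?f = "mcomp (mtcomp ((G.Ga ^^ Suc p) f) X) q" and ?g = "mcomp (mtcomp ((G.Ga ^^ Suc p) g) X) q"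
  have ga: "(G.Ga ^^ Suc p) f : Arr S" "(G.Ga ^^ Suc p) g : Arr S" "mtdom ((G.Ga ^^ Suc p) f) = (G.Go ^^ Suc p) F" "mtcod ((G.Ga ^^ Suc p) f) = (G.Go ^^ Suc p) H"
   "mtdom ((G.Ga ^^ Suc p) g) = (G.Go ^^ Suc p) H" "mtcod ((G.Ga ^^ Suc p) g) = (G.Go ^^ Suc p) J"
   using G.Gpow_simps(2-4)[OF a(1), of "Suc p"] G.Gpow_simps(2-4)[OF a(2), of "Suc p"] unfolding S_simps(1,2) a(3-6) by blast+
  note fs = Arr_S_simps(5-7)[OF ga(1) X, unfolded ga(3,4)] Arr_S_simps(5-7)[OF ga(2) X, unfolded ga(5,6)]
  have c: "(G.Ga ^^ Suc p) (g **\<^bsub>S\<^esub> f) = (G.Ga ^^ Suc p) g **\<^bsub>S\<^esub> (G.Ga ^^ Suc p) f"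
   by (rule G.Gpow_simps(6)) (use a in simp_all)
  note Bs = Arr_S_simps(5-7)[OF Bm_simps(1)[OF a(1)] X, unfolded Bm_simps(2,3)[OF a(1)] a] Arr_S_simps(5-7)[OF Bm_simps(1)[OF a(2)] X, unfolded Bm_simps(2,3)[OF a(2)] a]
  have 1: "mcomp (mtcomp (Bm f) X) n ** jb F X p q = jb H X p q ** ?f" "mcomp (mtcomp (Bm g) X) n ** jb H X p q = jb J X p q ** ?g"
   using Bm_facts(2)[OF a(1) X n] Bm_facts(2)[OF a(2) X n] unfolding a .
  have "mcomp (mtcomp ?L X) n ** jb F X p q = jb J X p q ** (?g ** ?f)"
   using Bm_facts(2)[OF gf X n] X unfolding c by (simp add: a del: funpow.simps)
  moreover have "mcomp (mtcomp (Bm g) X) n ** (jb H X p q ** ?f) = (jb J X p q ** ?g) ** ?f"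
   by (rule Comp_reassoc[OF 1(2)]) (use X O n fs Bs in "simp_all del: funpow.simps")
  ultimately show "mcomp (mtcomp ?L X) n ** jb F X p q = mcomp (mtcomp ?R X) n ** jb F X p q"
   using X O n fs Bs 1(1) by (simp del: funpow.simps)
 qed
qed

abbreviation e where "e F \<equiv> bar_aug C MC A MA G F"

lemma e_facts:
 assumes F: "F : Obj S"
 shows "e F : Hom S (Bo F) F"
  "[|X : Obj C; int p + q = n|] ==> mcomp (mtcomp (e F) X) n ** jb F X p q
   = (if p = 0 then mcomp (mtcomp (cte G F) X) q else Zer A (cob (fo (sfun ((G.Go ^^ Suc p) F)) X) q) (cob (fo (sfun F) X) n))"
proof -
 have c: "cte G F : Hom S (G.Go F) F" "cte G (G.Go F) : Hom S (G.Go (G.Go F)) (G.Go F)"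
  using cotriple F G.Gpow_simps(1)[OF F, of 1] by (simp_all add: is_cotriple_def Let_def)
 \<comment> \<open>The counit coequalizes the two faces of the standard construction by its own
   naturality, applied to the arrow \<open>cte G F\<close>.\<close>
 have n: "cte G F **\<^bsub>S\<^esub> G.Ga (cte G F) = cte G F **\<^bsub>S\<^esub> cte G (G.Go F)"
  using cotriple c(1) unfolding is_cotriple_def Let_def Hom_iff by metis
 have "augmented_simplicial C MC A MA (bar G F) (G.bar_opr F) F (cte G F)"
  by (intro augmented_simplicial.intro simplicial_functors_bar[OF F] augmented_simplicial_axioms.intro)
   (use c n in "simp_all add: bar_def")
 then interpret a: augmented_simplicial C MC A MA "bar G F" "G.bar_opr F" F "cte G F" .
 have ea: "a.aug_map = e F" unfolding a.aug_map_def bar_aug_def ..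
 show "e F : Hom S (Bo F) F" using a.aug_map_Hom unfolding ea Bo_def .
 show "[|X : Obj C; int p + q = n|] ==> mcomp (mtcomp (e F) X) n ** jb F X p q
   = (if p = 0 then mcomp (mtcomp (cte G F) X) q else Zer A (cob (fo (sfun ((G.Go ^^ Suc p) F)) X) q) (cob (fo (sfun F) X) n))"
  using a.ae_jn[of X p q n] unfolding ea sob_bar .
qed

lemma e_nat:
 assumes f: "f : Arr S"
 shows "e (mtcod f) **\<^bsub>S\<^esub> Bm f = f **\<^bsub>S\<^esub> e (mtdom f)"
proof -
 let ?F = "mtdom f" and ?H = "mtcod f"
 have O: "?F : Obj S" "?H : Obj S" using f Arr_S by blast+
 note eF = e_facts[OF O(1)] and eH = e_facts[OF O(2)]
 have eA: "e ?F : Arr S" "mtdom (e ?F) = Bo ?F" "mtcod (e ?F) = ?F" "e ?H : Arr S" "mtdom (e ?H) = Bo ?H" "mtcod (e ?H) = ?H"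
  using eF(1) eH(1) by (simp_all add: Hom_iff)
 show ?thesis
 proof (rule Bo_eqI[OF O(1)])
  show "e ?H **\<^bsub>S\<^esub> Bm f : Hom S (Bo ?F) ?H" by (rule G.Comp_Hom[OF Bm_facts(1)[OF f] eH(1)])
  show "f **\<^bsub>S\<^esub> e ?F : Hom S (Bo ?F) ?H" by (rule G.Comp_Hom[OF eF(1)]) (use f in "simp add: Hom_iff")
  fix X p q n assume X: "X : Obj C" and n: "int p + q = n"
  let ?f = "mcomp (mtcomp ((G.Ga ^^ Suc p) f) X) q"
  have ga: "(G.Ga ^^ Suc p) f : Arr S" "mtdom ((G.Ga ^^ Suc p) f) = (G.Go ^^ Suc p) ?F" "mtcod ((G.Ga ^^ Suc p) f) = (G.Go ^^ Suc p) ?H"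
   using G.Gpow_simps(2-4)[OF f, of "Suc p"] by (simp_all del: funpow.simps)
  have FO: "(G.Go ^^ Suc p) ?F : Obj S" using G.Gpow_simps(1)[OF O(1)] .
  have ob: "cob (fo (sfun ((G.Go ^^ Suc p) ?F)) X) q : Obj A" "cob (fo (sfun ?F) X) n : Obj A" "cob (fo (sfun ?H) X) n : Obj A"
   using functor_Ch_simps(1)[OF Obj_S_simps(3)[OF FO] X] functor_Ch_simps(1)[OF Obj_S_simps(3)[OF O(1)] X] functor_Ch_simps(1)[OF Obj_S_simps(3)[OF O(2)] X] by simp_all
  note s = Arr_S_simps(5-7)[OF ga(1) X, unfolded ga(2,3)] Arr_S_simps(5-7)[OF Bm_simps(1)[OF f] X, unfolded Bm_simps(2,3)[OF f]]
   Arr_S_simps(5-7)[OF eA(1) X, unfolded eA] Arr_S_simps(5-7)[OF eA(4) X, unfolded eA] Arr_S_simps(5-7)[OF f X]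
  have "mcomp (mtcomp (e ?H) X) n ** (mcomp (mtcomp (Bm f) X) n ** jb ?F X p q) = mcomp (mtcomp (e ?H) X) n ** (jb ?H X p q ** ?f)"
   unfolding Bm_facts(2)[OF f X n] ..
  also have "... = (if p = 0 then mcomp (mtcomp (cte G ?H) X) q else Zer A (cob (fo (sfun ((G.Go ^^ Suc p) ?H)) X) q) (cob (fo (sfun ?H) X) n)) ** ?f"
   by (rule Comp_reassoc[OF eH(2)[OF X n]]) (use X O n s in "simp_all del: funpow.simps")
  also have "... = mcomp (mtcomp f X) n ** (if p = 0 then mcomp (mtcomp (cte G ?F) X) q else Zer A (cob (fo (sfun ((G.Go ^^ Suc p) ?F)) X) q) (cob (fo (sfun ?F) X) n))"
  proof (cases "p = 0")
   case True
   have "cte G ?H **\<^bsub>S\<^esub> G.Ga f = f **\<^bsub>S\<^esub> cte G ?F" using cotriple f unfolding is_cotriple_def Let_def S_simps(1,2) by blast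
   from arg_cong[OF this, of "%t. mcomp (mtcomp t X) q"] show ?thesis using True n X by simp
  next
   case False
   then show ?thesis using s ob by (simp del: funpow.simps)
  qed
  also have "... = mcomp (mtcomp f X) n ** (mcomp (mtcomp (e ?F) X) n ** jb ?F X p q)"
   unfolding eF(2)[OF X n] ..
  finally show "mcomp (mtcomp (e ?H **\<^bsub>S\<^esub> Bm f) X) n ** jb ?F X p q = mcomp (mtcomp (f **\<^bsub>S\<^esub> e ?F) X) n ** jb ?F X p q"
   using X O n s by (simp del: funpow.simps)
 qed
qed

lemma Wq_Arr: "w \<in> Wq ==> w : Arr S"
 by (simp add: weqs_def)

theorem augmented_localization_bar: "augmented_localization S Wq Bo Bm e"
proof (intro augmented_localization.intro localization.intro category_S localization_axioms.intro augmented_localization_axioms.intro)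
 show "Wq \<subseteq> Arr S" using Wq_Arr by blast
 show "Bm w \<in> Wq" if "w \<in> Wq" for w using Bm_facts(3)[OF Wq_Arr[OF that]] that compatible by blast
qed (use Bm_facts(1) Bm_Idt Bm_Comp e_facts(1) e_nat in simp_all)

end

theorem theorem6p1p1:
  fixes C :: "('o,'a,'y) cat_scheme" and MC :: "('o,'a) mon"
    and A :: "('p,'b,'z) acat_scheme" and MA :: "('p,'b) mon"
    and \<Gamma> :: "(('o,'a,'p,'b) fctr, ('o,'a,'p,'b) ntr) cpx set"
    and G :: "(('o,'a,('p,'b) cpx,('p,'b) cmap) smf, ('o,'a,('p,'b) cpx,('p,'b) cmap) mnt) cotriple"
    and K L :: "('o,'a,('p,'b) cpx,('p,'b) cmap) smf"
    and \<alpha> :: "('o,'a,('p,'b) cpx,('p,'b) cmap) mnt"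
  assumes "symmetric_monoidal C MC"
    and "symmetric_abelian_monoidal A MA"
    and "acyclic_class (FunA C A) \<Gamma>"
    and "is_cotriple (SyMonCh C MC A MA) G"
    and standard_construction_bounded:
      "\<And>F. F \<in> Obj (SyMonCh C MC A MA) \<Longrightarrow> simp_unif_bounded C A (bar G F)"
    and "fa (ctF G) ` weqs C MC A MA \<Gamma> \<subseteq> weqs C MC A MA \<Gamma>"
    and "K \<in> Obj (SyMonCh C MC A MA)" and "L \<in> Obj (SyMonCh C MC A MA)"
    and "nonneg C A K" and "nonneg C A L"
    and "G_acyclic C MC A MA \<Gamma> G K" and "G_acyclic C MC A MA \<Gamma> G L"
    and "presentable C MC A MA \<Gamma> G K" and "presentable C MC A MA \<Gamma> G L"
    and "\<alpha> \<in> Hom (SyMonCh C MC A MA) (H0 C MC A MA K) (H0 C MC A MA L)"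
    and "iso_arr (SyMonCh C MC A MA) \<alpha>"
  shows "\<exists>!f. iso_arr (Loc (SyMonCh C MC A MA) (weqs C MC A MA \<Gamma>)) f \<and>
              lifts C MC A MA \<Gamma> K L \<alpha> f"
proof -
  interpret monoidal_functors C MC A MA
    using assms(1,2) by (intro monoidal_functors.intro)
  interpret standard_construction C MC A MA \<Gamma> G
    using monoidal_functors_axioms standard_construction_axioms.intro[OF assms(3-6)] by (rule standard_construction.intro)
  interpret augmented_localization "SyMonCh C MC A MA" "weqs C MC A MA \<Gamma>" Bo Bm e
    by (rule augmented_localization_bar)
  \<comment> \<open>Acyclicity concerns a single application of \<open>G\<close>; the higher powers
    that occur in the standard construction are supplied by \<open>Bm_facts\<close>.\<close>
  have aug: "aug C MC A MA M \<in> Hom S M (H0 C MC A MA M)" "Bm (aug C MC A MA M) \<in> Wq" if "G_acyclic C MC A MA \<Gamma> G M" for M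
  proof -
    have a: "aug C MC A MA M \<in> Arr S" "G.Ga (aug C MC A MA M) \<in> Wq" using that by (simp_all add: G_acyclic_def)
    then show "aug C MC A MA M \<in> Hom S M (H0 C MC A MA M)" by (simp add: Hom_iff aug_def)
    show "Bm (aug C MC A MA M) \<in> Wq" by (rule Bm_facts(3)[OF a])
  qed
  show ?thesis
    using unique_lift[OF aug(1)[OF assms(11)] aug(1)[OF assms(12)] assms(15,16) aug(2)[OF assms(11)] aug(2)[OF assms(12)]]
      assms(13,14) by (simp add: lifts_def Let_def presentable_def)
qed

end
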